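(* There exists a randomized algorithm that finds a decomposition of a given binary tree $T^b$ with $n$ vertices using $m$ machines, such that with high probability the algorithm terminates in $O(\log n)$ rounds of the MPC model, and each machine uses a memory of size at most $\tilde O(n/m)$ and runs an algorithm that is linear in its memory size.
   Context: MPC model: input of size $n$, $m$ machines with $m\ge n^{\delta}$ for a fixed constant $0<\delta<1$ and $m$ at most the space per machine; synchronous rounds of local computation, with communication only between rounds, and no machine sends or receives more than its memory size. Initially each machine holds $\tilde O(n/m)$ vertices, each vertex object storing its index and its parent's index. $\tilde O$ hides polylogarithmic factors; "with high probability" means with probability at least $1-1/\mathrm{poly}(n)$. A decomposition of a binary tree $T^b$ is a set of $O(m)$ components, where each component consists of a connected subset of the vertices of $T^b$, every vertex of $T^b$ lies in exactly one component, and a component stores its vertices, its inner edges (edges between two of its vertices) and its outer edges (edges between one of its vertices and a vertex of another component); the data stored in each component must have size $\tilde O(n/m)$. *)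

theory Defs
  imports "HOL-Probability.Probability" "HOL-Library.Log_Nat"
begin

text \<open>
  Local computation is a fixed program for a randomized word RAM, given as a structured
  while language over finitely many registers, one word-addressed memory, a read-only inbox
  (the words received in the preceding communication phase), an outbox and an output tape.
  A word has \<^term>\<open>w\<close> bits: constants and results of arithmetic are reduced modulo
  \<^term>\<open>2 ^ w\<close>, so no machine can pack large data into one cell.
\<close>

datatype binop = Add | Sub | Mul | Div | Mod | Less | Equal

datatype aexp =
    Const nat
  | Reg nat
  | Load aexp
  | Inbox aexp
  | InboxLength
  | Op binop aexp aexp

datatype com =
    Skip
  | Assign nat aexp
  | Store aexp aexp
  | Send aexp aexp
  | Emit aexp
  | Rand nat
  | Halt
  | Seq com com
  | Cond aexp com com
  | While aexp com

text \<open>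
  \<^term>\<open>top_addr\<close> below is one more than the largest memory address written so far; cells never
  written hold 0.  \<^term>\<open>steps\<close> is the running time of the current round.  An element
  \<^term>\<open>(d, x)\<close> of the outbox is a word \<^term>\<open>x\<close> addressed to machine \<^term>\<open>d\<close>.
\<close>

record machine =
  regs :: "nat \<Rightarrow> nat"
  mem :: "nat \<Rightarrow> nat"
  top_addr :: nat
  inbox :: "nat list"
  outbox :: "(nat \<times> nat) list"
  outp :: "nat list"
  halted :: bool
  steps :: nat

text \<open>Subtraction is truncated at 0, division by 0 yields 0, and comparisons yield 0 or 1.\<close>

fun binop_val :: "binop \<Rightarrow> nat \<Rightarrow> nat \<Rightarrow> nat" where
  "binop_val Add x y = x + y"
| "binop_val Sub x y = x - y"
| "binop_val Mul x y = x * y"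
| "binop_val Div x y = x div y"
| "binop_val Mod x y = x mod y"
| "binop_val Less x y = (if x < y then 1 else 0)"
| "binop_val Equal x y = (if x = y then 1 else 0)"

primrec aval :: "nat \<Rightarrow> machine \<Rightarrow> aexp \<Rightarrow> nat" where
  "aval w s (Const k) = k mod 2 ^ w"
| "aval w s (Reg r) = regs s r"
| "aval w s (Load e) = mem s (aval w s e)"
| "aval w s (Inbox e) = (let i = aval w s e in if i < length (inbox s) then inbox s ! i else 0)"
| "aval w s InboxLength = length (inbox s) mod 2 ^ w"
| "aval w s (Op b e1 e2) = binop_val b (aval w s e1) (aval w s e2) mod 2 ^ w"

primrec acost :: "aexp \<Rightarrow> nat" where
  "acost (Const k) = 1"
| "acost (Reg r) = 1"
| "acost (Load e) = 1 + acost e"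
| "acost (Inbox e) = 1 + acost e"
| "acost InboxLength = 1"
| "acost (Op b e1 e2) = 1 + acost e1 + acost e2"

definition tick :: "nat \<Rightarrow> machine \<Rightarrow> machine" where
  "tick k s = s\<lparr>steps := steps s + k\<rparr>"

text \<open>
  Diverging local computations lose probability mass.  \<^term>\<open>Rand r\<close> draws a fresh uniformly
  random word.  \<^term>\<open>Halt\<close> only raises a flag; it takes effect at the end of the round.
\<close>

partial_function (spmf) exec :: "nat \<Rightarrow> com \<Rightarrow> machine \<Rightarrow> machine spmf" where
  "exec w c s = (case c of
      Skip \<Rightarrow> return_spmf (tick 1 s)
    | Assign r e \<Rightarrow>
        return_spmf (tick (1 + acost e) (s\<lparr>regs := (regs s)(r := aval w s e)\<rparr>))
    | Store e1 e2 \<Rightarrow>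
        return_spmf (tick (1 + acost e1 + acost e2)
          (s\<lparr>mem := (mem s)(aval w s e1 := aval w s e2),
             top_addr := max (top_addr s) (aval w s e1 + 1)\<rparr>))
    | Send e1 e2 \<Rightarrow>
        return_spmf (tick (1 + acost e1 + acost e2)
          (s\<lparr>outbox := outbox s @ [(aval w s e1, aval w s e2)]\<rparr>))
    | Emit e \<Rightarrow>
        return_spmf (tick (1 + acost e) (s\<lparr>outp := outp s @ [aval w s e]\<rparr>))
    | Rand r \<Rightarrow>
        bind_spmf (spmf_of_set {..<2 ^ w})
          (\<lambda>x. return_spmf (tick 1 (s\<lparr>regs := (regs s)(r := x)\<rparr>)))
    | Halt \<Rightarrow> return_spmf (tick 1 (s\<lparr>halted := True\<rparr>))
    | Seq c1 c2 \<Rightarrow> bind_spmf (exec w c1 s) (exec w c2)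
    | Cond e c1 c2 \<Rightarrow>
        (if aval w s e \<noteq> 0 then exec w c1 (tick (1 + acost e) s)
         else exec w c2 (tick (1 + acost e) s))
    | While e c1 \<Rightarrow>
        (if aval w s e \<noteq> 0
         then bind_spmf (exec w c1 (tick (1 + acost e) s)) (exec w (While e c1))
         else return_spmf (tick (1 + acost e) s)))"

text \<open>
  A configuration lists the states of machines \<open>0, \<dots>, m - 1\<close>.  All machines run the same
  program on independent randomness.  Registers, memory and output tape persist across rounds.
\<close>

definition local_round :: "nat \<Rightarrow> com \<Rightarrow> machine \<Rightarrow> machine spmf" where
  "local_round w P s =
     (let s' = s\<lparr>outbox := [], steps := 0\<rparr> in if halted s then return_spmf s' else exec w P s')"

primrec sequence_spmf :: "'a spmf list \<Rightarrow> 'a list spmf" where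
  "sequence_spmf [] = return_spmf []"
| "sequence_spmf (p # ps) = bind_spmf p (\<lambda>x. map_spmf ((#) x) (sequence_spmf ps))"

definition deliver :: "machine list \<Rightarrow> machine list" where
  "deliver cfg = map (\<lambda>j. (cfg ! j)\<lparr>inbox :=
      concat (map (\<lambda>s. map snd (filter (\<lambda>msg. fst msg = j) (outbox s))) cfg)\<rparr>)
    [0..<length cfg]"

definition all_halted :: "machine list \<Rightarrow> bool" where
  "all_halted cfg \<longleftrightarrow> (\<forall>s\<in>set cfg. halted s)"

text \<open>
  The execution cut off after \<^term>\<open>t\<close> rounds, as the list of configurations at the end of the
  local computation of each round: there the inbox of a machine is what it received before that
  round and its outbox is what it is about to send.
\<close>

primrec mpc_run :: "nat \<Rightarrow> com \<Rightarrow> nat \<Rightarrow> machine list \<Rightarrow> machine list list spmf" where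
  "mpc_run w P 0 cfg = return_spmf []"
| "mpc_run w P (Suc t) cfg =
     bind_spmf (sequence_spmf (map (local_round w P) cfg))
       (\<lambda>cfg'. if all_halted cfg' then return_spmf [cfg']
               else map_spmf ((#) cfg') (mpc_run w P t (deliver cfg')))"

definition terminated :: "machine list list \<Rightarrow> bool" where
  "terminated tr \<longleftrightarrow> tr \<noteq> [] \<and> all_halted (last tr)"

text \<open>A message in transit occupies two words (destination and contents).\<close>

definition space :: "machine \<Rightarrow> nat" where
  "space s = top_addr s + length (inbox s) + 2 * length (outbox s) + length (outp s)"

text \<open>
  Every machine stays within memory size \<^term>\<open>S\<close>, sends and receives at most \<^term>\<open>S\<close> words per
  round, and the local computation of each round takes at most \<^term>\<open>L * S\<close> steps.
\<close>

definition within_resources :: "real \<Rightarrow> real \<Rightarrow> machine list list \<Rightarrow> bool" where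
  "within_resources S L tr \<longleftrightarrow>
     (\<forall>cfg\<in>set tr. \<forall>s\<in>set cfg.
        real (space s) \<le> S \<and>
        real (length (outbox s)) \<le> S \<and> real (length (inbox s)) \<le> S \<and>
        real (steps s) \<le> L * S)"

text \<open>
  The vertices are \<open>1, \<dots>, n\<close>; the parent index of the root is 0.  Edges are represented as
  (child, parent).
\<close>

definition tree_edges :: "nat \<Rightarrow> (nat \<Rightarrow> nat) \<Rightarrow> (nat \<times> nat) set" where
  "tree_edges n par = {(v, par v) | v. v \<in> {1..n} \<and> par v \<noteq> 0}"

definition binary_tree :: "nat \<Rightarrow> (nat \<Rightarrow> nat) \<Rightarrow> bool" where
  "binary_tree n par \<longleftrightarrow>
     (\<exists>r\<in>{1..n}. par r = 0 \<and> (\<forall>v\<in>{1..n}. v \<noteq> r \<longrightarrow> par v \<in> {1..n}) \<and>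
        (\<forall>v\<in>{1..n}. (v, r) \<in> (tree_edges n par)\<^sup>*)) \<and>
     (\<forall>u\<in>{1..n}. card {v\<in>{1..n}. par v = u} \<le> 2)"

definition connected_subset :: "(nat \<times> nat) set \<Rightarrow> nat set \<Rightarrow> bool" where
  "connected_subset E C \<longleftrightarrow> (\<forall>u\<in>C. \<forall>v\<in>C. (u, v) \<in> ((E \<union> E\<inverse>) \<inter> C \<times> C)\<^sup>*)"

record component =
  verts :: "nat list"
  inner :: "(nat \<times> nat) list"
  outer :: "(nat \<times> nat) list"

definition is_component :: "nat \<Rightarrow> (nat \<Rightarrow> nat) \<Rightarrow> component \<Rightarrow> bool" where
  "is_component n par c \<longleftrightarrow>
     (let E = tree_edges n par; C = set (verts c) in
        C \<noteq> {} \<and> C \<subseteq> {1..n} \<and> connected_subset E C \<and>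
        distinct (inner c) \<and> set (inner c) = {(u, v)\<in>E. u \<in> C \<and> v \<in> C} \<and>
        distinct (outer c) \<and> set (outer c) = {(u, v)\<in>E. (u \<in> C) \<noteq> (v \<in> C)})"

definition component_size :: "component \<Rightarrow> nat" where
  "component_size c = length (verts c) + 2 * length (inner c) + 2 * length (outer c)"

definition is_decomposition ::
  "nat \<Rightarrow> (nat \<Rightarrow> nat) \<Rightarrow> real \<Rightarrow> real \<Rightarrow> component list \<Rightarrow> bool" where
  "is_decomposition n par N S cs \<longleftrightarrow>
     real (length cs) \<le> N \<and>
     (\<forall>c\<in>set cs. is_component n par c \<and> real (component_size c) \<le> S) \<and>
     distinct (concat (map verts cs)) \<and> set (concat (map verts cs)) = {1..n}"

definition encode_edges :: "(nat \<times> nat) list \<Rightarrow> nat list" where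
  "encode_edges es = length es # concat (map (\<lambda>(u, v). [u, v]) es)"

definition encode_component :: "component \<Rightarrow> nat list" where
  "encode_component c =
     length (verts c) # verts c @ encode_edges (inner c) @ encode_edges (outer c)"

text \<open>
  The machines jointly output a decomposition into at most \<^term>\<open>N\<close> components of size at most
  \<^term>\<open>S\<close>, each component being stored entirely on one machine.
\<close>

definition outputs_decomposition ::
  "nat \<Rightarrow> (nat \<Rightarrow> nat) \<Rightarrow> real \<Rightarrow> real \<Rightarrow> machine list \<Rightarrow> bool" where
  "outputs_decomposition n par N S cfg \<longleftrightarrow>
     (\<exists>css. map outp cfg = map (\<lambda>cs. concat (map encode_component cs)) css \<and>
            is_decomposition n par N S (concat css))"

text \<open>\<open>polylog_share K k n m\<close> is the generic function in the class \<open>\<tilde>O(n/m)\<close>.\<close>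

definition polylog_share :: "real \<Rightarrow> nat \<Rightarrow> nat \<Rightarrow> nat \<Rightarrow> real" where
  "polylog_share K k n m = K * (real n / real m) * log 2 (real n) ^ k"

text \<open>
  \<^term>\<open>vss ! i\<close> lists the vertices initially held by machine \<^term>\<open>i\<close>; their distribution over
  the machines is arbitrary up to the load bound.
\<close>

definition mpc_input ::
  "real \<Rightarrow> real \<Rightarrow> nat \<Rightarrow> nat \<Rightarrow> nat \<Rightarrow> (nat \<Rightarrow> nat) \<Rightarrow> nat list list \<Rightarrow> bool" where
  "mpc_input \<delta> K k n m par vss \<longleftrightarrow>
     n \<ge> 2 \<and> real n powr \<delta> \<le> real m \<and> real m \<le> polylog_share K k n m \<and>
     binary_tree n par \<and>
     length vss = m \<and> distinct (concat vss) \<and> set (concat vss) = {1..n} \<and>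
     (\<forall>vs\<in>set vss. real (length vs) \<le> polylog_share K k n m)"

text \<open>
  Before the first round, machine \<^term>\<open>i\<close> finds \<^term>\<open>i\<close>, \<^term>\<open>m\<close> and \<^term>\<open>n\<close> in registers 0, 1
  and 2, and its vertex objects (index and parent index) in the inbox.
\<close>

definition initial_machine ::
  "nat \<Rightarrow> nat \<Rightarrow> (nat \<Rightarrow> nat) \<Rightarrow> nat list \<Rightarrow> nat \<Rightarrow> machine" where
  "initial_machine n m par vs i =
     \<lparr>regs = (\<lambda>_. 0)(0 := i, 1 := m, 2 := n), mem = (\<lambda>_. 0), top_addr = 0,
      inbox = concat (map (\<lambda>v. [v, par v]) vs), outbox = [], outp = [],
      halted = False, steps = 0\<rparr>"

definition initial_config ::
  "nat \<Rightarrow> nat \<Rightarrow> (nat \<Rightarrow> nat) \<Rightarrow> nat list list \<Rightarrow> machine list" where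
  "initial_config n m par vss = map (\<lambda>i. initial_machine n m par (vss ! i) i) [0..<m]"

text \<open>Executions on words of \<open>\<kappa> * (\<lfloor>log\<^sub>2 n\<rfloor> + 1)\<close> bits.\<close>

definition mpc_exec ::
  "nat \<Rightarrow> com \<Rightarrow> nat \<Rightarrow> nat \<Rightarrow> (nat \<Rightarrow> nat) \<Rightarrow> nat list list \<Rightarrow> nat \<Rightarrow> machine list list spmf" where
  "mpc_exec \<kappa> P n m par vss t =
     mpc_run (\<kappa> * floorlog 2 n) P t (initial_config n m par vss)"

end

theory Submission imports Defs "HOL-Library.Tree" begin

text \<open>
  The algorithm computes an Euler tour that visits the smaller subtree of each vertex first, cuts it
  into \<open>O(m / log n)\<close> intervals, one per machine, and splits the vertices of an interval into the
  connected pieces they induce.  Every piece other than the one of the root hangs on an edge that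
  crosses the left end of its interval.  An edge to a second child \<open>c\<close> of \<open>u\<close> can cross at a position
  inside the subtree of the first child, which is the smaller one, so the subtree size at least
  doubles from one such edge to the next; hence at most \<open>O(log n)\<close> edges cross any position and there
  are \<open>O(m)\<close> pieces.

  Positions in a tour are computed by pointer jumping in \<open>O(log n)\<close> rounds: first for the tour with
  an arbitrary order of the children, which yields the subtree sizes, and then again for the
  reordered tour.  All rounds are deterministic, so the probability bounds are trivial.
\<close>

section \<open>Deterministic execution of the word RAM\<close>

text \<open>With \<open>J\<close> about log n and \<open>H = J * (n div m + 1)\<close>, a machine
  owns \<open>128 * H\<close> cells and thereby \<open>4 * H\<close> positions of the tour. The
  factor \<open>J\<close> makes nonempty intervals rarer than machines by a factor of about log n,
  which pays for up to \<open>J + 1\<close> pieces per interval. The interval gained by rounding up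
  still costs \<open>J + 1\<close> pieces, and the lower bound on m makes these O(m). The reason is
  that parent edges do not cross: a marked vertex placed between a vertex and its parent would have
  its own parent at least as late as that parent, hence inside the interval. Machines never request
  data. Links in both directions let every item push what its neighbours need, so a doubling takes
  one round and a cell receives at most one write. Only the first round is different, because two
  children report to the same cell of their parent; a write therefore moves the old content into the
  next cell, and all written addresses are even.\<close>

primrec straight :: "com \<Rightarrow> bool" where
  "straight Skip = True"
| "straight (Assign r e) = True"
| "straight (Store e1 e2) = True"
| "straight (Send e1 e2) = True"
| "straight (Emit e) = True"
| "straight (Rand r) = False"
| "straight Halt = True"
| "straight (Seq c1 c2) = (straight c1 \<and> straight c2)"
| "straight (Cond e c1 c2) = (straight c1 \<and> straight c2)"
| "straight (While e c) = False"

text \<open>\<open>Rand\<close> and \<open>While\<close> get placeholder results, since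
  \<open>straight\<close> excludes them. \<open>steps\<close> stays as it is: results and running
  times are computed separately, so that programs can be rewritten without carrying exact
  costs.\<close>

primrec run :: "nat \<Rightarrow> com \<Rightarrow> machine \<Rightarrow> machine" where
  "run w Skip s = s"
| "run w (Assign r e) s = s\<lparr>regs := (regs s)(r := aval w s e)\<rparr>"
| "run w (Store e1 e2) s =
     s\<lparr>mem := (mem s)(aval w s e1 := aval w s e2), top_addr := max (top_addr s) (aval w s e1 + 1)\<rparr>"
| "run w (Send e1 e2) s = s\<lparr>outbox := outbox s @ [(aval w s e1, aval w s e2)]\<rparr>"
| "run w (Emit e) s = s\<lparr>outp := outp s @ [aval w s e]\<rparr>"
| "run w (Rand r) s = s"
| "run w Halt s = s\<lparr>halted := True\<rparr>"
| "run w (Seq c1 c2) s = run w c2 (run w c1 s)"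
| "run w (Cond e c1 c2) s = (if aval w s e \<noteq> 0 then run w c1 s else run w c2 s)"
| "run w (While e c) s = s"

primrec max_cost :: "com \<Rightarrow> nat" where
  "max_cost Skip = 1"
| "max_cost (Assign r e) = 1 + acost e"
| "max_cost (Store e1 e2) = 1 + acost e1 + acost e2"
| "max_cost (Send e1 e2) = 1 + acost e1 + acost e2"
| "max_cost (Emit e) = 1 + acost e"
| "max_cost (Rand r) = 1"
| "max_cost Halt = 1"
| "max_cost (Seq c1 c2) = max_cost c1 + max_cost c2"
| "max_cost (Cond e c1 c2) = 1 + acost e + max (max_cost c1) (max_cost c2)"
| "max_cost (While e c) = 0"

lemma tick_simps [simp]:
  "regs (tick k s) = regs s" "mem (tick k s) = mem s" "top_addr (tick k s) = top_addr s"
  "inbox (tick k s) = inbox s" "outbox (tick k s) = outbox s" "outp (tick k s) = outp s"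
  "halted (tick k s) = halted s" "steps (tick k s) = steps s + k"
  by (simp_all add: tick_def)

lemma aval_tick [simp]: "aval w (tick k s) e = aval w s e"
  by (induction e) (simp_all add: Let_def)

lemma tick_tick [simp]: "tick k (tick l s) = tick (l + k) s"
  by (simp add: tick_def add.assoc)

lemma run_tick [simp]: "run w c (tick k s) = tick k (run w c s)"
  by (induction c arbitrary: s) (simp_all add: tick_def[of k], simp_all add: tick_def[symmetric])

text \<open>The exact number of steps depends on the branches taken, so only the bound
  \<open>max_cost\<close> is kept.\<close>

lemma exec_run: "straight c \<Longrightarrow> \<exists>k\<le>max_cost c. exec w c s = return_spmf (tick k (run w c s))"
proof (induction c arbitrary: s)
  case (Seq c1 c2)
  then obtain k1 where k1: "k1 \<le> max_cost c1" "exec w c1 s = return_spmf (tick k1 (run w c1 s))"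
    by auto
  obtain k2 where k2: "k2 \<le> max_cost c2"
      "exec w c2 (tick k1 (run w c1 s)) = return_spmf (tick k2 (run w c2 (tick k1 (run w c1 s))))"
    using Seq(2)[of "tick k1 (run w c1 s)"] Seq(3) by (auto simp del: run_tick)
  show ?case using k1 k2 by (subst exec.simps, intro exI[of _ "k1 + k2"]) auto
next
  case (Cond e c1 c2)
  define s1 where "s1 = tick (1 + acost e) s"
  have s1: "run w c s1 = tick (1 + acost e) (run w c s)" for c
    by (simp only: s1_def run_tick)
  obtain k1 where k1: "k1 \<le> max_cost c1" "exec w c1 s1 = return_spmf (tick k1 (run w c1 s1))"
    using Cond by auto
  obtain k2 where k2: "k2 \<le> max_cost c2" "exec w c2 s1 = return_spmf (tick k2 (run w c2 s1))"
    using Cond by auto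
  have "exec w (Cond e c1 c2) s = (if aval w s e \<noteq> 0 then exec w c1 s1 else exec w c2 s1)"
    by (subst exec.simps) (simp only: com.case s1_def)
  then show ?case
    using k1 k2 by (intro exI[of _ "1 + acost e + (if aval w s e \<noteq> 0 then k1 else k2)"])
      (auto simp: s1 add.commute add.left_commute)
qed (subst exec.simps; force simp: tick_def)+

text \<open>Total correctness: the outcome is a point mass of full weight, which excludes both
  divergence and randomness. Time bounds can be part of \<open>Q\<close>, because
  \<open>steps\<close> is a field of the state.\<close>

definition wp :: "nat \<Rightarrow> com \<Rightarrow> machine \<Rightarrow> (machine \<Rightarrow> bool) \<Rightarrow> bool" where
  "wp w c s Q \<longleftrightarrow> (\<exists>s'. exec w c s = return_spmf s' \<and> Q s')"

lemma wp_mono: "wp w c s Q \<Longrightarrow> (\<And>s'. Q s' \<Longrightarrow> R s') \<Longrightarrow> wp w c s R"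
  by (auto simp: wp_def)

lemma wp_straight:
  "straight c \<Longrightarrow> (\<And>k. k \<le> max_cost c \<Longrightarrow> Q (tick k (run w c s))) \<Longrightarrow> wp w c s Q"
  unfolding wp_def using exec_run[of c w s] by blast

lemma run_fields [simp]:
  "regs (run w (Assign r e) s) = (regs s)(r := aval w s e)"
  "mem (run w (Assign r e) s) = mem s"
  "top_addr (run w (Assign r e) s) = top_addr s"
  "inbox (run w (Assign r e) s) = inbox s"
  "outbox (run w (Assign r e) s) = outbox s"
  "outp (run w (Assign r e) s) = outp s"
  "halted (run w (Assign r e) s) = halted s"
  "regs (run w (Store a e) s) = regs s"
  "mem (run w (Store a e) s) = (mem s)(aval w s a := aval w s e)"
  "top_addr (run w (Store a e) s) = max (top_addr s) (aval w s a + 1)"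
  "inbox (run w (Store a e) s) = inbox s"
  "outbox (run w (Store a e) s) = outbox s"
  "outp (run w (Store a e) s) = outp s"
  "halted (run w (Store a e) s) = halted s"
  "regs (run w (Send a e) s) = regs s"
  "mem (run w (Send a e) s) = mem s"
  "top_addr (run w (Send a e) s) = top_addr s"
  "inbox (run w (Send a e) s) = inbox s"
  "outbox (run w (Send a e) s) = outbox s @ [(aval w s a, aval w s e)]"
  "outp (run w (Send a e) s) = outp s"
  "halted (run w (Send a e) s) = halted s"
  "regs (run w (Emit e) s) = regs s"
  "mem (run w (Emit e) s) = mem s"
  "top_addr (run w (Emit e) s) = top_addr s"
  "inbox (run w (Emit e) s) = inbox s"
  "outbox (run w (Emit e) s) = outbox s"
  "outp (run w (Emit e) s) = outp s @ [aval w s e]"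
  "halted (run w (Emit e) s) = halted s"
  by simp_all

lemma run_Cond [simp]:
  "aval w s e \<noteq> 0 \<Longrightarrow> run w (Cond e c1 c2) s = run w c1 s"
  "aval w s e = 0 \<Longrightarrow> run w (Cond e c1 c2) s = run w c2 s"
  by simp_all

text \<open>
  Only the field equations above are used for rewriting: unfolding the record updates themselves
  makes symbolic execution blow up.
\<close>

declare run.simps(2-5,9) [simp del]

lemma wp_Seq: "wp w c1 s (\<lambda>s'. wp w c2 s' Q) \<Longrightarrow> wp w (Seq c1 c2) s Q"
  unfolding wp_def by (subst exec.simps) auto

lemma wp_Cond:
  "(aval w s e \<noteq> 0 \<Longrightarrow> wp w c1 (tick (1 + acost e) s) Q) \<Longrightarrow>
   (aval w s e = 0 \<Longrightarrow> wp w c2 (tick (1 + acost e) s) Q) \<Longrightarrow> wp w (Cond e c1 c2) s Q"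
  unfolding wp_def by (subst exec.simps) auto

lemma wp_While_step:
  "aval w s e \<noteq> 0 \<Longrightarrow> wp w c (tick (1 + acost e) s) (\<lambda>s'. wp w (While e c) s' Q) \<Longrightarrow>
   wp w (While e c) s Q"
  unfolding wp_def by (subst exec.simps) auto

lemma wp_While_exit:
  "aval w s e = 0 \<Longrightarrow> Q (tick (1 + acost e) s) \<Longrightarrow> wp w (While e c) s Q"
  unfolding wp_def by (subst exec.simps) auto

text \<open>\<open>k\<close> is a ghost counter. It lets the invariant say how far the data have
  been processed and bound \<open>steps\<close> linearly in \<open>k\<close>.\<close>

lemma wp_While_count:
  assumes "I k s" "k \<le> (N::nat)"
    and step: "\<And>k s. k < N \<Longrightarrow> I k s \<Longrightarrow>
      aval w s e \<noteq> 0 \<and> wp w c (tick (1 + acost e) s) (I (Suc k))"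
    and exit: "\<And>s. I N s \<Longrightarrow> aval w s e = 0 \<and> Q (tick (1 + acost e) s)"
  shows "wp w (While e c) s Q"
  using assms(1,2)
proof (induction "N - k" arbitrary: k s)
  case 0
  then show ?case using exit[of s] by (intro wp_While_exit) auto
next
  case (Suc d)
  have k: "k < N" "d = N - Suc k" using Suc(2) by auto
  show ?case
  proof (rule wp_While_step)
    show "aval w s e \<noteq> 0" using step[OF k(1) Suc(3)] by blast
    show "wp w c (tick (1 + acost e) s) (\<lambda>s'. wp w (While e c) s' Q)"
      by (rule wp_mono[OF conjunct2[OF step[OF k(1) Suc(3)]]]) (use Suc(1)[OF k(2)] k in simp)
  qed
qed

text \<open>For a loop whose stride varies, such as the output loop, which advances by a whole
  component at a time.\<close>

lemma wp_While_measure: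
  assumes "I s"
    and step: "\<And>s. I s \<Longrightarrow> aval w s e \<noteq> 0 \<Longrightarrow>
      wp w c (tick (1 + acost e) s) (\<lambda>s'. I s' \<and> \<mu> s' < (\<mu> s :: nat))"
    and exit: "\<And>s. I s \<Longrightarrow> aval w s e = 0 \<Longrightarrow> Q (tick (1 + acost e) s)"
  shows "wp w (While e c) s Q"
  using assms(1)
proof (induction "\<mu> s" arbitrary: s rule: less_induct)
  case less
  show ?case
  proof (cases "aval w s e = 0")
    case True
    then show ?thesis using exit less by (intro wp_While_exit) auto
  next
    case False
    then show ?thesis
      using step[OF less.prems False] less.hyps
      by (intro wp_While_step) (auto elim!: wp_mono)
  qed
qed

section \<open>Synchronous rounds of deterministic machines\<close>

lemma sequence_spmf_map_return:
  "(\<And>x. x \<in> set xs \<Longrightarrow> f x = return_spmf (g x)) \<Longrightarrow>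
   sequence_spmf (map f xs) = return_spmf (map g xs)"
  by (induction xs) simp_all

lemma sequence_spmf_returns:
  assumes "length ps = k" "\<And>i. i < k \<Longrightarrow> \<exists>x. ps ! i = return_spmf x \<and> Q i x"
  shows "\<exists>xs. sequence_spmf ps = return_spmf xs \<and> length xs = k \<and> (\<forall>i<k. Q i (xs ! i))"
proof -
  obtain g where g: "\<And>i. i < k \<Longrightarrow> ps ! i = return_spmf (g i) \<and> Q i (g i)"
    using assms(2) by metis
  have "ps = map (\<lambda>i. return_spmf (g i)) [0..<k]"
    using assms(1) g by (intro nth_equalityI) auto
  then have "sequence_spmf ps = return_spmf (map g [0..<k])"
    using sequence_spmf_map_return[of "[0..<k]" "\<lambda>i. return_spmf (g i)" g] by simp
  then show ?thesis using g by (intro exI[of _ "map g [0..<k]"]) simp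
qed

lemma wp_local_round:
  assumes "\<not> halted s" "wp w P (s\<lparr>outbox := [], steps := 0\<rparr>) Q"
  shows "\<exists>s'. local_round w P s = return_spmf s' \<and> Q s'"
  using assms by (simp add: local_round_def wp_def)

text \<open>\<^term>\<open>Inv t\<close> describes the configuration before the local computation of round \<^term>\<open>t\<close>.\<close>

lemma mpc_run_deterministic:
  assumes step: "\<And>t cfg. t \<le> T \<Longrightarrow> Inv t cfg \<Longrightarrow>
      \<exists>cfg'. sequence_spmf (map (local_round w P) cfg) = return_spmf cfg' \<and> R cfg' \<and>
        (if t = T then all_halted cfg' \<and> Fin cfg'
         else \<not> all_halted cfg' \<and> Inv (Suc t) (deliver cfg'))"
    and "t \<le> T" "Inv t cfg"
  shows "\<exists>tr. length tr = Suc (T - t) \<and> terminated tr \<and> Fin (last tr) \<and> (\<forall>c\<in>set tr. R c) \<and>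
     (\<forall>k. mpc_run w P k cfg = return_spmf (take k tr)) \<and>
     (\<forall>k\<le>T - t. \<not> terminated (take k tr))"
  using assms(2,3)
proof (induction "T - t" arbitrary: t cfg)
  case 0
  then have [simp]: "t = T" by simp
  obtain cfg' where c: "sequence_spmf (map (local_round w P) cfg) = return_spmf cfg'" "R cfg'"
      "all_halted cfg'" "Fin cfg'"
    using step[OF 0(2,3)] by auto
  have "mpc_run w P k cfg = return_spmf (take k [cfg'])" for k
    using c by (cases k) auto
  then show ?case using c by (intro exI[of _ "[cfg']"]) (auto simp: terminated_def)
next
  case (Suc d)
  then have "t \<noteq> T" by simp
  then obtain cfg' where c: "sequence_spmf (map (local_round w P) cfg) = return_spmf cfg'" "R cfg'"
      "\<not> all_halted cfg'" "Inv (Suc t) (deliver cfg')"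
    using step[OF Suc(3,4)] by auto
  have d: "d = T - Suc t" "Suc t \<le> T" using Suc(2,3) \<open>t \<noteq> T\<close> by auto
  obtain tr where tr: "length tr = Suc (T - Suc t)" "terminated tr" "Fin (last tr)"
      "\<forall>c\<in>set tr. R c" "\<And>k. mpc_run w P k (deliver cfg') = return_spmf (take k tr)"
      "\<forall>k\<le>T - Suc t. \<not> terminated (take k tr)"
    using Suc(1)[OF d c(4)] by blast
  have "mpc_run w P k cfg = return_spmf (take k (cfg' # tr))" for k
    using c tr by (cases k) auto
  \<comment> \<open>A proper prefix of the trace ends in a configuration with a running machine.
    Hence an execution that was cut off too early never counts as terminated, and every terminated
    outcome is the whole trace.\<close>
  moreover have "\<not> terminated (take k (cfg' # tr))" if "k \<le> T - t" for k
  proof (cases k)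
    case (Suc k')
    show ?thesis
    proof (cases "take k' tr = []")
      case True
      then show ?thesis using c(3) Suc by (simp add: terminated_def)
    next
      case False
      moreover have "\<not> terminated (take k' tr)"
        using tr(6) Suc that d \<open>Suc d = T - t\<close> by simp
      ultimately show ?thesis using Suc by (auto simp: terminated_def)
    qed
  qed (simp add: terminated_def)
  ultimately show ?case
    using tr c Suc(2) by (intro exI[of _ "cfg' # tr"]) (auto simp: terminated_def)
qed

section \<open>The program and its local rounds\<close>

abbreviation plus_e :: "aexp \<Rightarrow> aexp \<Rightarrow> aexp" (infixl "\<oplus>" 65) where "plus_e \<equiv> Op Add"
abbreviation seq_c :: "com \<Rightarrow> com \<Rightarrow> com" (infixr ";;" 60) where "seq_c \<equiv> Seq"
abbreviation guarded :: "aexp \<Rightarrow> com \<Rightarrow> com" where "guarded e c \<equiv> Cond e c Skip"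

text \<open>
  Registers 3, 4, 5 and 6 hold the number of the round, the number \<open>J\<close> of doublings, the number of
  memory cells per machine and the global address of the first cell of this machine.

  The record of a vertex \<open>v\<close> starts at the global address \<open>128 * v\<close>.  Its items are \<open>x = 128 * v\<close>,
  \<open>128 * v + 32\<close> and \<open>128 * v + 64\<close>; cells \<open>x\<close> and \<open>x + 2\<close> point to a later and an earlier item,
  and \<open>x + 4\<close> counts the items skipped by \<open>x\<close>, with an increment in transit arriving in \<open>x + 4\<close> and
  pushing the old count to \<open>x + 5\<close>.  Cells 6 and 7 hold the children and cell 38 holds
  \<open>128 * par v + 1\<close>, which is nonzero exactly for genuine vertices.

  The slot \<open>p\<close> of the tour starts at \<open>32 * p\<close>: cells 8 and 10 hold the vertex and its parent, cell 12
  tells whether a component starts there, and cells 14 and 16 hold the children that lie in another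
  component.
\<close>

definition cell :: "nat \<Rightarrow> aexp" where "cell k = Reg 7 \<oplus> Const k"
definition fld :: "nat \<Rightarrow> aexp" where "fld k = Load (cell k)"

text \<open>A remote write sends two words to the owner of the cell, first the local address and
  then the value. \<open>deliver\<close> keeps the order of the words of one sender and does not
  interleave senders, so the two arrive side by side.\<close>

definition push :: "aexp \<Rightarrow> nat \<Rightarrow> aexp \<Rightarrow> com" where
  "push e k x = Assign 8 (e \<oplus> Const k) ;;
     Send (Op Div (Reg 8) (Reg 5)) (Op Mod (Reg 8) (Reg 5)) ;; Send (Op Div (Reg 8) (Reg 5)) x"

definition for_records :: "nat \<Rightarrow> com \<Rightarrow> com" where
  "for_records c body = Assign 7 (Const 0) ;;
     While (Op Less (Reg 7) (Reg 5)) (body ;; Assign 7 (Reg 7 \<oplus> Const c))"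

text \<open>An item tells its later neighbour the earlier one and vice versa, so nobody has to ask.
  Null pointers are sent as well, which is how a pointer past an end of the tour becomes 0. The two
  counter cells are merged before the count is sent, which frees cell 5 for the next
  arrival.\<close>

definition jump_body :: com where
  "jump_body = Store (cell 4) (fld 4 \<oplus> fld 5) ;; Store (cell 5) (Const 0) ;;
     guarded (fld 0) (push (fld 0) 2 (fld 2)) ;;
     guarded (fld 2) (push (fld 2) 0 (fld 0) ;; push (fld 2) 4 (fld 4))"

text \<open>The stretch of the tour from item \<open>p\<close> to item \<open>q\<close> of the
  vertex in register 9: through the entry and exit items of the child if there is one, directly
  otherwise. Each link is written in both directions.\<close>

definition link_child :: "nat \<Rightarrow> nat \<Rightarrow> nat \<Rightarrow> com" where
  "link_child c p q = Cond (Reg c)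
     (push (Reg 9) p (Reg c) ;; push (Reg c) 2 (Reg 9 \<oplus> Const p) ;;
      push (Reg c) 64 (Reg 9 \<oplus> Const q) ;; push (Reg 9) (q + 2) (Reg c \<oplus> Const 64))
     (push (Reg 9) p (Reg 9 \<oplus> Const q) ;; push (Reg 9) (q + 2) (Reg 9 \<oplus> Const p))"

text \<open>In the first link round all counters are 0 and nothing is swapped; in the second they
  hold ranks, and the children are put in order of subtree size. The counters restart at 1 because
  an item counts itself.\<close>

definition link_body :: com where
  "link_body = guarded (fld 38) (
     Assign 9 (Reg 6 \<oplus> Reg 7) ;;
     Cond (Op Less (fld 36 \<oplus> fld 36) (fld 4 \<oplus> fld 68))
       (Assign 10 (fld 7) ;; Assign 11 (fld 6)) (Assign 10 (fld 6) ;; Assign 11 (fld 7)) ;;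
     Store (cell 6) (Reg 10) ;; Store (cell 7) (Reg 11) ;;
     Store (cell 4) (Const 1) ;; Store (cell 36) (Const 1) ;; Store (cell 68) (Const 1) ;;
     link_child 10 0 32 ;; link_child 11 32 64)"

text \<open>In the tour the first child follows the entry item of its parent and the second child
  the middle item, so the parent knows from its own ranks which machine gets the slot of a child.
  The branch \<open>Skip\<close> is an inner edge; the slot of the child already names the
  parent.\<close>

definition scatter_child :: "nat \<Rightarrow> nat \<Rightarrow> nat \<Rightarrow> com" where
  "scatter_child f r d = guarded (fld f) (
     Assign 10 (Reg r \<oplus> Const 32) ;;
     Cond (Op Equal (Op Div (Reg 10) (Reg 5)) (Op Div (Reg 12) (Reg 5))) Skip
       (push (Reg 10) 12 (Const 1) ;; push (Reg 12) d (fld f)))"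

definition scatter_body :: com where
  "scatter_body = guarded (fld 38) (
     Assign 9 (Reg 6 \<oplus> Reg 7) ;;
     Assign 12 (Op Mul (Const 32) (Op Sub (Op Mul (Const 3) (Reg 2)) (fld 4))) ;;
     Assign 13 (Op Mul (Const 32) (Op Sub (Op Mul (Const 3) (Reg 2)) (fld 36))) ;;
     push (Reg 12) 8 (Reg 9) ;; push (Reg 12) 10 (fld 38) ;;
     guarded (Op Equal (fld 38) (Const 1)) (push (Reg 12) 12 (Const 1)) ;;
     scatter_child 6 12 14 ;; scatter_child 7 13 16)"

definition receive :: com where
  "receive = Assign 7 (Const 0) ;;
     While (Op Less (Reg 7) InboxLength)
       (Store (Inbox (Reg 7) \<oplus> Const 1) (Load (Inbox (Reg 7))) ;;
        Store (Inbox (Reg 7)) (Inbox (Reg 7 \<oplus> Const 1)) ;;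
        Assign 7 (Reg 7 \<oplus> Const 2))"

text \<open>The root sends its child message to record 0, whose cell 38 stays 0 and which is
  therefore never treated as a vertex. Both children of a vertex write to cell 6, and the second
  arrival moves the first into cell 7.\<close>

definition init_body :: com where
  "init_body = push (Op Mul (Const 128) (Inbox (Reg 7))) 38
       (Op Mul (Const 128) (Inbox (Reg 7 \<oplus> Const 1)) \<oplus> Const 1) ;;
     push (Op Mul (Const 128) (Inbox (Reg 7 \<oplus> Const 1))) 6 (Op Mul (Const 128) (Inbox (Reg 7))) ;;
     Assign 7 (Reg 7 \<oplus> Const 2)"

text \<open>The loop finds the least \<open>J\<close> with \<open>4 * n \<le> 2 ^ J\<close>. The
  factor \<open>J\<close> in the number of cells makes the intervals of the tour longer, hence
  fewer, by a factor of about log n.\<close>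

definition setup_round :: com where
  "setup_round = Assign 4 (Const 0) ;; Assign 9 (Const 1) ;;
     While (Op Less (Reg 9) (Op Mul (Const 4) (Reg 2)))
       (Assign 9 (Reg 9 \<oplus> Reg 9) ;; Assign 4 (Reg 4 \<oplus> Const 1)) ;;
     Assign 5 (Op Mul (Const 128) (Op Mul (Reg 4) (Op Div (Reg 2) (Reg 1) \<oplus> Const 1))) ;;
     Assign 6 (Op Mul (Reg 0) (Reg 5)) ;;
     Assign 7 (Const 0) ;;
     While (Op Less (Reg 7) InboxLength) init_body"

definition scell :: "nat \<Rightarrow> aexp" where "scell k = Load (Reg 8 \<oplus> Const k)"

definition scan :: "com \<Rightarrow> com" where
  "scan body = Assign 8 (Reg 7) ;;
     While (Op Less (Reg 8) (Reg 9)) (body ;; Assign 8 (Reg 8 \<oplus> Const 32))"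

definition incr :: "nat \<Rightarrow> com" where "incr r = Assign r (Reg r \<oplus> Const 1)"
definition emit_edge :: "aexp \<Rightarrow> aexp \<Rightarrow> com" where
  "emit_edge e f = Emit (Op Div e (Const 128)) ;; Emit (Op Div f (Const 128))"

definition count_body :: com where
  "count_body = guarded (scell 8) (incr 10 ;; Cond (scell 12) Skip (incr 11)) ;;
     guarded (scell 14) (incr 12) ;; guarded (scell 16) (incr 12)"
definition verts_body :: com where
  "verts_body = guarded (scell 8) (Emit (Op Div (scell 8) (Const 128)))"
definition inner_body :: com where
  "inner_body = guarded (scell 8) (Cond (scell 12) Skip (emit_edge (scell 8) (scell 10)))"
definition outer_body :: com where
  "outer_body = guarded (scell 14) (emit_edge (scell 14) (scell 8)) ;;
     guarded (scell 16) (emit_edge (scell 16) (scell 8))"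

text \<open>Each list is encoded after its length, so the slots are scanned once to count and then
  once per list. Only the vertex in the first slot of a component can have its parent outside, hence
  the single upward edge.\<close>

definition emit_component :: com where
  "emit_component =
     Assign 9 (cell 32) ;;
     While (Op Mul (Op Less (Reg 9) (Reg 5)) (Op Equal (Load (Reg 9 \<oplus> Const 12)) (Const 0)))
       (Assign 9 (Reg 9 \<oplus> Const 32)) ;;
     Assign 10 (Const 0) ;; Assign 11 (Const 0) ;; Assign 12 (Const 0) ;;
     guarded (Op Div (fld 10) (Const 128)) (incr 12) ;;
     scan count_body ;;
     Emit (Reg 10) ;; scan verts_body ;;
     Emit (Reg 11) ;; scan inner_body ;;
     Emit (Reg 12) ;; guarded (Op Div (fld 10) (Const 128)) (emit_edge (fld 8) (fld 10)) ;;
     scan outer_body ;;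
     Assign 7 (Reg 9)"

definition output_round :: com where
  "output_round = Assign 7 (Const 0) ;;
     While (Op Less (Reg 7) (Reg 5))
       (Cond (fld 12) emit_component (Assign 7 (cell 32)))"

text \<open>Round 0 sets up, rounds 1 and \<open>J + 3\<close> link, the \<open>J + 1\<close> rounds
  after each of them jump, round \<open>2 * J + 5\<close> scatters and round
  \<open>2 * J + 6\<close> prints. After \<open>J\<close> doublings all pointers are null, so the
  last jump of each phase sends nothing and only merges the two counter cells.\<close>

definition prog :: com where
  "prog =
     Cond (Reg 3)
       (receive ;;
        Cond (Op Less (Reg 3) (Reg 4 \<oplus> Reg 4 \<oplus> Const 5))
          (Cond (Op Equal (Reg 3) (Const 1) \<oplus> Op Equal (Reg 3) (Reg 4 \<oplus> Const 3))
             (for_records 128 link_body) (for_records 32 jump_body))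
          (Cond (Op Equal (Reg 3) (Reg 4 \<oplus> Reg 4 \<oplus> Const 5))
             (for_records 128 scatter_body) (output_round ;; Halt)))
       setup_round ;;
     Assign 3 (Reg 3 \<oplus> Const 1)"

section \<open>Messages and new content of a single record\<close>

definition encq :: "nat \<Rightarrow> (nat \<times> nat) list \<Rightarrow> (nat \<times> nat) list" where
  "encq SZ qs = concat (map (\<lambda>(g, x). [(g div SZ, g mod SZ), (g div SZ, x)]) qs)"

lemma encq_simps [simp]:
  "encq SZ [] = []"
  "encq SZ ((g, x) # qs) = (g div SZ, g mod SZ) # (g div SZ, x) # encq SZ qs"
  "encq SZ (qs @ qs') = encq SZ qs @ encq SZ qs'"
  by (simp_all add: encq_def)

lemma length_encq [simp]: "length (encq SZ qs) = 2 * length qs"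
  by (induction qs) auto

text \<open>\<open>M\<close> is the modulus of word arithmetic, \<open>n\<close> the number of
  vertices, \<open>r\<close> the content of the record and \<open>y\<close> its global address; a
  pair is a write to a global address. \<open>jump_new\<close> is the accompanying change of the
  record itself. The other two kinds of rounds follow the same pattern.\<close>

definition jump_msgs :: "nat \<Rightarrow> nat \<Rightarrow> (nat \<Rightarrow> nat) \<Rightarrow> nat \<Rightarrow> (nat \<times> nat) list" where
  "jump_msgs M n r y =
     (if r 0 \<noteq> 0 then [((r 0 + 2) mod M, r 2)] else []) @
     (if r 2 \<noteq> 0 then [(r 2 mod M, r 0), ((r 2 + 4) mod M, (r 4 + r 5) mod M)] else [])"

definition jump_new :: "nat \<Rightarrow> (nat \<Rightarrow> nat) \<Rightarrow> nat \<Rightarrow> nat" where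
  "jump_new M r f = (if f = 4 then (r 4 + r 5) mod M else if f = 5 then 0 else r f)"

definition child_msgs :: "nat \<Rightarrow> nat \<Rightarrow> nat \<Rightarrow> nat \<Rightarrow> nat \<Rightarrow> (nat \<times> nat) list" where
  "child_msgs M c y p q =
     (if c \<noteq> 0 then [((y + p) mod M, c), ((c + 2) mod M, (y + p) mod M),
        ((c + 64) mod M, (y + q) mod M), ((y + (q + 2)) mod M, (c + 64) mod M)]
      else [((y + p) mod M, (y + q) mod M), ((y + (q + 2)) mod M, (y + p) mod M)])"

text \<open>Cells 4, 36 and 68 hold the ranks, counted from the end, of the three items of a vertex.
  Neighbouring ranks differ by one plus three times the size of the subtree in between, so the test
  says that the first difference exceeds the second: the first subtree is the larger one.\<close>

definition swaps :: "nat \<Rightarrow> (nat \<Rightarrow> nat) \<Rightarrow> bool" where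
  "swaps M r \<longleftrightarrow> (r 36 + r 36) mod M < (r 4 + r 68) mod M"

definition link_msgs :: "nat \<Rightarrow> nat \<Rightarrow> (nat \<Rightarrow> nat) \<Rightarrow> nat \<Rightarrow> (nat \<times> nat) list" where
  "link_msgs M n r y = (if r 38 = 0 then [] else
     child_msgs M (if swaps M r then r 7 else r 6) y 0 32 @
     child_msgs M (if swaps M r then r 6 else r 7) y 32 64)"

definition link_new :: "nat \<Rightarrow> (nat \<Rightarrow> nat) \<Rightarrow> nat \<Rightarrow> nat" where
  "link_new M r f = (if r 38 = 0 then r f else
     if f = 4 \<or> f = 36 \<or> f = 68 then 1
     else if f = 6 then (if swaps M r then r 7 else r 6)
     else if f = 7 then (if swaps M r then r 6 else r 7)
     else r f)"

definition scatter_child_msgs :: "nat \<Rightarrow> nat \<Rightarrow> nat \<Rightarrow> nat \<Rightarrow> nat \<Rightarrow> nat \<Rightarrow> (nat \<times> nat) list" where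
  "scatter_child_msgs M SZ c q p d =
     (if c \<noteq> 0 \<and> (q + 32) mod M div SZ \<noteq> p div SZ
      then [(((q + 32) mod M + 12) mod M, 1), ((p + d) mod M, c)] else [])"

text \<open>A rank counts items up to the end of the tour, so \<open>3 * n\<close> minus the rank is
  a position and 32 times that the address of a slot. \<open>p\<close> belongs to the entry item and
  \<open>q\<close> to the middle item.\<close>

definition scatter_msgs :: "nat \<Rightarrow> nat \<Rightarrow> nat \<Rightarrow> (nat \<Rightarrow> nat) \<Rightarrow> nat \<Rightarrow> (nat \<times> nat) list" where
  "scatter_msgs M SZ n r y = (if r 38 = 0 then [] else
     let p = 32 * (3 * n mod M - r 4) mod M; q = 32 * (3 * n mod M - r 36) mod M in
       [((p + 8) mod M, y), ((p + 10) mod M, r 38)] @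
       (if r 38 = 1 then [((p + 12) mod M, 1)] else []) @
       scatter_child_msgs M SZ (r 6) p p 14 @ scatter_child_msgs M SZ (r 7) q p 16)"

definition frame :: "machine \<Rightarrow> machine \<Rightarrow> bool" where
  "frame s s' \<longleftrightarrow> (\<forall>r\<le>6. regs s' r = regs s r) \<and> inbox s' = inbox s \<and> halted s' = halted s"

text \<open>
  \<^term>\<open>body\<close> treats the record of \<^term>\<open>c\<close> cells that starts at the address in register 7.
\<close>

definition record_body ::
  "nat \<Rightarrow> nat \<Rightarrow> nat \<Rightarrow> com \<Rightarrow> ((nat \<Rightarrow> nat) \<Rightarrow> nat \<Rightarrow> nat) \<Rightarrow>
   (nat \<Rightarrow> (nat \<Rightarrow> nat) \<Rightarrow> nat \<Rightarrow> (nat \<times> nat) list) \<Rightarrow> bool" where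
  "record_body w SZ c body new msgs \<longleftrightarrow> straight body \<and>
     (\<forall>s b. regs s 5 = SZ \<longrightarrow> regs s 7 = b \<longrightarrow> b + c \<le> SZ \<longrightarrow>
        frame s (run w body s) \<and> outp (run w body s) = outp s \<and> regs (run w body s) 7 = b \<and>
        mem (run w body s) =
          (\<lambda>a. if b \<le> a \<and> a < b + c then new (\<lambda>f. mem s (b + f)) (a - b) else mem s a) \<and>
        outbox (run w body s) = outbox s @
          encq SZ (msgs (regs s 2) (\<lambda>f. mem s (b + f)) ((regs s 6 + b) mod 2 ^ w)) \<and>
        top_addr (run w body s) \<le> max (top_addr s) (b + c))"

section \<open>Symbolic execution of the record bodies\<close>

lemma mod_mod_simps:
  fixes x :: nat
  shows "x mod 2 ^ w div k mod 2 ^ w = x mod 2 ^ w div k"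
    "x mod 2 ^ w mod k mod 2 ^ w = x mod 2 ^ w mod k"
proof -
  have "x mod 2 ^ w div k \<le> x mod 2 ^ w" "x mod 2 ^ w mod k \<le> x mod 2 ^ w"
    by (simp_all add: div_le_dividend)
  moreover have "x mod 2 ^ w < 2 ^ w" by simp
  ultimately show "x mod 2 ^ w div k mod 2 ^ w = x mod 2 ^ w div k"
    "x mod 2 ^ w mod k mod 2 ^ w = x mod 2 ^ w mod k"
    by (metis le_less_trans mod_less)+
qed

lemmas exec_simps = cell_def fld_def push_def mod_mod_simps

lemma steps_run [simp]: "steps (run w c s) = steps s"
  by (induction c arbitrary: s) (simp_all add: run.simps)

lemma const_mods:
  fixes SZ b c :: nat
  assumes "SZ + 256 < 2 ^ w"
  shows "numeral k \<le> (256::nat) \<Longrightarrow> numeral k mod 2 ^ w = (numeral k :: nat)"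
    "Suc 0 mod 2 ^ w = Suc 0" "1 mod 2 ^ w = (1::nat)"
    "b + c \<le> SZ \<Longrightarrow> numeral k < c \<Longrightarrow> (b + numeral k) mod 2 ^ w = b + numeral k"
    "b + c \<le> SZ \<Longrightarrow> b mod 2 ^ w = b" "0 < w"
proof -
  show "0 < w" using assms by (cases w) auto
qed (rule mod_less; use assms in linarith)+

lemma record_body_jump:
  assumes "SZ + 256 < 2 ^ w"
  shows "record_body w SZ 32 jump_body (jump_new (2 ^ w)) (jump_msgs (2 ^ w))"
proof -
  have "frame s (run w jump_body s) \<and> outp (run w jump_body s) = outp s \<and> regs (run w jump_body s) 7 = b \<and>
        mem (run w jump_body s) =
          (\<lambda>a. if b \<le> a \<and> a < b + 32 then jump_new (2 ^ w) (\<lambda>f. mem s (b + f)) (a - b) else mem s a) \<and>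
        outbox (run w jump_body s) = outbox s @
          encq SZ (jump_msgs (2 ^ w) (regs s 2) (\<lambda>f. mem s (b + f)) ((regs s 6 + b) mod 2 ^ w)) \<and>
        top_addr (run w jump_body s) \<le> max (top_addr s) (b + 32)"
    if r: "regs s 5 = SZ" "regs s 7 = b" "b + 32 \<le> SZ" for s b
    by (cases "mem s b = 0"; cases "mem s (b + 2) = 0")
      (simp_all add: jump_body_def r jump_msgs_def jump_new_def exec_simps const_mods[OF assms] const_mods(4,5)[OF assms r(3)] frame_def fun_eq_iff
        del: add_2_eq_Suc add_2_eq_Suc', auto)
  then show ?thesis
    unfolding record_body_def by (simp add: jump_body_def push_def)
qed

text \<open>The first equation has the new state on both sides: it says that only register 8
  changes, without naming its final value. Summarising one call keeps the case splits of the two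
  calls in \<open>link_body\<close> apart.\<close>

lemma run_link_child:
  assumes "SZ + 256 < 2 ^ w" "regs s 5 = SZ" "p \<le> 128" "q \<le> 128" "c \<noteq> 8"
  shows "regs (run w (link_child c p q) s) = (regs s)(8 := regs (run w (link_child c p q) s) 8)"
    "mem (run w (link_child c p q) s) = mem s"
    "inbox (run w (link_child c p q) s) = inbox s"
    "outp (run w (link_child c p q) s) = outp s"
    "halted (run w (link_child c p q) s) = halted s"
    "top_addr (run w (link_child c p q) s) = top_addr s"
    "outbox (run w (link_child c p q) s) =
       outbox s @ encq SZ (child_msgs (2 ^ w) (regs s c) (regs s 9) p q)"
proof -
  have a: "k mod 2 ^ w = k" if "k \<le> p + 128 \<or> k \<le> q + 128" for k :: nat
    using assms that by (intro mod_less) linarith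
  show "regs (run w (link_child c p q) s) = (regs s)(8 := regs (run w (link_child c p q) s) 8)"
    "mem (run w (link_child c p q) s) = mem s"
    "inbox (run w (link_child c p q) s) = inbox s"
    "outp (run w (link_child c p q) s) = outp s"
    "halted (run w (link_child c p q) s) = halted s"
    "top_addr (run w (link_child c p q) s) = top_addr s"
    "outbox (run w (link_child c p q) s) =
       outbox s @ encq SZ (child_msgs (2 ^ w) (regs s c) (regs s 9) p q)"
    by (cases "regs s c = 0"; simp add: assms(2-5) link_child_def exec_simps const_mods[OF assms(1)] child_msgs_def a fun_eq_iff
      del: add_2_eq_Suc add_2_eq_Suc')+
qed

lemma record_body_link:
  assumes "SZ + 256 < 2 ^ w"
  shows "record_body w SZ 128 link_body (link_new (2 ^ w)) (link_msgs (2 ^ w))"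
proof -
  have "frame s (run w link_body s) \<and> outp (run w link_body s) = outp s \<and> regs (run w link_body s) 7 = b \<and>
        mem (run w link_body s) =
          (\<lambda>a. if b \<le> a \<and> a < b + 128 then link_new (2 ^ w) (\<lambda>f. mem s (b + f)) (a - b) else mem s a) \<and>
        outbox (run w link_body s) = outbox s @
          encq SZ (link_msgs (2 ^ w) (regs s 2) (\<lambda>f. mem s (b + f)) ((regs s 6 + b) mod 2 ^ w)) \<and>
        top_addr (run w link_body s) \<le> max (top_addr s) (b + 128)"
    if r: "regs s 5 = SZ" "regs s 7 = b" "b + 128 \<le> SZ" for s b
  proof (cases "mem s (b + 38) = 0")
    case True
    then show ?thesis
      by (simp add: link_body_def r link_msgs_def link_new_def cell_def fld_def const_mods[OF assms]
          const_mods(4,5)[OF assms r(3)] frame_def fun_eq_iff)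
  next
    case False
    define sw where "sw = swaps (2 ^ w) (\<lambda>f. mem s (b + f))"
    define x y where "x = (if sw then mem s (b + 7) else mem s (b + 6))"
      and "y = (if sw then mem s (b + 6) else mem s (b + 7))"
    \<comment> \<open>The execution is cut into the choice of the order, the stores and the two
      calls of \<open>link_child\<close>. Every intermediate state is named and then used through
      its fields only, so that the terms stay small.\<close>
    define s1 where "s1 = run w (Assign 9 (Reg 6 \<oplus> Reg 7) ;;
     Cond (Op Less (fld 36 \<oplus> fld 36) (fld 4 \<oplus> fld 68))
       (Assign 10 (fld 7) ;; Assign 11 (fld 6)) (Assign 10 (fld 6) ;; Assign 11 (fld 7))) s"
    note sm = r cell_def fld_def const_mods[OF assms] const_mods(4,5)[OF assms r(3)]
    have s1c: "regs s1 = (regs s)(9 := (regs s 6 + b) mod 2 ^ w, 10 := x, 11 := y) \<and> mem s1 = mem s \<and>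
       inbox s1 = inbox s \<and> outp s1 = outp s \<and> halted s1 = halted s \<and> outbox s1 = outbox s \<and> top_addr s1 = top_addr s"
    proof (cases sw)
      case True
      then have "(mem s (b + 36) + mem s (b + 36)) mod 2 ^ w < (mem s (b + 4) + mem s (b + 68)) mod 2 ^ w"
        by (simp add: sw_def swaps_def)
      with True show "regs s1 = (regs s)(9 := (regs s 6 + b) mod 2 ^ w, 10 := x, 11 := y) \<and> mem s1 = mem s \<and>
       inbox s1 = inbox s \<and> outp s1 = outp s \<and> halted s1 = halted s \<and> outbox s1 = outbox s \<and> top_addr s1 = top_addr s"
        by (simp add: s1_def sm x_def y_def)
    next
      case False
      then have "\<not> (mem s (b + 36) + mem s (b + 36)) mod 2 ^ w < (mem s (b + 4) + mem s (b + 68)) mod 2 ^ w"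
        by (simp add: sw_def swaps_def)
      with False show "regs s1 = (regs s)(9 := (regs s 6 + b) mod 2 ^ w, 10 := x, 11 := y) \<and> mem s1 = mem s \<and>
       inbox s1 = inbox s \<and> outp s1 = outp s \<and> halted s1 = halted s \<and> outbox s1 = outbox s \<and> top_addr s1 = top_addr s"
        by (simp add: s1_def sm x_def y_def)
    qed
    have s1: "regs s1 = (regs s)(9 := (regs s 6 + b) mod 2 ^ w, 10 := x, 11 := y)" "mem s1 = mem s"
       "inbox s1 = inbox s" "outp s1 = outp s" "halted s1 = halted s" "outbox s1 = outbox s" "top_addr s1 = top_addr s"
      using s1c by simp_all
    define s2 where "s2 = run w (Store (cell 6) (Reg 10) ;; Store (cell 7) (Reg 11) ;;
     Store (cell 4) (Const 1) ;; Store (cell 36) (Const 1) ;; Store (cell 68) (Const 1)) s1"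
    have s2: "regs s2 = regs s1"
       "mem s2 = (mem s)(b + 6 := x, b + 7 := y, b + 4 := 1, b + 36 := 1, b + 68 := 1)"
       "inbox s2 = inbox s" "outp s2 = outp s" "halted s2 = halted s" "outbox s2 = outbox s"
       "top_addr s2 \<le> max (top_addr s) (b + 128)"
      by (simp_all add: s2_def s1 sm, auto)
    have *: "run w link_body s = run w (link_child 11 32 64) (run w (link_child 10 0 32) s2)"
      using False by (simp add: link_body_def s2_def s1_def sm)
    have m: "mem s2 = (\<lambda>a. if b \<le> a \<and> a < b + 128 then link_new (2 ^ w) (\<lambda>f. mem s (b + f)) (a - b) else mem s a)"
    proof
      fix a
      show "mem s2 a = (if b \<le> a \<and> a < b + 128 then link_new (2 ^ w) (\<lambda>f. mem s (b + f)) (a - b) else mem s a)"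
      proof (cases "b \<le> a \<and> a < b + 128")
        case True
        then obtain f where a: "a = b + f" "f < 128" by (metis le_iff_add add_less_cancel_left)
        show ?thesis
          using False unfolding s2 a link_new_def sw_def[symmetric] x_def[symmetric] y_def[symmetric]
          by (simp add: a(2))
      next
        case a: False
        then show ?thesis unfolding s2 by auto
      qed
    qed
    have z: "regs s2 5 = SZ" "regs s2 9 = (regs s 6 + b) mod 2 ^ w" "regs s2 10 = x" "regs s2 11 = y"
      by (simp_all add: s2 s1 r)
    have q: "link_msgs (2 ^ w) (regs s 2) (\<lambda>f. mem s (b + f)) ((regs s 6 + b) mod 2 ^ w) =
       child_msgs (2 ^ w) x ((regs s 6 + b) mod 2 ^ w) 0 32 @ child_msgs (2 ^ w) y ((regs s 6 + b) mod 2 ^ w) 32 64"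
      using False by (simp add: link_msgs_def sw_def x_def y_def)
    have l1: "regs (run w (link_child 10 0 32) s2) r = regs s2 r" if "r \<noteq> 8" for r
    proof -
      have "regs (run w (link_child 10 0 32) s2) =
          (regs s2)(8 := regs (run w (link_child 10 0 32) s2) 8)"
        by (rule run_link_child(1)[OF assms z(1)]) simp_all
      from fun_cong[OF this, of r] that show ?thesis by simp
    qed
    note L1 = run_link_child(2-)[OF assms z(1), of 0 32 10, simplified]
    have z1: "regs (run w (link_child 10 0 32) s2) 5 = SZ" by (simp add: l1 z)
    note L2 = run_link_child(2-)[OF assms z1, of 32 64 11, simplified]
    have l2: "regs (run w (link_child 11 32 64) (run w (link_child 10 0 32) s2)) r = regs (run w (link_child 10 0 32) s2) r" if "r \<noteq> 8" for r
    proof -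
      let ?s = "run w (link_child 11 32 64) (run w (link_child 10 0 32) s2)"
      have "regs ?s = (regs (run w (link_child 10 0 32) s2))(8 := regs ?s 8)"
        by (rule run_link_child(1)[OF assms z1]) simp_all
      from fun_cong[OF this, of r] that show ?thesis by simp
    qed
    show ?thesis
      unfolding * q frame_def using s2(7) m
      by (simp add: L1 L2 l1 l2 z s2(3-6)) (auto simp: s2 s1 r)
  qed
  then show ?thesis
    unfolding record_body_def by (simp add: link_body_def link_child_def push_def)
qed

lemma run_scatter_child:
  assumes "SZ + 256 < 2 ^ w" "regs s 5 = SZ" "regs s 7 = b" "b + 128 \<le> SZ" "regs s 12 < 2 ^ w"
    "f < 128" "d \<le> 128" "r \<noteq> 8" "r \<noteq> 10"
  shows "regs (run w (scatter_child f r d) s) =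
      (regs s)(8 := regs (run w (scatter_child f r d) s) 8, 10 := regs (run w (scatter_child f r d) s) 10) \<and>
    mem (run w (scatter_child f r d) s) = mem s \<and>
    inbox (run w (scatter_child f r d) s) = inbox s \<and>
    outp (run w (scatter_child f r d) s) = outp s \<and>
    halted (run w (scatter_child f r d) s) = halted s \<and>
    top_addr (run w (scatter_child f r d) s) = top_addr s \<and>
    outbox (run w (scatter_child f r d) s) =
       outbox s @ encq SZ (scatter_child_msgs (2 ^ w) SZ (mem s (b + f)) (regs s r) (regs s 12) d)"
proof -
  have a: "d mod 2 ^ w = d" "f mod 2 ^ w = f" "(b + f) mod 2 ^ w = b + f"
    "regs s 12 div SZ mod 2 ^ w = regs s 12 div SZ"
    using assms by (auto intro!: mod_less intro: le_less_trans[OF div_le_dividend])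
  note sm = assms(2-3,8,9) a scatter_child_def exec_simps const_mods[OF assms(1)] scatter_child_msgs_def fun_eq_iff
  consider "mem s (b + f) = 0" | "mem s (b + f) > 0" "(regs s r + 32) mod 2 ^ w div SZ = regs s 12 div SZ"
    | "mem s (b + f) > 0" "(regs s r + 32) mod 2 ^ w div SZ \<noteq> regs s 12 div SZ" by auto
  then show ?thesis
    by cases (simp_all add: sm del: add_2_eq_Suc add_2_eq_Suc')
qed

lemma record_body_scatter:
  assumes "SZ + 256 < 2 ^ w"
  shows "record_body w SZ 128 scatter_body (\<lambda>r. r) (scatter_msgs (2 ^ w) SZ)"
proof -
  have "frame s (run w scatter_body s) \<and> outp (run w scatter_body s) = outp s \<and> regs (run w scatter_body s) 7 = b \<and>
        mem (run w scatter_body s) =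
          (\<lambda>a. if b \<le> a \<and> a < b + 128 then mem s (b + (a - b)) else mem s a) \<and>
        outbox (run w scatter_body s) = outbox s @
          encq SZ (scatter_msgs (2 ^ w) SZ (regs s 2) (\<lambda>f. mem s (b + f)) ((regs s 6 + b) mod 2 ^ w)) \<and>
        top_addr (run w scatter_body s) \<le> max (top_addr s) (b + 128)"
    if r: "regs s 5 = SZ" "regs s 7 = b" "b + 128 \<le> SZ" for s b
  proof (cases "mem s (b + 38) = 0")
    case True
    then show ?thesis
      by (simp add: scatter_body_def r scatter_msgs_def cell_def fld_def const_mods[OF assms]
          const_mods(4,5)[OF assms r(3)] frame_def fun_eq_iff)
  next
    case False
    define p where "p = 32 * (3 * regs s 2 mod 2 ^ w - mem s (b + 4)) mod 2 ^ w"
    define q where "q = 32 * (3 * regs s 2 mod 2 ^ w - mem s (b + 36)) mod 2 ^ w"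
    define y where "y = (regs s 6 + b) mod 2 ^ w"
    note sm = r cell_def fld_def const_mods[OF assms] const_mods(4,5)[OF assms r(3)]
    define s1 where "s1 = run w (Assign 9 (Reg 6 \<oplus> Reg 7) ;;
     Assign 12 (Op Mul (Const 32) (Op Sub (Op Mul (Const 3) (Reg 2)) (fld 4))) ;;
     Assign 13 (Op Mul (Const 32) (Op Sub (Op Mul (Const 3) (Reg 2)) (fld 36)))) s"
    have lt: "a mod 2 ^ w - c < 2 ^ w" for a c :: nat
      by (rule le_less_trans[OF diff_le_self]) simp
    have s1: "regs s1 = (regs s)(9 := y, 12 := p, 13 := q)" "mem s1 = mem s"
       "inbox s1 = inbox s" "outp s1 = outp s" "halted s1 = halted s" "outbox s1 = outbox s" "top_addr s1 = top_addr s"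
      by (simp_all add: s1_def sm p_def q_def y_def lt)
    define s2 where "s2 = run w (push (Reg 12) 8 (Reg 9) ;; push (Reg 12) 10 (fld 38) ;;
     guarded (Op Equal (fld 38) (Const 1)) (push (Reg 12) 12 (Const 1))) s1"
    have s2: "regs s2 = (regs s1)(8 := regs s2 8)" "mem s2 = mem s"
       "inbox s2 = inbox s" "outp s2 = outp s" "halted s2 = halted s"
       "top_addr s2 = top_addr s" "outbox s2 = outbox s @ encq SZ ([((p + 8) mod 2 ^ w, y), ((p + 10) mod 2 ^ w, mem s (b + 38))] @
       (if mem s (b + 38) = 1 then [((p + 12) mod 2 ^ w, 1)] else []))"
      by (cases "mem s (b + 38) = 1"; simp add: s2_def s1 sm push_def mod_mod_simps del: add_2_eq_Suc add_2_eq_Suc')+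
    have *: "run w scatter_body s = run w (scatter_child 7 13 16) (run w (scatter_child 6 12 14) s2)"
      using False by (simp add: scatter_body_def s2_def s1_def sm)
    have z: "regs s2 r = (if r = 8 then regs s2 8 else if r = 9 then y else if r = 12 then p else if r = 13 then q else regs s r)" for r
      by (subst s2(1)) (simp add: s1)
    have lt2: "p < 2 ^ w" by (simp add: p_def)
    define s3 where "s3 = run w (scatter_child 6 12 14) s2"
    have s3: "regs s3 = (regs s2)(8 := regs s3 8, 10 := regs s3 10)" "mem s3 = mem s"
       "inbox s3 = inbox s" "outp s3 = outp s" "halted s3 = halted s"
       "top_addr s3 = top_addr s" "outbox s3 = outbox s2 @ encq SZ (scatter_child_msgs (2 ^ w) SZ (mem s (b + 6)) p p 14)"
      using run_scatter_child[OF assms, of s2 b 6 14 12] unfolding s3_def by (simp_all add: z r lt2 s2(2-6))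
    have z3: "regs s3 r = (if r = 8 then regs s3 8 else if r = 10 then regs s3 10 else regs s2 r)" for r
      by (subst s3(1)) simp
    define s4 where "s4 = run w (scatter_child 7 13 16) s3"
    have s4: "regs s4 = (regs s3)(8 := regs s4 8, 10 := regs s4 10)" "mem s4 = mem s"
       "inbox s4 = inbox s" "outp s4 = outp s" "halted s4 = halted s"
       "top_addr s4 = top_addr s" "outbox s4 = outbox s3 @ encq SZ (scatter_child_msgs (2 ^ w) SZ (mem s (b + 7)) q p 16)"
      using run_scatter_child[OF assms, of s3 b 7 16 13] unfolding s4_def by (simp_all add: z z3 r lt2 s3(2-6))
    have z4: "regs s4 r = (if r = 8 then regs s4 8 else if r = 10 then regs s4 10 else regs s3 r)" for r
      by (subst s4(1)) simp
    have "regs s4 k = regs s k" if "k \<le> 7" for k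
      using that by (simp add: z4 z3 z)
    then show ?thesis
      using False unfolding * s3_def[symmetric] s4_def[symmetric] frame_def
      by (auto simp: s4(2-7) s3(2-7) s2(2-7) scatter_msgs_def p_def q_def y_def Let_def r fun_eq_iff)
  qed
  then show ?thesis
    unfolding record_body_def by (simp add: scatter_body_def scatter_child_def push_def)
qed

section \<open>Loops over records and over the inbox\<close>

lemma frame_tick [simp]: "frame s (tick k s') = frame s s'" "frame (tick k s) s' = frame s s'"
  by (simp_all add: frame_def)

text \<open>A record looks only at its own \<open>c\<close> cells, which earlier iterations have not
  touched. The two locality hypotheses express this, and they make the loop in place agree with a
  simultaneous update of all records.\<close>

lemma wp_for_records:
  assumes body: "record_body w SZ c body new msgs"
    and size: "SZ = c * K" "0 < c" "SZ + c < 2 ^ w" "regs s 5 = SZ"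
    and local_new: "\<And>r r' f. f < c \<Longrightarrow> (\<And>g. g < c \<Longrightarrow> r g = r' g) \<Longrightarrow> new r f = new r' f"
    and local_msgs: "\<And>r r' n y. (\<And>g. g < c \<Longrightarrow> r g = r' g) \<Longrightarrow> msgs n r y = msgs n r' y"
    and Q: "\<And>s'. frame s s' \<Longrightarrow> outp s' = outp s \<Longrightarrow>
      mem s' = (\<lambda>a. if a < SZ then new (\<lambda>f. mem s (a - a mod c + f)) (a mod c) else mem s a) \<Longrightarrow>
      outbox s' = outbox s @ encq SZ (concat (map (\<lambda>k. msgs (regs s 2) (\<lambda>f. mem s (c * k + f))
        ((regs s 6 + c * k) mod 2 ^ w)) [0..<K])) \<Longrightarrow>
      top_addr s' \<le> max (top_addr s) SZ \<Longrightarrow>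
      steps s' \<le> steps s + 10 + K * (max_cost body + 10) \<Longrightarrow> Q s'"
  shows "wp w (for_records c body) s Q"
proof -
  define M :: nat where "M = 2 ^ w"
  define old where "old k f = mem s (c * k + f)" for k f
  define I where "I k s' \<longleftrightarrow> frame s s' \<and> outp s' = outp s \<and> regs s' 7 = c * k \<and>
      mem s' = (\<lambda>a. if a < c * k then new (old (a div c)) (a mod c) else mem s a) \<and>
      outbox s' = outbox s @ encq SZ (concat (map (\<lambda>k. msgs (regs s 2) (old k) ((regs s 6 + c * k) mod M)) [0..<k])) \<and>
      top_addr s' \<le> max (top_addr s) SZ \<and>
      steps s' \<le> steps s + 2 + k * (max_cost body + 10)" for k s'
  have st: "straight body" using body by (simp add: record_body_def)
  have "2 ^ w > c" using size by linarith
  then have cM: "c mod 2 ^ w = c" by simp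
  have le: "c * Suc k \<le> SZ" if "k < K" for k using that size by (metis Suc_leI mult_le_mono2)
  have step: "aval w s1 (Op Less (Reg 7) (Reg 5)) \<noteq> 0 \<and>
      wp w (body ;; Assign 7 (Reg 7 \<oplus> Const c)) (tick (1 + acost (Op Less (Reg 7) (Reg 5))) s1) (I (Suc k))"
    if k: "k < K" and I: "I k s1" for k s1
  proof -
    have r5: "regs s1 5 = SZ" using I size by (simp add: I_def frame_def)
    have r26: "regs s1 2 = regs s 2" "regs s1 6 = regs s 6" using I by (simp_all add: I_def frame_def)
    have r7: "regs s1 7 = c * k" using I by (simp add: I_def)
    have lek: "c * k + c \<le> SZ" using le[OF k] by simp
    define s2 where "s2 = run w body s1"
    have rec: "mem s1 (c * k + f) = old k f" if "f < c" for f
      using I by (simp add: I_def old_def)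
    have s2: "frame s1 s2" "outp s2 = outp s1" "regs s2 7 = c * k"
        "mem s2 = (\<lambda>a. if c * k \<le> a \<and> a < c * k + c then new (\<lambda>f. mem s1 (c * k + f)) (a - c * k) else mem s1 a)"
        "outbox s2 = outbox s1 @ encq SZ (msgs (regs s1 2) (\<lambda>f. mem s1 (c * k + f)) ((regs s1 6 + c * k) mod 2 ^ w))"
        "top_addr s2 \<le> max (top_addr s1) (c * k + c)"
      using body r5 r7 lek unfolding record_body_def s2_def by blast+
    have st2: "steps s2 = steps s1" by (simp add: s2_def)
    have m: "mem s2 = (\<lambda>a. if a < c * Suc k then new (old (a div c)) (a mod c) else mem s a)"
    proof
      fix a
      show "mem s2 a = (if a < c * Suc k then new (old (a div c)) (a mod c) else mem s a)"
      proof (cases "c * k \<le> a \<and> a < c * k + c")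
        case True
        then obtain f where a: "a = c * k + f" "f < c" by (metis le_iff_add add_less_cancel_left)
        then have d: "a div c = k" "a mod c = f" using size by (auto simp: add.commute)
        have "mem s2 a = new (\<lambda>f. mem s1 (c * k + f)) f" using True a by (simp add: s2(4))
        also have "\<dots> = new (old k) f" by (rule local_new) (use a rec in auto)
        finally show ?thesis using True d by simp
      next
        case False
        then show ?thesis using I by (auto simp: s2(4) I_def)
      qed
    qed
    have e: "msgs (regs s1 2) (\<lambda>f. mem s1 (c * k + f)) ((regs s1 6 + c * k) mod 2 ^ w) =
        msgs (regs s 2) (old k) ((regs s 6 + c * k) mod M)"
      unfolding r26 M_def by (rule local_msgs) (use rec in auto)
    have "c * k + c < 2 ^ w" using lek size by linarith
    then have r7': "aval w s2 (Reg 7 \<oplus> Const c) = c * Suc k" using s2(3) cM by (simp add: add.commute)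
    have *: "aval w s1 (Op Less (Reg 7) (Reg 5)) \<noteq> 0"
    proof -
      have "0 < w" using size(2,3) by (cases w) simp_all
      moreover have "c * k < SZ" using lek size(2) by linarith
      ultimately show ?thesis using r5 r7 by simp
    qed
    have "wp w (body ;; Assign 7 (Reg 7 \<oplus> Const c)) (tick 4 s1) (I (Suc k))"
    proof (rule wp_straight)
      fix j assume j: "j \<le> max_cost (body ;; Assign 7 (Reg 7 \<oplus> Const c))"
      show "I (Suc k) (tick j (run w (body ;; Assign 7 (Reg 7 \<oplus> Const c)) (tick 4 s1)))"
        unfolding I_def
      proof (intro conjI)
        show "frame s (tick j (run w (body ;; Assign 7 (Reg 7 \<oplus> Const c)) (tick 4 s1)))"
          using I s2(1) by (simp add: I_def frame_def s2_def)
      qed (use I j r7' m e s2 st2 lek in \<open>auto simp: I_def s2_def[symmetric]\<close>)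
    qed (simp add: st)
    moreover have "1 + acost (Op Less (Reg 7) (Reg 5)) = 4" by simp
    ultimately show ?thesis using * by presburger
  qed
  show ?thesis
    unfolding for_records_def
  proof (rule wp_Seq, rule wp_straight)
    fix j assume j: "j \<le> max_cost (Assign 7 (Const 0))"
    show "wp w (While (Op Less (Reg 7) (Reg 5)) (body ;; Assign 7 (Reg 7 \<oplus> Const c)))
        (tick j (run w (Assign 7 (Const 0)) s)) Q"
    proof (rule wp_While_count[where I = I and k = 0 and N = K])
      show "I 0 (tick j (run w (Assign 7 (Const 0)) s))"
        using j by (auto simp: I_def frame_def)
    next
      fix s' assume I: "I K s'"
      have d: "c * (a div c) = a - a mod c" for a by (simp add: minus_mod_eq_mult_div)
      have oe: "old (a div c) = (\<lambda>f. mem s (a - a mod c + f))" for a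
        by (rule ext) (simp add: old_def d)
      have "regs s' 5 = SZ" "regs s' 7 = SZ" using I size by (simp_all add: I_def frame_def)
      moreover have "Q (tick (1 + acost (Op Less (Reg 7) (Reg 5))) s')"
      proof (rule Q)
        show "mem (tick (1 + acost (Op Less (Reg 7) (Reg 5))) s') =
            (\<lambda>a. if a < SZ then new (\<lambda>f. mem s (a - a mod c + f)) (a mod c) else mem s a)"
        proof -
          have "mem s' = (\<lambda>a. if a < c * K then new (old (a div c)) (a mod c) else mem s a)"
            using I by (simp add: I_def)
          then show ?thesis unfolding tick_simps oe size(1) .
        qed
      qed (use I in \<open>simp_all add: I_def old_def[abs_def] M_def\<close>)
      ultimately show "aval w s' (Op Less (Reg 7) (Reg 5)) = 0 \<and>
          Q (tick (1 + acost (Op Less (Reg 7) (Reg 5))) s')" by simp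
    qed (use step in auto)
  qed simp
qed

definition flat_pairs :: "(nat \<times> nat) list \<Rightarrow> nat list" where
  "flat_pairs qs = concat (map (\<lambda>(a, x). [a, x]) qs)"

lemma flat_pairs_simps [simp]:
  "flat_pairs [] = []" "flat_pairs ((a, x) # qs) = a # x # flat_pairs qs"
  "flat_pairs (qs @ qs') = flat_pairs qs @ flat_pairs qs'"
  by (simp_all add: flat_pairs_def)

lemma length_flat_pairs [simp]: "length (flat_pairs qs) = 2 * length qs"
  by (induction qs) auto

lemma flat_pairs_nth:
  "k < length qs \<Longrightarrow> flat_pairs qs ! (2 * k) = fst (qs ! k)"
  "k < length qs \<Longrightarrow> flat_pairs qs ! Suc (2 * k) = snd (qs ! k)"
proof -
  assume k: "k < length qs"
  obtain a x where ax: "qs ! k = (a, x)" by force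
  have "flat_pairs qs = flat_pairs (take k qs) @ a # x # flat_pairs (drop (Suc k) qs)"
    using id_take_nth_drop[OF k] ax by (metis flat_pairs_simps(2,3) append_Cons)
  moreover have "length (flat_pairs (take k qs)) = 2 * k" using k by simp
  ultimately show "flat_pairs qs ! (2 * k) = fst (qs ! k)" "flat_pairs qs ! Suc (2 * k) = snd (qs ! k)"
    using ax by (simp_all add: nth_append)
qed

text \<open>
  A second value sent to the same cell pushes the first into the following cell.  This is how a
  vertex learns about both of its children without any arbitration between them.
\<close>

fun push_cell :: "nat \<times> nat \<Rightarrow> (nat \<Rightarrow> nat) \<Rightarrow> nat \<Rightarrow> nat" where
  "push_cell (a, x) m = m(a + 1 := m a, a := x)"

text \<open>A write also fills the cell after its target, so \<open>a + 1\<close> has to lie within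
  the memory of the machine; this is what bounds \<open>top_addr\<close>.\<close>

lemma wp_receive:
  assumes qs: "inbox s = flat_pairs qs" "\<And>a x. (a, x) \<in> set qs \<Longrightarrow> a + 1 < SZ"
    and M: "SZ + 256 < 2 ^ w" "2 * length qs + 2 < 2 ^ w"
    and Q: "\<And>s'. frame s s' \<Longrightarrow> outp s' = outp s \<Longrightarrow> outbox s' = outbox s \<Longrightarrow>
      mem s' = fold push_cell qs (mem s) \<Longrightarrow> top_addr s' \<le> max (top_addr s) SZ \<Longrightarrow>
      steps s' \<le> steps s + 10 + 30 * length qs \<Longrightarrow> Q s'"
  shows "wp w receive s Q"
proof -
  define I where "I k s' \<longleftrightarrow> frame s s' \<and> outp s' = outp s \<and> outbox s' = outbox s \<and>
      regs s' 7 = 2 * k \<and> mem s' = fold push_cell (take k qs) (mem s) \<and>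
      top_addr s' \<le> max (top_addr s) SZ \<and> steps s' \<le> steps s + 2 + 30 * k" for k s'
  let ?body = "Store (Inbox (Reg 7) \<oplus> Const 1) (Load (Inbox (Reg 7))) ;;
        Store (Inbox (Reg 7)) (Inbox (Reg 7 \<oplus> Const 1)) ;; Assign 7 (Reg 7 \<oplus> Const 2)"
  have len: "2 * length qs mod 2 ^ w = 2 * length qs" using M by simp
  note cm = const_mods[OF M(1)]
  have step: "aval w s1 (Op Less (Reg 7) InboxLength) \<noteq> 0 \<and>
      wp w ?body (tick (1 + acost (Op Less (Reg 7) InboxLength)) s1) (I (Suc k))"
    if k: "k < length qs" and I: "I k s1" for k s1
  proof
    have ib: "inbox s1 = flat_pairs qs" and r7: "regs s1 7 = 2 * k"
      using I qs by (simp_all add: I_def frame_def)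
    show "aval w s1 (Op Less (Reg 7) InboxLength) \<noteq> 0"
      using k ib r7 len cm by simp
    obtain a x where ax: "qs ! k = (a, x)" by force
    have "(a, x) \<in> set qs" using ax k by (metis nth_mem)
    then have a: "a + 1 < SZ" by (rule qs)
    have m: "Suc (2 * k) mod 2 ^ w = Suc (2 * k)" "Suc (Suc (2 * k)) mod 2 ^ w = Suc (Suc (2 * k))"
      "Suc a mod 2 ^ w = Suc a"
      using k M a by (auto intro!: mod_less)
    have f: "fold push_cell (take (Suc k) qs) (mem s) = push_cell (a, x) (fold push_cell (take k qs) (mem s))"
      using k by (simp add: take_Suc_conv_app_nth ax)
    show "wp w ?body (tick (1 + acost (Op Less (Reg 7) InboxLength)) s1) (I (Suc k))"
    proof (rule wp_straight)
      fix j assume j: "j \<le> max_cost ?body"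
      show "I (Suc k) (tick j (run w ?body (tick (1 + acost (Op Less (Reg 7) InboxLength)) s1)))"
        using I j k a unfolding I_def f
        by (simp add: frame_def ib qs(1) r7 flat_pairs_nth ax m cm)
    qed simp
  qed
  show ?thesis
    unfolding receive_def
  proof (rule wp_Seq, rule wp_straight)
    fix j assume j: "j \<le> max_cost (Assign 7 (Const 0))"
    show "wp w (While (Op Less (Reg 7) InboxLength) ?body) (tick j (run w (Assign 7 (Const 0)) s)) Q"
    proof (rule wp_While_count[where I = I and k = 0 and N = "length qs"])
      show "I 0 (tick j (run w (Assign 7 (Const 0)) s))"
        using j by (auto simp: I_def frame_def)
    next
      fix s' assume I: "I (length qs) s'"
      have "inbox s' = flat_pairs qs" "regs s' 7 = 2 * length qs"
        using I qs by (simp_all add: I_def frame_def)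
      moreover have "Q (tick (1 + acost (Op Less (Reg 7) InboxLength)) s')"
        by (rule Q) (use I in \<open>simp_all add: I_def\<close>)
      ultimately show "aval w s' (Op Less (Reg 7) InboxLength) = 0 \<and>
          Q (tick (1 + acost (Op Less (Reg 7) InboxLength)) s')" using len by simp
    qed (use step in auto)
  qed simp
qed

section \<open>The setup round\<close>

fun init_msgs :: "nat \<times> nat \<Rightarrow> (nat \<times> nat) list" where
  "init_msgs (v, u) = [(128 * v + 38, 128 * u + 1), (128 * u + 6, 128 * v)]"

text \<open>\<open>2 ^ J \<ge> 4 * n\<close> exceeds the \<open>3 * n\<close> items of the tour, so
  after \<open>J\<close> doublings all pointers are null. The same \<open>J\<close> bounds the
  number of edges that cross a position, as 2 to that number is at most
  \<open>2 * n\<close>.\<close>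

definition doublings :: "nat \<Rightarrow> nat" where "doublings n = (LEAST j. 4 * n \<le> 2 ^ j)"

lemma doublings_ge: "4 * n \<le> 2 ^ doublings n"
proof -
  have "4 * n \<le> 2 ^ (4 * n)" using less_exp[of "4 * n"] by (rule less_imp_le)
  then show ?thesis unfolding doublings_def by (rule LeastI)
qed

lemma doublings_less: "k < doublings n \<Longrightarrow> 2 ^ k < 4 * n"
  unfolding doublings_def using not_less_Least by (metis not_le)

lemma wp_setup_round:
  fixes n m i w :: nat and s :: machine
  defines "J \<equiv> doublings n"
  defines "SZ \<equiv> 128 * (J * (n div m + 1))"
  assumes r: "regs s 0 = i" "regs s 1 = m" "regs s 2 = n" "0 < n" "0 < m"
    and ib: "inbox s = flat_pairs vp" "\<And>v u. (v, u) \<in> set vp \<Longrightarrow> v \<le> n \<and> u \<le> n"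
    and M: "SZ + 256 < 2 ^ w" "2 * length vp + 2 < 2 ^ w" "128 * n + 256 < 2 ^ w" "i * SZ < 2 ^ w"
    and Q: "\<And>s'. (\<And>k. k \<le> 3 \<Longrightarrow> regs s' k = regs s k) \<Longrightarrow> regs s' 4 = J \<Longrightarrow> regs s' 5 = SZ \<Longrightarrow>
      regs s' 6 = i * SZ \<Longrightarrow> inbox s' = inbox s \<Longrightarrow> halted s' = halted s \<Longrightarrow>
      outp s' = outp s \<Longrightarrow> mem s' = mem s \<Longrightarrow> top_addr s' = top_addr s \<Longrightarrow>
      outbox s' = outbox s @ encq SZ (concat (map init_msgs vp)) \<Longrightarrow>
      steps s' \<le> steps s + 100 + 20 * J + 100 * length vp \<Longrightarrow> Q s'"
  shows "wp w setup_round s Q"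
proof -
  have w: "0 < w" using M by (cases w) auto
  note cm = const_mods[OF M(1)]
  have J1: "0 < J"
  proof (rule ccontr)
    assume "\<not> 0 < J"
    then show False using doublings_ge[of n] r(4) by (simp add: J_def)
  qed
  have JS: "J + 256 < 2 ^ w" "n div m + 1 < 2 ^ w" "J * (n div m + 1) < 2 ^ w"
  proof -
    define x where "x = n div m + 1"
    have "0 < x" by (simp add: x_def)
    then have x: "J \<le> J * x" "x \<le> J * x" using J1 by simp_all
    have "128 * (J * x) + 256 < 2 ^ w" using M(1) by (simp only: SZ_def x_def)
    then show "J + 256 < 2 ^ w" "n div m + 1 < 2 ^ w" "J * (n div m + 1) < 2 ^ w"
      using x unfolding x_def[symmetric] by linarith+
  qed
  define D where "D = (\<lambda>(s0 :: machine) (s' :: machine). (\<forall>k\<le>3. regs s' k = regs s0 k) \<and> inbox s' = inbox s0 \<and> halted s' = halted s0 \<and>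
      outp s' = outp s0 \<and> mem s' = mem s0 \<and> top_addr s' = top_addr s0)"
  define I1 where "I1 = (\<lambda>k s'. D s s' \<and> outbox s' = outbox s \<and>
     regs s' 4 = k \<and> regs s' 9 = 2 ^ k \<and> steps s' \<le> steps s + 10 + 20 * k)"
  define I2 where "I2 = (\<lambda>k s'. D s s' \<and> outbox s' = outbox s @ encq SZ (concat (map init_msgs (take k vp))) \<and>
     regs s' 4 = J \<and> regs s' 5 = SZ \<and> regs s' 6 = i * SZ \<and> regs s' 7 = 2 * k \<and>
     steps s' \<le> steps s + 50 + 20 * J + 80 * k)"
  have n4: "4 * n mod 2 ^ w = 4 * n" using M by simp
  have len: "2 * length vp mod 2 ^ w = 2 * length vp" using M by simp
  let ?b1 = "Assign 9 (Reg 9 \<oplus> Reg 9) ;; Assign 4 (Reg 4 \<oplus> Const 1)"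
  let ?e1 = "Op Less (Reg 9) (Op Mul (Const 4) (Reg 2))"
  let ?e2 = "Op Less (Reg 7) InboxLength"
  let ?rest = "Assign 5 (Op Mul (Const 128) (Op Mul (Reg 4) (Op Div (Reg 2) (Reg 1) \<oplus> Const 1))) ;;
     Assign 6 (Op Mul (Reg 0) (Reg 5)) ;; Assign 7 (Const 0)"
  have step1: "aval w s1 ?e1 \<noteq> 0 \<and> wp w ?b1 (tick (1 + acost ?e1) s1) (I1 (Suc k))"
    if k: "k < J" and I: "I1 k s1" for k s1
  proof
    have lt: "2 ^ k < 4 * n" using k doublings_less J_def by simp
    have "regs s1 2 = n" using I r by (simp add: I1_def D_def)
    then show "aval w s1 ?e1 \<noteq> 0" using I lt n4 cm w by (simp add: I1_def)
    \<comment> \<open>While the loop runs, \<open>2 ^ k < 4 * n\<close>, so the doubled value is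
      below \<open>8 * n\<close> and fits into a word.\<close>
    have *: "(2 ^ k + 2 ^ k) mod 2 ^ w = (2 ^ Suc k :: nat)" using lt M by simp
    have **: "Suc k mod 2 ^ w = Suc k" using k JS by simp
    show "wp w ?b1 (tick (1 + acost ?e1) s1) (I1 (Suc k))"
      by (rule wp_straight) (use I * ** cm w in \<open>auto simp: I1_def D_def\<close>)
  qed
  have step2: "aval w s1 ?e2 \<noteq> 0 \<and> wp w init_body (tick (1 + acost ?e2) s1) (I2 (Suc k))"
    if k: "k < length vp" and I: "I2 k s1" for k s1
  proof
    have ib1: "inbox s1 = flat_pairs vp" and r7: "regs s1 7 = 2 * k"
      using I ib by (simp_all add: I2_def D_def)
    show "aval w s1 ?e2 \<noteq> 0" using k ib1 r7 len cm w by simp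
    obtain v u where vu: "vp ! k = (v, u)" by force
    have "(v, u) \<in> set vp" using vu k by (metis nth_mem)
    then have le: "v \<le> n" "u \<le> n" using ib by blast+
    have m: "Suc (2 * k) mod 2 ^ w = Suc (2 * k)" "Suc (Suc (2 * k)) mod 2 ^ w = Suc (Suc (2 * k))"
      "128 * v mod 2 ^ w = 128 * v" "128 * u mod 2 ^ w = 128 * u" "Suc (128 * u) mod 2 ^ w = Suc (128 * u)"
      "(128 * v + 38) mod 2 ^ w = 128 * v + 38" "(128 * u + 6) mod 2 ^ w = 128 * u + 6"
      using k M le by (auto intro!: mod_less)
    have le2: "x div SZ mod 2 ^ w = x div SZ" "x mod SZ mod 2 ^ w = x mod SZ" if "x < 2 ^ w" for x :: nat
      using that mod_mod_simps[of x w SZ] by simp_all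
    have m2: "(128 * v + 38) div SZ mod 2 ^ w = (128 * v + 38) div SZ" "(128 * v + 38) mod SZ mod 2 ^ w = (128 * v + 38) mod SZ"
      "(128 * u + 6) div SZ mod 2 ^ w = (128 * u + 6) div SZ" "(128 * u + 6) mod SZ mod 2 ^ w = (128 * u + 6) mod SZ"
      by (rule le2; use M le in linarith)+
    have f: "concat (map init_msgs (take (Suc k) vp)) = concat (map init_msgs (take k vp)) @ init_msgs (v, u)"
      using k by (simp add: take_Suc_conv_app_nth vu)
    show "wp w init_body (tick (1 + acost ?e2) s1) (I2 (Suc k))"
    proof (rule wp_straight)
      fix j assume j: "j \<le> max_cost init_body"
      show "I2 (Suc k) (tick j (run w init_body (tick (1 + acost ?e2) s1)))"
        using I j k unfolding I2_def f
        by (simp add: D_def init_body_def push_def ib(1) ib1 r7 flat_pairs_nth vu m m2 cm)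
    qed (simp add: init_body_def push_def)
  qed
  show ?thesis
    unfolding setup_round_def
  proof (rule wp_Seq, rule wp_straight, simp, rule wp_Seq, rule wp_straight, simp, rule wp_Seq)
    fix j j' assume j: "j \<le> max_cost (Assign 4 (Const 0))" "j' \<le> max_cost (Assign 9 (Const 1))"
    show "wp w (While ?e1 ?b1) (tick j' (run w (Assign 9 (Const 1)) (tick j (run w (Assign 4 (Const 0)) s))))
       (\<lambda>s'. wp w (Assign 5 (Op Mul (Const 128) (Op Mul (Reg 4) (Op Div (Reg 2) (Reg 1) \<oplus> Const 1))) ;;
     Assign 6 (Op Mul (Reg 0) (Reg 5)) ;; Assign 7 (Const 0) ;; While ?e2 init_body) s' Q)"
    proof (rule wp_While_count[where I = I1 and k = 0 and N = J])
      show "I1 0 (tick j' (run w (Assign 9 (Const 1)) (tick j (run w (Assign 4 (Const 0)) s))))"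
        using j w by (auto simp: I1_def D_def)
    next
      fix s1 assume I: "I1 J s1"
      have "regs s1 2 = n" using I r by (simp add: I1_def D_def)
      then have a: "aval w s1 ?e1 = 0" using I doublings_ge[of n] n4 cm by (simp add: I1_def J_def)
      define s2 where "s2 = tick (1 + acost ?e1) s1"
      have s2: "D s s2" "outbox s2 = outbox s" "regs s2 4 = J" "steps s2 \<le> steps s + 16 + 20 * J"
        using I by (auto simp: I1_def D_def s2_def)
      have r2: "regs s2 0 = i" "regs s2 (Suc 0) = m" "regs s2 2 = n" using s2(1) r by (simp_all add: D_def)
      have ndm: "n div m mod 2 ^ w = n div m" "Suc (n div m) mod 2 ^ w = Suc (n div m)" using JS by simp_all
      have d: "J * (n div m + 1) = J + J * (n div m)" by simp
      have jm: "(J + J * (n div m)) mod 2 ^ w = J + J * (n div m)" using JS(3) unfolding d by simp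
      have d2: "128 * J + 128 * (J * (n div m)) = SZ" by (simp add: SZ_def)
      have sm: "(128 * J + 128 * (J * (n div m))) mod 2 ^ w = SZ" "i * SZ mod 2 ^ w = i * SZ"
        using M(1,4) unfolding d2 by simp_all
      have "wp w (Assign 5 (Op Mul (Const 128) (Op Mul (Reg 4) (Op Div (Reg 2) (Reg 1) \<oplus> Const 1))) ;;
     Assign 6 (Op Mul (Reg 0) (Reg 5)) ;; Assign 7 (Const 0) ;; While ?e2 init_body) s2 Q"
      proof (rule wp_Seq, rule wp_straight, simp, rule wp_Seq, rule wp_straight, simp, rule wp_Seq, rule wp_straight, simp)
        fix j1 j2 j3
        assume j: "j1 \<le> max_cost (Assign 5 (Op Mul (Const 128) (Op Mul (Reg 4) (Op Div (Reg 2) (Reg 1) \<oplus> Const 1))))"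
          "j2 \<le> max_cost (Assign 6 (Op Mul (Reg 0) (Reg 5)))" "j3 \<le> max_cost (Assign 7 (Const 0))"
        define s3 where "s3 = tick j3 (run w (Assign 7 (Const 0)) (tick j2 (run w (Assign 6 (Op Mul (Reg 0) (Reg 5)))
          (tick j1 (run w (Assign 5 (Op Mul (Const 128) (Op Mul (Reg 4) (Op Div (Reg 2) (Reg 1) \<oplus> Const 1)))) s2)))))"
        show "wp w (While ?e2 init_body) (tick j3 (run w (Assign 7 (Const 0)) (tick j2 (run w (Assign 6 (Op Mul (Reg 0) (Reg 5)))
          (tick j1 (run w (Assign 5 (Op Mul (Const 128) (Op Mul (Reg 4) (Op Div (Reg 2) (Reg 1) \<oplus> Const 1)))) s2)))))) Q"
          unfolding s3_def[symmetric]
        proof (rule wp_While_count[where I = I2 and k = 0 and N = "length vp"])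
          show "I2 0 s3"
            using s2 j by (simp add: s3_def I2_def D_def r2 ndm jm sm cm)
        next
          fix s' assume I: "I2 (length vp) s'"
          have "inbox s' = flat_pairs vp" "regs s' 7 = 2 * length vp"
            using I ib by (simp_all add: I2_def D_def)
          moreover have "Q (tick (1 + acost ?e2) s')"
            by (rule Q) (use I in \<open>simp_all add: I2_def D_def\<close>)
          ultimately show "aval w s' ?e2 = 0 \<and> Q (tick (1 + acost ?e2) s')" using len by simp
        qed (use step2 in auto)
      qed
      then show "aval w s1 ?e1 = 0 \<and> wp w (Assign 5 (Op Mul (Const 128) (Op Mul (Reg 4) (Op Div (Reg 2) (Reg 1) \<oplus> Const 1))) ;;
     Assign 6 (Op Mul (Reg 0) (Reg 5)) ;; Assign 7 (Const 0) ;; While ?e2 init_body) (tick (1 + acost ?e1) s1) Q"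
        using a by (simp only: s2_def simp_thms)
    qed (use step1 in auto)
  qed
qed

section \<open>The output round\<close>

definition same_store :: "machine \<Rightarrow> machine \<Rightarrow> bool" where
  "same_store s s' \<longleftrightarrow> mem s' = mem s \<and> inbox s' = inbox s \<and> outbox s' = outbox s \<and>
     halted s' = halted s \<and> top_addr s' = top_addr s"

lemma same_store_simps [simp]:
  "same_store s s" "same_store s (tick k s') = same_store s s'"
  "same_store (tick k s) s' = same_store s s'"
  by (simp_all add: same_store_def)

lemma same_store_trans: "same_store s s' \<Longrightarrow> same_store s' s'' \<Longrightarrow> same_store s s''"
  by (simp add: same_store_def)

text \<open>
  One step of a scan over slots: \<^term>\<open>cnt 0\<close>, \<^term>\<open>cnt 1\<close>, \<^term>\<open>cnt 2\<close> are the increments of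
  the counters in registers 10, 11, 12.
\<close>

definition scan_body ::
  "nat \<Rightarrow> (nat \<Rightarrow> nat) \<Rightarrow> com \<Rightarrow> (nat \<Rightarrow> nat \<Rightarrow> nat) \<Rightarrow> (nat \<Rightarrow> nat list) \<Rightarrow> nat \<Rightarrow> bool" where
  "scan_body w m body cnt out k \<longleftrightarrow> straight body \<and> max_cost body \<le> 60 \<and>
     (\<forall>i<3. cnt i k \<le> 2) \<and>
     (\<forall>s. mem s = m \<longrightarrow> regs s 8 = 32 * k \<longrightarrow> regs s 10 + 2 < 2 ^ w \<longrightarrow> regs s 11 + 2 < 2 ^ w \<longrightarrow>
        regs s 12 + 2 < 2 ^ w \<longrightarrow>
        same_store s (run w body s) \<and> outp (run w body s) = outp s @ out k \<and>
        regs (run w body s) = (regs s)(10 := regs s 10 + cnt 0 k, 11 := regs s 11 + cnt 1 k,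
          12 := regs s 12 + cnt 2 k))"

lemma wp_scan:
  assumes body: "\<And>k. j \<le> k \<Longrightarrow> k < e \<Longrightarrow> scan_body w (mem s) body cnt out k"
    and r: "regs s 7 = 32 * j" "regs s 9 = 32 * e" "j \<le> e" "32 * e + 256 < 2 ^ w"
      "regs s 10 + 2 * (e - j) + 2 < 2 ^ w" "regs s 11 + 2 * (e - j) + 2 < 2 ^ w"
      "regs s 12 + 2 * (e - j) + 2 < 2 ^ w"
    and Q: "\<And>s'. same_store s s' \<Longrightarrow> outp s' = outp s @ concat (map out [j..<e]) \<Longrightarrow>
      (\<And>r. r \<notin> {8, 10, 11, 12} \<Longrightarrow> regs s' r = regs s r) \<Longrightarrow>
      regs s' 10 = regs s 10 + sum_list (map (cnt 0) [j..<e]) \<Longrightarrow>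
      regs s' 11 = regs s 11 + sum_list (map (cnt 1) [j..<e]) \<Longrightarrow>
      regs s' 12 = regs s 12 + sum_list (map (cnt 2) [j..<e]) \<Longrightarrow>
      steps s' \<le> steps s + 10 + 80 * (e - j) \<Longrightarrow> Q s'"
  shows "wp w (scan body) s Q"
proof -
  have w: "32 * e + 256 < 2 ^ w" using r by simp
  note cm = const_mods[OF w]
  define I where "I = (\<lambda>d s'. same_store s s' \<and> outp s' = outp s @ concat (map out [j..<j + d]) \<and>
      (\<forall>r. r \<notin> {8, 10, 11, 12} \<longrightarrow> regs s' r = regs s r) \<and> regs s' 8 = 32 * (j + d) \<and>
      regs s' 10 = regs s 10 + sum_list (map (cnt 0) [j..<j + d]) \<and>
      regs s' 11 = regs s 11 + sum_list (map (cnt 1) [j..<j + d]) \<and>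
      regs s' 12 = regs s 12 + sum_list (map (cnt 2) [j..<j + d]) \<and>
      sum_list (map (cnt 0) [j..<j + d]) \<le> 2 * d \<and> sum_list (map (cnt 1) [j..<j + d]) \<le> 2 * d \<and>
      sum_list (map (cnt 2) [j..<j + d]) \<le> 2 * d \<and>
      steps s' \<le> steps s + 2 + 80 * d)"
  let ?e = "Op Less (Reg 8) (Reg 9)"
  let ?b = "body ;; Assign 8 (Reg 8 \<oplus> Const 32)"
  have step: "aval w s1 ?e \<noteq> 0 \<and> wp w ?b (tick (1 + acost ?e) s1) (I (Suc d))"
    if d: "d < e - j" and I: "I d s1" for d s1
  proof
    have r1: "regs s1 8 = 32 * (j + d)" "regs s1 9 = 32 * e" using I r by (simp_all add: I_def)
    then show "aval w s1 ?e \<noteq> 0" using d cm by simp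
    have b: "scan_body w (mem s) body cnt out (j + d)" using body d by simp
    have m: "mem s1 = mem s" using I by (simp add: I_def same_store_def)
    have lt: "regs s1 10 + 2 < 2 ^ w" "regs s1 11 + 2 < 2 ^ w" "regs s1 12 + 2 < 2 ^ w"
      using I d r by (auto simp: I_def)
    define s2 where "s2 = run w body s1"
    have s2: "same_store s1 s2" "outp s2 = outp s1 @ out (j + d)"
      "regs s2 = (regs s1)(10 := regs s1 10 + cnt 0 (j + d), 11 := regs s1 11 + cnt 1 (j + d),
          12 := regs s1 12 + cnt 2 (j + d))"
      using b m r1 lt unfolding scan_body_def s2_def by blast+
    have st: "steps s2 = steps s1" by (simp add: s2_def)
    have c: "cnt 0 (j + d) \<le> 2" "cnt 1 (j + d) \<le> 2" "cnt 2 (j + d) \<le> 2" "straight body" "max_cost body \<le> 60"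
      using b unfolding scan_body_def by auto
    have u: "[j..<j + Suc d] = [j..<j + d] @ [j + d]" by simp
    have a: "(32 * (j + d) + 32) mod 2 ^ w = 32 * (j + Suc d)" using d r by simp
    show "wp w ?b (tick (1 + acost ?e) s1) (I (Suc d))"
    proof (rule wp_straight)
      fix i assume i: "i \<le> max_cost ?b"
      have "same_store s s2" using I s2(1) by (auto simp: I_def intro: same_store_trans)
      then have ss: "same_store s (run w (Assign 8 (Reg 8 \<oplus> Const 32)) s2)" by (simp add: same_store_def)
      show "I (Suc d) (tick i (run w ?b (tick (1 + acost ?e) s1)))"
        using I i c ss unfolding I_def u
        by (simp add: s2_def[symmetric] s2 st cm, simp add: r1 a[simplified])
    qed (simp add: c)
  qed
  show ?thesis
    unfolding scan_def
  proof (rule wp_Seq, rule wp_straight)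
    fix i assume i: "i \<le> max_cost (Assign 8 (Reg 7))"
    show "wp w (While ?e ?b) (tick i (run w (Assign 8 (Reg 7)) s)) Q"
    proof (rule wp_While_count[where I = I and k = 0 and N = "e - j"])
      show "I 0 (tick i (run w (Assign 8 (Reg 7)) s))"
        using i r by (simp add: I_def same_store_def)
    next
      fix s' assume I: "I (e - j) s'"
      have "regs s' 8 = 32 * e" "regs s' 9 = 32 * e" using I r by (simp_all add: I_def)
      moreover have "Q (tick (1 + acost ?e) s')"
        by (rule Q) (use I r in \<open>simp_all add: I_def\<close>)
      ultimately show "aval w s' ?e = 0 \<and> Q (tick (1 + acost ?e) s')" by simp
    qed (use step in auto)
  qed simp
qed

definition slot_vert :: "(nat \<Rightarrow> nat) \<Rightarrow> nat \<Rightarrow> nat list" where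
  "slot_vert m k = (if m (32 * k + 8) \<noteq> 0 then [m (32 * k + 8) div 128] else [])"
definition slot_inner :: "(nat \<Rightarrow> nat) \<Rightarrow> nat \<Rightarrow> (nat \<times> nat) list" where
  "slot_inner m k = (if m (32 * k + 8) \<noteq> 0 \<and> m (32 * k + 12) = 0
     then [(m (32 * k + 8) div 128, m (32 * k + 10) div 128)] else [])"
definition slot_outer :: "(nat \<Rightarrow> nat) \<Rightarrow> nat \<Rightarrow> (nat \<times> nat) list" where
  "slot_outer m k =
     (if m (32 * k + 14) \<noteq> 0 then [(m (32 * k + 14) div 128, m (32 * k + 8) div 128)] else []) @
     (if m (32 * k + 16) \<noteq> 0 then [(m (32 * k + 16) div 128, m (32 * k + 8) div 128)] else [])"
text \<open>Cell 10 holds \<open>128 * par v + 1\<close>, so the division yields the parent, and 0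
  exactly for the root.\<close>

definition slot_up :: "(nat \<Rightarrow> nat) \<Rightarrow> nat \<Rightarrow> (nat \<times> nat) list" where
  "slot_up m k = (if m (32 * k + 10) div 128 \<noteq> 0
     then [(m (32 * k + 8) div 128, m (32 * k + 10) div 128)] else [])"

definition slots_component :: "(nat \<Rightarrow> nat) \<Rightarrow> nat \<Rightarrow> nat \<Rightarrow> component" where
  "slots_component m j e = \<lparr>verts = concat (map (slot_vert m) [j..<e]),
     inner = concat (map (slot_inner m) [j..<e]),
     outer = slot_up m j @ concat (map (slot_outer m) [j..<e])\<rparr>"

text \<open>The end of the memory acts as a mark, so a component never extends beyond its
  machine.\<close>

definition next_break :: "(nat \<Rightarrow> nat) \<Rightarrow> nat \<Rightarrow> nat \<Rightarrow> nat" where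
  "next_break m K j = (LEAST e. j < e \<and> (K \<le> e \<or> m (32 * e + 12) \<noteq> 0))"

lemma next_break:
  shows next_break_gt: "j < next_break m K j"
    and next_break_stop: "K \<le> next_break m K j \<or> m (32 * next_break m K j + 12) \<noteq> 0"
    and next_break_between: "j < e \<Longrightarrow> e < next_break m K j \<Longrightarrow> e < K \<and> m (32 * e + 12) = 0"
    and next_break_le: "j < K \<Longrightarrow> next_break m K j \<le> K"
proof -
  have *: "j < next_break m K j \<and> (K \<le> next_break m K j \<or> m (32 * next_break m K j + 12) \<noteq> 0)"
    unfolding next_break_def by (rule LeastI[of _ "max (Suc j) K"]) auto
  then show "j < next_break m K j" "K \<le> next_break m K j \<or> m (32 * next_break m K j + 12) \<noteq> 0"
    by simp_all
  show "j < e \<Longrightarrow> e < next_break m K j \<Longrightarrow> e < K \<and> m (32 * e + 12) = 0"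
    unfolding next_break_def by (drule not_less_Least) auto
  show "j < K \<Longrightarrow> next_break m K j \<le> K"
    unfolding next_break_def by (rule Least_le) auto
qed

text \<open>Slots in front of the first mark are passed over; in the final memory they hold no
  vertex, because every vertex has an ancestor in its interval that carries a mark.\<close>

function slots_components :: "(nat \<Rightarrow> nat) \<Rightarrow> nat \<Rightarrow> nat \<Rightarrow> component list" where
  "slots_components m K j = (if K \<le> j then [] else if m (32 * j + 12) \<noteq> 0
     then slots_component m j (next_break m K j) # slots_components m K (next_break m K j)
     else slots_components m K (Suc j))"
  by auto
termination
  by (relation "Wellfounded.measure (\<lambda>(m, K, j). K - j)") (auto intro: diff_less_mono2 next_break_gt)

declare slots_components.simps [simp del]

lemma length_concat_sum: "length (concat (map f xs)) = sum_list (map (\<lambda>x. length (f x)) xs)"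
  by (induction xs) simp_all

lemma encode_edges_concat:
  "encode_edges es = length es # flat_pairs es"
  by (simp add: encode_edges_def flat_pairs_def)

lemma flat_pairs_concat: "flat_pairs (concat (map f xs)) = concat (map (\<lambda>x. flat_pairs (f x)) xs)"
  by (induction xs) simp_all

definition slot_counts :: "(nat \<Rightarrow> nat) \<Rightarrow> nat \<Rightarrow> nat \<Rightarrow> nat" where
  "slot_counts m i k = (if i = 0 then length (slot_vert m k)
     else if i = 1 then length (slot_inner m k) else length (slot_outer m k))"

lemma scan_bodies:
  assumes w: "32 * k + 256 < 2 ^ w" and m: "\<And>f. f \<in> {8, 10, 14, 16} \<Longrightarrow> m (32 * k + f) < 2 ^ w"
  shows "scan_body w m count_body
      (slot_counts m) (\<lambda>k. []) k"
    and "scan_body w m verts_body (\<lambda>i k. 0) (slot_vert m) k"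
    and "scan_body w m inner_body (\<lambda>i k. 0) (\<lambda>k. flat_pairs (slot_inner m k)) k"
    and "scan_body w m outer_body (\<lambda>i k. 0) (\<lambda>k. flat_pairs (slot_outer m k)) k"
proof -
  have cm: "(32 * k + 8) mod 2 ^ w = 32 * k + 8" "(32 * k + 10) mod 2 ^ w = 32 * k + 10"
    "(32 * k + 12) mod 2 ^ w = 32 * k + 12" "(32 * k + 14) mod 2 ^ w = 32 * k + 14"
    "(32 * k + 16) mod 2 ^ w = 32 * k + 16"
    using w by simp_all
  have dm0: "x div 128 mod 2 ^ w = x div 128" if "x < 2 ^ w" for x :: nat
    using that by (metis div_le_dividend le_less_trans mod_less)
  have dm: "m (32 * k + 8) div 128 mod 2 ^ w = m (32 * k + 8) div 128"
    "m (32 * k + 10) div 128 mod 2 ^ w = m (32 * k + 10) div 128"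
    "m (32 * k + 14) div 128 mod 2 ^ w = m (32 * k + 14) div 128"
    "m (32 * k + 16) div 128 mod 2 ^ w = m (32 * k + 16) div 128"
    by (rule dm0, rule m, simp)+
  note sm = scan_body_def same_store_def slot_vert_def slot_inner_def slot_outer_def cm dm
    const_mods[OF w] scell_def incr_def emit_edge_def fun_eq_iff
  have suc: "Suc x mod 2 ^ w = Suc x" "Suc (Suc x) mod 2 ^ w = Suc (Suc x)" if "Suc (Suc x) < 2 ^ w" for x :: nat
    using that by simp_all
  show "scan_body w m verts_body (\<lambda>i k. 0) (slot_vert m) k"
    by (cases "m (32 * k + 8) = 0") (simp_all add: sm verts_body_def)
  show "scan_body w m inner_body (\<lambda>i k. 0) (\<lambda>k. flat_pairs (slot_inner m k)) k"
    by (cases "m (32 * k + 8) = 0"; cases "m (32 * k + 12) = 0") (simp_all add: sm inner_body_def)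
  show "scan_body w m outer_body (\<lambda>i k. 0) (\<lambda>k. flat_pairs (slot_outer m k)) k"
    by (cases "m (32 * k + 14) = 0"; cases "m (32 * k + 16) = 0") (simp_all add: sm outer_body_def)
  show "scan_body w m count_body
      (slot_counts m) (\<lambda>k. []) k"
    by (cases "m (32 * k + 8) = 0"; cases "m (32 * k + 12) = 0"; cases "m (32 * k + 14) = 0"; cases "m (32 * k + 16) = 0")
      (simp_all add: sm count_body_def suc slot_counts_def)
qed

lemma wp_emit_component:
  assumes r: "regs s 5 = 32 * K" "regs s 7 = 32 * j" "j < K" "32 * K + 256 < 2 ^ w"
    and m: "mem s = m" "\<And>k f. k < K \<Longrightarrow> f \<in> {8, 10, 14, 16} \<Longrightarrow> m (32 * k + f) < 2 ^ w"
    and e: "e = next_break m K j"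
    and Q: "\<And>s'. same_store s s' \<Longrightarrow> (\<And>r. r \<le> 6 \<Longrightarrow> regs s' r = regs s r) \<Longrightarrow> regs s' 7 = 32 * e \<Longrightarrow>
      outp s' = outp s @ encode_component (slots_component m j e) \<Longrightarrow>
      steps s' \<le> steps s + 1000 * (e - j) \<Longrightarrow> Q s'"
  shows "wp w emit_component s Q"
proof -
  note cm = const_mods[OF r(4)]
  have ej: "j < e" "e \<le> K" using next_break_gt next_break_le r e by simp_all
  have w: "32 * e + 256 < 2 ^ w" using ej r by simp
  have gc: "(32 * e + 12) mod 2 ^ w = 32 * e + 12" using w by simp
  have mj: "(32 * j + k) mod 2 ^ w = 32 * j + k" if "k \<le> 32" for k using ej w that by simp
  have mj8: "m (32 * j + 8) div 128 mod 2 ^ w = m (32 * j + 8) div 128"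
      "m (32 * j + 10) div 128 mod 2 ^ w = m (32 * j + 10) div 128"
    using m(2)[OF r(3), of 8] m(2)[OF r(3), of 10] by (simp_all add: le_less_trans[OF div_le_dividend])
  have bodies: "scan_body w m count_body
      (slot_counts m) (\<lambda>k. []) k"
    "scan_body w m verts_body (\<lambda>i k. 0) (slot_vert m) k"
    "scan_body w m inner_body (\<lambda>i k. 0) (\<lambda>k. flat_pairs (slot_inner m k)) k"
    "scan_body w m outer_body (\<lambda>i k. 0) (\<lambda>k. flat_pairs (slot_outer m k)) k" if "k < e" for k
    by (rule scan_bodies; use that ej r m in auto)+
  define vs ins os where "vs = concat (map (slot_vert m) [j..<e])"
    and "ins = concat (map (slot_inner m) [j..<e])" and "os = concat (map (slot_outer m) [j..<e])"
  have enc: "encode_component (slots_component m j e) =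
      length vs # vs @ (length ins # flat_pairs ins) @
      (length (slot_up m j) + length os) # flat_pairs (slot_up m j) @ flat_pairs os"
    by (simp add: encode_component_def slots_component_def encode_edges_concat vs_def ins_def os_def)
  have up: "length (slot_up m j) \<le> 1" by (simp add: slot_up_def)
  let ?e = "Op Mul (Op Less (Reg 9) (Reg 5)) (Op Equal (Load (Reg 9 \<oplus> Const 12)) (Const 0))"
  let ?ext = "guarded (Op Div (fld 10) (Const 128)) (incr 12)"
  let ?up = "guarded (Op Div (fld 10) (Const 128)) (emit_edge (fld 8) (fld 10))"
  define P where "P = (\<lambda>s'. same_store s s' \<and> (\<forall>r\<le>7. regs s' r = regs s r))"
  have Pm: "mem s' = m" "regs s' 7 = 32 * j" "regs s' 5 = 32 * K" if "P s'" for s'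
    using that r m by (simp_all add: P_def same_store_def)
  \<comment> \<open>The rest of the program after the end \<open>e\<close> has been found. Register
    12 already counts the upward edge, if there is one.\<close>
  have fin: "wp w (scan count_body ;;
     Emit (Reg 10) ;; scan verts_body ;;
     Emit (Reg 11) ;; scan inner_body ;;
     Emit (Reg 12) ;; ?up ;; scan outer_body ;; Assign 7 (Reg 9)) s1 Q"
    if s1: "P s1" "regs s1 9 = 32 * e" "regs s1 10 = 0" "regs s1 11 = 0"
      "regs s1 12 = length (slot_up m j)" "outp s1 = outp s" "steps s1 \<le> steps s + 60 + 20 * (e - j)" for s1
  proof (rule wp_Seq, rule wp_scan[where e = e and j = j])
    fix s2 assume s2: "same_store s1 s2" "outp s2 = outp s1 @ concat (map (\<lambda>k. []) [j..<e])"
      "\<And>r. r \<notin> {8, 10, 11, 12} \<Longrightarrow> regs s2 r = regs s1 r"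
      "regs s2 10 = regs s1 10 + sum_list (map (slot_counts m 0) [j..<e])"
      "regs s2 11 = regs s1 11 + sum_list (map (slot_counts m 1) [j..<e])"
      "regs s2 12 = regs s1 12 + sum_list (map (slot_counts m 2) [j..<e])"
      "steps s2 \<le> steps s1 + 10 + 80 * (e - j)"
    have P2: "P s2" using s1 s2(1,3) by (auto simp: P_def same_store_def)
    have c2: "regs s2 10 = length vs" "regs s2 11 = length ins" "regs s2 12 = length (slot_up m j) + length os"
      "regs s2 9 = 32 * e" "outp s2 = outp s"
      using s2 s1 by (simp_all add: slot_counts_def[abs_def] length_concat_sum vs_def ins_def os_def)
    \<comment> \<open>These bounds keep the counters far from the word size, which
      \<open>wp_scan\<close> demands of the later scans too.\<close>
    have lens: "length vs \<le> e - j" "length ins \<le> e - j" "length os \<le> 2 * (e - j)"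
    proof -
      have *: "sum_list (map f [j..<e]) \<le> c * (e - j)" if "\<And>k. f k \<le> c" for f :: "nat \<Rightarrow> nat" and c
        using sum_list_mono[of "[j..<e]" f "\<lambda>_. c"] that by (simp add: sum_list_triv mult.commute)
      show "length vs \<le> e - j" "length ins \<le> e - j" "length os \<le> 2 * (e - j)"
        unfolding vs_def ins_def os_def length_concat_sum
        by (rule *[of _ 1, simplified]; simp add: slot_vert_def slot_inner_def)+
          (rule *, simp add: slot_outer_def)
    qed
    \<comment> \<open>After the counting scan the three counters keep their values; \<open>Z\<close>
      records them together with the output \<open>o'\<close> and the time \<open>t\<close> spent so
      far.\<close>
    define Z where "Z = (\<lambda>s' o' t. P s' \<and> regs s' 9 = 32 * e \<and> regs s' 10 = length vs \<and> regs s' 11 = length ins \<and>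
      regs s' 12 = length (slot_up m j) + length os \<and> outp s' = outp s @ o' \<and> steps s' \<le> steps s + t)"
    have Z2: "Z s2 [] (70 + 100 * (e - j))" using P2 c2 s2(7) s1 by (simp add: Z_def)
    have Zscan: "wp w (scan body) s' R"
      if "Z s' o' t" "\<And>k. k < e \<Longrightarrow> scan_body w m body (\<lambda>i k. 0) out k"
        "\<And>s''. Z s'' (o' @ concat (map out [j..<e])) (t + 10 + 80 * (e - j)) \<Longrightarrow> R s''" for s' o' t body out R
    proof (rule wp_scan[where e = e and j = j])
      fix s'' assume a: "same_store s' s''" "outp s'' = outp s' @ concat (map out [j..<e])"
        "\<And>r. r \<notin> {8, 10, 11, 12} \<Longrightarrow> regs s'' r = regs s' r"
        "regs s'' 10 = regs s' 10 + sum_list (map ((\<lambda>i k. 0) (0::nat)) [j..<e])"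
        "regs s'' 11 = regs s' 11 + sum_list (map ((\<lambda>i k. 0) (1::nat)) [j..<e])"
        "regs s'' 12 = regs s' 12 + sum_list (map ((\<lambda>i k. 0) (2::nat)) [j..<e])"
        "steps s'' \<le> steps s' + 10 + 80 * (e - j)"
      show "R s''"
        by (rule that(3)) (use that(1) a in \<open>auto simp: Z_def P_def same_store_def\<close>)
    qed (use that(1,2) Pm ej w lens up in \<open>auto simp: Z_def\<close>)
    have Zemit: "wp w (Emit e') s' R"
      if "Z s' o' t" "aval w s' e' = x" "acost e' \<le> 4" "\<And>s''. Z s'' (o' @ [x]) (t + 5) \<Longrightarrow> R s''" for s' o' t e' x R
      by (rule wp_straight) (use that in \<open>auto intro!: that(4) simp: Z_def P_def same_store_def\<close>)
    show "wp w (Emit (Reg 10) ;; scan verts_body ;;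
     Emit (Reg 11) ;; scan inner_body ;;
     Emit (Reg 12) ;; ?up ;; scan outer_body ;; Assign 7 (Reg 9)) s2 Q"
    proof (rule wp_Seq, rule Zemit[OF Z2, of "Reg 10" "length vs"])
      fix s3 assume Z3: "Z s3 ([] @ [length vs]) (70 + 100 * (e - j) + 5)"
      show "wp w (scan verts_body ;; Emit (Reg 11) ;; scan inner_body ;;
     Emit (Reg 12) ;; ?up ;; scan outer_body ;; Assign 7 (Reg 9)) s3 Q"
      proof (rule wp_Seq, rule Zscan[OF Z3], erule bodies(2))
        fix s4 assume Z4: "Z s4 (([] @ [length vs]) @ concat (map (slot_vert m) [j..<e]))
             (70 + 100 * (e - j) + 5 + 10 + 80 * (e - j))"
        show "wp w (Emit (Reg 11) ;; scan inner_body ;;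
     Emit (Reg 12) ;; ?up ;; scan outer_body ;; Assign 7 (Reg 9)) s4 Q"
        proof (rule wp_Seq, rule Zemit[OF Z4, of "Reg 11" "length ins"])
          fix s5 assume Z5: "Z s5 ((([] @ [length vs]) @ concat (map (slot_vert m) [j..<e])) @ [length ins])
             (70 + 100 * (e - j) + 5 + 10 + 80 * (e - j) + 5)"
          show "wp w (scan inner_body ;; Emit (Reg 12) ;; ?up ;; scan outer_body ;; Assign 7 (Reg 9)) s5 Q"
          proof (rule wp_Seq, rule Zscan[OF Z5], erule bodies(3))
            fix s6 assume Z6: "Z s6 (((([] @ [length vs]) @ concat (map (slot_vert m) [j..<e])) @ [length ins])
                @ concat (map (\<lambda>k. flat_pairs (slot_inner m k)) [j..<e]))
               (70 + 100 * (e - j) + 5 + 10 + 80 * (e - j) + 5 + 10 + 80 * (e - j))"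
            show "wp w (Emit (Reg 12) ;; ?up ;; scan outer_body ;; Assign 7 (Reg 9)) s6 Q"
            proof (rule wp_Seq, rule Zemit[OF Z6, of "Reg 12" "length (slot_up m j) + length os"])
              fix s7
              define o7 where "o7 = ((((([] @ [length vs]) @ concat (map (slot_vert m) [j..<e])) @ [length ins])
                @ concat (map (\<lambda>k. flat_pairs (slot_inner m k)) [j..<e]))
                @ [length (slot_up m j) + length os])"
              assume "Z s7 ((((([] @ [length vs]) @ concat (map (slot_vert m) [j..<e])) @ [length ins])
                @ concat (map (\<lambda>k. flat_pairs (slot_inner m k)) [j..<e]))
                @ [length (slot_up m j) + length os])
               (70 + 100 * (e - j) + 5 + 10 + 80 * (e - j) + 5 + 10 + 80 * (e - j) + 5)"
              then have Z7: "Z s7 o7 (105 + 260 * (e - j))" by (auto simp: o7_def Z_def)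
              have Zup: "Z (tick i (run w ?up s7)) (o7 @ flat_pairs (slot_up m j)) (165 + 260 * (e - j))"
                if "i \<le> max_cost ?up" for i
              proof -
                have P7: "P s7" using Z7 by (simp add: Z_def)
                note p7 = Pm[OF P7]
                have a: "aval w s7 (fld 8) = m (32 * j + 8)" "aval w s7 (fld 10) = m (32 * j + 10)"
                  using mj[of 8] mj[of 10] by (simp_all add: fld_def cell_def cm p7)
                have b: "aval w s7 (Op Div (fld 8) (Const 128)) = m (32 * j + 8) div 128"
                  "aval w s7 (Op Div (fld 10) (Const 128)) = m (32 * j + 10) div 128"
                  using mj8 by (simp_all add: a cm)
                have c: "max_cost ?up \<le> 60" by (simp add: fld_def cell_def emit_edge_def)
                show ?thesis
                proof (cases "m (32 * j + 10) div 128 = 0")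
                  case True
                  then have "run w ?up s7 = s7" "slot_up m j = []" using b by (simp_all add: slot_up_def del: aval.simps)
                  moreover have "Z (tick i s7) o7 (165 + 260 * (e - j))"
                    using Z7 that c by (simp add: Z_def P_def)
                  ultimately show ?thesis by (simp only: flat_pairs_simps append_Nil2)
                next
                  case False
                  define s8 where "s8 = run w (emit_edge (fld 8) (fld 10)) s7"
                  have u: "run w ?up s7 = s8" "flat_pairs (slot_up m j) = [m (32 * j + 8) div 128, m (32 * j + 10) div 128]"
                    using False b by (simp_all add: s8_def slot_up_def del: aval.simps)
                  have av: "aval w (run w (Emit x) s7) y = aval w s7 y" for x y
                    by (induction y) (simp_all add: Let_def)
                  have s8: "regs s8 = regs s7" "same_store s7 s8" "steps s8 = steps s7"
                    "outp s8 = outp s7 @ flat_pairs (slot_up m j)"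
                    unfolding u(2) by (simp_all add: s8_def emit_edge_def same_store_def av b del: aval.simps)
                  have "same_store s s8" using P7 s8(2) by (auto simp: P_def intro: same_store_trans)
                  then have "Z (tick i s8) (o7 @ flat_pairs (slot_up m j)) (165 + 260 * (e - j))"
                    using Z7 that c s8 by (simp add: Z_def P_def)
                  then show ?thesis by (simp only: u(1))
                qed
              qed
              show "wp w (?up ;; scan outer_body ;; Assign 7 (Reg 9)) s7 Q"
              proof (rule wp_Seq, rule wp_straight)
                fix i assume i: "i \<le> max_cost ?up"
                show "wp w (scan outer_body ;; Assign 7 (Reg 9)) (tick i (run w ?up s7)) Q"
                proof (rule wp_Seq, rule Zscan[OF Zup[OF i]], erule bodies(4))
                  fix s8 assume Z8: "Z s8 ((o7 @ flat_pairs (slot_up m j)) @ concat (map (\<lambda>k. flat_pairs (slot_outer m k)) [j..<e]))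
                    (165 + 260 * (e - j) + 10 + 80 * (e - j))"
                  show "wp w (Assign 7 (Reg 9)) s8 Q"
                  proof (rule wp_straight)
                    fix i assume i: "i \<le> max_cost (Assign 7 (Reg 9))"
                    show "Q (tick i (run w (Assign 7 (Reg 9)) s8))"
                    proof (rule Q)
                      show "same_store s (tick i (run w (Assign 7 (Reg 9)) s8))"
                        using Z8 by (simp add: Z_def P_def same_store_def)
                      show "outp (tick i (run w (Assign 7 (Reg 9)) s8)) =
                          outp s @ encode_component (slots_component m j e)"
                        using Z8 unfolding enc by (simp add: Z_def o7_def vs_def ins_def os_def flat_pairs_concat)
                      show "steps (tick i (run w (Assign 7 (Reg 9)) s8)) \<le> steps s + 1000 * (e - j)"
                      proof -
                        have "steps s8 \<le> steps s + (165 + 260 * (e - j) + 10 + 80 * (e - j))"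
                          using Z8 by (simp add: Z_def)
                        moreover have "i \<le> 2" using i by simp
                        moreover have "1 \<le> e - j" using ej by simp
                        ultimately have "steps s8 + i \<le> steps s + 1000 * (e - j)" by linarith
                        then show ?thesis by simp
                      qed
                    qed (use Z8 in \<open>simp_all add: Z_def P_def\<close>)
                  qed simp
                qed
              qed (simp add: emit_edge_def)
            qed (use Z6 in \<open>simp_all add: Z_def\<close>)
          qed
        qed (use Z4 in \<open>simp_all add: Z_def\<close>)
      qed
    qed (use Z2 in \<open>simp_all add: Z_def\<close>)
  next
    fix k assume "j \<le> k" "k < e"
    then show "scan_body w (mem s1) count_body
      (slot_counts m) (\<lambda>k. []) k"
      using bodies(1) Pm(1)[OF s1(1)] by simp
  qed (use s1 Pm[OF s1(1)] ej w up in simp_all)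
  \<comment> \<open>Invariant of the search for the end: \<open>d\<close> slots after slot
    \<open>j\<close> have been found to carry no mark.\<close>
  define J where "J = (\<lambda>d s'. P s' \<and> outp s' = outp s \<and> regs s' 9 = 32 * (j + 1 + d) \<and>
     steps s' \<le> steps s + 20 + 20 * d)"
  have step: "aval w s1 ?e \<noteq> 0 \<and> wp w (Assign 9 (Reg 9 \<oplus> Const 32)) (tick (1 + acost ?e) s1) (J (Suc d))"
    if d: "d < e - Suc j" and I: "J d s1" for d s1
  proof
    have "j + 1 + d < e" using d by simp
    then have b: "j + 1 + d < K" "m (32 * (j + 1 + d) + 12) = 0"
      using next_break_between[of j "j + 1 + d" m K] unfolding e by simp_all
    have a: "(32 * (j + 1 + d) + 12) mod 2 ^ w = 32 * (j + 1 + d) + 12"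
      "(32 * (j + 1 + d) + 32) mod 2 ^ w = 32 * (j + 1 + Suc d)"
      using d w by simp_all
    have r1: "regs s1 9 = 32 * (j + 1 + d)" "regs s1 5 = 32 * K" "mem s1 = m" using I Pm by (simp_all add: J_def)
    have A: "aval w s1 (Op Less (Reg 9) (Reg 5)) = 1" using r1(1,2) b(1) cm by simp
    have "aval w s1 (Load (Reg 9 \<oplus> Const 12)) = 0"
      using r1(1,3) b(2) a(1) by (simp only: aval.simps binop_val.simps cm r1)
    then have B: "aval w s1 (Op Equal (Load (Reg 9 \<oplus> Const 12)) (Const 0)) = 1" using cm by simp
    show "aval w s1 ?e \<noteq> 0" using A B cm by (simp del: aval.simps add: aval.simps(6)[of _ _ Mul])
    have C: "aval w s1 (Reg 9 \<oplus> Const 32) = 32 * (j + 1 + Suc d)"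
      using r1(1) a(2) by (simp only: aval.simps binop_val.simps cm r1)
    show "wp w (Assign 9 (Reg 9 \<oplus> Const 32)) (tick (1 + acost ?e) s1) (J (Suc d))"
      by (rule wp_straight) (use I C in \<open>auto simp: J_def P_def same_store_def simp del: aval.simps\<close>)
  qed
  show ?thesis
    unfolding emit_component_def
  proof (rule wp_Seq, rule wp_straight, simp, rule wp_Seq)
    fix i assume i: "i \<le> max_cost (Assign 9 (cell 32))"
    show "wp w (While ?e (Assign 9 (Reg 9 \<oplus> Const 32))) (tick i (run w (Assign 9 (cell 32)) s))
     (\<lambda>s'. wp w (Assign 10 (Const 0) ;; Assign 11 (Const 0) ;; Assign 12 (Const 0) ;; ?ext ;;
       scan count_body ;; Emit (Reg 10) ;; scan verts_body ;; Emit (Reg 11) ;; scan inner_body ;;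
     Emit (Reg 12) ;; ?up ;; scan outer_body ;; Assign 7 (Reg 9)) s' Q)"
    proof (rule wp_While_count[where I = J and k = 0 and N = "e - Suc j"])
      show "J 0 (tick i (run w (Assign 9 (cell 32)) s))"
        using i r(2) mj[of 32] by (simp add: J_def P_def same_store_def cell_def cm)
    next
      fix s1 assume I: "J (e - Suc j) s1"
      have r1: "regs s1 9 = 32 * e" "regs s1 5 = 32 * K" "mem s1 = m" using I Pm ej by (simp_all add: J_def)
      \<comment> \<open>The search stops at the end of the memory or at a mark. Multiplication does
        not shortcut, so past the end the cell is still loaded, but then the first factor is
        0.\<close>
      have A: "aval w s1 ?e = 0"
        using next_break_stop[of K m j] gc unfolding e[symmetric]
        by (auto simp: r1 cm)
      define s2 where "s2 = tick (1 + acost ?e) s1"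
      have s2: "P s2" "outp s2 = outp s" "regs s2 9 = 32 * e" "steps s2 \<le> steps s + 29 + 20 * (e - j)"
        using I r1 ej by (auto simp: s2_def J_def P_def)
      have "wp w (Assign 10 (Const 0) ;; Assign 11 (Const 0) ;; Assign 12 (Const 0) ;; ?ext ;;
       scan count_body ;; Emit (Reg 10) ;; scan verts_body ;; Emit (Reg 11) ;; scan inner_body ;;
     Emit (Reg 12) ;; ?up ;; scan outer_body ;; Assign 7 (Reg 9)) s2 Q"
      proof (rule wp_Seq, rule wp_straight, simp, rule wp_Seq, rule wp_straight, simp,
          rule wp_Seq, rule wp_straight, simp, rule wp_Seq, rule wp_straight)
        fix i1 i2 i3 i4
        assume i: "i1 \<le> max_cost (Assign 10 (Const 0))" "i2 \<le> max_cost (Assign 11 (Const 0))"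
          "i3 \<le> max_cost (Assign 12 (Const 0))" "i4 \<le> max_cost ?ext"
        note p = Pm[OF s2(1)]
        define s3 where "s3 = tick i4 (run w ?ext (tick i3 (run w (Assign 12 (Const 0))
           (tick i2 (run w (Assign 11 (Const 0)) (tick i1 (run w (Assign 10 (Const 0)) s2)))))))"
        have "P s3 \<and> regs s3 9 = 32 * e \<and> regs s3 10 = 0 \<and> regs s3 11 = 0 \<and>
            regs s3 12 = length (slot_up m j) \<and> outp s3 = outp s \<and> steps s3 \<le> steps s + 60 + 20 * (e - j)"
          using s2 i mj mj8(2)
          by (cases "m (32 * j + 10) div 128 = 0")
            (simp_all add: s3_def P_def same_store_def slot_up_def incr_def fld_def cell_def cm p)
        then show "wp w (scan count_body ;; Emit (Reg 10) ;; scan verts_body ;; Emit (Reg 11) ;; scan inner_body ;;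
           Emit (Reg 12) ;; ?up ;; scan outer_body ;; Assign 7 (Reg 9))
           (tick i4 (run w ?ext (tick i3 (run w (Assign 12 (Const 0))
           (tick i2 (run w (Assign 11 (Const 0)) (tick i1 (run w (Assign 10 (Const 0)) s2)))))))) Q"
          unfolding s3_def[symmetric] by (intro fin) auto
      qed (simp add: incr_def)
      with A show "aval w s1 ?e = 0 \<and> wp w (Assign 10 (Const 0) ;; Assign 11 (Const 0) ;; Assign 12 (Const 0) ;; ?ext ;;
       scan count_body ;; Emit (Reg 10) ;; scan verts_body ;; Emit (Reg 11) ;; scan inner_body ;;
     Emit (Reg 12) ;; ?up ;; scan outer_body ;; Assign 7 (Reg 9)) (tick (1 + acost ?e) s1) Q"
        by (simp only: s2_def simp_thms)
    qed (use step in auto)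
  qed
qed

lemma wp_output_round:
  assumes r: "regs s 5 = 32 * K" "32 * K + 256 < 2 ^ w"
    and m: "mem s = m" "\<And>k f. k < K \<Longrightarrow> f \<in> {8, 10, 14, 16} \<Longrightarrow> m (32 * k + f) < 2 ^ w"
    and Q: "\<And>s'. same_store s s' \<Longrightarrow> (\<And>r. r \<le> 6 \<Longrightarrow> regs s' r = regs s r) \<Longrightarrow>
      outp s' = outp s @ concat (map encode_component (slots_components m K 0)) \<Longrightarrow>
      steps s' \<le> steps s + 10 + 1100 * K \<Longrightarrow> Q s'"
  shows "wp w output_round s Q"
proof -
  note cm = const_mods[OF r(2)]
  \<comment> \<open>What has been printed together with what is still due from slot \<open>j\<close>
    on stays constant.\<close>
  define I where "I = (\<lambda>s'. \<exists>j\<le>K. same_store s s' \<and> (\<forall>r\<le>6. regs s' r = regs s r) \<and> regs s' 7 = 32 * j \<and>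
    outp s' @ concat (map encode_component (slots_components m K j)) =
      outp s @ concat (map encode_component (slots_components m K 0)) \<and>
    steps s' \<le> steps s + 2 + 1100 * j)"
  let ?e = "Op Less (Reg 7) (Reg 5)"
  let ?b = "Cond (fld 12) emit_component (Assign 7 (cell 32))"
  show ?thesis
    unfolding output_round_def
  proof (rule wp_Seq, rule wp_straight)
    fix i assume i: "i \<le> max_cost (Assign 7 (Const 0))"
    show "wp w (While ?e ?b) (tick i (run w (Assign 7 (Const 0)) s)) Q"
    proof (rule wp_While_measure[where I = I and \<mu> = "\<lambda>s'. 32 * K - regs s' 7"])
      show "I (tick i (run w (Assign 7 (Const 0)) s))"
        using i by (auto simp: I_def same_store_def)
    next
      fix s1 assume "I s1" and e: "aval w s1 ?e \<noteq> 0"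
      then obtain j where j: "j \<le> K" "same_store s s1" "\<forall>r\<le>6. regs s1 r = regs s r" "regs s1 7 = 32 * j"
        "outp s1 @ concat (map encode_component (slots_components m K j)) =
          outp s @ concat (map encode_component (slots_components m K 0))"
        "steps s1 \<le> steps s + 2 + 1100 * j" unfolding I_def by blast
      have r5: "regs s1 5 = 32 * K" "mem s1 = m" using j r m by (simp_all add: same_store_def)
      have jK: "j < K" using e j r5 by (cases "j = K") auto
      have mj: "(32 * j + k) mod 2 ^ w = 32 * j + k" if "k \<le> 32" for k using jK r that by simp
      define s2 where "s2 = tick (1 + acost ?e) s1"
      have s2: "same_store s s2" "\<forall>r\<le>6. regs s2 r = regs s r" "regs s2 7 = 32 * j" "mem s2 = m"
        "regs s2 5 = 32 * K" "outp s2 = outp s1" "steps s2 \<le> steps s + 6 + 1100 * j"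
        using j r5 by (simp_all add: s2_def)
      have f: "aval w s2 (fld 12) = m (32 * j + 12)" using s2 mj by (simp add: fld_def cell_def cm)
      show "wp w ?b (tick (1 + acost ?e) s1) (\<lambda>s'. I s' \<and> 32 * K - regs s' 7 < 32 * K - regs s1 7)"
        unfolding s2_def[symmetric]
      proof (rule wp_Cond)
        assume nz: "aval w s2 (fld 12) \<noteq> 0"
        define e where "e = next_break m K j"
        have e: "j < e" "e \<le> K" using next_break_gt next_break_le jK by (simp_all add: e_def)
        show "wp w emit_component (tick (1 + acost (fld 12)) s2)
            (\<lambda>s'. I s' \<and> 32 * K - regs s' 7 < 32 * K - regs s1 7)"
        proof (rule wp_emit_component[where K = K and j = j and m = m and e = e])
          fix s' assume s': "same_store (tick (1 + acost (fld 12)) s2) s'"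
            "\<And>r. r \<le> 6 \<Longrightarrow> regs s' r = regs (tick (1 + acost (fld 12)) s2) r" "regs s' 7 = 32 * e"
            "outp s' = outp (tick (1 + acost (fld 12)) s2) @ encode_component (slots_component m j e)"
            "steps s' \<le> steps (tick (1 + acost (fld 12)) s2) + 1000 * (e - j)"
          have "slots_components m K j = slots_component m j e # slots_components m K e"
            using nz f jK by (subst slots_components.simps) (simp add: e_def)
          then have "I s'"
            unfolding I_def using e s' s2 j(5)
            by (intro exI[of _ e]) (auto simp: fld_def cell_def intro: same_store_trans)
          then show "I s' \<and> 32 * K - regs s' 7 < 32 * K - regs s1 7" using s'(3) j(4) e by auto
        qed (use s2 r m jK in \<open>simp_all add: e_def\<close>)
      next
        assume z: "aval w s2 (fld 12) = 0"
        have c: "slots_components m K j = slots_components m K (Suc j)"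
          using z f jK by (subst slots_components.simps) simp
        show "wp w (Assign 7 (cell 32)) (tick (1 + acost (fld 12)) s2)
            (\<lambda>s'. I s' \<and> 32 * K - regs s' 7 < 32 * K - regs s1 7)"
        proof (rule wp_straight)
          fix i assume i: "i \<le> max_cost (Assign 7 (cell 32))"
          define s' where "s' = tick i (run w (Assign 7 (cell 32)) (tick (1 + acost (fld 12)) s2))"
          have s': "regs s' 7 = 32 * Suc j" "same_store s s'" "\<forall>r\<le>6. regs s' r = regs s r" "outp s' = outp s1"
            "steps s' \<le> steps s + 2 + 1100 * Suc j"
            using s2 i mj[of 32] by (simp_all add: s'_def cell_def fld_def cm same_store_def)
          have "I s'"
            unfolding I_def using s' jK j(5) c by (intro exI[of _ "Suc j"]) simp
          then show "I (tick i (run w (Assign 7 (cell 32)) (tick (1 + acost (fld 12)) s2))) \<and>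
             32 * K - regs (tick i (run w (Assign 7 (cell 32)) (tick (1 + acost (fld 12)) s2))) 7 < 32 * K - regs s1 7"
            unfolding s'_def[symmetric] using s'(1) j(4) jK by auto
        qed simp
      qed
    next
      fix s1 assume "I s1" and e: "aval w s1 ?e = 0"
      then obtain j where j: "j \<le> K" "same_store s s1" "\<forall>r\<le>6. regs s1 r = regs s r" "regs s1 7 = 32 * j"
        "outp s1 @ concat (map encode_component (slots_components m K j)) =
          outp s @ concat (map encode_component (slots_components m K 0))"
        "steps s1 \<le> steps s + 2 + 1100 * j" unfolding I_def by blast
      have "regs s1 5 = 32 * K" using j r by simp
      then have "j = K" using e j cm by (cases "j < K") auto
      then have "slots_components m K j = []" by (subst slots_components.simps) simp
      then show "Q (tick (1 + acost ?e) s1)"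
        by (intro Q) (use j in auto)
    qed
  qed simp
qed

text \<open>Per slot: one word for the vertex, two for an inner edge, four for two outer edges. The
  5 extra words are the three lengths and the upward edge.\<close>

lemma length_encode_component:
  "length (encode_component (slots_component m j e)) \<le> 5 + 7 * (e - j)"
proof -
  have *: "length (concat (map f [j..<e])) \<le> c * (e - j)" if "\<And>k. length (f k) \<le> c"
    for f :: "nat \<Rightarrow> 'a list" and c
    using sum_list_mono[of "[j..<e]" "\<lambda>k. length (f k)" "\<lambda>_. c"] that
    by (simp add: length_concat_sum sum_list_triv mult.commute)
  have "length (concat (map (slot_vert m) [j..<e])) \<le> 1 * (e - j)"
    by (rule *) (simp add: slot_vert_def)
  moreover have "length (concat (map (slot_inner m) [j..<e])) \<le> 1 * (e - j)"
    by (rule *) (simp add: slot_inner_def)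
  moreover have "length (concat (map (slot_outer m) [j..<e])) \<le> 2 * (e - j)"
    by (rule *) (simp add: slot_outer_def)
  moreover have "length (slot_up m j) \<le> 1" by (simp add: slot_up_def)
  ultimately show ?thesis
    by (simp add: encode_component_def slots_component_def encode_edges_concat)
qed

text \<open>Every component has at least one slot, so its 5 extra words can be charged to a
  slot.\<close>

lemma length_encode_slots_components:
  "length (concat (map encode_component (slots_components m K j))) \<le> 12 * (K - j)"
proof (induction m K j rule: slots_components.induct)
  case (1 m K j)
  consider "K \<le> j" | "j < K" "m (32 * j + 12) \<noteq> 0" | "j < K" "m (32 * j + 12) = 0" by linarith
  then show ?case
  proof cases
    case 1
    then show ?thesis by (subst slots_components.simps) simp
  next
    case 2
    let ?e = "next_break m K j"
    have "j < ?e" "?e \<le> K" using next_break_gt next_break_le 2 by simp_all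
    moreover have "length (concat (map encode_component (slots_components m K ?e))) \<le> 12 * (K - ?e)"
      using 1 2 by simp
    ultimately show ?thesis
      using length_encode_component[of m j ?e] 2 by (subst slots_components.simps) simp
  next
    case 3
    then have "length (concat (map encode_component (slots_components m K (Suc j)))) \<le> 12 * (K - Suc j)"
      using 1 by simp
    then show ?thesis using 3 by (subst slots_components.simps) simp
  qed
qed

section \<open>The program in a single round\<close>

lemma jump_local:
  assumes "\<And>g. g < 32 \<Longrightarrow> r g = r' g"
  shows "f < 32 \<Longrightarrow> jump_new M r f = jump_new M r' f" "jump_msgs M n r y = jump_msgs M n r' y"
  using assms by (simp_all add: jump_new_def jump_msgs_def)

lemma link_local:
  assumes "\<And>g. g < 128 \<Longrightarrow> r g = r' g"
  shows "f < 128 \<Longrightarrow> link_new M r f = link_new M r' f" "link_msgs M n r y = link_msgs M n r' y"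
  using assms by (simp_all add: link_new_def link_msgs_def swaps_def)

lemma scatter_local:
  assumes "\<And>g. g < 128 \<Longrightarrow> r g = r' g"
  shows "scatter_msgs M SZ n r y = scatter_msgs M SZ n r' y"
  using assms by (simp add: scatter_msgs_def Let_def)

lemma length_jump_msgs: "length (jump_msgs M n r y) \<le> 8"
  by (simp add: jump_msgs_def)

lemma length_link_msgs: "length (link_msgs M n r y) \<le> 8"
  by (simp add: link_msgs_def child_msgs_def)

lemma length_scatter_msgs: "length (scatter_msgs M SZ n r y) \<le> 8"
  by (simp add: scatter_msgs_def scatter_child_msgs_def Let_def)

text \<open>The link, jump and scatter rounds differ only in the record size and in the two
  functions, so one correctness lemma covers all of them.\<close>

inductive round_kind ::
  "nat \<Rightarrow> nat \<Rightarrow> nat \<Rightarrow> nat \<Rightarrow> nat \<Rightarrow> ((nat \<Rightarrow> nat) \<Rightarrow> nat \<Rightarrow> nat) \<Rightarrow>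
   (nat \<Rightarrow> (nat \<Rightarrow> nat) \<Rightarrow> nat \<Rightarrow> (nat \<times> nat) list) \<Rightarrow> bool" for M SZ J t where
  link: "t = 1 \<or> t = J + 3 \<Longrightarrow> round_kind M SZ J t 128 (link_new M) (link_msgs M)"
| jump: "1 \<le> t \<Longrightarrow> t \<noteq> 1 \<Longrightarrow> t \<noteq> J + 3 \<Longrightarrow> t < 2 * J + 5 \<Longrightarrow>
    round_kind M SZ J t 32 (jump_new M) (jump_msgs M)"
| scatter: "t = 2 * J + 5 \<Longrightarrow> round_kind M SZ J t 128 (\<lambda>r. r) (scatter_msgs M SZ)"

lemma round_kind_length: "round_kind M SZ J t c new msgs \<Longrightarrow> length (msgs n r y) \<le> 8"
  by (erule round_kind.cases)
    (simp_all add: length_jump_msgs length_link_msgs length_scatter_msgs)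

lemma wp_prog_records:
  assumes kind: "round_kind (2 ^ w) SZ J t c new msgs"
    and r: "regs s 3 = t" "regs s 4 = J" "regs s 5 = SZ" "SZ = c * K"
    and qs: "inbox s = flat_pairs qs" "\<And>a x. (a, x) \<in> set qs \<Longrightarrow> a + 1 < SZ"
    and M: "SZ + 256 < 2 ^ w" "2 * length qs + 2 < 2 ^ w" "2 * J + 10 < 2 ^ w"
    and m1: "m1 = fold push_cell qs (mem s)"
    and Q: "\<And>s'. (\<And>r. r \<le> 6 \<Longrightarrow> r \<noteq> 3 \<Longrightarrow> regs s' r = regs s r) \<Longrightarrow> regs s' 3 = Suc t \<Longrightarrow>
      inbox s' = inbox s \<Longrightarrow> halted s' = halted s \<Longrightarrow> outp s' = outp s \<Longrightarrow>
      mem s' = (\<lambda>a. if a < SZ then new (\<lambda>f. m1 (a - a mod c + f)) (a mod c) else m1 a) \<Longrightarrow>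
      outbox s' = outbox s @ encq SZ (concat (map (\<lambda>k. msgs (regs s 2) (\<lambda>f. m1 (c * k + f))
        ((regs s 6 + c * k) mod 2 ^ w)) [0..<K])) \<Longrightarrow>
      top_addr s' \<le> max (top_addr s) SZ \<Longrightarrow>
      steps s' \<le> steps s + 100 + 30 * length qs + 10 * SZ \<Longrightarrow> Q s'"
  shows "wp w prog s Q"
proof -
  note cm = const_mods[OF M(1)]
  define body where "body = (if t = 1 \<or> t = J + 3 then link_body else if t < 2 * J + 5 then jump_body else scatter_body)"
  have tJ: "1 \<le> t" "t \<le> 2 * J + 5" "0 < c" "c \<le> 128"
    using kind by (cases rule: round_kind.cases, auto)+
  have c: "c = (if t = 1 \<or> t = J + 3 \<or> t = 2 * J + 5 then 128 else 32)"
    using kind by (cases rule: round_kind.cases) auto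
  \<comment> \<open>Ten steps per cell are to cover a record with its loop overhead. The jump
    records of 32 cells are the critical case: \<open>310 + 10 = 10 * 32\<close>.\<close>
  have costs: "max_cost link_body \<le> 310" "max_cost jump_body \<le> 310" "max_cost scatter_body \<le> 310"
    by (simp_all add: link_body_def link_child_def jump_body_def scatter_body_def scatter_child_def
        push_def cell_def fld_def)
  have body: "record_body w SZ c body new msgs" "max_cost body + 10 \<le> 10 * c"
    using kind costs
    by (cases rule: round_kind.cases; simp add: body_def record_body_link[OF M(1)]
        record_body_jump[OF M(1)] record_body_scatter[OF M(1)])+
  have new: "new r f = new r' f" if "f < c" "\<And>g. g < c \<Longrightarrow> r g = r' g" for r r' f
    using kind
  proof (cases rule: round_kind.cases)
    case link
    then show ?thesis using link_local(1)[of r r' f] that by simp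
  next
    case jump
    then show ?thesis using jump_local(1)[of r r' f] that by simp
  next
    case scatter
    then show ?thesis using that by simp
  qed
  have msgs: "msgs n r y = msgs n r' y" if "\<And>g. g < c \<Longrightarrow> r g = r' g" for r r' n y
    using kind
  proof (cases rule: round_kind.cases)
    case link
    then show ?thesis using link_local(2)[of r r'] that by simp
  next
    case jump
    then show ?thesis using jump_local(2)[of r r'] that by simp
  next
    case scatter
    then show ?thesis using scatter_local[of r r'] that by simp
  qed
  have cost: "K * (max_cost body + 10) \<le> 10 * SZ"
    using mult_le_mono2[OF body(2), of K] r(4) by (simp add: mult.commute mult.left_commute)
  have Mt: "t mod 2 ^ w = t" "Suc t mod 2 ^ w = Suc t" "(2 * J) mod 2 ^ w = 2 * J" "(J + 3) mod 2 ^ w = J + 3"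
    "(2 * J + 5) mod 2 ^ w = 2 * J + 5" "(J + J) mod 2 ^ w = 2 * J"
    using M tJ by simp_all
  let ?e1 = "Op Less (Reg 3) (Reg 4 \<oplus> Reg 4 \<oplus> Const 5)"
  let ?e2 = "Op Equal (Reg 3) (Const 1) \<oplus> Op Equal (Reg 3) (Reg 4 \<oplus> Const 3)"
  let ?e3 = "Op Equal (Reg 3) (Reg 4 \<oplus> Reg 4 \<oplus> Const 5)"
  let ?dispatch = "Cond ?e1 (Cond ?e2 (for_records 128 link_body) (for_records 32 jump_body))
          (Cond ?e3 (for_records 128 scatter_body) (output_round ;; Halt))"
  have disp: "wp w ?dispatch s1 R"
    if s1: "frame s s1" "\<And>k. k \<le> 60 \<Longrightarrow> wp w (for_records c body) (tick k s1) R" for s1 R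
  proof -
    have "regs s1 3 = t" "regs s1 4 = J" using s1 r by (simp_all add: frame_def)
    then have e: "aval w s1 ?e1 = (if t < 2 * J + 5 then 1 else 0)"
      "aval w s1 ?e2 = 0 \<longleftrightarrow> \<not> (t = 1 \<or> t = J + 3)"
      "aval w s1 ?e3 = (if t = 2 * J + 5 then 1 else 0)"
      using cm Mt by auto
    have k: "1 + acost ?e1 + (1 + acost ?e2) \<le> 60" "1 + acost ?e1 + (1 + acost ?e3) \<le> 60" by simp_all
    consider "t = 1 \<or> t = J + 3" | "t < 2 * J + 5" "\<not> (t = 1 \<or> t = J + 3)" | "t = 2 * J + 5" "\<not> (t = 1 \<or> t = J + 3)"
      using tJ by linarith
    then show ?thesis
    proof cases
      case 1
      then have "t < 2 * J + 5" "for_records 128 link_body = for_records c body" by (auto simp: c body_def)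
      then show ?thesis
        by (intro wp_Cond) (use 1 e s1(2)[OF k(1)] in \<open>simp_all del: aval.simps acost.simps\<close>)
    next
      case 2
      then have "for_records 32 jump_body = for_records c body" by (auto simp: c body_def)
      then show ?thesis
        by (intro wp_Cond) (use 2 e s1(2)[OF k(1)] in \<open>simp_all del: aval.simps acost.simps\<close>)
    next
      case 3
      then have "for_records 128 scatter_body = for_records c body" "\<not> t < 2 * J + 5" by (auto simp: c body_def)
      then show ?thesis
        by (intro wp_Cond) (use 3 e s1(2)[OF k(2)] in \<open>simp_all del: aval.simps acost.simps\<close>)
    qed
  qed
  have t0: "aval w s (Reg 3) \<noteq> 0" using r tJ by simp
  show ?thesis
    unfolding prog_def
  proof (rule wp_Seq, rule wp_Cond)
    show "wp w (receive ;; ?dispatch) (tick (1 + acost (Reg 3)) s)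
        (\<lambda>s'. wp w (Assign 3 (Reg 3 \<oplus> Const 1)) s' Q)"
    proof (rule wp_Seq, rule wp_receive[where qs = qs and SZ = SZ])
      fix s1 :: machine assume s1: "frame (tick (1 + acost (Reg 3)) s) s1" "outp s1 = outp (tick (1 + acost (Reg 3)) s)"
        "outbox s1 = outbox (tick (1 + acost (Reg 3)) s)"
        "mem s1 = fold push_cell qs (mem (tick (1 + acost (Reg 3)) s))"
        "top_addr s1 \<le> max (top_addr (tick (1 + acost (Reg 3)) s)) SZ"
        "steps s1 \<le> steps (tick (1 + acost (Reg 3)) s) + 10 + 30 * length qs"
      show "wp w ?dispatch s1 (\<lambda>s'. wp w (Assign 3 (Reg 3 \<oplus> Const 1)) s' Q)"
      proof (rule disp)
        show "frame s s1" using s1 by simp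
        fix k :: nat assume k: "k \<le> 60"
        show "wp w (for_records c body) (tick k s1) (\<lambda>s'. wp w (Assign 3 (Reg 3 \<oplus> Const 1)) s' Q)"
        proof (rule wp_for_records[OF body(1) r(4) tJ(3) _ _ new msgs])
          show "SZ + c < 2 ^ w" using M(1) tJ by linarith
          show "regs (tick k s1) 5 = SZ" using s1 r by (simp add: frame_def)
          fix s2 :: machine assume s2: "frame (tick k s1) s2" "outp s2 = outp (tick k s1)"
            "mem s2 = (\<lambda>a. if a < SZ then new (\<lambda>f. mem (tick k s1) (a - a mod c + f)) (a mod c) else mem (tick k s1) a)"
            "outbox s2 = outbox (tick k s1) @ encq SZ (concat (map (\<lambda>ka. msgs (regs (tick k s1) 2)
               (\<lambda>f. mem (tick k s1) (c * ka + f)) ((regs (tick k s1) 6 + c * ka) mod 2 ^ w)) [0..<K]))"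
            "top_addr s2 \<le> max (top_addr (tick k s1)) SZ"
            "steps s2 \<le> steps (tick k s1) + 10 + K * (max_cost body + 10)"
          show "wp w (Assign 3 (Reg 3 \<oplus> Const 1)) s2 Q"
          proof (rule wp_straight)
            fix j assume j: "j \<le> max_cost (Assign 3 (Reg 3 \<oplus> Const 1))"
            have r2: "regs s2 2 = regs s 2" "regs s2 3 = t" "regs s1 6 = regs s 6" "regs s1 2 = regs s 2"
              using s2(1) s1(1) r by (simp_all add: frame_def)
            have ms: "mem s1 = m1" using s1(4) m1 by simp
            show "Q (tick j (run w (Assign 3 (Reg 3 \<oplus> Const 1)) s2))"
            proof (rule Q)
              show "outbox (tick j (run w (Assign 3 (Reg 3 \<oplus> Const 1)) s2)) = outbox s @
                 encq SZ (concat (map (\<lambda>k. msgs (regs s 2) (\<lambda>f. m1 (c * k + f)) ((regs s 6 + c * k) mod 2 ^ w)) [0..<K]))"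
                using s1(3) s2(4) r2 ms by simp
              show "mem (tick j (run w (Assign 3 (Reg 3 \<oplus> Const 1)) s2)) =
                 (\<lambda>a. if a < SZ then new (\<lambda>f. m1 (a - a mod c + f)) (a mod c) else m1 a)"
                using s2(3) by (simp only: tick_simps run_fields ms)
              show "regs (tick j (run w (Assign 3 (Reg 3 \<oplus> Const 1)) s2)) 3 = Suc t"
                using r2 cm Mt by simp
              show "steps (tick j (run w (Assign 3 (Reg 3 \<oplus> Const 1)) s2)) \<le> steps s + 100 + 30 * length qs + 10 * SZ"
                using s2(6) s1(6) k j cost by simp
              show "top_addr (tick j (run w (Assign 3 (Reg 3 \<oplus> Const 1)) s2)) \<le> max (top_addr s) SZ"
                using s2(5) s1(5) by simp
            qed (use s1 s2 in \<open>simp_all add: frame_def\<close>)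
          qed simp
        qed
      qed
    qed (use qs M in simp_all)
  qed (use t0 in simp)
qed

lemma wp_prog_setup:
  fixes n m i w :: nat and s :: machine
  defines "J \<equiv> doublings n"
  defines "SZ \<equiv> 128 * (J * (n div m + 1))"
  assumes r: "regs s 0 = i" "regs s 1 = m" "regs s 2 = n" "regs s 3 = 0" "0 < n" "0 < m"
    and ib: "inbox s = flat_pairs vp" "\<And>v u. (v, u) \<in> set vp \<Longrightarrow> v \<le> n \<and> u \<le> n"
    and M: "SZ + 256 < 2 ^ w" "2 * length vp + 2 < 2 ^ w" "128 * n + 256 < 2 ^ w" "i * SZ < 2 ^ w"
    and Q: "\<And>s'. (\<And>k. k < 3 \<Longrightarrow> regs s' k = regs s k) \<Longrightarrow> regs s' 3 = 1 \<Longrightarrow> regs s' 4 = J \<Longrightarrow>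
      regs s' 5 = SZ \<Longrightarrow> regs s' 6 = i * SZ \<Longrightarrow> inbox s' = inbox s \<Longrightarrow> halted s' = halted s \<Longrightarrow>
      outp s' = outp s \<Longrightarrow> mem s' = mem s \<Longrightarrow> top_addr s' = top_addr s \<Longrightarrow>
      outbox s' = outbox s @ encq SZ (concat (map init_msgs vp)) \<Longrightarrow>
      steps s' \<le> steps s + 150 + 20 * J + 100 * length vp \<Longrightarrow> Q s'"
  shows "wp w prog s Q"
  unfolding prog_def
proof (rule wp_Seq, rule wp_Cond)
  show "wp w setup_round (tick (1 + acost (Reg 3)) s) (\<lambda>s'. wp w (Assign 3 (Reg 3 \<oplus> Const 1)) s' Q)"
  proof (rule wp_setup_round[where n = n and m = m and i = i and vp = vp])
    fix s1 :: machine assume s1: "\<And>k. k \<le> 3 \<Longrightarrow> regs s1 k = regs (tick (1 + acost (Reg 3)) s) k"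
      "regs s1 4 = doublings n" "regs s1 5 = 128 * (doublings n * (n div m + 1))"
      "regs s1 6 = i * (128 * (doublings n * (n div m + 1)))" "inbox s1 = inbox (tick (1 + acost (Reg 3)) s)"
      "halted s1 = halted (tick (1 + acost (Reg 3)) s)" "outp s1 = outp (tick (1 + acost (Reg 3)) s)"
      "mem s1 = mem (tick (1 + acost (Reg 3)) s)" "top_addr s1 = top_addr (tick (1 + acost (Reg 3)) s)"
      "outbox s1 = outbox (tick (1 + acost (Reg 3)) s) @
         encq (128 * (doublings n * (n div m + 1))) (concat (map init_msgs vp))"
      "steps s1 \<le> steps (tick (1 + acost (Reg 3)) s) + 100 + 20 * doublings n + 100 * length vp"
    show "wp w (Assign 3 (Reg 3 \<oplus> Const 1)) s1 Q"
    proof (rule wp_straight)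
      fix j assume j: "j \<le> max_cost (Assign 3 (Reg 3 \<oplus> Const 1))"
      have "regs s1 3 = 0" using s1(1)[of 3] r by simp
      then have "regs (tick j (run w (Assign 3 (Reg 3 \<oplus> Const 1)) s1)) 3 = 1"
        using const_mods[OF M(1)] by simp
      then show "Q (tick j (run w (Assign 3 (Reg 3 \<oplus> Const 1)) s1))"
        by (intro Q) (use s1 j in \<open>simp_all add: J_def SZ_def\<close>)
    qed simp
  qed (use r ib M in \<open>simp_all add: J_def SZ_def\<close>)
qed (use r in simp)

lemma wp_prog_output:
  assumes r: "regs s 3 = 2 * J + 6" "regs s 4 = J" "regs s 5 = 32 * K"
    and qs: "inbox s = flat_pairs qs" "\<And>a x. (a, x) \<in> set qs \<Longrightarrow> a + 1 < 32 * K"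
    and M: "32 * K + 256 < 2 ^ w" "2 * length qs + 2 < 2 ^ w" "2 * J + 10 < 2 ^ w"
    and m1: "m1 = fold push_cell qs (mem s)"
      "\<And>k f. k < K \<Longrightarrow> f \<in> {8, 10, 14, 16} \<Longrightarrow> m1 (32 * k + f) < 2 ^ w"
    and Q: "\<And>s'. inbox s' = inbox s \<Longrightarrow> halted s' \<Longrightarrow> outbox s' = outbox s \<Longrightarrow>
      outp s' = outp s @ concat (map encode_component (slots_components m1 K 0)) \<Longrightarrow>
      top_addr s' \<le> max (top_addr s) (32 * K) \<Longrightarrow>
      steps s' \<le> steps s + 200 + 30 * length qs + 1100 * K \<Longrightarrow> Q s'"
  shows "wp w prog s Q"
proof -
  note cm = const_mods[OF M(1)]
  have Mt: "(2 * J + 5) mod 2 ^ w = 2 * J + 5" "(J + J) mod 2 ^ w = 2 * J"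
    using M by simp_all
  let ?e1 = "Op Less (Reg 3) (Reg 4 \<oplus> Reg 4 \<oplus> Const 5)"
  let ?e3 = "Op Equal (Reg 3) (Reg 4 \<oplus> Reg 4 \<oplus> Const 5)"
  show ?thesis
    unfolding prog_def
  proof (rule wp_Seq, rule wp_Cond, rule wp_Seq, rule wp_receive[where qs = qs and SZ = "32 * K"])
    fix s1 :: machine assume s1: "frame (tick (1 + acost (Reg 3)) s) s1" "outp s1 = outp (tick (1 + acost (Reg 3)) s)"
        "outbox s1 = outbox (tick (1 + acost (Reg 3)) s)"
        "mem s1 = fold push_cell qs (mem (tick (1 + acost (Reg 3)) s))"
        "top_addr s1 \<le> max (top_addr (tick (1 + acost (Reg 3)) s)) (32 * K)"
        "steps s1 \<le> steps (tick (1 + acost (Reg 3)) s) + 10 + 30 * length qs"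
    have "regs s1 3 = 2 * J + 6" "regs s1 4 = J" using s1 r by (simp_all add: frame_def)
    then have e: "aval w s1 ?e1 = 0" "aval w s1 ?e3 = 0" using cm Mt by auto
    define s2 where "s2 = tick (1 + acost ?e3) (tick (1 + acost ?e1) s1)"
    have s2: "mem s2 = m1" "regs s2 5 = 32 * K" "outp s2 = outp s" "outbox s2 = outbox s"
      "inbox s2 = inbox s" "top_addr s2 \<le> max (top_addr s) (32 * K)"
      "steps s2 \<le> steps s + 50 + 30 * length qs"
      using s1 r m1 by (simp_all add: s2_def frame_def)
    have out: "wp w (output_round ;; Halt) s2 (\<lambda>s'. wp w (Assign 3 (Reg 3 \<oplus> Const 1)) s' Q)"
    proof (rule wp_Seq, rule wp_output_round[where K = K and m = m1])
      fix s3 :: machine assume s3: "same_store s2 s3"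
        "outp s3 = outp s2 @ concat (map encode_component (slots_components m1 K 0))"
        "steps s3 \<le> steps s2 + 10 + 1100 * K"
      show "wp w Halt s3 (\<lambda>s'. wp w (Assign 3 (Reg 3 \<oplus> Const 1)) s' Q)"
      proof (rule wp_straight, simp, rule wp_straight, simp)
        fix i j assume "i \<le> max_cost Halt" "j \<le> max_cost (Assign 3 (Reg 3 \<oplus> Const 1))"
        then show "Q (tick j (run w (Assign 3 (Reg 3 \<oplus> Const 1)) (tick i (run w Halt s3))))"
          by (intro Q) (use s2 s3 in \<open>simp_all add: same_store_def\<close>)
      qed
    qed (use s2 m1 M in simp_all)
    show "wp w (Cond ?e1
          (Cond (Op Equal (Reg 3) (Const 1) \<oplus> Op Equal (Reg 3) (Reg 4 \<oplus> Const 3))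
             (for_records 128 link_body) (for_records 32 jump_body))
          (Cond ?e3 (for_records 128 scatter_body) (output_round ;; Halt))) s1
        (\<lambda>s'. wp w (Assign 3 (Reg 3 \<oplus> Const 1)) s' Q)"
      by (intro wp_Cond) (use e out in \<open>simp_all add: s2_def del: aval.simps acost.simps tick_tick\<close>)
  qed (use qs M r in simp_all)
qed

section \<open>Shared memory\<close>

definition local_q :: "nat \<Rightarrow> nat \<Rightarrow> (nat \<times> nat) list \<Rightarrow> (nat \<times> nat) list" where
  "local_q SZ i Q = map (\<lambda>(g, x). (g mod SZ, x)) (filter (\<lambda>(g, x). g div SZ = i) Q)"

lemma local_q_simps [simp]:
  "local_q SZ i [] = []"
  "local_q SZ i ((g, x) # Q) = (if g div SZ = i then [(g mod SZ, x)] else []) @ local_q SZ i Q"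
  "local_q SZ i (Q @ Q') = local_q SZ i Q @ local_q SZ i Q'"
  by (simp_all add: local_q_def)

text \<open>A write changes \<open>g\<close> and \<open>g + 1\<close>, and the first hypothesis
  keeps both on one machine. Writes for other machines therefore leave the local cells alone, and
  the local ones happen in the same order as in the global list.\<close>

lemma fold_push_local:
  assumes "\<And>g x. (g, x) \<in> set Q \<Longrightarrow> g mod SZ + 1 < SZ" "\<And>a. a < SZ \<Longrightarrow> m a = G (i * SZ + a)" "a < SZ"
  shows "fold push_cell (local_q SZ i Q) m a = fold push_cell Q G (i * SZ + a)"
  using assms
proof (induction Q arbitrary: m G)
  case (Cons q Q)
  obtain g x where q: "q = (g, x)" by force
  have g: "g mod SZ + 1 < SZ" using Cons.prems(1)[of g x] q by simp
  have ge: "g = g div SZ * SZ + g mod SZ" by simp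
  have P: "h mod SZ + 1 < SZ" if "(h, y) \<in> set Q" for h y
    using Cons.prems(1)[of h y] that by simp
  show ?case
  proof (cases "g div SZ = i")
    case True
    then have gi: "g = i * SZ + g mod SZ" using ge by simp
    have H: "push_cell (g mod SZ, x) m b = push_cell (g, x) G (i * SZ + b)" if "b < SZ" for b
      using that g gi Cons.prems(2) by (auto simp: fun_upd_def)
    have "fold push_cell (local_q SZ i Q) (push_cell (g mod SZ, x) m) a =
        fold push_cell Q (push_cell (g, x) G) (i * SZ + a)"
      by (rule Cons.IH, erule P, erule H, rule Cons.prems(3))
    then show ?thesis using True q by (simp del: push_cell.simps)
  next
    case False
    have H: "m b = push_cell (g, x) G (i * SZ + b)" if b: "b < SZ" for b
    proof -
      have "g \<noteq> i * SZ + b" using False b by auto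
      moreover have "g + 1 \<noteq> i * SZ + b"
      proof
        assume "g + 1 = i * SZ + b"
        then have "(g + 1) div SZ = i" using b by simp
        moreover have "(g + 1) div SZ = g div SZ"
        proof -
          have "(g + 1) div SZ = (g div SZ * SZ + (g mod SZ + 1)) div SZ" by simp
          also have "\<dots> = g div SZ" using g by (simp only: div_mult_self3) simp
          finally show ?thesis .
        qed
        ultimately show False using False by simp
      qed
      ultimately show ?thesis using Cons.prems(2)[OF b] by simp
    qed
    have "fold push_cell (local_q SZ i Q) m a = fold push_cell Q (push_cell (g, x) G) (i * SZ + a)"
      by (rule Cons.IH, erule P, erule H, rule Cons.prems(3))
    then show ?thesis using False q by (simp del: push_cell.simps)
  qed
qed simp

lemma filter_encq:
  "map snd (filter (\<lambda>msg. fst msg = j) (encq SZ qs)) = flat_pairs (local_q SZ j qs)"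
  by (induction qs) auto

text \<open>Both words of a write have the same destination, so filtering keeps the pairs intact.
  The order is by sender and then by time of sending.\<close>

lemma inbox_deliver:
  assumes "length cfg = m" "\<And>i. i < m \<Longrightarrow> outbox (cfg ! i) = encq SZ (qs i)" "j < m"
  shows "deliver cfg ! j = (cfg ! j)\<lparr>inbox := flat_pairs (local_q SZ j (concat (map qs [0..<m])))\<rparr>"
proof -
  have "concat (map (\<lambda>s. map snd (filter (\<lambda>msg. fst msg = j) (outbox s))) cfg) =
      concat (map (\<lambda>i. flat_pairs (local_q SZ j (qs i))) [0..<m])"
  proof -
    have "map (\<lambda>s. map snd (filter (\<lambda>msg. fst msg = j) (outbox s))) cfg =
       map (\<lambda>i. map snd (filter (\<lambda>msg. fst msg = j) (outbox (cfg ! i)))) [0..<m]"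
      using assms(1) by (intro nth_equalityI) auto
    also have "\<dots> = map (\<lambda>i. flat_pairs (local_q SZ j (qs i))) [0..<m]"
      using assms(2) by (auto simp: filter_encq)
    finally show ?thesis by simp
  qed
  also have "\<dots> = flat_pairs (local_q SZ j (concat (map qs [0..<m])))"
  proof -
    have "concat (map (\<lambda>i. flat_pairs (local_q SZ j (qs i))) xs) =
       flat_pairs (local_q SZ j (concat (map qs xs)))" for xs
      by (induction xs) simp_all
    then show ?thesis .
  qed
  finally show ?thesis using assms(1,3) by (simp add: deliver_def)
qed

section \<open>One synchronous round on the shared memory\<close>

definition gnew :: "nat \<Rightarrow> ((nat \<Rightarrow> nat) \<Rightarrow> nat \<Rightarrow> nat) \<Rightarrow> (nat \<Rightarrow> nat) \<Rightarrow> nat \<Rightarrow> nat" where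
  "gnew c new G g = new (\<lambda>f. G (g - g mod c + f)) (g mod c)"

definition gmsgs :: "nat \<Rightarrow> (nat \<Rightarrow> (nat \<Rightarrow> nat) \<Rightarrow> nat \<Rightarrow> (nat \<times> nat) list) \<Rightarrow> nat \<Rightarrow> (nat \<Rightarrow> nat) \<Rightarrow>
    nat \<Rightarrow> (nat \<times> nat) list" where
  "gmsgs c msgs n G X = concat (map (\<lambda>k. msgs n (\<lambda>f. G (c * k + f)) (c * k)) [0..<X])"

lemma concat_map_blocks:
  "concat (map (\<lambda>i. concat (map (\<lambda>k. h (i * K + k)) [0..<K])) [0..<m]) = concat (map h [0..<m * K])"
proof (induction m)
  case (Suc m)
  have "[0..<Suc m * K] = [0..<m * K] @ map (\<lambda>k. m * K + k) [0..<K]"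
  proof -
    have "[0..<m * K + K] = [0..<m * K] @ [m * K..<m * K + K]" by (rule upt_add_eq_append) simp
    moreover have "[m * K..<m * K + K] = map (\<lambda>k. m * K + k) [0..<K]" by (intro nth_equalityI) auto
    ultimately show ?thesis by (simp add: add.commute)
  qed
  then show ?case using Suc by (simp add: o_def)
qed simp

text \<open>
  The machines jointly represent a shared memory \<^term>\<open>G\<close>, of which machine \<^term>\<open>i\<close> holds the cells
  \<open>i * SZ, \<dots>, i * SZ + SZ - 1\<close>; \<^term>\<open>Q\<close> lists the writes in transit.
\<close>

definition sim :: "nat \<Rightarrow> nat \<Rightarrow> nat \<Rightarrow> nat \<Rightarrow> nat \<Rightarrow> (nat \<Rightarrow> nat) \<Rightarrow> (nat \<times> nat) list \<Rightarrow> machine list \<Rightarrow> bool" where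
  "sim n m J SZ t G Q cfg \<longleftrightarrow> length cfg = m \<and>
     (\<forall>i<m. regs (cfg ! i) 2 = n \<and> regs (cfg ! i) 3 = t \<and> regs (cfg ! i) 4 = J \<and>
        regs (cfg ! i) 5 = SZ \<and> regs (cfg ! i) 6 = i * SZ \<and>
        (\<forall>a<SZ. mem (cfg ! i) a = G (i * SZ + a)) \<and>
        inbox (cfg ! i) = flat_pairs (local_q SZ i Q) \<and> top_addr (cfg ! i) \<le> SZ \<and>
        outp (cfg ! i) = [] \<and> \<not> halted (cfg ! i))"

text \<open>Machine boundaries are even, so the cell after an even address, which takes the old
  content, belongs to the same machine.\<close>

definition fits :: "nat \<Rightarrow> nat \<Rightarrow> (nat \<times> nat) list \<Rightarrow> bool" where
  "fits m SZ Q \<longleftrightarrow> (\<forall>(g, x)\<in>set Q. even g) \<and> (\<forall>i<m. length (local_q SZ i Q) \<le> 2 * SZ)"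

definition resources :: "nat \<Rightarrow> machine list \<Rightarrow> bool" where
  "resources X cfg \<longleftrightarrow> (\<forall>s\<in>set cfg. space s \<le> X \<and> length (outbox s) \<le> X \<and> length (inbox s) \<le> X \<and> steps s \<le> X)"

lemma even_mod_less:
  assumes "even SZ" "0 < SZ" "even (g :: nat)"
  shows "g mod SZ + 1 < SZ"
proof -
  have "even (g mod SZ)" using assms by (simp add: dvd_mod)
  then have "g mod SZ + 1 \<noteq> SZ" using assms by (metis even_plus_one_iff)
  moreover have "g mod SZ < SZ" using assms by simp
  ultimately show ?thesis by linarith
qed

lemma local_q_addr:
  assumes "fits m SZ Q" "even SZ" "0 < SZ" "(a, x) \<in> set (local_q SZ i Q)"
  shows "a + 1 < SZ"
  using assms even_mod_less unfolding local_q_def fits_def by auto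

lemma sequence_local_rounds:
  assumes "length cfg = m" "\<And>i. i < m \<Longrightarrow> \<not> halted (cfg ! i)"
    "\<And>i. i < m \<Longrightarrow> wp w P ((cfg ! i)\<lparr>outbox := [], steps := 0\<rparr>) (Q i)"
  shows "\<exists>cfg'. sequence_spmf (map (local_round w P) cfg) = return_spmf cfg' \<and>
    length cfg' = m \<and> (\<forall>i<m. Q i (cfg' ! i))"
  by (rule sequence_spmf_returns) (use assms wp_local_round in auto)

text \<open>After this lemma machines are no longer needed for the record rounds: the writes in
  transit take effect, all records change at once by \<open>gnew\<close>, and \<open>gmsgs\<close>
  are the new writes in transit. The product \<open>m * SZ\<close> bounds all global addresses, so
  none of them wraps around.\<close>

lemma sim_round:
  assumes S: "sim n m J SZ t G Q cfg"
    and kind: "round_kind (2 ^ w) SZ J t c new msgs" and K: "SZ = c * K" "0 < K" "even SZ" "0 < m"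
    and Q: "fits m SZ Q"
    and M: "m * SZ + 4 * SZ + 256 < 2 ^ w" "2 * J + 10 < 2 ^ w"
  defines "G1 \<equiv> fold push_cell Q G"
  shows "\<exists>cfg'. sequence_spmf (map (local_round w prog) cfg) = return_spmf cfg' \<and>
    resources (1000 * SZ) cfg' \<and> \<not> all_halted cfg' \<and>
    sim n m J SZ (Suc t) (gnew c new G1) (gmsgs c msgs n G1 (m * K)) (deliver cfg')"
proof -
  have c: "32 \<le> c" using kind by (cases rule: round_kind.cases) auto
  have SZ: "0 < SZ" using c K by simp
  define h where "h = (\<lambda>k. msgs n (\<lambda>f. G1 (c * k + f)) (c * k))"
  define post where "post = (\<lambda>i (s' :: machine). regs s' 2 = n \<and> regs s' 3 = Suc t \<and> regs s' 4 = J \<and> regs s' 5 = SZ \<and>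
      regs s' 6 = i * SZ \<and> (\<forall>a<SZ. mem s' a = gnew c new G1 (i * SZ + a)) \<and>
      inbox s' = flat_pairs (local_q SZ i Q) \<and> top_addr s' \<le> SZ \<and> outp s' = [] \<and> \<not> halted s' \<and>
      outbox s' = encq SZ (concat (map (\<lambda>k. h (i * K + k)) [0..<K])) \<and> steps s' \<le> 100 + 70 * SZ)"
  have wp: "wp w prog ((cfg ! i)\<lparr>outbox := [], steps := 0\<rparr>) (post i)" if i: "i < m" for i
  proof (rule wp_prog_records[OF kind])
    note Si = S[unfolded sim_def, THEN conjunct2, rule_format, OF i]
    have len: "length (local_q SZ i Q) \<le> 2 * SZ" using Q i by (simp add: fits_def)
    let ?s = "(cfg ! i)\<lparr>outbox := [], steps := 0\<rparr>"
    define m1 where "m1 = fold push_cell (local_q SZ i Q) (mem ?s)"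
    have m1: "m1 a = G1 (i * SZ + a)" if "a < SZ" for a
      unfolding m1_def G1_def
      by (rule fold_push_local) (use Q K SZ even_mod_less Si that in \<open>auto simp: fits_def\<close>)
    show "m1 = fold push_cell (local_q SZ i Q) (mem ?s)" by (simp add: m1_def)
    show "a + 1 < SZ" if "(a, x) \<in> set (local_q SZ i Q)" for a x
      using local_q_addr[OF Q K(3) SZ that] .
    show "SZ + 256 < 2 ^ w" "2 * length (local_q SZ i Q) + 2 < 2 ^ w" "2 * J + 10 < 2 ^ w"
      using M len by linarith+
    fix s' :: machine
    assume a: "\<And>r. r \<le> 6 \<Longrightarrow> r \<noteq> 3 \<Longrightarrow> regs s' r = regs ?s r" "regs s' 3 = Suc t" "inbox s' = inbox ?s"
      "halted s' = halted ?s" "outp s' = outp ?s"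
      "mem s' = (\<lambda>a. if a < SZ then new (\<lambda>f. m1 (a - a mod c + f)) (a mod c) else m1 a)"
      "outbox s' = outbox ?s @ encq SZ (concat (map (\<lambda>k. msgs (regs ?s 2) (\<lambda>f. m1 (c * k + f))
         ((regs ?s 6 + c * k) mod 2 ^ w)) [0..<K]))"
      "top_addr s' \<le> max (top_addr ?s) SZ" "steps s' \<le> steps ?s + 100 + 30 * length (local_q SZ i Q) + 10 * SZ"
    have loc_new: "new r f = new r' f" if "f < c" "\<And>g. g < c \<Longrightarrow> r g = r' g" for r r' f
      using kind that by (cases rule: round_kind.cases) (auto intro: jump_local link_local)
    have loc_msgs: "msgs n r y = msgs n r' y" if "\<And>g. g < c \<Longrightarrow> r g = r' g" for r r' y
      using kind that by (cases rule: round_kind.cases) (auto intro: jump_local link_local scatter_local)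
    have "mem s' b = gnew c new G1 (i * SZ + b)" if b: "b < SZ" for b
    proof -
      \<comment> \<open>\<open>c\<close> divides \<open>SZ\<close>, so no record straddles two
        machines and local and global record boundaries agree.\<close>
      have d: "(i * SZ + b) mod c = b mod c" using K by (simp add: mult.left_commute)
      define x where "x = b - b mod c"
      have e: "i * SZ + b - b mod c = i * SZ + x"
        using mod_less_eq_dividend[of b c] by (simp add: x_def)
      have x: "x + f < SZ" if "f < c" for f
      proof -
        have "b div c < K" using b K by (simp add: less_mult_imp_div_less mult.commute)
        then have "Suc (b div c) * c \<le> K * c" by (intro mult_le_mono1) simp
        moreover have "x = b div c * c" unfolding x_def by (simp add: minus_mod_eq_div_mult)
        ultimately show ?thesis using that K by (simp add: mult.commute)
      qed
      have "new (\<lambda>f. m1 (x + f)) (b mod c) = new (\<lambda>f. G1 (i * SZ + x + f)) (b mod c)"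
        using c x by (intro loc_new) (auto simp: m1 add.assoc)
      then show ?thesis using a(6) b by (simp only: gnew_def d e x_def[symmetric] if_True)
    qed
    moreover have "outbox s' = encq SZ (concat (map (\<lambda>k. h (i * K + k)) [0..<K]))"
    proof -
      have "msgs (regs ?s 2) (\<lambda>f. m1 (c * k + f)) ((regs ?s 6 + c * k) mod 2 ^ w) = h (i * K + k)" if k: "k < K" for k
      proof -
        have "Suc k * c \<le> K * c" using k by (intro mult_le_mono1) simp
        then have ck: "c * k + c \<le> SZ" using K by (simp add: mult.commute)
        have "Suc i * SZ \<le> m * SZ" using i by (intro mult_le_mono1) simp
        then have "i * SZ + c * k < 2 ^ w" using ck M by simp
        moreover have "i * SZ + c * k = c * (i * K + k)" using K by (simp add: algebra_simps)
        ultimately have y: "(regs ?s 6 + c * k) mod 2 ^ w = c * (i * K + k)" using Si by simp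
        have "m1 (c * k + f) = G1 (c * (i * K + k) + f)" if "f < c" for f
          using m1[of "c * k + f"] that ck K by (simp add: algebra_simps)
        then have "msgs n (\<lambda>f. m1 (c * k + f)) (c * (i * K + k)) = msgs n (\<lambda>f. G1 (c * (i * K + k) + f)) (c * (i * K + k))"
          by (rule loc_msgs)
        then show ?thesis unfolding h_def y using Si by simp
      qed
      then have E: "map (\<lambda>k. msgs (regs ?s 2) (\<lambda>f. m1 (c * k + f)) ((regs ?s 6 + c * k) mod 2 ^ w)) [0..<K] =
         map (\<lambda>k. h (i * K + k)) [0..<K]" by simp
      show ?thesis using a(7) unfolding E by simp
    qed
    ultimately show "post i s'"
      using a Si len by (simp add: post_def)
  qed (use S that K in \<open>simp_all add: sim_def\<close>)
  obtain cfg' where cfg': "sequence_spmf (map (local_round w prog) cfg) = return_spmf cfg'"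
      "length cfg' = m" "\<And>i. i < m \<Longrightarrow> post i (cfg' ! i)"
    using sequence_local_rounds[of cfg m w prog post] S wp by (auto simp: sim_def)
  have del: "deliver cfg' ! j = (cfg' ! j)\<lparr>inbox := flat_pairs (local_q SZ j (gmsgs c msgs n G1 (m * K)))\<rparr>"
    if "j < m" for j
    using inbox_deliver[of cfg' m SZ "\<lambda>i. concat (map (\<lambda>k. h (i * K + k)) [0..<K])" j] that cfg'
    by (simp add: post_def concat_map_blocks) (simp add: gmsgs_def h_def)
  have "sim n m J SZ (Suc t) (gnew c new G1) (gmsgs c msgs n G1 (m * K)) (deliver cfg')"
    unfolding sim_def using cfg' del by (simp add: post_def deliver_def)
  moreover have "resources (1000 * SZ) cfg'"
    unfolding resources_def
  proof
    fix s assume "s \<in> set cfg'"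
    then obtain i where i: "i < m" "s = cfg' ! i" using cfg'(2) by (metis in_set_conv_nth)
    have p: "post i s" using cfg' i by simp
    have "length (concat (map (\<lambda>k. h (i * K + k)) [0..<K])) \<le> 8 * K"
      using sum_list_mono[of "[0..<K]" "\<lambda>k. length (h (i * K + k))" "\<lambda>_. 8"] round_kind_length[OF kind]
      by (simp add: length_concat_sum sum_list_triv h_def mult.commute)
    moreover have "8 * K \<le> SZ" using mult_le_mono1[OF c, of K] K by simp
    moreover have "length (local_q SZ i Q) \<le> 2 * SZ" using Q i by (simp add: fits_def)
    ultimately show "space s \<le> 1000 * SZ \<and> length (outbox s) \<le> 1000 * SZ \<and> length (inbox s) \<le> 1000 * SZ \<and> steps s \<le> 1000 * SZ"
      using p SZ by (simp add: post_def space_def)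
  qed
  moreover have "\<not> all_halted cfg'"
  proof -
    have "cfg' ! 0 \<in> set cfg'" "\<not> halted (cfg' ! 0)"
      using cfg'(2) cfg'(3)[of 0] K(4) by (auto simp: post_def)
    then show ?thesis by (auto simp: all_halted_def)
  qed
  ultimately show ?thesis using cfg'(1) by blast
qed

lemma sim_setup:
  fixes n m w :: nat and vss :: "nat list list"
  defines "J \<equiv> doublings n"
  defines "SZ \<equiv> 128 * (J * (n div m + 1))"
  assumes n: "0 < n" "0 < m" and vss: "length vss = m" "set (concat vss) = {1..n}"
    "\<And>v. v \<in> {1..n} \<Longrightarrow> par v \<le> n" "\<And>vs. vs \<in> set vss \<Longrightarrow> length vs \<le> X"
    and M: "m * SZ + SZ + 256 < 2 ^ w" "2 * X + 2 < 2 ^ w" "128 * n + 256 < 2 ^ w"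
  shows "\<exists>cfg'. sequence_spmf (map (local_round w prog) (initial_config n m par vss)) = return_spmf cfg' \<and>
    resources (1000 * (SZ + X)) cfg' \<and> \<not> all_halted cfg' \<and>
    sim n m J SZ 1 (\<lambda>_. 0) (concat (map (\<lambda>v. init_msgs (v, par v)) (concat vss))) (deliver cfg')"
proof -
  have J1: "0 < J" using doublings_ge[of n] n by (cases "doublings n") (auto simp: J_def)
  have JS: "J \<le> SZ" "0 < SZ" using J1 by (simp_all add: SZ_def)
  define qs where "qs = (\<lambda>i. concat (map (\<lambda>v. init_msgs (v, par v)) (vss ! i)))"
  define vp where "vp = (\<lambda>i. map (\<lambda>v. (v, par v)) (vss ! i))"
  define post where "post = (\<lambda>i (s' :: machine). regs s' 2 = n \<and> regs s' 3 = 1 \<and> regs s' 4 = J \<and> regs s' 5 = SZ \<and>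
      regs s' 6 = i * SZ \<and> mem s' = (\<lambda>_. 0) \<and>
      inbox s' = flat_pairs (vp i) \<and> top_addr s' = 0 \<and> outp s' = [] \<and> \<not> halted s' \<and>
      outbox s' = encq SZ (qs i) \<and> steps s' \<le> 150 + 20 * J + 100 * length (vp i))"
  let ?cfg = "initial_config n m par vss"
  have len: "length (vss ! i) \<le> X" "set (vss ! i) \<subseteq> {1..n}" if "i < m" for i
    using that vss nth_mem[of i vss] by auto
  have cfg: "length ?cfg = m" "\<And>i. i < m \<Longrightarrow> ?cfg ! i = initial_machine n m par (vss ! i) i"
    by (simp_all add: initial_config_def)
  have wp: "wp w prog ((?cfg ! i)\<lparr>outbox := [], steps := 0\<rparr>) (post i)" if i: "i < m" for i
  proof (rule wp_prog_setup[where i = i and n = n and m = m and vp = "vp i"])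
    have "Suc i * SZ \<le> m * SZ" using i by (intro mult_le_mono1) simp
    then show "i * (128 * (doublings n * (n div m + 1))) < 2 ^ w" "128 * (doublings n * (n div m + 1)) + 256 < 2 ^ w"
      using M unfolding SZ_def[unfolded J_def, symmetric] by simp_all
    show "2 * length (vp i) + 2 < 2 ^ w" using len(1)[OF i] M by (simp add: vp_def)
    show "v \<le> n \<and> u \<le> n" if "(v, u) \<in> set (vp i)" for v u
      using that len(2)[OF i] vss(3) by (auto simp: vp_def)
    show "inbox ((?cfg ! i)\<lparr>outbox := [], steps := 0\<rparr>) = flat_pairs (vp i)"
      using i by (simp add: cfg initial_machine_def vp_def flat_pairs_def o_def)
  next
    fix s' :: machine assume a: "\<And>k. k < 3 \<Longrightarrow> regs s' k = regs ((?cfg ! i)\<lparr>outbox := [], steps := 0\<rparr>) k"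
      "regs s' 3 = 1" "regs s' 4 = doublings n" "regs s' 5 = 128 * (doublings n * (n div m + 1))"
      "regs s' 6 = i * (128 * (doublings n * (n div m + 1)))"
      "inbox s' = inbox ((?cfg ! i)\<lparr>outbox := [], steps := 0\<rparr>)"
      "halted s' = halted ((?cfg ! i)\<lparr>outbox := [], steps := 0\<rparr>)"
      "outp s' = outp ((?cfg ! i)\<lparr>outbox := [], steps := 0\<rparr>)"
      "mem s' = mem ((?cfg ! i)\<lparr>outbox := [], steps := 0\<rparr>)"
      "top_addr s' = top_addr ((?cfg ! i)\<lparr>outbox := [], steps := 0\<rparr>)"
      "outbox s' = outbox ((?cfg ! i)\<lparr>outbox := [], steps := 0\<rparr>) @
         encq (128 * (doublings n * (n div m + 1))) (concat (map init_msgs (vp i)))"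
      "steps s' \<le> steps ((?cfg ! i)\<lparr>outbox := [], steps := 0\<rparr>) + 150 + 20 * doublings n + 100 * length (vp i)"
    have "inbox s' = flat_pairs (vp i)"
      using i a(6) by (simp add: cfg initial_machine_def vp_def flat_pairs_def o_def)
    then show "post i s'"
      using i a(1)[of 2] a(2-5,7-) by (simp add: post_def cfg initial_machine_def SZ_def J_def qs_def vp_def o_def)
  qed (use i n M in \<open>simp_all add: cfg initial_machine_def\<close>)
  obtain cfg' where cfg': "sequence_spmf (map (local_round w prog) ?cfg) = return_spmf cfg'"
      "length cfg' = m" "\<And>i. i < m \<Longrightarrow> post i (cfg' ! i)"
    using sequence_local_rounds[of ?cfg m w prog post] wp by (auto simp: cfg initial_machine_def)
  have cc: "concat (map qs [0..<m]) = concat (map (\<lambda>v. init_msgs (v, par v)) (concat vss))"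
  proof -
    have "concat (map (\<lambda>v. init_msgs (v, par v)) (concat xss)) =
        concat (map (\<lambda>vs. concat (map (\<lambda>v. init_msgs (v, par v)) vs)) xss)" for xss
      by (induction xss) simp_all
    moreover have "map qs [0..<m] = map (\<lambda>vs. concat (map (\<lambda>v. init_msgs (v, par v)) vs)) vss"
      using vss(1) by (intro nth_equalityI) (simp_all add: qs_def)
    ultimately show ?thesis by simp
  qed
  have del: "deliver cfg' ! j = (cfg' ! j)\<lparr>inbox := flat_pairs (local_q SZ j (concat (map (\<lambda>v. init_msgs (v, par v)) (concat vss))))\<rparr>"
    if "j < m" for j
    using inbox_deliver[of cfg' m SZ qs j] that cfg' by (simp add: post_def cc)
  have "sim n m J SZ 1 (\<lambda>_. 0) (concat (map (\<lambda>v. init_msgs (v, par v)) (concat vss))) (deliver cfg')"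
    unfolding sim_def using cfg' del by (simp add: post_def deliver_def)
  moreover have "resources (1000 * (SZ + X)) cfg'"
    unfolding resources_def
  proof
    fix s assume "s \<in> set cfg'"
    then obtain i where i: "i < m" "s = cfg' ! i" using cfg'(2) by (metis in_set_conv_nth)
    have p: "post i s" using cfg' i by simp
    have "length (qs i) = 2 * length (vss ! i)"
    proof -
      have "length (concat (map (\<lambda>v. init_msgs (v, par v)) vs)) = 2 * length vs" for vs
        by (induction vs) simp_all
      then show ?thesis by (simp add: qs_def)
    qed
    then show "space s \<le> 1000 * (SZ + X) \<and> length (outbox s) \<le> 1000 * (SZ + X) \<and>
        length (inbox s) \<le> 1000 * (SZ + X) \<and> steps s \<le> 1000 * (SZ + X)"
      using p JS len(1)[OF i(1)] by (simp add: post_def space_def vp_def)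
  qed
  moreover have "\<not> all_halted cfg'"
  proof -
    have "cfg' ! 0 \<in> set cfg'" "\<not> halted (cfg' ! 0)"
      using cfg'(2) cfg'(3)[of 0] n by (auto simp: post_def)
    then show ?thesis by (auto simp: all_halted_def)
  qed
  ultimately show ?thesis using cfg'(1) by blast
qed

lemma slots_components_cong:
  assumes "\<And>a. a < 32 * K \<Longrightarrow> m a = m' a"
  shows "slots_components m K j = slots_components m' K j"
  using assms
proof (induction m K j rule: slots_components.induct)
  case (1 m K j)
  have nb: "next_break m K j = next_break m' K j"
  proof -
    have "(j < e \<and> (K \<le> e \<or> m (32 * e + 12) \<noteq> 0)) = (j < e \<and> (K \<le> e \<or> m' (32 * e + 12) \<noteq> 0))" for e
    proof (cases "K \<le> e")
      case False
      then have "32 * e + 12 < 32 * K" by simp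
      then show ?thesis using 1(3) by simp
    qed simp
    then show ?thesis unfolding next_break_def by presburger
  qed
  show ?case
  proof (cases "K \<le> j")
    case True
    then show ?thesis by (simp add: slots_components.simps)
  next
    case False
    then have mj: "m (32 * j + 12) = m' (32 * j + 12)" using 1(3) by simp
    have le: "next_break m K j \<le> K" using next_break_le False by simp
    have "slot_vert m k = slot_vert m' k" "slot_inner m k = slot_inner m' k" "slot_outer m k = slot_outer m' k"
      "slot_up m k = slot_up m' k" if "k < K" for k
      using that 1(3) by (simp_all add: slot_vert_def slot_inner_def slot_outer_def slot_up_def)
    then have "slots_component m j (next_break m K j) = slots_component m' j (next_break m K j)"
      using le False by (auto simp: slots_component_def intro!: arg_cong[of _ _ concat] map_cong)
    then show ?thesis
      using 1 False mj nb by (subst (1 2) slots_components.simps) simp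
  qed
qed

lemma sim_output:
  assumes S: "sim n m J SZ (2 * J + 6) G Q cfg" and K: "SZ = 32 * K" "0 < K"
    and Q: "fits m SZ Q" and M: "m * SZ + 4 * SZ + 256 < 2 ^ w" "2 * J + 10 < 2 ^ w"
  defines "G1 \<equiv> fold push_cell Q G"
  assumes bound: "\<And>k f. f \<in> {8, 10, 14, 16} \<Longrightarrow> G1 (32 * k + f) < 2 ^ w"
  shows "\<exists>cfg'. sequence_spmf (map (local_round w prog) cfg) = return_spmf cfg' \<and>
    resources (1000 * SZ) cfg' \<and> all_halted cfg' \<and>
    map outp cfg' = map (\<lambda>cs. concat (map encode_component cs))
      (map (\<lambda>i. slots_components (\<lambda>a. G1 (i * SZ + a)) K 0) [0..<m])"
proof -
  have SZ: "0 < SZ" "even SZ" using K by simp_all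
  define post where "post = (\<lambda>i (s' :: machine). inbox s' = flat_pairs (local_q SZ i Q) \<and> top_addr s' \<le> SZ \<and>
      outp s' = concat (map encode_component (slots_components (\<lambda>a. G1 (i * SZ + a)) K 0)) \<and> halted s' \<and>
      outbox s' = [] \<and> steps s' \<le> 200 + 60 * SZ + 1100 * K)"
  have wp: "wp w prog ((cfg ! i)\<lparr>outbox := [], steps := 0\<rparr>) (post i)" if i: "i < m" for i
  proof (rule wp_prog_output[where J = J and K = K and qs = "local_q SZ i Q"])
    note Si = S[unfolded sim_def, THEN conjunct2, rule_format, OF i]
    have len: "length (local_q SZ i Q) \<le> 2 * SZ" using Q i by (simp add: fits_def)
    let ?s = "(cfg ! i)\<lparr>outbox := [], steps := 0\<rparr>"
    define m1 where "m1 = fold push_cell (local_q SZ i Q) (mem ?s)"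
    have m1: "m1 a = G1 (i * SZ + a)" if "a < SZ" for a
      unfolding m1_def G1_def
      by (rule fold_push_local) (use Q K SZ even_mod_less Si that in \<open>auto simp: fits_def\<close>)
    show "m1 = fold push_cell (local_q SZ i Q) (mem ?s)" by (simp add: m1_def)
    show "a + 1 < 32 * K" if "(a, x) \<in> set (local_q SZ i Q)" for a x
      using local_q_addr[OF Q SZ(2,1) that] K by simp
    show "32 * K + 256 < 2 ^ w" "2 * length (local_q SZ i Q) + 2 < 2 ^ w" "2 * J + 10 < 2 ^ w"
      using M len K by linarith+
    show "m1 (32 * k + f) < 2 ^ w" if "k < K" "f \<in> {8, 10, 14, 16}" for k f
    proof -
      have "32 * k + f < SZ" using that K by auto
      moreover have "i * SZ + (32 * k + f) = 32 * (i * K + k) + f" using K by (simp add: algebra_simps)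
      ultimately have "m1 (32 * k + f) = G1 (32 * (i * K + k) + f)" using m1 by metis
      then show ?thesis using bound[OF that(2)] by metis
    qed
    fix s' :: machine assume a: "inbox s' = inbox ?s" "halted s'" "outbox s' = outbox ?s"
      "outp s' = outp ?s @ concat (map encode_component (slots_components m1 K 0))"
      "top_addr s' \<le> max (top_addr ?s) (32 * K)"
      "steps s' \<le> steps ?s + 200 + 30 * length (local_q SZ i Q) + 1100 * K"
    have "slots_components m1 K 0 = slots_components (\<lambda>a. G1 (i * SZ + a)) K 0"
      by (rule slots_components_cong) (use m1 K in auto)
    then show "post i s'" using a Si len K by (simp add: post_def)
  qed (use S that K in \<open>simp_all add: sim_def\<close>)
  obtain cfg' where cfg': "sequence_spmf (map (local_round w prog) cfg) = return_spmf cfg'"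
      "length cfg' = m" "\<And>i. i < m \<Longrightarrow> post i (cfg' ! i)"
    using sequence_local_rounds[of cfg m w prog post] S wp by (auto simp: sim_def)
  have "resources (1000 * SZ) cfg'"
    unfolding resources_def
  proof
    fix s assume "s \<in> set cfg'"
    then obtain i where i: "i < m" "s = cfg' ! i" using cfg'(2) by (metis in_set_conv_nth)
    have p: "post i s" using cfg' i by simp
    have "length (outp s) \<le> 12 * K"
      using p length_encode_slots_components[of "\<lambda>a. G1 (i * SZ + a)" K 0] by (simp add: post_def)
    moreover have "length (local_q SZ i Q) \<le> 2 * SZ" using Q i by (simp add: fits_def)
    ultimately show "space s \<le> 1000 * SZ \<and> length (outbox s) \<le> 1000 * SZ \<and> length (inbox s) \<le> 1000 * SZ \<and> steps s \<le> 1000 * SZ"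
      using p SZ K by (simp add: post_def space_def)
  qed
  moreover have "all_halted cfg'"
    using cfg' by (auto simp: all_halted_def post_def in_set_conv_nth)
  moreover have "map outp cfg' = map (\<lambda>cs. concat (map encode_component cs))
      (map (\<lambda>i. slots_components (\<lambda>a. G1 (i * SZ + a)) K 0) [0..<m])"
    using cfg' by (intro nth_equalityI) (simp_all add: post_def)
  ultimately show ?thesis using cfg'(1) by blast
qed

section \<open>Euler tours of binary trees\<close>

primrec rt :: "nat tree \<Rightarrow> nat" where
  "rt Leaf = 0"
| "rt (Node l v r) = v"

text \<open>0 is the null pointer as well as \<open>rt Leaf\<close>, hence the condition that no
  vertex is 0.\<close>

primrec child_ptrs :: "(nat \<Rightarrow> nat) \<Rightarrow> (nat \<Rightarrow> nat) \<Rightarrow> nat tree \<Rightarrow> bool" where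
  "child_ptrs c1 c2 Leaf = True"
| "child_ptrs c1 c2 (Node l v r) =
     (v \<noteq> 0 \<and> c1 v = rt l \<and> c2 v = rt r \<and> child_ptrs c1 c2 l \<and> child_ptrs c1 c2 r)"

primrec parent_ptrs :: "(nat \<Rightarrow> nat) \<Rightarrow> nat tree \<Rightarrow> bool" where
  "parent_ptrs par Leaf = True"
| "parent_ptrs par (Node l v r) = ((l \<noteq> Leaf \<longrightarrow> par (rt l) = v) \<and> (r \<noteq> Leaf \<longrightarrow> par (rt r) = v) \<and>
     parent_ptrs par l \<and> parent_ptrs par r)"

text \<open>
  The Euler tour visits a vertex \<^term>\<open>v\<close> before, between and after its subtrees, as the items
  \<open>128 * v\<close>, \<open>128 * v + 32\<close> and \<open>128 * v + 64\<close>.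
\<close>

primrec tour :: "nat tree \<Rightarrow> nat list" where
  "tour Leaf = []"
| "tour (Node l v r) = 128 * v # tour l @ (128 * v + 32) # tour r @ [128 * v + 64]"

text \<open>The index of the entry item of \<open>x\<close> in the tour, counted from
  \<open>k\<close>. Slots of vertices are chosen by this index, so two thirds of all slots remain
  empty.\<close>

primrec pos :: "nat \<Rightarrow> nat tree \<Rightarrow> nat \<Rightarrow> nat" where
  "pos k Leaf x = k"
| "pos k (Node l v r) x = (if x = v then k else if x \<in> set_tree l then pos (k + 1) l x
     else pos (k + 2 + 3 * size l) r x)"

primrec left_size :: "nat tree \<Rightarrow> nat \<Rightarrow> nat" where
  "left_size Leaf x = 0"
| "left_size (Node l v r) x = (if x = v then size l else if x \<in> set_tree l then left_size l x else left_size r x)"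

primrec right_size :: "nat tree \<Rightarrow> nat \<Rightarrow> nat" where
  "right_size Leaf x = 0"
| "right_size (Node l v r) x = (if x = v then size r else if x \<in> set_tree l then right_size l x else right_size r x)"

section \<open>Positions of vertices in the tour\<close>

lemma rt_in_set [simp]: "T \<noteq> Leaf \<Longrightarrow> rt T \<in> set_tree T"
  by (cases T) auto

lemma length_tour [simp]: "length (tour T) = 3 * size T"
  by (induction T) auto

lemma set_tour: "set (tour T) = (\<Union>v\<in>set_tree T. {128 * v, 128 * v + 32, 128 * v + 64})"
  by (induction T) auto

lemma distinct_tour: "distinct (inorder T) \<Longrightarrow> distinct (tour T)"
proof (induction T)
  case (Node l v r)
  have v: "v \<notin> set_tree l" "v \<notin> set_tree r" "set_tree l \<inter> set_tree r = {}"
    using Node.prems by auto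
  have in_tree: "x div 128 \<in> set_tree T" if "x \<in> set (tour T)" for x T
    using that by (auto simp: set_tour)
  have vi: "128 * v + i \<notin> set (tour l)" "128 * v + i \<notin> set (tour r)" if "i < 128" for i
    using in_tree[of "128 * v + i" l] in_tree[of "128 * v + i" r] v that by auto
  have lr: "set (tour l) \<inter> set (tour r) = {}"
    using in_tree[of _ l] in_tree[of _ r] v(3) by blast
  from lr vi[of 0] vi[of 32] vi[of 64] show ?case using Node by auto
qed simp

lemma pos_bounds:
  "x \<in> set_tree T \<Longrightarrow> k \<le> pos k T x \<and> pos k T x < k + 3 * size T"
proof (induction T arbitrary: k)
  case (Node l v r)
  consider "x = v" | "x \<noteq> v" "x \<in> set_tree l" | "x \<noteq> v" "x \<notin> set_tree l" "x \<in> set_tree r"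
    using Node.prems by auto
  then show ?case
  proof cases
    case 2
    then show ?thesis using Node.IH(1)[of "k + 1"] by auto
  next
    case 3
    then show ?thesis using Node.IH(2)[of "k + 2 + 3 * size l"] by auto
  qed simp
qed simp

lemma pos_shift: "x \<in> set_tree T \<Longrightarrow> pos (k + d) T x = pos k T x + d"
proof (induction T arbitrary: k)
  case (Node l v r)
  consider "x = v" | "x \<noteq> v" "x \<in> set_tree l" | "x \<noteq> v" "x \<notin> set_tree l" "x \<in> set_tree r"
    using Node.prems by auto
  then show ?case
  proof cases
    case 2
    then show ?thesis using Node.IH(1)[of "k + 1"] by (simp add: ac_simps)
  next
    case 3
    then show ?thesis using Node.IH(2)[of "k + 2 + 3 * size l"] by (simp add: ac_simps)
  qed simp
qed simp

text \<open>The left-hand side is the position of the exit item of \<open>x\<close>; this one bound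
  justifies all list accesses to its three items.\<close>

lemma left_right_size:
  assumes "x \<in> set_tree T"
  shows "pos k T x + 2 + 3 * left_size T x + 3 * right_size T x < k + 3 * size T"
  using assms
proof (induction T arbitrary: k)
  case (Node l v r)
  consider "x = v" | "x \<noteq> v" "x \<in> set_tree l" | "x \<noteq> v" "x \<notin> set_tree l" "x \<in> set_tree r"
    using Node.prems by auto
  then show ?case
  proof cases
    case 2
    then show ?thesis using Node.IH(1)[of "k + 1"] by auto
  next
    case 3
    then show ?thesis using Node.IH(2)[of "k + 2 + 3 * size l"] by auto
  qed simp
qed simp

text \<open>A subtree occupies three items per vertex, so the gaps between the three items of a
  vertex reveal the sizes of its subtrees. This is what turns ranks into subtree sizes.\<close>

lemma tour_nth:
  assumes "x \<in> set_tree T"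
  shows "tour T ! pos 0 T x = 128 * x" (is "?A T")
    and "tour T ! (pos 0 T x + 1 + 3 * left_size T x) = 128 * x + 32" (is "?B T")
    and "tour T ! (pos 0 T x + 2 + 3 * left_size T x + 3 * right_size T x) = 128 * x + 64" (is "?C T")
proof -
  have "?A T \<and> ?B T \<and> ?C T"
    using assms
  proof (induction T)
    case (Node l v r)
    consider "x = v" | "x \<noteq> v" "x \<in> set_tree l" | "x \<noteq> v" "x \<notin> set_tree l" "x \<in> set_tree r"
      using Node.prems by auto
    then show ?case
    proof cases
      case 1
      then show ?thesis by (simp add: nth_append nth_Cons')
    next
      case 2
      have p: "pos 1 l x = pos 0 l x + 1" using pos_shift[of x l 0 1] 2 by simp
      have b: "pos 0 l x + 2 + 3 * left_size l x + 3 * right_size l x < 3 * size l"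
        using left_right_size[of x l 0] 2 by simp
      have n: "tour (Node l v r) ! (i + 1) = tour l ! i" if "i < 3 * size l" for i
        using that by (simp add: nth_append)
      have e: "pos 0 (Node l v r) x = pos 0 l x + 1" "left_size (Node l v r) x = left_size l x"
        "right_size (Node l v r) x = right_size l x"
        using 2 p by simp_all
      have "tour (Node l v r) ! (pos 0 l x + 1) = tour l ! pos 0 l x"
        "tour (Node l v r) ! (pos 0 l x + 1 + 3 * left_size l x + 1) = tour l ! (pos 0 l x + 1 + 3 * left_size l x)"
        "tour (Node l v r) ! (pos 0 l x + 2 + 3 * left_size l x + 3 * right_size l x + 1) =
          tour l ! (pos 0 l x + 2 + 3 * left_size l x + 3 * right_size l x)"
        by (rule n; use b in linarith)+
      then show ?thesis unfolding e using Node.IH(1) 2 by (simp add: ac_simps del: tour.simps)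
    next
      case 3
      have p: "pos (Suc (Suc (3 * size l))) r x = pos 0 r x + (2 + 3 * size l)"
        using pos_shift[of x r 0 "2 + 3 * size l"] 3 by simp
      have b: "pos 0 r x + 2 + 3 * left_size r x + 3 * right_size r x < 3 * size r"
        using left_right_size[of x r 0] 3 by simp
      have n: "tour (Node l v r) ! (i + (2 + 3 * size l)) = tour r ! i" if "i < 3 * size r" for i
        using that by (simp add: nth_append)
      have e: "pos 0 (Node l v r) x = pos 0 r x + (2 + 3 * size l)" "left_size (Node l v r) x = left_size r x"
        "right_size (Node l v r) x = right_size r x"
        using 3 p by simp_all
      have "tour (Node l v r) ! (pos 0 r x + (2 + 3 * size l)) = tour r ! pos 0 r x"
        "tour (Node l v r) ! (pos 0 r x + 1 + 3 * left_size r x + (2 + 3 * size l)) = tour r ! (pos 0 r x + 1 + 3 * left_size r x)"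
        "tour (Node l v r) ! (pos 0 r x + 2 + 3 * left_size r x + 3 * right_size r x + (2 + 3 * size l)) =
          tour r ! (pos 0 r x + 2 + 3 * left_size r x + 3 * right_size r x)"
        by (rule n; use b in linarith)+
      then show ?thesis unfolding e using Node.IH(2) 3 by (simp add: ac_simps del: tour.simps)
    qed
  qed simp
  then show "?A T" "?B T" "?C T" by auto
qed

lemma pos_inj:
  assumes "x \<in> set_tree T" "y \<in> set_tree T" "pos 0 T x = pos 0 T y"
  shows "x = y"
proof -
  have "128 * x = 128 * y"
    using tour_nth(1)[OF assms(1)] tour_nth(1)[OF assms(2)] assms(3) by metis
  then show ?thesis by simp
qed

lemma pos_children:
  assumes "child_ptrs c1 c2 T" "distinct (inorder T)" "x \<in> set_tree T"
  shows "(c1 x \<noteq> 0 \<longrightarrow> c1 x \<in> set_tree T \<and> pos k T (c1 x) = pos k T x + 1) \<and>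
    (c2 x \<noteq> 0 \<longrightarrow> c2 x \<in> set_tree T \<and> pos k T (c2 x) = pos k T x + 2 + 3 * left_size T x)"
  using assms
proof (induction T arbitrary: k)
  case (Node l v r)
  have d: "v \<notin> set_tree l" "v \<notin> set_tree r" "set_tree l \<inter> set_tree r = {}"
    using Node.prems by auto
  consider "x = v" | "x \<noteq> v" "x \<in> set_tree l" | "x \<noteq> v" "x \<notin> set_tree l" "x \<in> set_tree r"
    using Node.prems by auto
  then show ?case
  proof cases
    case 1
    have "l \<noteq> Leaf \<Longrightarrow> pos (k + 1) l (rt l) = k + 1" "r \<noteq> Leaf \<Longrightarrow> pos (k + 2 + 3 * size l) r (rt r) = k + 2 + 3 * size l"
      by (cases l; simp) (cases r; simp)
    moreover have "c1 x \<noteq> 0 \<Longrightarrow> l \<noteq> Leaf" "c2 x \<noteq> 0 \<Longrightarrow> r \<noteq> Leaf" "c1 x = rt l" "c2 x = rt r"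
      using Node.prems 1 by auto
    moreover have "l \<noteq> Leaf \<Longrightarrow> rt l \<in> set_tree l" "r \<noteq> Leaf \<Longrightarrow> rt r \<in> set_tree r" by simp_all
    moreover have "l \<noteq> Leaf \<Longrightarrow> rt l \<noteq> v" "r \<noteq> Leaf \<Longrightarrow> rt r \<noteq> v" "r \<noteq> Leaf \<Longrightarrow> rt r \<notin> set_tree l"
      using d rt_in_set by blast+
    ultimately show ?thesis using 1 by auto
  next
    case 2
    have "(c1 x \<noteq> 0 \<longrightarrow> c1 x \<in> set_tree l \<and> pos (k + 1) l (c1 x) = pos (k + 1) l x + 1) \<and>
      (c2 x \<noteq> 0 \<longrightarrow> c2 x \<in> set_tree l \<and> pos (k + 1) l (c2 x) = pos (k + 1) l x + 2 + 3 * left_size l x)"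
      by (rule Node.IH(1)) (use Node.prems 2 in auto)
    then show ?thesis using 2 d by auto
  next
    case 3
    have "(c1 x \<noteq> 0 \<longrightarrow> c1 x \<in> set_tree r \<and> pos (k + 2 + 3 * size l) r (c1 x) = pos (k + 2 + 3 * size l) r x + 1) \<and>
      (c2 x \<noteq> 0 \<longrightarrow> c2 x \<in> set_tree r \<and> pos (k + 2 + 3 * size l) r (c2 x) =
         pos (k + 2 + 3 * size l) r x + 2 + 3 * left_size r x)"
      by (rule Node.IH(2)) (use Node.prems 3 in auto)
    then show ?thesis using 3 d by auto
  qed
qed simp

lemma parent_in_tree:
  assumes "parent_ptrs par T" "distinct (inorder T)" "x \<in> set_tree T" "x \<noteq> rt T"
  shows "par x \<in> set_tree T \<and> pos k T (par x) < pos k T x"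
  using assms
proof (induction T arbitrary: k)
  case (Node l v r)
  have d: "v \<notin> set_tree l" "v \<notin> set_tree r" "set_tree l \<inter> set_tree r = {}"
    using Node.prems by auto
  consider "x \<in> set_tree l" | "x \<in> set_tree r" using Node.prems by auto
  then show ?case
  proof cases
    case 1
    have pb: "k + 1 \<le> pos (k + 1) l x" using pos_bounds[OF 1, of "k + 1"] by simp
    show ?thesis
    proof (cases "x = rt l")
      case True
      then show ?thesis using Node.prems 1 d pb by auto
    next
      case False
      then have "par x \<in> set_tree l \<and> pos (k + 1) l (par x) < pos (k + 1) l x"
        using Node.IH(1) Node.prems 1 by auto
      then show ?thesis using 1 d by auto
    qed
  next
    case 2
    have pb: "k + 2 + 3 * size l \<le> pos (k + 2 + 3 * size l) r x" using pos_bounds[OF 2, of "k + 2 + 3 * size l"] by simp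
    have nl: "x \<notin> set_tree l" "x \<noteq> v" using 2 d by auto
    show ?thesis
    proof (cases "x = rt r")
      case True
      then show ?thesis using Node.prems 2 nl pb by auto
    next
      case False
      then have *: "par x \<in> set_tree r \<and> pos (k + 2 + 3 * size l) r (par x) < pos (k + 2 + 3 * size l) r x"
        using Node.IH(2) Node.prems 2 by auto
      then have "par x \<notin> set_tree l" "par x \<noteq> v" using d by auto
      then show ?thesis using * nl by auto
    qed
  qed
qed simp

text \<open>The positions from \<open>par x\<close> up to \<open>x\<close> all lie in the range of
  the subtree of \<open>par x\<close>. Hence \<open>y\<close> is a proper descendant of
  \<open>par x\<close>, and its parent is in that subtree too.\<close>

lemma edges_noncrossing:
  assumes "parent_ptrs par T" "distinct (inorder T)" "x \<in> set_tree T" "y \<in> set_tree T" "x \<noteq> rt T"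
    "pos k T (par x) < pos k T y" "pos k T y < pos k T x"
  shows "y \<noteq> rt T \<and> pos k T (par x) \<le> pos k T (par y)"
  using assms
proof (induction T arbitrary: k)
  case (Node l v r)
  have d: "v \<notin> set_tree l" "v \<notin> set_tree r" "set_tree l \<inter> set_tree r = {}"
    using Node.prems by auto
  have kle: "k \<le> pos k (Node l v r) z" if "z \<in> set_tree (Node l v r)" for z
    using pos_bounds[OF that, of k] by blast
  have px: "par x \<in> set_tree (Node l v r)"
    using parent_in_tree[OF Node.prems(1,2,3,5), of k] by blast
  have yv: "y \<noteq> v" using Node.prems(6) kle[OF px] by auto
  then have py: "par y \<in> set_tree (Node l v r)"
    using parent_in_tree[OF Node.prems(1,2,4), of k] by simp
  show ?case
  proof (cases "par x = v")
    case True
    then show ?thesis using kle[OF py] yv by simp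
  next
    case False
    then have nr: "x \<noteq> rt l \<or> l = Leaf" "x \<noteq> rt r \<or> r = Leaf" "x \<noteq> v" using Node.prems by auto
    consider "x \<in> set_tree l" | "x \<in> set_tree r" using Node.prems by auto
    then show ?thesis
    proof cases
      case 1
      then have l: "x \<noteq> rt l" using nr by auto
      have pl: "par x \<in> set_tree l" using parent_in_tree[of par l x k] Node.prems 1 l by auto
      have y: "y \<in> set_tree l"
      proof (rule ccontr)
        assume "y \<notin> set_tree l"
        then have "y \<in> set_tree r" using Node.prems(4) yv by auto
        then have "k + 2 + 3 * size l \<le> pos k (Node l v r) y"
          using pos_bounds[of y r "k + 2 + 3 * size l"] yv \<open>y \<notin> set_tree l\<close> by simp
        moreover have "pos k (Node l v r) x < k + 1 + 3 * size l"
          using pos_bounds[OF 1, of "k + 1"] 1 nr by simp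
        ultimately show False using Node.prems(7) by linarith
      qed
      have e: "pos k (Node l v r) z = pos (k + 1) l z" if "z \<in> set_tree l" for z using that d by auto
      have "y \<noteq> rt l \<and> pos (k + 1) l (par x) \<le> pos (k + 1) l (par y)"
        using Node.IH(1)[of "k + 1"] Node.prems 1 y l e[OF 1] e[OF y] e[OF pl] by auto
      moreover from this have "par y \<in> set_tree l" using parent_in_tree[of par l y k] Node.prems y by auto
      ultimately show ?thesis using e pl yv by simp
    next
      case 2
      then have l: "x \<noteq> rt r" using nr by auto
      have pl: "par x \<in> set_tree r" using parent_in_tree[of par r x k] Node.prems 2 l by auto
      have e: "pos k (Node l v r) z = pos (k + 2 + 3 * size l) r z" if "z \<in> set_tree r" for z using that d by auto
      have y: "y \<in> set_tree r"
      proof (rule ccontr)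
        assume "y \<notin> set_tree r"
        then have yl: "y \<in> set_tree l" using Node.prems(4) yv by auto
        then have "pos k (Node l v r) y < k + 1 + 3 * size l"
          using pos_bounds[of y l "k + 1"] yv by simp
        moreover have "k + 2 + 3 * size l \<le> pos k (Node l v r) (par x)"
          using pos_bounds[OF pl, of "k + 2 + 3 * size l"] e[OF pl] by simp
        ultimately show False using Node.prems(6) by linarith
      qed
      have "y \<noteq> rt r \<and> pos (k + 2 + 3 * size l) r (par x) \<le> pos (k + 2 + 3 * size l) r (par y)"
        using Node.IH(2)[of "k + 2 + 3 * size l"] Node.prems 2 y l e[OF 2] e[OF y] e[OF pl] by auto
      moreover from this have "par y \<in> set_tree r" using parent_in_tree[of par r y k] Node.prems y by auto
      ultimately show ?thesis using e pl yv by simp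
    qed
  qed
qed simp

section \<open>Edges crossing a position of a light-first tour\<close>

primrec light_first :: "nat tree \<Rightarrow> bool" where
  "light_first Leaf = True"
| "light_first (Node l v r) = (size l \<le> size r \<and> light_first l \<and> light_first r)"

definition crossing :: "(nat \<Rightarrow> nat) \<Rightarrow> nat \<Rightarrow> nat tree \<Rightarrow> nat \<Rightarrow> nat set" where
  "crossing par k T s = {x \<in> set_tree T. x \<noteq> rt T \<and> pos k T (par x) < s \<and> s \<le> pos k T x}"

text \<open>
  An edge from a vertex to its second child crosses \<^term>\<open>s\<close> together with edges below the first
  child only, and the first child has the smaller subtree; so every further crossing edge doubles the
  size.
\<close>

lemma card_crossing:
  assumes "parent_ptrs par T" "distinct (inorder T)" "light_first T" "T \<noteq> Leaf"
  shows "2 ^ card (crossing par k T s) \<le> 2 * size T"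
  using assms
proof (induction T arbitrary: k)
  case (Node l v r)
  have d: "v \<notin> set_tree l" "v \<notin> set_tree r" "set_tree l \<inter> set_tree r = {}"
    using Node.prems by auto
  let ?k = "k + 2 + 3 * size l"
  have fin: "finite (crossing par k' T' s)" for k' T'
    by (rule finite_subset[of _ "set_tree T'"]) (auto simp: crossing_def)
  \<comment> \<open>A crossing edge starts at the root or crosses inside one of the subtrees. The
    children of the root are at the positions \<open>k + 1\<close> and \<open>?k\<close>, which
    gives the conditions on \<open>s\<close>.\<close>
  have sub: "crossing par k (Node l v r) s \<subseteq>
     (if l \<noteq> Leaf \<and> k < s \<and> s \<le> k + 1 then {rt l} else {}) \<union>
     (if r \<noteq> Leaf \<and> k < s \<and> s \<le> ?k then {rt r} else {}) \<union> crossing par (k + 1) l s \<union> crossing par ?k r s"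
  proof
    fix x assume x: "x \<in> crossing par k (Node l v r) s"
    then have xs: "x \<in> set_tree (Node l v r)" "x \<noteq> v" "pos k (Node l v r) (par x) < s" "s \<le> pos k (Node l v r) x"
      by (auto simp: crossing_def)
    consider "x \<in> set_tree l" | "x \<in> set_tree r" "x \<notin> set_tree l" using xs by auto
    then show "x \<in> (if l \<noteq> Leaf \<and> k < s \<and> s \<le> k + 1 then {rt l} else {}) \<union>
     (if r \<noteq> Leaf \<and> k < s \<and> s \<le> ?k then {rt r} else {}) \<union> crossing par (k + 1) l s \<union> crossing par ?k r s"
    proof cases
      case 1
      then have ne: "l \<noteq> Leaf" by auto
      show ?thesis
      proof (cases "x = rt l")
        case True
        have "pos (k + 1) l (rt l) = k + 1" using ne by (cases l) auto
        then show ?thesis using True xs 1 ne Node.prems(1) by auto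
      next
        case False
        have p: "par x \<in> set_tree l" using parent_in_tree[of par l x k] Node.prems 1 False by auto
        then have "par x \<noteq> v" using d by auto
        then have "x \<in> crossing par (k + 1) l s" using xs 1 p False by (simp add: crossing_def)
        then show ?thesis by blast
      qed
    next
      case 2
      then have ne: "r \<noteq> Leaf" by auto
      show ?thesis
      proof (cases "x = rt r")
        case True
        have "pos ?k r (rt r) = ?k" using ne by (cases r) auto
        then show ?thesis using True xs 2 ne Node.prems(1) by auto
      next
        case False
        have p: "par x \<in> set_tree r" using parent_in_tree[of par r x k] Node.prems 2 False by auto
        then have "par x \<noteq> v" "par x \<notin> set_tree l" using d by auto
        then have "x \<in> crossing par ?k r s" using xs 2 p False by (simp add: crossing_def)
        then show ?thesis by blast
      qed
    qed
  qed
  have lo: "crossing par k' T' s = {}" if "s \<le> k'" "parent_ptrs par T'" "distinct (inorder T')" for k' T'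
  proof -
    have "k' \<le> pos k' T' (par x)" if "x \<in> set_tree T'" "x \<noteq> rt T'" for x
      using parent_in_tree[of par T' x k'] pos_bounds[of "par x" T' k'] that \<open>parent_ptrs par T'\<close> \<open>distinct (inorder T')\<close> by blast
    then show ?thesis using that(1) by (fastforce simp: crossing_def)
  qed
  have hi: "crossing par k' T' s = {}" if "k' + 3 * size T' \<le> s" for k' T'
    using pos_bounds[of _ T' k'] that by (fastforce simp: crossing_def)
  have IHl: "2 ^ card (crossing par (k + 1) l s) \<le> 2 * size l" if "l \<noteq> Leaf"
    using Node.IH(1) Node.prems that by auto
  have IHr: "2 ^ card (crossing par ?k r s) \<le> 2 * size r" if "r \<noteq> Leaf"
    using Node.IH(2) Node.prems that by auto
  have le: "size l \<le> size r" using Node.prems by simp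
  have pl: "parent_ptrs par l" "distinct (inorder l)" "parent_ptrs par r" "distinct (inorder r)"
    using Node.prems by auto
  have cl0: "l = Leaf \<Longrightarrow> crossing par (k + 1) l s = {}" "r = Leaf \<Longrightarrow> crossing par ?k r s = {}"
    by (auto simp: crossing_def)
  have goal: ?case if "card (crossing par k (Node l v r) s) \<le> c" "2 ^ c \<le> 2 * size (Node l v r)" for c
    using that power_increasing[of "card (crossing par k (Node l v r) s)" c "2::nat"] by linarith
  \<comment> \<open>The cut lies before the root, directly behind it, before the second child but
    after the first position of the first subtree, or beyond the second child. Directly behind the
    root only the two edges of the root itself can cross.\<close>
  consider "s \<le> k" | "s = k + 1" | "k + 1 < s" "s \<le> ?k" | "?k < s" by linarith
  then show ?case
  proof cases
    case 1
    then show ?thesis using lo[of k "Node l v r"] Node.prems by simp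
  next
    case 2
    have e: "crossing par (k + 1) l s = {}" "crossing par ?k r s = {}" using lo 2 pl by auto
    show ?thesis
    proof (cases "l = Leaf")
      case True
      then have "crossing par k (Node l v r) s \<subseteq> {rt r}" using sub e by (auto split: if_splits)
      then have "card (crossing par k (Node l v r) s) \<le> 1" using card_mono[of "{rt r}"] by fastforce
      then show ?thesis by (rule goal) simp
    next
      case False
      then have "1 \<le> size l" by (cases l) auto
      have "crossing par k (Node l v r) s \<subseteq> {rt l, rt r}" using sub e by (auto split: if_splits)
      then have "card (crossing par k (Node l v r) s) \<le> card {rt l, rt r}" by (intro card_mono) auto
      also have "\<dots> \<le> 2" by (simp add: card_insert_if)
      finally show ?thesis by (rule goal) (use le \<open>1 \<le> size l\<close> in simp)
    qed
  next
    case 3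
    have e: "crossing par ?k r s = {}" using lo 3 pl by auto
    then have s3: "crossing par k (Node l v r) s \<subseteq> insert (rt r) (crossing par (k + 1) l s)"
      using sub 3 by (auto split: if_splits)
    have "card (crossing par k (Node l v r) s) \<le> card (insert (rt r) (crossing par (k + 1) l s))"
      by (rule card_mono[OF _ s3]) (simp add: fin)
    also have "\<dots> \<le> Suc (card (crossing par (k + 1) l s))" by (simp add: card_insert_le_m1 card_insert_if fin)
    finally show ?thesis
    proof (rule goal)
      \<comment> \<open>Twice the bound for the first subtree is \<open>4 * size l\<close>, and the
        order of the children gives \<open>size l + size l \<le> size l + size r\<close>.\<close>
      show "2 ^ Suc (card (crossing par (k + 1) l s)) \<le> 2 * size (Node l v r)"
        using IHl cl0 le by (cases "l = Leaf") auto
    qed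
  next
    case 4
    have e: "crossing par (k + 1) l s = {}" using hi[of "k + 1" l] 4 by simp
    then have "crossing par k (Node l v r) s \<subseteq> crossing par ?k r s" using sub 4 by (auto split: if_splits)
    then have "card (crossing par k (Node l v r) s) \<le> card (crossing par ?k r s)" by (rule card_mono[OF fin])
    then show ?thesis
    proof (rule goal)
      show "2 ^ card (crossing par ?k r s) \<le> 2 * size (Node l v r)"
        using IHr cl0 by (cases "r = Leaf") auto
    qed
  qed
qed simp

text \<open>Subtrees are exchanged only if the first is strictly larger, exactly as decided by
  \<open>swaps\<close>, so that both treat ties alike.\<close>

primrec lighten :: "nat tree \<Rightarrow> nat tree" where
  "lighten Leaf = Leaf"
| "lighten (Node l v r) = (if size r < size l then Node (lighten r) v (lighten l) else Node (lighten l) v (lighten r))"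

lemma lighten_simps [simp]:
  "size (lighten T) = size T" "set_tree (lighten T) = set_tree T" "rt (lighten T) = rt T"
  "lighten T = Leaf \<longleftrightarrow> T = Leaf"
  by (induction T) auto

lemma light_first_lighten: "light_first (lighten T)"
  by (induction T) auto

lemma distinct_lighten: "distinct (inorder T) \<Longrightarrow> distinct (inorder (lighten T))"
  by (induction T) auto

lemma parent_ptrs_lighten: "parent_ptrs par T \<Longrightarrow> parent_ptrs par (lighten T)"
  by (induction T) auto

lemma child_ptrs_lighten:
  assumes "child_ptrs c1 c2 T" "distinct (inorder T)"
    "\<And>v. v \<in> set_tree T \<Longrightarrow> c1' v = (if right_size T v < left_size T v then c2 v else c1 v)"
    "\<And>v. v \<in> set_tree T \<Longrightarrow> c2' v = (if right_size T v < left_size T v then c1 v else c2 v)"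
  shows "child_ptrs c1' c2' (lighten T)"
  using assms
proof (induction T)
  case (Node l v r)
  have d: "v \<notin> set_tree l" "v \<notin> set_tree r" "set_tree l \<inter> set_tree r = {}"
    using Node.prems by auto
  have "child_ptrs c1' c2' (lighten l)"
    by (rule Node.IH(1)) (use Node.prems d in auto)
  moreover have "child_ptrs c1' c2' (lighten r)"
  proof (rule Node.IH(2))
    fix x assume x: "x \<in> set_tree r"
    then have "x \<notin> set_tree l" "x \<noteq> v" using d by auto
    then show "c1' x = (if right_size r x < left_size r x then c2 x else c1 x)"
      "c2' x = (if right_size r x < left_size r x then c1 x else c2 x)"
      using Node.prems(3,4)[of x] x by simp_all
  qed (use Node.prems in auto)
  ultimately show ?case using Node.prems(1) Node.prems(3,4)[of v] by auto
qed simp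

section \<open>Links of the tour, and the tree behind the parent function\<close>

definition adj :: "'a list \<Rightarrow> ('a \<times> 'a) set" where "adj xs = set (zip xs (tl xs))"

lemma adj_simps [simp]: "adj [] = {}" "adj [x] = {}" "adj (x # y # zs) = insert (x, y) (adj (y # zs))"
  by (simp_all add: adj_def)

lemma adj_append:
  "xs \<noteq> [] \<Longrightarrow> ys \<noteq> [] \<Longrightarrow> adj (xs @ ys) = adj xs \<union> {(last xs, hd ys)} \<union> adj ys"
proof (induction xs rule: induct_list012)
  case (2 x)
  then show ?case by (cases ys) auto
qed auto

lemma adj_iff: "(x, y) \<in> adj xs \<longleftrightarrow> (\<exists>i. Suc i < length xs \<and> xs ! i = x \<and> xs ! Suc i = y)"
proof -
  have "i < length xs - 1 \<longleftrightarrow> Suc i < length xs" for i by linarith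
  then show ?thesis by (auto simp: adj_def set_zip nth_tl)
qed

text \<open>The links between \<open>p\<close> and \<open>q\<close> that the parent of
  \<open>a\<close> has to write; \<open>a = 0\<close> means that there is no child.\<close>

definition child_pairs :: "nat \<Rightarrow> nat \<Rightarrow> nat \<Rightarrow> (nat \<times> nat) set" where
  "child_pairs a p q = (if a = 0 then {(p, q)} else {(p, 128 * a), (128 * a + 64, q)})"

lemma tour_ends: "T \<noteq> Leaf \<Longrightarrow> tour T \<noteq> [] \<and> hd (tour T) = 128 * rt T \<and> last (tour T) = 128 * rt T + 64"
  by (cases T) auto

lemma rt_eq_0: "child_ptrs c1 c2 T \<Longrightarrow> rt T = 0 \<longleftrightarrow> T = Leaf"
  by (cases T) auto

text \<open>The set of links is a union of contributions that each vertex can compute from its own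
  child pointers. This is why one round suffices to build the linked list.\<close>

lemma adj_tour:
  assumes "child_ptrs c1 c2 T"
  shows "adj (tour T) = (\<Union>v\<in>set_tree T. child_pairs (c1 v) (128 * v) (128 * v + 32) \<union>
     child_pairs (c2 v) (128 * v + 32) (128 * v + 64))"
  using assms
proof (induction T)
  case (Node l v r)
  have between: "adj (p # tour t @ q # zs) = child_pairs (rt t) p q \<union> adj (tour t) \<union> adj (q # zs)"
    if "child_ptrs c1 c2 t" for t p q zs
  proof (cases "t = Leaf")
    case True
    then show ?thesis by (simp add: child_pairs_def)
  next
    case False
    have e: "tour t \<noteq> []" "hd (tour t) = 128 * rt t" "last (tour t) = 128 * rt t + 64" "rt t \<noteq> 0"
      using tour_ends[OF False] rt_eq_0[OF that] False by auto
    have "adj (p # tour t @ q # zs) = adj ([p] @ tour t @ q # zs)" by simp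
    also have "\<dots> = {(p, 128 * rt t)} \<union> (adj (tour t) \<union> {(128 * rt t + 64, q)} \<union> adj (q # zs))"
      using e by (subst adj_append, simp, simp, subst adj_append) (simp_all)
    finally show ?thesis using e by (auto simp: child_pairs_def)
  qed
  have "adj (tour (Node l v r)) = child_pairs (rt l) (128 * v) (128 * v + 32) \<union> adj (tour l) \<union>
      (child_pairs (rt r) (128 * v + 32) (128 * v + 64) \<union> adj (tour r))"
    using Node.prems by (simp add: between del: adj_simps(3))
  then show ?case using Node by auto
qed simp

text \<open>The child pointers are unfolded by induction on the number of descendants. Depth
  excludes cycles, and uniqueness of parents makes the two subtrees disjoint. The order of the
  children is whatever \<open>c1\<close> and \<open>c2\<close> say, since the first tour has to cope
  with the order of arrival.\<close>

lemma binary_tree_imp_tree: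
  assumes bt: "binary_tree n par"
    and ch: "\<And>v. v \<in> {1..n} \<Longrightarrow> {c1 v, c2 v} - {0} = {u \<in> {1..n}. par u = v}"
      "\<And>v. v \<in> {1..n} \<Longrightarrow> c1 v = c2 v \<Longrightarrow> c1 v = 0"
  obtains T where "T \<noteq> Leaf" "set_tree T = {1..n}" "size T = n" "distinct (inorder T)" "child_ptrs c1 c2 T"
    "parent_ptrs par T" "par (rt T) = 0"
proof -
  define E where "E = tree_edges n par"
  obtain r where r: "r \<in> {1..n}" "par r = 0" "\<And>v. v \<in> {1..n} \<Longrightarrow> v \<noteq> r \<Longrightarrow> par v \<in> {1..n}"
    "\<And>v. v \<in> {1..n} \<Longrightarrow> (v, r) \<in> E\<^sup>*"
    using bt unfolding binary_tree_def E_def by blast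
  have E: "(u, v) \<in> E \<longleftrightarrow> u \<in> {1..n} \<and> u \<noteq> r \<and> v = par u" for u v
    using r(2) r(3)[of u] by (cases "u = r") (auto simp: E_def tree_edges_def)
  have E_in: "v \<in> {1..n}" if "(u, v) \<in> E" for u v using that E r(3) by auto
  have reach: "\<exists>k. (par ^^ k) v = r" if "v \<in> {1..n}" for v
    using r(4)[OF that]
  proof (induction rule: converse_rtrancl_induct)
    case base
    show ?case by (rule exI[of _ 0]) simp
  next
    case (step u v)
    then obtain k where "(par ^^ k) v = r" by blast
    then have "(par ^^ Suc k) u = r" using step(1) E by (simp add: funpow_swap1)
    then show ?case by blast
  qed
  \<comment> \<open>The depth of \<open>v\<close>. It drops by one along every edge, so proper
    ancestors have smaller depth.\<close>
  define d where "d v = (LEAST k. (par ^^ k) v = r)" for v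
  have d: "d v = Suc (d (par v))" if v: "v \<in> {1..n}" "v \<noteq> r" for v
  proof -
    obtain k where "(par ^^ k) v = r" using reach v by blast
    then have "d v = Suc (LEAST k. (par ^^ Suc k) v = r)"
      unfolding d_def by (rule Least_Suc) (use v in simp)
    then show ?thesis by (simp add: d_def funpow_swap1)
  qed
  have dE: "u = v \<or> d v < d u" if "(u, v) \<in> E\<^sup>*" for u v
    using that
  proof (induction rule: converse_rtrancl_induct)
    case (step u w)
    have "d u = Suc (d w)" using step(1) E[of u w] d[of u] by simp
    then show ?case using step(3) by auto
  qed simp
  have sv: "single_valued E"
  proof (rule single_valuedI)
    fix x y z assume "(x, y) \<in> E" "(x, z) \<in> E"
    then show "y = z" using E[of x y] E[of x z] by simp
  qed
  define D where "D v = {u \<in> {1..n}. (u, v) \<in> E\<^sup>*}" for v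
  have finD: "finite (D v)" for v by (simp add: D_def)
  have chE: "(u, v) \<in> E" if "v \<in> {1..n}" "u \<in> {c1 v, c2 v}" "u \<noteq> 0" for u v
  proof -
    have "u \<in> {c1 v, c2 v} - {0}" using that by blast
    then have "u \<in> {u \<in> {1..n}. par u = v}" by (simp only: ch(1)[OF that(1)])
    then have "u \<in> {1..n}" "par u = v" by simp_all
    then show ?thesis using E r(2) that(1) by auto
  qed
  have main: "\<exists>T. rt T = v \<and> T \<noteq> Leaf \<and> child_ptrs c1 c2 T \<and> parent_ptrs par T \<and> set_tree T = D v \<and>
      distinct (inorder T)" if "v \<in> {1..n}" for v
    using that
  proof (induction "card (D v)" arbitrary: v rule: less_induct)
    case less
    have vD: "v \<in> D v" using less.prems by (simp add: D_def)
    have sub: "\<exists>T. rt T = u \<and> child_ptrs c1 c2 T \<and> parent_ptrs par T \<and>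
        set_tree T = (if u = 0 then {} else D u) \<and> distinct (inorder T)" if u: "u \<in> {c1 v, c2 v}" for u
    proof (cases "u = 0")
      case True
      then show ?thesis by (intro exI[of _ Leaf]) simp
    next
      case False
      have e: "(u, v) \<in> E" using chE[OF less.prems u False] .
      then have u1: "u \<in> {1..n}" using E by blast
      have "D u \<subseteq> D v" using e by (auto simp: D_def intro: rtrancl_into_rtrancl)
      moreover have "v \<notin> D u"
      proof
        assume "v \<in> D u"
        then have "v = u \<or> d u < d v" using dE by (auto simp: D_def)
        moreover have "d u = Suc (d v)" using e E d by auto
        ultimately show False by auto
      qed
      ultimately have "D u \<subset> D v" using vD by blast
      then have "card (D u) < card (D v)" using psubset_card_mono finD by blast
      then show ?thesis using less.hyps[of u] u1 False by auto
    qed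
    obtain l where l: "rt l = c1 v" "child_ptrs c1 c2 l" "parent_ptrs par l"
      "set_tree l = (if c1 v = 0 then {} else D (c1 v))" "distinct (inorder l)" using sub[of "c1 v"] by blast
    obtain t where t: "rt t = c2 v" "child_ptrs c1 c2 t" "parent_ptrs par t"
      "set_tree t = (if c2 v = 0 then {} else D (c2 v))" "distinct (inorder t)" using sub[of "c2 v"] by blast
    have v0: "v \<noteq> 0" using less.prems by simp
    have Dv: "D v = {v} \<union> set_tree l \<union> set_tree t"
    proof (intro equalityI subsetI)
      fix x assume x: "x \<in> D v"
      then have "(x, v) \<in> E\<^sup>*" "x \<in> {1..n}" by (auto simp: D_def)
      then show "x \<in> {v} \<union> set_tree l \<union> set_tree t"
      proof (cases rule: rtranclE)
        case (step w)
        then have "w \<in> {u \<in> {1..n}. par u = v}" using E by auto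
        then have "w \<in> {c1 v, c2 v} - {0}" by (simp only: ch(1)[OF less.prems])
        moreover have "x \<in> D w" using step \<open>x \<in> {1..n}\<close> by (simp add: D_def)
        ultimately show ?thesis using l(4) t(4) by auto
      qed simp
    next
      fix x assume "x \<in> {v} \<union> set_tree l \<union> set_tree t"
      then show "x \<in> D v"
        using vD l(4) t(4) chE[OF less.prems] by (auto simp: D_def split: if_splits intro: rtrancl_into_rtrancl)
    qed
    have notin: "v \<notin> D u" if "u \<in> {c1 v, c2 v}" "u \<noteq> 0" for u
    proof
      assume "v \<in> D u"
      then have "v = u \<or> d u < d v" using dE by (auto simp: D_def)
      moreover have "d u = Suc (d v)" using chE[OF less.prems that] E d by auto
      ultimately show False by auto
    qed
    \<comment> \<open>Two ancestors of one vertex are comparable because parents are unique, but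
      siblings have the same depth.\<close>
    have disj: "D (c1 v) \<inter> D (c2 v) = {}" if nz: "c1 v \<noteq> 0" "c2 v \<noteq> 0"
    proof (rule ccontr)
      assume "D (c1 v) \<inter> D (c2 v) \<noteq> {}"
      then obtain x where "(x, c1 v) \<in> E\<^sup>*" "(x, c2 v) \<in> E\<^sup>*" by (auto simp: D_def)
      then have "(c1 v, c2 v) \<in> E\<^sup>* \<or> (c2 v, c1 v) \<in> E\<^sup>*" using single_valued_confluent[OF sv] by blast
      moreover have "d (c1 v) = Suc (d v)" "d (c2 v) = Suc (d v)"
        using chE[OF less.prems] nz E d by auto
      ultimately have "c1 v = c2 v" using dE by fastforce
      then show False using ch(2)[OF less.prems] nz by simp
    qed
    show ?case
    proof (intro exI[of _ "Node l v t"] conjI)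
      show "parent_ptrs par (Node l v t)"
        using l t chE[OF less.prems] E rt_eq_0[OF l(2)] rt_eq_0[OF t(2)] by auto
      show "distinct (inorder (Node l v t))"
        using l t notin disj by (auto split: if_splits)
    qed (use l t v0 Dv in auto)
  qed
  obtain T where T: "rt T = r" "T \<noteq> Leaf" "child_ptrs c1 c2 T" "parent_ptrs par T" "set_tree T = D r"
      "distinct (inorder T)"
    using main[OF r(1)] by blast
  have "D r = {1..n}" using r(4) by (auto simp: D_def)
  moreover have "size T = card (set_tree T)"
    using distinct_card[OF T(6)] by simp
  ultimately show ?thesis using that[of T] T r(2) by simp
qed

section \<open>Pointer jumping\<close>

lemma fold_push_other:
  "(\<And>h x. (h, x) \<in> set Q \<Longrightarrow> h \<noteq> g \<and> h + 1 \<noteq> g) \<Longrightarrow> fold push_cell Q G g = G g"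
proof (induction Q arbitrary: G)
  case (Cons q Q)
  obtain h x where q: "q = (h, x)" by force
  have "fold push_cell Q (push_cell (h, x) G) g = push_cell (h, x) G g"
    by (rule Cons.IH) (use Cons.prems in auto)
  moreover have "push_cell (h, x) G g = G g" using Cons.prems[of h x] q by simp
  ultimately show ?case using q by simp
qed simp

text \<open>The cell \<open>g\<close> is written once, so the old value moved to
  \<open>g + 1\<close> is not moved again; writes to other even addresses miss both cells.\<close>

lemma fold_push_in:
  assumes "distinct (map fst Q)" "\<forall>q\<in>set Q. even (fst q)" "(g, x) \<in> set Q"
  shows "fold push_cell Q G g = x \<and> fold push_cell Q G (g + 1) = G g"
  using assms
proof (induction Q arbitrary: G)
  case (Cons q Q)
  obtain h y where q: "q = (h, y)" by force
  have ev: "even h'" if "(h', x') \<in> set Q" for h' x' using Cons.prems(2) that by auto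
  have eh: "even h" "even g" using Cons.prems(2,3) q by auto
  have hQ: "h \<notin> fst ` set Q" using Cons.prems(1) q by simp
  show ?case
  proof (cases "h = g")
    case True
    then have "(g, x) \<notin> set Q" using hQ by force
    then have "y = x" using Cons.prems(3) q True by auto
    have ne: "h' \<noteq> g \<and> h' + 1 \<noteq> g \<and> h' \<noteq> g + 1 \<and> h' + 1 \<noteq> g + 1" if "(h', x') \<in> set Q" for h' x'
    proof -
      have "h' \<noteq> g" using that hQ True by force
      moreover have "even h'" by (rule ev[OF that])
      ultimately show ?thesis using eh(2) by (metis add_right_cancel even_plus_one_iff)
    qed
    have "fold push_cell Q G' g = G' g" "fold push_cell Q G' (g + 1) = G' (g + 1)" for G'
      by (rule fold_push_other; use ne in blast)+
    then show ?thesis using q True \<open>y = x\<close> by simp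
  next
    case False
    then have gx: "(g, x) \<in> set Q" using Cons.prems(3) q by auto
    have ne: "g \<noteq> h + 1" using eh by (metis even_plus_one_iff)
    have "fold push_cell Q (push_cell (h, y) G) g = x \<and>
       fold push_cell Q (push_cell (h, y) G) (g + 1) = push_cell (h, y) G g"
      by (rule Cons.IH) (use Cons.prems(1,2) gx in auto)
    then show ?thesis using q False ne by simp
  qed
qed simp

lemma fold_push_notin:
  assumes "\<forall>q\<in>set Q. even (fst q)" "even g" "g \<notin> fst ` set Q"
  shows "fold push_cell Q G g = G g \<and> fold push_cell Q G (g + 1) = G (g + 1)"
proof
  have *: "h \<noteq> g \<and> h + 1 \<noteq> g \<and> h \<noteq> g + 1 \<and> h + 1 \<noteq> g + 1" if "(h, x) \<in> set Q" for h x
  proof -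
    have "even h" using assms(1) that by force
    moreover have "h \<noteq> g" using assms(3) that by force
    ultimately show ?thesis using assms(2) by (metis add_right_cancel even_plus_one_iff)
  qed
  show "fold push_cell Q G g = G g" "fold push_cell Q G (g + 1) = G (g + 1)"
    by (rule fold_push_other; use * in blast)+
qed

text \<open>Meant for the messages of a round. That no cell is written twice is reduced to
  recovering, from a cell, the record that writes it.\<close>

lemma distinct_fst_concat:
  assumes "distinct xs" "\<And>x. x \<in> set xs \<Longrightarrow> distinct (map fst (f x))"
    "\<And>x y g a b. x \<in> set xs \<Longrightarrow> y \<in> set xs \<Longrightarrow> (g, a) \<in> set (f x) \<Longrightarrow> (g, b) \<in> set (f y) \<Longrightarrow> x = y"
  shows "distinct (map fst (concat (map f xs)))"
  using assms
proof (induction xs)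
  case (Cons x xs)
  have "distinct (map fst (concat (map f xs)))"
  proof (rule Cons.IH)
    show "distinct xs" using Cons.prems(1) by simp
    show "\<And>y. y \<in> set xs \<Longrightarrow> distinct (map fst (f y))" using Cons.prems(2) by simp
    fix y z g a b
    assume "y \<in> set xs" "z \<in> set xs" "(g, a) \<in> set (f y)" "(g, b) \<in> set (f z)"
    then show "y = z" by (intro Cons.prems(3)[of y z g a b]) simp_all
  qed
  moreover have "fst ` set (f x) \<inter> fst ` set (concat (map f xs)) = {}"
  proof (rule ccontr)
    assume "fst ` set (f x) \<inter> fst ` set (concat (map f xs)) \<noteq> {}"
    then obtain g where g: "g \<in> fst ` set (f x)" "g \<in> fst ` set (concat (map f xs))" by blast
    from g(1) obtain a where "(g, a) \<in> set (f x)" by force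
    moreover from g(2) obtain y b where "y \<in> set xs" "(g, b) \<in> set (f y)" by auto
    ultimately obtain a b y where y: "(g, a) \<in> set (f x)" "y \<in> set xs" "(g, b) \<in> set (f y)" by blast
    then have "x = y" by (intro Cons.prems(3)[of x y g a b]) simp_all
    then show False using y Cons.prems(1) by simp
  qed
  ultimately show ?case using Cons.prems(2)[of x] by (simp add: image_Un image_UN)
qed simp

text \<open>If no cell is written twice, a machine receives at most one write per cell, so the
  communication bound follows from the memory bound.\<close>

lemma fits_distinct:
  assumes "distinct (map fst Q)" "\<forall>q\<in>set Q. even (fst q)" "0 < SZ"
  shows "fits m SZ Q"
  unfolding fits_def
proof (intro conjI allI impI)
  fix i
  have "distinct (map fst (filter (\<lambda>(g, x). g div SZ = i) Q))"
    using assms(1) by (simp add: distinct_map_filter)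
  moreover have "inj_on (\<lambda>g. g mod SZ) (set (map fst (filter (\<lambda>(g, x). g div SZ = i) Q)))"
    by (rule inj_onI) (auto, metis mult_div_mod_eq)
  ultimately have "distinct (map (\<lambda>g. g mod SZ) (map fst (filter (\<lambda>(g, x). g div SZ = i) Q)))"
    by (simp only: distinct_map simp_thms)
  moreover have "map (\<lambda>g. g mod SZ) (map fst (filter (\<lambda>(g, x). g div SZ = i) Q)) = map fst (local_q SZ i Q)"
    by (simp add: local_q_def o_def case_prod_beta)
  ultimately have d: "distinct (map fst (local_q SZ i Q))" by simp
  have "set (map fst (local_q SZ i Q)) \<subseteq> {..<SZ}" using assms(3) by (auto simp: local_q_def)
  then have "card (set (map fst (local_q SZ i Q))) \<le> card {..<SZ}" by (intro card_mono) auto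
  then have "length (local_q SZ i Q) \<le> SZ" using distinct_card[OF d] by simp
  then show "length (local_q SZ i Q) \<le> 2 * SZ" by simp
qed (use assms(2) in auto)

lemma dvd_32_offsets:
  assumes "32 dvd a" "32 dvd (b :: nat)"
  shows "a + 2 \<noteq> b" "a + 2 \<noteq> b + 4" "a + 4 \<noteq> b" "a + 4 \<noteq> b + 2"
    "b \<noteq> a + 2" "b \<noteq> a + 4" "a \<noteq> b + 2" "a \<noteq> b + 4" "b + 2 \<noteq> a" "b + 4 \<noteq> a"
proof -
  obtain i j where "a = 32 * i" "b = 32 * j" using assms unfolding dvd_def by blast
  then show "a + 2 \<noteq> b" "a + 2 \<noteq> b + 4" "a + 4 \<noteq> b" "a + 4 \<noteq> b + 2"
    "b \<noteq> a + 2" "b \<noteq> a + 4" "a \<noteq> b + 2" "a \<noteq> b + 4" "b + 2 \<noteq> a" "b + 4 \<noteq> a" by presburger+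
qed

lemma in_gmsgs: "q \<in> set (gmsgs c msgs n G X) \<longleftrightarrow> (\<exists>k<X. q \<in> set (msgs n (\<lambda>f. G (c * k + f)) (c * k)))"
  by (auto simp: gmsgs_def)

text \<open>\<open>H\<close> is the number of vertex records per machine and \<open>M\<close> the
  modulus of word arithmetic. \<open>room\<close> counts \<open>n + 1\<close> records, because
  record 0 receives the message of the root.\<close>

locale run_data =
  fixes n m H J M :: nat and par :: "nat \<Rightarrow> nat"
  assumes n: "0 < n" and H: "0 < H" and m: "0 < m" and room: "128 * (n + 1) \<le> m * (128 * H)"
    and M: "m * (128 * H) + 1000 < M" and J: "4 * n \<le> 2 ^ J" and par: "\<And>v. v \<in> {1..n} \<Longrightarrow> par v \<le> n"
begin

definition "V = {1..n}"

definition is_tour :: "nat tree \<Rightarrow> bool" where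
  "is_tour T \<longleftrightarrow> T \<noteq> Leaf \<and> set_tree T = V \<and> size T = n \<and> distinct (inorder T) \<and> parent_ptrs par T \<and> par (rt T) = 0"

text \<open>Vertex records and tour slots share one address space without overlap: modulo 32,
  records use the residues 0 to 7 and slots the residues 8 to 16. The last line says that the slots
  are still blank.\<close>

definition vert :: "(nat \<Rightarrow> nat) \<Rightarrow> (nat \<Rightarrow> nat) \<Rightarrow> (nat \<Rightarrow> nat) \<Rightarrow> bool" where
  "vert G c1 c2 \<longleftrightarrow>
     (\<forall>v\<in>V. G (128 * v + 38) = 128 * par v + 1 \<and> G (128 * v + 6) = 128 * c1 v \<and> G (128 * v + 7) = 128 * c2 v) \<and>
     (\<forall>v. v \<notin> V \<longrightarrow> G (128 * v + 38) = 0) \<and>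
     (\<forall>k. \<forall>f\<in>{8, 10, 12, 14, 16}. G (32 * k + f) = 0)"

text \<open>The linked list after \<open>k\<close> doublings. The count is the sum of two cells
  because the latest increment has arrived but is not merged. The last line keeps addresses that are
  no tour items silent.\<close>

definition tours :: "nat \<Rightarrow> (nat \<Rightarrow> nat) \<Rightarrow> nat list \<Rightarrow> bool" where
  "tours k G L \<longleftrightarrow>
     (\<forall>i<length L. G (L ! i) = (if i + 2 ^ k < length L then L ! (i + 2 ^ k) else 0) \<and>
        G (L ! i + 2) = (if 2 ^ k \<le> i then L ! (i - 2 ^ k) else 0) \<and>
        G (L ! i + 4) + G (L ! i + 5) = min (2 ^ k) (length L - i)) \<and>
     (\<forall>x. 32 dvd x \<longrightarrow> x \<notin> set L \<longrightarrow> G x = 0 \<and> G (x + 2) = 0)"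

lemma tour_facts:
  assumes "is_tour T"
  shows "length (tour T) = 3 * n" "distinct (tour T)"
    "x \<in> set (tour T) \<longleftrightarrow> (\<exists>v\<in>V. x = 128 * v \<or> x = 128 * v + 32 \<or> x = 128 * v + 64)"
    "x \<in> set (tour T) \<Longrightarrow> 32 dvd x \<and> 128 \<le> x \<and> x + 64 \<le> 128 * (n + 1)"
proof -
  show "length (tour T) = 3 * n" "distinct (tour T)" using assms by (auto simp: is_tour_def distinct_tour)
  show s: "x \<in> set (tour T) \<longleftrightarrow> (\<exists>v\<in>V. x = 128 * v \<or> x = 128 * v + 32 \<or> x = 128 * v + 64)"
    using assms by (auto simp: is_tour_def set_tour)
  show "32 dvd x \<and> 128 \<le> x \<and> x + 64 \<le> 128 * (n + 1)" if x: "x \<in> set (tour T)"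
  proof -
    obtain v where v: "1 \<le> v" "v \<le> n" "x = 128 * v \<or> x = 128 * v + 32 \<or> x = 128 * v + 64"
      using s x by (auto simp: V_def)
    have "32 dvd x" using v(3) by (elim disjE) presburger+
    then show ?thesis using v by auto
  qed
qed

text \<open>Writes to residues 0, 2 and 4 modulo 32 change residues up to 5 only, while all cells of
  \<open>vert\<close> have residue 6 or more.\<close>

lemma vert_preserved:
  assumes "vert G c1 c2" "\<And>h x. (h, x) \<in> set Q \<Longrightarrow> h mod 32 \<in> {0, 2, 4}"
    "\<And>g. 6 \<le> g mod 32 \<Longrightarrow> G' g = G g"
  shows "vert (fold push_cell Q G') c1 c2"
proof -
  have e: "fold push_cell Q G' g = G g" if "6 \<le> g mod 32" for g
  proof -
    have "h \<noteq> g \<and> h + 1 \<noteq> g" if "(h, x) \<in> set Q" for h x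
    proof -
      have "h mod 32 \<le> 4" using assms(2)[OF that] by auto
      moreover from this have "(h + 1) mod 32 \<le> 5" by presburger
      ultimately show ?thesis using \<open>6 \<le> g mod 32\<close> by auto
    qed
    then show ?thesis using fold_push_other[of Q g G'] assms(3)[OF that] by auto
  qed
  have "fold push_cell Q G' (128 * v + 38) = G (128 * v + 38)"
    "fold push_cell Q G' (128 * v + 6) = G (128 * v + 6)"
    "fold push_cell Q G' (128 * v + 7) = G (128 * v + 7)" for v
    by (rule e, presburger)+
  moreover have "fold push_cell Q G' (32 * k + f) = G (32 * k + f)" if "f \<in> {8, 10, 12, 14, 16}" for k f
    by (rule e) (use that in auto)
  ultimately show ?thesis using assms(1) unfolding vert_def by (simp only: refl cong: ball_cong) simp
qed

text \<open>Distances \<open>2 ^ k\<close> add up to \<open>2 ^ Suc k\<close>, and the counts of two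
  adjacent stretches add up likewise. Once the distance exceeds the tour there is nothing left to
  send, and the merged counters are the ranks from the end.\<close>

lemma jump_step:
  assumes T: "is_tour T" and G: "tours k G (tour T)" "vert G c1 c2"
  defines "Q \<equiv> gmsgs 32 (jump_msgs M) n G (m * (4 * H))" and "G' \<equiv> gnew 32 (jump_new M) G"
  shows "tours (Suc k) (fold push_cell Q G') (tour T) \<and> vert (fold push_cell Q G') c1 c2 \<and>
    fits m (128 * H) Q \<and> (J \<le> k \<longrightarrow> Q = [] \<and> (\<forall>i<3 * n. G' (tour T ! i + 4) = 3 * n - i \<and> G' (tour T ! i + 5) = 0))"
proof -
  define L where "L = tour T"
  note L = tour_facts[OF T, folded L_def]
  have K: "32 * (m * (4 * H)) = m * (128 * H)" by simp
  define N P R where "N x = G x" and "P x = G (x + 2)" and "R x = G (x + 4) + G (x + 5)" for x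
  have item: "L ! i \<in> set L" if "i < 3 * n" for i using that L(1) by simp
  have dL: "32 dvd L ! i" if "i < 3 * n" for i using L(4)[OF item[OF that]] by blast
  have inj: "i = j" if "i < 3 * n" "j < 3 * n" "L ! i = L ! j" for i j
    using that L(1,2) by (simp add: nth_eq_iff_index_eq)
  have pos: "L ! i \<noteq> 0" if "i < 3 * n" for i using L(4)[OF item[OF that]] by auto
  have NPR: "N (L ! i) = (if i + 2 ^ k < 3 * n then L ! (i + 2 ^ k) else 0)"
    "P (L ! i) = (if 2 ^ k \<le> i then L ! (i - 2 ^ k) else 0)" "R (L ! i) = min (2 ^ k) (3 * n - i)"
    if "i < 3 * n" for i
    using that G(1) L(1) unfolding tours_def L_def[symmetric] N_def P_def R_def by auto
  have NP0: "N x = 0" "P x = 0" if "32 dvd x" "x \<notin> set L" for x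
    using that G(1) unfolding tours_def L_def[symmetric] N_def P_def by auto
  have Nin: "\<exists>i. i + 2 ^ k < 3 * n \<and> x = L ! i \<and> N x = L ! (i + 2 ^ k)" if "32 dvd x" "N x \<noteq> 0" for x
  proof -
    have "x \<in> set L" using NP0(1)[OF that(1)] that(2) by (rule_tac ccontr) simp
    then obtain i where i: "i < 3 * n" "x = L ! i" unfolding in_set_conv_nth L(1) by blast
    then show ?thesis using NPR(1)[OF i(1)] that(2) by (intro exI[of _ i]) (simp split: if_splits)
  qed
  have Pin: "\<exists>i. 2 ^ k \<le> i \<and> i < 3 * n \<and> x = L ! i \<and> P x = L ! (i - 2 ^ k)" if "32 dvd x" "P x \<noteq> 0" for x
  proof -
    have "x \<in> set L" using NP0(2)[OF that(1)] that(2) by (rule_tac ccontr) simp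
    then obtain i where i: "i < 3 * n" "x = L ! i" unfolding in_set_conv_nth L(1) by blast
    then show ?thesis using NPR(2)[OF i(1)] that(2) by (intro exI[of _ i]) (simp split: if_splits)
  qed
  have small: "L ! i + 4 < M" "(L ! i + 2) mod M = L ! i + 2" "(L ! i + 4) mod M = L ! i + 4" "L ! i mod M = L ! i"
     if "i < 3 * n" for i
  proof -
    show "L ! i + 4 < M" using L(4)[OF item[OF that]] room M by linarith
    then show "(L ! i + 2) mod M = L ! i + 2" "(L ! i + 4) mod M = L ! i + 4" "L ! i mod M = L ! i" by simp_all
  qed
  have n3: "3 * n < M" using room M by simp
  have RM: "R (L ! i) mod M = R (L ! i)" if "i < 3 * n" for i using NPR(3)[OF that] n3 by simp
  define ms where "ms x = jump_msgs M n (\<lambda>f. G (x + f)) x" for x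
  have ms: "ms x = (if N x \<noteq> 0 then [(N x + 2, P x)] else []) @
      (if P x \<noteq> 0 then [(P x, N x), (P x + 4, R x)] else [])" if x: "32 dvd x" for x
  proof -
    have a: "(N x + 2) mod M = N x + 2" if "N x \<noteq> 0"
      using Nin[OF x that] small by auto
    have b: "P x mod M = P x" "(P x + 4) mod M = P x + 4" "R x mod M = R x" if nz: "P x \<noteq> 0"
    proof -
      obtain i where i: "2 ^ k \<le> i" "i < 3 * n" "x = L ! i" "P x = L ! (i - 2 ^ k)" using Pin[OF x nz] by blast
      then show "P x mod M = P x" "(P x + 4) mod M = P x + 4" "R x mod M = R x"
        using small[of "i - 2 ^ k"] RM[of i] by simp_all
    qed
    show ?thesis using a b by (simp add: ms_def jump_msgs_def N_def P_def R_def)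
  qed
  have Qset: "q \<in> set Q \<longleftrightarrow> (\<exists>i<3 * n. q \<in> set (ms (L ! i)))" for q
  proof
    assume "q \<in> set Q"
    then obtain j where j: "j < m * (4 * H)" "q \<in> set (ms (32 * j))" by (auto simp: Q_def in_gmsgs ms_def)
    then have "N (32 * j) \<noteq> 0 \<or> P (32 * j) \<noteq> 0" using ms[of "32 * j"] by (auto split: if_splits)
    then have "32 * j \<in> set L" by (rule_tac ccontr) (use NP0[of "32 * j"] in simp)
    then obtain i where "i < 3 * n" "32 * j = L ! i" unfolding in_set_conv_nth L(1) by metis
    then show "\<exists>i<3 * n. q \<in> set (ms (L ! i))" using j(2) by (intro exI[of _ i]) simp
  next
    assume "\<exists>i<3 * n. q \<in> set (ms (L ! i))"
    then obtain i where i: "i < 3 * n" "q \<in> set (ms (L ! i))" by blast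
    then obtain j where j: "L ! i = 32 * j" using L(4)[OF item] by (meson dvdE)
    have "32 * j < 32 * (m * (4 * H))" unfolding K using L(4)[OF item[OF i(1)]] room j by linarith
    then have "j < m * (4 * H)" by (simp only: mult_less_cancel1)
    moreover have "q \<in> set (jump_msgs M n (\<lambda>f. G (32 * j + f)) (32 * j))" using i(2) by (simp add: ms_def j)
    ultimately show "q \<in> set Q" unfolding Q_def in_gmsgs by blast
  qed
  \<comment> \<open>The messages as seen by the receivers: position \<open>i\<close> learns its new
    next pointer and its increment from position \<open>i + 2 ^ k\<close>, which in turn learns its
    new previous pointer from \<open>i\<close>.\<close>
  have Q_iff: "(g, x) \<in> set Q \<longleftrightarrow>
      (\<exists>i. i + 2 ^ k < 3 * n \<and> g = L ! (i + 2 ^ k) + 2 \<and> x = P (L ! i)) \<or>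
      (\<exists>i. i + 2 ^ k < 3 * n \<and> g = L ! i \<and> x = N (L ! (i + 2 ^ k))) \<or>
      (\<exists>i. i + 2 ^ k < 3 * n \<and> g = L ! i + 4 \<and> x = R (L ! (i + 2 ^ k)))" (is "_ \<longleftrightarrow> ?A \<or> ?B \<or> ?C") for g x
  proof
    assume "(g, x) \<in> set Q"
    then obtain i where i: "i < 3 * n" "(g, x) \<in> set (ms (L ! i))" using Qset by blast
    have d: "32 dvd L ! i" using L(4)[OF item[OF i(1)]] by blast
    from i(2) consider "N (L ! i) \<noteq> 0" "g = N (L ! i) + 2" "x = P (L ! i)"
      | "P (L ! i) \<noteq> 0" "g = P (L ! i) \<and> x = N (L ! i) \<or> g = P (L ! i) + 4 \<and> x = R (L ! i)"
      unfolding ms[OF d] by (auto split: if_splits)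
    then show "?A \<or> ?B \<or> ?C"
    proof cases
      case 1
      then show ?thesis using NPR(1)[OF i(1)] by (auto split: if_splits)
    next
      case 2
      then have "2 ^ k \<le> i" "P (L ! i) = L ! (i - 2 ^ k)" using NPR(2)[OF i(1)] by (auto split: if_splits)
      then have "(i - 2 ^ k) + 2 ^ k < 3 * n" "(i - 2 ^ k) + 2 ^ k = i" using i by auto
      then show ?thesis using 2(2) \<open>P (L ! i) = L ! (i - 2 ^ k)\<close> by metis
    qed
  next
    have A: "(L ! (i + 2 ^ k) + 2, P (L ! i)) \<in> set Q" if "i + 2 ^ k < 3 * n" for i
    proof -
      have i: "i < 3 * n" using that by simp
      have "32 dvd L ! i" using L(4)[OF item[OF i]] by blast
      then have "(L ! (i + 2 ^ k) + 2, P (L ! i)) \<in> set (ms (L ! i))"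
        using that NPR(1)[OF i] pos[OF that] by (simp add: ms)
      then show ?thesis using Qset i by blast
    qed
    have B: "(L ! i, N (L ! (i + 2 ^ k))) \<in> set Q \<and> (L ! i + 4, R (L ! (i + 2 ^ k))) \<in> set Q" if "i + 2 ^ k < 3 * n" for i
    proof -
      have i: "i < 3 * n" using that by simp
      have "32 dvd L ! (i + 2 ^ k)" using L(4)[OF item[OF that]] by blast
      moreover have "P (L ! (i + 2 ^ k)) = L ! i" using NPR(2)[OF that] by simp
      ultimately have "(L ! i, N (L ! (i + 2 ^ k))) \<in> set (ms (L ! (i + 2 ^ k)))"
        "(L ! i + 4, R (L ! (i + 2 ^ k))) \<in> set (ms (L ! (i + 2 ^ k)))" using pos[OF i] by (auto simp: ms)
      then show ?thesis using Qset that by blast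
    qed
    assume "?A \<or> ?B \<or> ?C"
    then show "(g, x) \<in> set Q" using A B by blast
  qed
  have mod32: "L ! i mod 32 = 0" if "i < 3 * n" for i using L(4)[OF item[OF that]] by auto
  have mods: "(L ! i + 2) mod 32 = 2" "(L ! i + 4) mod 32 = 4" if "i < 3 * n" for i
    using mod32[OF that] by presburger+
  have Qmod: "h mod 32 \<in> {0, 2, 4}" if "(h, x) \<in> set Q" for h x
    using that mod32 mods unfolding Q_iff by auto
  have Qeven: "even h" if "(h, x) \<in> set Q" for h x
  proof -
    have "h mod 32 = 0 \<or> h mod 32 = 2 \<or> h mod 32 = 4" using Qmod[OF that] by simp
    then show ?thesis by presburger
  qed
  have Qev: "\<forall>q\<in>set Q. even (fst q)" using Qeven by (metis prod.collapse)
  \<comment> \<open>The pointers are injective since the tour has no repetitions, and the offsets 0,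
    2 and 4 from multiples of 32 separate the three kinds of messages.\<close>
  have dist: "distinct (map fst Q)"
    unfolding Q_def gmsgs_def
  proof (rule distinct_fst_concat)
    have kk: "\<And>j. jump_msgs M n (\<lambda>f. G (32 * j + f)) (32 * j) = ms (32 * j)" by (simp add: ms_def)
    fix j assume "j \<in> set [0..<m * (4 * H)]"
    have Nd: "32 dvd N (32 * j)" if nz: "N (32 * j) \<noteq> 0"
    proof -
      obtain i where i: "i + 2 ^ k < 3 * n" "N (32 * j) = L ! (i + 2 ^ k)" using Nin[OF _ nz] by auto
      then show ?thesis using dL[OF i(1)] by simp
    qed
    have Pd: "32 dvd P (32 * j)" if nz: "P (32 * j) \<noteq> 0"
    proof -
      obtain i where i: "i < 3 * n" "P (32 * j) = L ! (i - 2 ^ k)" using Pin[OF _ nz] by auto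
      then show ?thesis using dL[of "i - 2 ^ k"] by simp
    qed
    have "N (32 * j) + 2 \<noteq> P (32 * j)" "N (32 * j) + 2 \<noteq> P (32 * j) + 4" if "N (32 * j) \<noteq> 0" "P (32 * j) \<noteq> 0"
      using dvd_32_offsets[OF Nd[OF that(1)] Pd[OF that(2)]] by blast+
    then show "distinct (map fst (jump_msgs M n (\<lambda>f. G (32 * j + f)) (32 * j)))"
      unfolding kk ms[OF dvd_triv_left] by auto
  next
    have kk: "\<And>j. jump_msgs M n (\<lambda>f. G (32 * j + f)) (32 * j) = ms (32 * j)" by (simp add: ms_def)
    fix x y g a b assume "(g, a) \<in> set (jump_msgs M n (\<lambda>f. G (32 * x + f)) (32 * x))"
      "(g, b) \<in> set (jump_msgs M n (\<lambda>f. G (32 * y + f)) (32 * y))"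
    then have gx: "(N (32 * x) \<noteq> 0 \<and> g = N (32 * x) + 2) \<or> (P (32 * x) \<noteq> 0 \<and> (g = P (32 * x) \<or> g = P (32 * x) + 4))"
      and gy: "(N (32 * y) \<noteq> 0 \<and> g = N (32 * y) + 2) \<or> (P (32 * y) \<noteq> 0 \<and> (g = P (32 * y) \<or> g = P (32 * y) + 4))"
      unfolding kk ms[OF dvd_triv_left] by (auto split: if_splits)
    have Nd: "32 dvd N (32 * j)" if nz: "N (32 * j) \<noteq> 0" for j
    proof -
      obtain i where i: "i + 2 ^ k < 3 * n" "N (32 * j) = L ! (i + 2 ^ k)" using Nin[OF _ nz] by auto
      then show ?thesis using dL[OF i(1)] by simp
    qed
    have Pd: "32 dvd P (32 * j)" if nz: "P (32 * j) \<noteq> 0" for j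
    proof -
      obtain i where i: "i < 3 * n" "P (32 * j) = L ! (i - 2 ^ k)" using Pin[OF _ nz] by auto
      then show ?thesis using dL[of "i - 2 ^ k"] by simp
    qed
    have NN: "x = y" if xy: "N (32 * x) \<noteq> 0" "N (32 * x) = N (32 * y)"
    proof -
      obtain i where i: "i + 2 ^ k < 3 * n" "32 * x = L ! i" "N (32 * x) = L ! (i + 2 ^ k)"
        using Nin[of "32 * x"] xy by auto
      obtain j where j: "j + 2 ^ k < 3 * n" "32 * y = L ! j" "N (32 * y) = L ! (j + 2 ^ k)"
        using Nin[of "32 * y"] xy by auto
      have "i + 2 ^ k = j + 2 ^ k" by (rule inj) (use i j xy in auto)
      then have "32 * x = 32 * y" using i j by simp
      then show ?thesis by simp
    qed
    have PP: "x = y" if xy: "P (32 * x) \<noteq> 0" "P (32 * x) = P (32 * y)"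
    proof -
      obtain i where i: "2 ^ k \<le> i" "i < 3 * n" "32 * x = L ! i" "P (32 * x) = L ! (i - 2 ^ k)"
        using Pin[of "32 * x"] xy by auto
      obtain j where j: "2 ^ k \<le> j" "j < 3 * n" "32 * y = L ! j" "P (32 * y) = L ! (j - 2 ^ k)"
        using Pin[of "32 * y"] xy by auto
      have "i - 2 ^ k = j - 2 ^ k" by (rule inj) (use i j xy in auto)
      then have "i = j" using i j by linarith
      then have "32 * x = 32 * y" using i j by simp
      then show ?thesis by simp
    qed
    consider "N (32 * x) \<noteq> 0" "g = N (32 * x) + 2" "N (32 * y) \<noteq> 0" "g = N (32 * y) + 2"
      | "P (32 * x) \<noteq> 0" "P (32 * y) \<noteq> 0" "g = P (32 * x) \<or> g = P (32 * x) + 4" "g = P (32 * y) \<or> g = P (32 * y) + 4"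
      | "N (32 * x) \<noteq> 0" "g = N (32 * x) + 2" "P (32 * y) \<noteq> 0" "g = P (32 * y) \<or> g = P (32 * y) + 4"
      | "P (32 * x) \<noteq> 0" "g = P (32 * x) \<or> g = P (32 * x) + 4" "N (32 * y) \<noteq> 0" "g = N (32 * y) + 2"
      using gx gy by blast
    then show "x = y"
    proof cases
      case 1
      then have "N (32 * x) = N (32 * y)" by simp
      then show ?thesis using NN[OF 1(1)] by blast
    next
      case 2
      note dvd_32_offsets[OF Pd[OF 2(1)] Pd[OF 2(2)]]
      with 2(3,4) have "P (32 * x) = P (32 * y)" by auto
      then show ?thesis using PP 2(1) by blast
    next
      case 3
      from 3(2,4) dvd_32_offsets(1,2)[OF Nd[OF 3(1)] Pd[OF 3(3)]] show ?thesis by metis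
    next
      case 4
      from 4(2,4) dvd_32_offsets(1,2)[OF Nd[OF 4(3)] Pd[OF 4(1)]] show ?thesis by metis
    qed
  qed simp
  have G': "G' g = G g" if "g mod 32 \<notin> {4, 5}" for g
    using that mod_less_eq_dividend[of g 32] by (simp add: G'_def gnew_def jump_new_def)
  have G'4: "G' (x + 4) = R x mod M" "G' (x + 5) = 0" if "32 dvd x" for x
  proof -
    have "(x + 4) mod 32 = 4" "(x + 5) mod 32 = 5" using that by presburger+
    then show "G' (x + 4) = R x mod M" "G' (x + 5) = 0"
      by (simp_all add: G'_def gnew_def jump_new_def R_def)
  qed
  have G'NP: "G' x = N x" "G' (x + 2) = P x" if "32 dvd x" for x
  proof -
    have "x mod 32 = 0" "(x + 2) mod 32 = 2" using that by presburger+
    then show "G' x = N x" "G' (x + 2) = P x" using G' by (simp_all add: N_def P_def)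
  qed
  have in_N: "L ! i \<in> fst ` set Q \<longleftrightarrow> i + 2 ^ k < 3 * n" if "i < 3 * n" for i
  proof
    assume "L ! i \<in> fst ` set Q"
    then obtain x where "(L ! i, x) \<in> set Q" by force
    then obtain j where j: "j + 2 ^ k < 3 * n" "L ! i = L ! (j + 2 ^ k) + 2 \<or> L ! i = L ! j \<or> L ! i = L ! j + 4"
      unfolding Q_iff by blast
    have j': "j < 3 * n" using j(1) by simp
    have "L ! i = L ! j" using j(2) dvd_32_offsets[OF dL[OF that] dL[OF j(1)]] dvd_32_offsets[OF dL[OF that] dL[OF j']] by blast
    then have "i = j" by (rule inj[OF that j'])
    then show "i + 2 ^ k < 3 * n" using j(1) by simp
  next
    assume "i + 2 ^ k < 3 * n"
    then have "(L ! i, N (L ! (i + 2 ^ k))) \<in> set Q" unfolding Q_iff by blast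
    then show "L ! i \<in> fst ` set Q" by force
  qed
  have in_P: "L ! i + 2 \<in> fst ` set Q \<longleftrightarrow> 2 ^ k \<le> i" if "i < 3 * n" for i
  proof
    assume "L ! i + 2 \<in> fst ` set Q"
    then obtain x where "(L ! i + 2, x) \<in> set Q" by force
    then obtain j where j: "j + 2 ^ k < 3 * n" "L ! i + 2 = L ! (j + 2 ^ k) + 2 \<or> L ! i + 2 = L ! j \<or> L ! i + 2 = L ! j + 4"
      unfolding Q_iff by blast
    have j': "j < 3 * n" using j(1) by simp
    note dvd_32_offsets[OF dL[OF that] dL[OF j']]
    with j(2) have "L ! i = L ! (j + 2 ^ k)" by simp
    then have "i = j + 2 ^ k" by (rule inj[OF that j(1)])
    then show "2 ^ k \<le> i" by simp
  next
    assume "2 ^ k \<le> i"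
    then have "(L ! i + 2, P (L ! (i - 2 ^ k))) \<in> set Q" unfolding Q_iff using that by (intro disjI1 exI[of _ "i - 2 ^ k"]) simp
    then show "L ! i + 2 \<in> fst ` set Q" by force
  qed
  have in_R: "L ! i + 4 \<in> fst ` set Q \<longleftrightarrow> i + 2 ^ k < 3 * n" if "i < 3 * n" for i
  proof
    assume "L ! i + 4 \<in> fst ` set Q"
    then obtain x where "(L ! i + 4, x) \<in> set Q" by force
    then obtain j where j: "j + 2 ^ k < 3 * n" "L ! i + 4 = L ! (j + 2 ^ k) + 2 \<or> L ! i + 4 = L ! j \<or> L ! i + 4 = L ! j + 4"
      unfolding Q_iff by blast
    have j': "j < 3 * n" using j(1) by simp
    note dvd_32_offsets[OF dL[OF that] dL[OF j']] dvd_32_offsets[OF dL[OF that] dL[OF j(1)]]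
    with j(2) have "L ! i = L ! j" by simp
    then have "i = j" by (rule inj[OF that j'])
    then show "i + 2 ^ k < 3 * n" using j(1) by simp
  next
    assume "i + 2 ^ k < 3 * n"
    then have "(L ! i + 4, R (L ! (i + 2 ^ k))) \<in> set Q" unfolding Q_iff by blast
    then show "L ! i + 4 \<in> fst ` set Q" by force
  qed
  have items_only: "x \<notin> fst ` set Q" "x + 2 \<notin> fst ` set Q" if "32 dvd x" "x \<notin> set L" for x
  proof -
    have d: "32 dvd L ! j" "L ! j \<noteq> x" if "j < 3 * n" for j using L(4)[OF item[OF that]] item[OF that] \<open>x \<notin> set L\<close> by auto
    have lt: "j < 3 * n" if "j + 2 ^ k < 3 * n" for j using that by simp
    show "x \<notin> fst ` set Q"
    proof
      assume "x \<in> fst ` set Q"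
      then obtain y where "(x, y) \<in> set Q" by force
      then obtain j where j: "j + 2 ^ k < 3 * n" "x = L ! (j + 2 ^ k) + 2 \<or> x = L ! j \<or> x = L ! j + 4"
        unfolding Q_iff by blast
      note dvd_32_offsets[OF d(1)[OF j(1)] that(1)] dvd_32_offsets[OF d(1)[OF lt[OF j(1)]] that(1)] d(2)[OF lt[OF j(1)]]
      with j(2) show False by auto
    qed
    show "x + 2 \<notin> fst ` set Q"
    proof
      assume "x + 2 \<in> fst ` set Q"
      then obtain y where "(x + 2, y) \<in> set Q" by force
      then obtain j where j: "j + 2 ^ k < 3 * n" "x + 2 = L ! (j + 2 ^ k) + 2 \<or> x + 2 = L ! j \<or> x + 2 = L ! j + 4"
        unfolding Q_iff by blast
      note dvd_32_offsets[OF that(1) d(1)[OF lt[OF j(1)]]] d(2)[OF j(1)]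
      with j(2) show False by auto
    qed
  qed
  have ev: "even x" if "32 dvd x" for x :: nat using that by presburger
  have "tours (Suc k) (fold push_cell Q G') L"
    unfolding tours_def
  proof (intro conjI allI impI)
    fix i assume "i < length L"
    then have i: "i < 3 * n" using L(1) by simp
    have d: "32 dvd L ! i" using L(4)[OF item[OF i]] by blast
    show "fold push_cell Q G' (L ! i) = (if i + 2 ^ Suc k < length L then L ! (i + 2 ^ Suc k) else 0)"
    proof (cases "i + 2 ^ k < 3 * n")
      case True
      then have "(L ! i, N (L ! (i + 2 ^ k))) \<in> set Q" unfolding Q_iff by blast
      then have "fold push_cell Q G' (L ! i) = N (L ! (i + 2 ^ k))" using fold_push_in[OF dist Qev] by blast
      then show ?thesis using NPR(1)[OF True] L(1) by (simp add: add.assoc mult_2)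
    next
      case False
      then have "fold push_cell Q G' (L ! i) = G' (L ! i)"
        using fold_push_notin[OF Qev ev[OF d]] in_N[OF i] by blast
      then show ?thesis using G'NP(1)[OF d] NPR(1)[OF i] False L(1) by simp
    qed
    show "fold push_cell Q G' (L ! i + 2) = (if 2 ^ Suc k \<le> i then L ! (i - 2 ^ Suc k) else 0)"
    proof (cases "2 ^ k \<le> i")
      case True
      have i': "i - 2 ^ k < 3 * n" using i by simp
      have "(L ! i + 2, P (L ! (i - 2 ^ k))) \<in> set Q"
        unfolding Q_iff using True i by (intro disjI1 exI[of _ "i - 2 ^ k"]) simp
      then have "fold push_cell Q G' (L ! i + 2) = P (L ! (i - 2 ^ k))" using fold_push_in[OF dist Qev] by blast
      moreover have "2 ^ k \<le> i - 2 ^ k \<longleftrightarrow> 2 ^ Suc k \<le> i" "i - 2 ^ k - 2 ^ k = i - 2 ^ Suc k" using True by auto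
      ultimately show ?thesis using NPR(2)[OF i'] by simp
    next
      case False
      then have "fold push_cell Q G' (L ! i + 2) = G' (L ! i + 2)"
        using fold_push_notin[OF Qev, where g = "L ! i + 2"] ev[OF d] in_P[OF i] by auto
      then show ?thesis using G'NP(2)[OF d] NPR(2)[OF i] False by simp
    qed
    have e5: "L ! i + 4 + 1 = L ! i + 5" by simp
    show "fold push_cell Q G' (L ! i + 4) + fold push_cell Q G' (L ! i + 5) = min (2 ^ Suc k) (length L - i)"
    proof (cases "i + 2 ^ k < 3 * n")
      case True
      then have "(L ! i + 4, R (L ! (i + 2 ^ k))) \<in> set Q" unfolding Q_iff by blast
      then have "fold push_cell Q G' (L ! i + 4) = R (L ! (i + 2 ^ k)) \<and> fold push_cell Q G' (L ! i + 4 + 1) = G' (L ! i + 4)"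
        using fold_push_in[OF dist Qev] by blast
      then have "fold push_cell Q G' (L ! i + 4) = R (L ! (i + 2 ^ k)) \<and> fold push_cell Q G' (L ! i + 5) = G' (L ! i + 4)"
        unfolding e5 .
      then show ?thesis
        using NPR(3)[OF True] NPR(3)[OF i] G'4(1)[OF d] RM[OF i] True L(1) by simp
    next
      case False
      then have "fold push_cell Q G' (L ! i + 4) = G' (L ! i + 4) \<and> fold push_cell Q G' (L ! i + 4 + 1) = G' (L ! i + 4 + 1)"
        using fold_push_notin[OF Qev, where g = "L ! i + 4"] ev[OF d] in_R[OF i] by auto
      then have "fold push_cell Q G' (L ! i + 4) = G' (L ! i + 4) \<and> fold push_cell Q G' (L ! i + 5) = G' (L ! i + 5)"
        unfolding e5 .
      then show ?thesis
        using NPR(3)[OF i] G'4[OF d] RM[OF i] False L(1) by simp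
    qed
  next
    fix x :: nat assume x: "32 dvd x" "x \<notin> set L"
    show "fold push_cell Q G' x = 0"
      using fold_push_notin[OF Qev ev[OF x(1)] items_only(1)[OF x]] G'NP(1)[OF x(1)] NP0[OF x] by simp
    show "fold push_cell Q G' (x + 2) = 0"
      using fold_push_notin[OF Qev, where g = "x + 2"] ev[OF x(1)] items_only(2)[OF x] G'NP(2)[OF x(1)] NP0[OF x] by auto
  qed
  moreover have "vert (fold push_cell Q G') c1 c2"
    using G(2) Qmod by (rule vert_preserved) (use G' in auto)
  moreover have "fits m (128 * H) Q"
    using dist Qev H by (intro fits_distinct) auto
  \<comment> \<open>\<open>2 ^ k\<close> exceeds all positions, so \<open>Q_iff\<close> leaves no
    message, and the count of position \<open>i\<close> has reached
    \<open>3 * n - i\<close>.\<close>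
  moreover have "Q = [] \<and> (\<forall>i<3 * n. G' (L ! i + 4) = 3 * n - i \<and> G' (L ! i + 5) = 0)" if "J \<le> k"
  proof -
    have "(2::nat) ^ J \<le> 2 ^ k" using that by (intro power_increasing) auto
    then have big: "3 * n \<le> 2 ^ k" using J by linarith
    then have "q \<notin> set Q" for q using Q_iff[of "fst q" "snd q"] by auto
    then have "Q = []" by (cases Q) auto
    moreover have "G' (L ! i + 4) = 3 * n - i \<and> G' (L ! i + 5) = 0" if "i < 3 * n" for i
    proof -
      have "32 dvd L ! i" using L(4)[OF item[OF that]] by blast
      then show ?thesis using G'4 NPR(3)[OF that] RM[OF that] big by simp
    qed
    ultimately show ?thesis by blast
  qed
  ultimately show ?thesis by (simp add: L_def)
qed

end

section \<open>Linking the tour and scattering the vertices\<close>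

lemma offset_128:
  fixes a b i j :: nat
  shows "i < 128 \<Longrightarrow> j < 128 \<Longrightarrow> 128 * a + i = 128 * b + j \<longleftrightarrow> a = b \<and> i = j"
    and "j < 128 \<Longrightarrow> 128 * a = 128 * b + j \<longleftrightarrow> a = b \<and> 0 = j"
    and "i < 128 \<Longrightarrow> 128 * a + i = 128 * b \<longleftrightarrow> a = b \<and> i = 0"
proof -
  have *: "a = b \<and> i = j" if "128 * a + i = 128 * b + j" "i < 128" "j < 128" for a b i j :: nat
  proof -
    have "a = (128 * a + i) div 128" using that(2) by simp
    also have "\<dots> = b" unfolding that(1) using that(3) by simp
    finally show ?thesis using that(1) by simp
  qed
  show "i < 128 \<Longrightarrow> j < 128 \<Longrightarrow> 128 * a + i = 128 * b + j \<longleftrightarrow> a = b \<and> i = j" using * by blast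
  show "j < 128 \<Longrightarrow> 128 * a = 128 * b + j \<longleftrightarrow> a = b \<and> 0 = j" using *[of a 0 b j] by auto
  show "i < 128 \<Longrightarrow> 128 * a + i = 128 * b \<longleftrightarrow> a = b \<and> i = 0" using *[of a i b 0] by auto
qed

lemma offset_32:
  fixes a b i j :: nat
  assumes "i < 32" "j < 32"
  shows "32 * a + i = 32 * b + j \<longleftrightarrow> a = b \<and> i = j"
proof
  assume e: "32 * a + i = 32 * b + j"
  have "a = (32 * a + i) div 32" using assms by simp
  also have "\<dots> = b" unfolding e using assms by simp
  finally show "a = b \<and> i = j" using e by simp
qed simp

text \<open>The set consists of the cells changed by \<open>link_new\<close>, whose residues modulo
  32 are 4, 6 and 7.\<close>

lemma mod_128_cases:
  fixes g :: nat
  assumes "g mod 32 = 0 \<or> g mod 32 = 2 \<or> g mod 32 = 5 \<or> 8 \<le> g mod 32"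
  shows "g mod 128 \<notin> {4, 36, 68, 6, 7}"
proof
  assume "g mod 128 \<in> {4, 36, 68, 6, 7}"
  then have "g mod 128 mod 32 = 4 \<or> g mod 128 mod 32 = 6 \<or> g mod 128 mod 32 = 7" by auto
  moreover have "g mod 128 mod 32 = g mod 32" by (rule mod_mod_cancel) simp
  ultimately show False using assms by auto
qed

text \<open>Used together with \<open>bex_shift\<close> to collect the forward links on one side and
  the backward links, shifted by \<open>k = 2\<close>, on the other.\<close>

lemma or_ex_shift:
  "((A \<or> (\<exists>t. g = t + k \<and> B t)) \<or> C \<or> (\<exists>t. g = t + k \<and> D t)) \<longleftrightarrow>
    (A \<or> C) \<or> (\<exists>t. g = t + (k :: nat) \<and> (B t \<or> D t))"
  by blast

lemma bex_shift:
  "(\<exists>v\<in>V. X v \<or> (\<exists>t. g = t + k \<and> Y v t)) \<longleftrightarrow>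
    (\<exists>v\<in>V. X v) \<or> (\<exists>t. g = t + (k :: nat) \<and> (\<exists>v\<in>V. Y v t))"
  by blast

lemma par_child:
  assumes "child_ptrs c1 c2 T" "parent_ptrs par T" "v \<in> set_tree T"
  shows "(c1 v \<noteq> 0 \<longrightarrow> par (c1 v) = v) \<and> (c2 v \<noteq> 0 \<longrightarrow> par (c2 v) = v)"
  using assms by (induction T) auto

lemma child_par:
  assumes "child_ptrs c1 c2 T" "parent_ptrs par T" "x \<in> set_tree T" "x \<noteq> rt T"
  shows "c1 (par x) = x \<or> c2 (par x) = x"
  using assms
proof (induction T)
  case (Node l v r)
  consider "x \<in> set_tree l" | "x \<in> set_tree r" using Node.prems by auto
  then show ?case
  proof cases
    case 1
    then show ?thesis using Node.IH(1) Node.prems by (cases "x = rt l") auto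
  next
    case 2
    then show ?thesis using Node.IH(2) Node.prems by (cases "x = rt r") auto
  qed
qed simp

context run_data
begin

lemma tour_children:
  assumes T: "is_tour T" "child_ptrs c1 c2 T" and v: "v \<in> V"
  shows "c1 v \<noteq> 0 \<Longrightarrow> c1 v \<in> V \<and> par (c1 v) = v \<and> pos 0 T (c1 v) = pos 0 T v + 1"
    "c2 v \<noteq> 0 \<Longrightarrow> c2 v \<in> V \<and> par (c2 v) = v \<and> pos 0 T (c2 v) = pos 0 T v + 2 + 3 * left_size T v"
    "c1 v \<noteq> 0 \<Longrightarrow> c1 v \<noteq> c2 v"
proof -
  have t: "distinct (inorder T)" "parent_ptrs par T" "v \<in> set_tree T" "set_tree T = V"
    using T v by (auto simp: is_tour_def)
  note p = pos_children[OF T(2) t(1,3), of 0] par_child[OF T(2) t(2,3)]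
  show 1: "c1 v \<noteq> 0 \<Longrightarrow> c1 v \<in> V \<and> par (c1 v) = v \<and> pos 0 T (c1 v) = pos 0 T v + 1"
    and 2: "c2 v \<noteq> 0 \<Longrightarrow> c2 v \<in> V \<and> par (c2 v) = v \<and> pos 0 T (c2 v) = pos 0 T v + 2 + 3 * left_size T v"
    using p t by auto
  show "c1 v \<noteq> c2 v" if "c1 v \<noteq> 0"
  proof
    assume e: "c1 v = c2 v"
    then have "pos 0 T v + 1 = pos 0 T v + 2 + 3 * left_size T v" using 1 2 that by metis
    then show False by simp
  qed
qed

lemma V_room: "v \<in> V \<Longrightarrow> v < m * H" "v \<in> V \<Longrightarrow> 128 * v + 1000 < M" "v \<in> V \<Longrightarrow> 0 < v"
proof -
  assume "v \<in> V"
  then have v: "1 \<le> v" "v \<le> n" by (auto simp: V_def)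
  have "128 * (v + 1) \<le> 128 * (n + 1)" using v by simp
  also note room
  finally have a: "128 * (v + 1) \<le> m * (128 * H)" .
  then have "128 * (v + 1) \<le> 128 * (m * H)" by (simp only: mult.left_commute)
  then have "v + 1 \<le> m * H" by simp
  then show "v < m * H" by simp
  show "128 * v + 1000 < M" using a M by simp
  show "0 < v" using v by simp
qed

text \<open>Each vertex writes the links around its children's subtrees, and by
  \<open>adj_tour\<close> these are all links of the tour. What the round does not write, namely the
  two ends and all non-items, has to be 0 already, which is the hypothesis
  \<open>zero\<close>.\<close>

lemma link_step:
  assumes T: "is_tour T" "child_ptrs c1' c2' T" and G: "vert G c1 c2"
    and zero: "\<And>x. 32 dvd x \<Longrightarrow> G x = 0 \<and> G (x + 2) = 0"
      "\<And>x. x \<in> set (tour T) \<Longrightarrow> G (x + 5) = 0"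
    and sw: "\<And>v. v \<in> V \<Longrightarrow> c1' v = (if swaps M (\<lambda>f. G (128 * v + f)) then c2 v else c1 v)"
      "\<And>v. v \<in> V \<Longrightarrow> c2' v = (if swaps M (\<lambda>f. G (128 * v + f)) then c1 v else c2 v)"
  defines "Q \<equiv> gmsgs 128 (link_msgs M) n G (m * H)" and "G' \<equiv> gnew 128 (link_new M) G"
  shows "tours 0 (fold push_cell Q G') (tour T) \<and> vert (fold push_cell Q G') c1' c2' \<and> fits m (128 * H) Q"
proof -
  define L where "L = tour T"
  note L = tour_facts[OF T(1), folded L_def]
  note [simp del] = add_2_eq_Suc add_2_eq_Suc'
  have G38: "G (128 * v + 38) = (if v \<in> V then 128 * par v + 1 else 0)" for v
    using G by (simp add: vert_def)
  have Gc: "G (128 * v + 6) = 128 * c1 v" "G (128 * v + 7) = 128 * c2 v" if "v \<in> V" for v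
    using G that by (simp_all add: vert_def)
  define cm where "cm c y p q = (if c \<noteq> 0 then [(y + p, 128 * c), (128 * c + 2, y + p), (128 * c + 64, y + q),
     (y + (q + 2), 128 * c + 64)] else [(y + p, y + q), (y + (q + 2), y + p)])" for c y p q :: nat
  define ms where "ms v = link_msgs M n (\<lambda>f. G (128 * v + f)) (128 * v)" for v
  have cmM: "child_msgs M (128 * c) (128 * v) p q = cm c (128 * v) p q"
    if "c \<noteq> 0 \<longrightarrow> c \<in> V" "v \<in> V" "p \<le> 128" "q \<le> 128" for c v p q
  proof -
    have "128 * v + p < M" "128 * v + q < M" "128 * v + (q + 2) < M" using V_room(2)[OF that(2)] that by linarith+
    moreover have "128 * c + 2 < M" "128 * c + 64 < M" if "c \<noteq> 0"
      using V_room(2)[of c] that \<open>c \<noteq> 0 \<longrightarrow> c \<in> V\<close> by auto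
    ultimately show ?thesis by (simp add: child_msgs_def cm_def)
  qed
  have ms: "ms v = (if v \<in> V then cm (c1' v) (128 * v) 0 32 @ cm (c2' v) (128 * v) 32 64 else [])" for v
  proof (cases "v \<in> V")
    case True
    have "c1' v \<noteq> 0 \<longrightarrow> c1' v \<in> V" "c2' v \<noteq> 0 \<longrightarrow> c2' v \<in> V" using tour_children[OF T True] by auto
    then have "child_msgs M (128 * c1' v) (128 * v) 0 32 = cm (c1' v) (128 * v) 0 32"
      "child_msgs M (128 * c2' v) (128 * v) 32 64 = cm (c2' v) (128 * v) 32 64"
      using cmM True by simp_all
    moreover have "128 * c1' v = (if swaps M (\<lambda>f. G (128 * v + f)) then G (128 * v + 7) else G (128 * v + 6))"
      "128 * c2' v = (if swaps M (\<lambda>f. G (128 * v + f)) then G (128 * v + 6) else G (128 * v + 7))"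
      using sw[OF True] Gc[OF True] by auto
    ultimately show ?thesis using True G38[of v] by (simp add: ms_def link_msgs_def)
  next
    case False
    then show ?thesis using G38[of v] by (simp add: ms_def link_msgs_def)
  qed
  have Qset: "q \<in> set Q \<longleftrightarrow> (\<exists>v\<in>V. q \<in> set (ms v))" for q
  proof
    assume "q \<in> set Q"
    then obtain v where "q \<in> set (ms v)" unfolding Q_def in_gmsgs ms_def by blast
    moreover from this have "v \<in> V" using ms[of v] by (cases "v \<in> V") simp_all
    ultimately show "\<exists>v\<in>V. q \<in> set (ms v)" by blast
  next
    assume "\<exists>v\<in>V. q \<in> set (ms v)"
    then show "q \<in> set Q" unfolding Q_def in_gmsgs ms_def using V_room(1) by blast
  qed
  have A: "adj L = (\<Union>v\<in>V. child_pairs (c1' v) (128 * v) (128 * v + 32) \<union> child_pairs (c2' v) (128 * v + 32) (128 * v + 64))"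
    using adj_tour[OF T(2)] T(1) by (simp add: L_def is_tour_def)
  have cmp: "(g, x) \<in> set (cm c y p q) \<longleftrightarrow> (g, x) \<in> child_pairs c (y + p) (y + q) \<or>
      (\<exists>t. g = t + 2 \<and> (x, t) \<in> child_pairs c (y + p) (y + q))" for g x c y p q
    by (auto simp: cm_def child_pairs_def)
  have Q_iff: "(g, x) \<in> set Q \<longleftrightarrow> (g, x) \<in> adj L \<or> (\<exists>t. g = t + 2 \<and> (x, t) \<in> adj L)" for g x
  proof -
    define CP where "CP v = child_pairs (c1' v) (128 * v) (128 * v + 32) \<union>
       child_pairs (c2' v) (128 * v + 32) (128 * v + 64)" for v
    have "(g, x) \<in> set (ms v) \<longleftrightarrow> (g, x) \<in> CP v \<or> (\<exists>t. g = t + 2 \<and> (x, t) \<in> CP v)" if "v \<in> V" for v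
    proof -
      have "(g, x) \<in> set (ms v) \<longleftrightarrow> (g, x) \<in> set (cm (c1' v) (128 * v) 0 32) \<or> (g, x) \<in> set (cm (c2' v) (128 * v) 32 64)"
        using that by (simp add: ms)
      then show ?thesis unfolding CP_def cmp add_0_right Un_iff by (simp only: or_ex_shift)
    qed
    then have "(g, x) \<in> set Q \<longleftrightarrow> (\<exists>v\<in>V. (g, x) \<in> CP v \<or> (\<exists>t. g = t + 2 \<and> (x, t) \<in> CP v))"
      unfolding Qset by (intro bex_cong) auto
    also have "\<dots> \<longleftrightarrow> (g, x) \<in> (\<Union>v\<in>V. CP v) \<or> (\<exists>t. g = t + 2 \<and> (x, t) \<in> (\<Union>v\<in>V. CP v))"
      unfolding UN_iff by (rule bex_shift)
    finally show ?thesis unfolding A CP_def .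
  qed
  have item: "L ! i \<in> set L" if "i < 3 * n" for i using that L(1) by simp
  have dL: "32 dvd L ! i" if "i < 3 * n" for i using L(4)[OF item[OF that]] by blast
  have inj: "i = j" if "L ! i = L ! j" "i < 3 * n" "j < 3 * n" for i j
    using that L(1,2) by (simp add: nth_eq_iff_index_eq)
  have adjL: "(s, t) \<in> adj L \<longleftrightarrow> (\<exists>i. Suc i < 3 * n \<and> s = L ! i \<and> t = L ! Suc i)" for s t
    unfolding adj_iff L(1) by blast
  have adj_items: "s \<in> set L \<and> t \<in> set L \<and> 32 dvd s \<and> 32 dvd t" if st: "(s, t) \<in> adj L" for s t
  proof -
    obtain i where "Suc i < 3 * n" "s = L ! i" "t = L ! Suc i" using st unfolding adjL by blast
    then show ?thesis using item dL by simp
  qed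
  have Qmod: "h mod 32 = 0 \<or> h mod 32 = 2" if "(h, x) \<in> set Q" for h x
  proof -
    from that consider "32 dvd h" | t where "h = t + 2" "32 dvd t" unfolding Q_iff using adj_items by blast
    then show ?thesis by cases presburger+
  qed
  have Qeven: "\<forall>q\<in>set Q. even (fst q)"
  proof
    fix q assume "q \<in> set Q"
    then have "fst q mod 32 = 0 \<or> fst q mod 32 = 2" using Qmod[of "fst q" "snd q"] by simp
    then show "even (fst q)" by presburger
  qed
  have dist: "distinct (map fst Q)"
    unfolding Q_def gmsgs_def ms_def[symmetric]
  proof (rule distinct_fst_concat)
    fix v assume "v \<in> set [0..<m * H]"
    show "distinct (map fst (ms v))"
    proof (cases "v \<in> V")
      case True
      then have "c1' v \<noteq> 0 \<Longrightarrow> c1' v \<noteq> c2' v" using tour_children(3)[OF T True] by simp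
      then show ?thesis using True by (auto simp: ms cm_def offset_128)
    qed (simp add: ms)
  next
    \<comment> \<open>The vertex that writes cell \<open>g\<close>. The back pointer of an entry
      item and the next pointer of an exit item, offsets 2 and 64, are written by the parent; all
      other links of a record by the vertex itself.\<close>
    define own where "own g = (if g mod 128 = 2 \<or> g mod 128 = 64 then par (g div 128) else g div 128)" for g :: nat
    have own: "own g = v" if "(g, x) \<in> set (ms v)" for g x v
    proof -
      have v: "v \<in> V" using that by (cases "v \<in> V") (simp_all add: ms)
      have "(c1' v \<noteq> 0 \<and> (g = 128 * c1' v + 2 \<or> g = 128 * c1' v + 64)) \<or>
          (c2' v \<noteq> 0 \<and> (g = 128 * c2' v + 2 \<or> g = 128 * c2' v + 64)) \<or>
          g = 128 * v \<or> g = 128 * v + 34 \<or> g = 128 * v + 32 \<or> g = 128 * v + 66"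
        using that v by (auto simp: ms cm_def split: if_splits)
      then show ?thesis using tour_children(1,2)[OF T v] by (elim disjE conjE) (simp_all add: own_def)
    qed
    fix x y g a b assume "(g, a) \<in> set (ms x)" "(g, b) \<in> set (ms y)"
    then show "x = y" using own by metis
  qed simp
  have r128: "g - g mod 128 = 128 * (g div 128)" "128 * (g div 128) + g mod 128 = g" for g :: nat
    by (simp_all add: minus_mod_eq_mult_div)
  have G': "G' g = G g" if "g mod 128 \<notin> {4, 36, 68, 6, 7}" for g
    using that by (simp add: G'_def gnew_def link_new_def r128)
  have G'4: "G' (x + 4) = 1" if x: "x \<in> set L" for x
  proof -
    obtain v i where v: "v \<in> V" "x = 128 * v + i" "i = 0 \<or> i = 32 \<or> i = 64" using L(3)[of x] x by fastforce
    have m4: "(x + 4) div 128 = v" "(x + 4) mod 128 = i + 4" using v by auto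
    have "(x + 4) - (x + 4) mod 128 = 128 * v" using r128(1)[of "x + 4"] m4 by simp
    then show ?thesis using m4 v G38[of v] by (auto simp: G'_def gnew_def link_new_def)
  qed
  have vert': "vert G' c1' c2'"
  proof -
    have "G' (128 * v + 6) = 128 * c1' v" "G' (128 * v + 7) = 128 * c2' v" if "v \<in> V" for v
      using that sw[OF that] Gc[OF that] G38[of v] by (simp_all add: G'_def gnew_def link_new_def)
    moreover have "G' (128 * v + 38) = G (128 * v + 38)" for v by (rule G') simp
    moreover have "G' (32 * k + f) = 0" if "f \<in> {8, 10, 12, 14, 16}" for k f
    proof -
      have "6 < (32 * k + f) mod 32" "(32 * k + f) mod 32 \<noteq> 7" using that by auto
      then have "(32 * k + f) mod 128 \<notin> {4, 36, 68, 6, 7}" by (intro mod_128_cases) auto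
      then have "G' (32 * k + f) = G (32 * k + f)" by (rule G')
      moreover have "G (32 * k + f) = 0"
        using G[unfolded vert_def, THEN conjunct2, THEN conjunct2, rule_format, OF that] .
      ultimately show ?thesis by (rule trans)
    qed
    ultimately show ?thesis using G by (simp add: vert_def)
  qed
  have "tours 0 (fold push_cell Q G') L"
    unfolding tours_def
  proof (intro conjI allI impI)
    fix i assume "i < length L"
    then have i: "i < 3 * n" using L(1) by simp
    have d: "32 dvd L ! i" by (rule dL[OF i])
    have dm: "L ! i mod 128 \<notin> {4, 36, 68, 6, 7}" "(L ! i + 2) mod 128 \<notin> {4, 36, 68, 6, 7}"
       "(L ! i + 5) mod 128 \<notin> {4, 36, 68, 6, 7}"
      by (rule mod_128_cases; use d in presburger)+
    show "fold push_cell Q G' (L ! i) = (if i + 2 ^ 0 < length L then L ! (i + 2 ^ 0) else 0)"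
    proof (cases "Suc i < 3 * n")
      case True
      then have "(L ! i, L ! Suc i) \<in> set Q" unfolding Q_iff adjL by blast
      then show ?thesis using fold_push_in[OF dist Qeven] True L(1) by simp
    next
      \<comment> \<open>Nobody writes the next pointer of the last item; it is still 0 from before
        the round.\<close>
      case False
      have "L ! i \<notin> fst ` set Q"
      proof
        assume "L ! i \<in> fst ` set Q"
        then obtain x where "(L ! i, x) \<in> set Q" by force
        then have "\<exists>j. Suc j < 3 * n \<and> L ! i = L ! j"
          unfolding Q_iff using adjL adj_items dvd_32_offsets(5)[OF _ d] by metis
        then obtain j where j: "Suc j < 3 * n" "L ! i = L ! j" by blast
        have "i = j" by (rule inj[OF j(2) i]) (use j in simp)
        then show False using False j by simp
      qed
      moreover have "even (L ! i)" using d by presburger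
      ultimately have "fold push_cell Q G' (L ! i) = G' (L ! i)"
        using fold_push_notin[OF Qeven] by blast
      then show ?thesis using G'[OF dm(1)] zero(1)[OF d] False L(1) by simp
    qed
    show "fold push_cell Q G' (L ! i + 2) = (if 2 ^ 0 \<le> i then L ! (i - 2 ^ 0) else 0)"
    proof (cases i)
      case (Suc j)
      then have "(L ! j, L ! i) \<in> adj L" unfolding adjL using i by blast
      then have "(L ! i + 2, L ! j) \<in> set Q" unfolding Q_iff by blast
      then show ?thesis using fold_push_in[OF dist Qeven] Suc by simp
    next
      \<comment> \<open>Likewise for the previous pointer of the first item.\<close>
      case 0
      have "L ! i + 2 \<notin> fst ` set Q"
      proof
        assume "L ! i + 2 \<in> fst ` set Q"
        then obtain x where "(L ! i + 2, x) \<in> set Q" by force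
        then have "(x, L ! i) \<in> adj L"
          unfolding Q_iff using adj_items dvd_32_offsets(1)[OF d] by (metis add_right_cancel)
        then obtain j where j: "Suc j < 3 * n" "L ! i = L ! Suc j" unfolding adjL by blast
        have "i = Suc j" by (rule inj[OF j(2) i j(1)])
        then show False using 0 by simp
      qed
      moreover have "even (L ! i + 2)" using d by presburger
      ultimately have "fold push_cell Q G' (L ! i + 2) = G' (L ! i + 2)"
        using fold_push_notin[OF Qeven] by blast
      then show ?thesis using G'[OF dm(2)] zero(1)[OF d] 0 by simp
    qed
    have "L ! i + 4 \<notin> fst ` set Q"
    proof
      assume "L ! i + 4 \<in> fst ` set Q"
      then obtain x where "(L ! i + 4, x) \<in> set Q" by force
      from Qmod[OF this] d show False by presburger
    qed
    moreover have "even (L ! i + 4)" using d by presburger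
    ultimately have "fold push_cell Q G' (L ! i + 4) = G' (L ! i + 4) \<and> fold push_cell Q G' (L ! i + 4 + 1) = G' (L ! i + 4 + 1)"
      using fold_push_notin[OF Qeven] by blast
    moreover have "L ! i + 4 + 1 = L ! i + 5" by simp
    ultimately have "fold push_cell Q G' (L ! i + 4) = G' (L ! i + 4) \<and> fold push_cell Q G' (L ! i + 5) = G' (L ! i + 5)" by metis
    then show "fold push_cell Q G' (L ! i + 4) + fold push_cell Q G' (L ! i + 5) = min (2 ^ 0) (length L - i)"
      using G'4[OF item[OF i]] G'[OF dm(3)] zero(2)[OF item[OF i, unfolded L_def], folded L_def] L(1) i by simp
  next
    fix x :: nat assume x: "32 dvd x" "x \<notin> set L"
    have dm: "x mod 128 \<notin> {4, 36, 68, 6, 7}" "(x + 2) mod 128 \<notin> {4, 36, 68, 6, 7}"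
      by (rule mod_128_cases; use x(1) in presburger)+
    have ev: "even x" "even (x + 2)" using x(1) by presburger+
    have "x \<notin> fst ` set Q"
    proof
      assume "x \<in> fst ` set Q"
      then obtain y where "(x, y) \<in> set Q" by force
      then show False unfolding Q_iff using adj_items x dvd_32_offsets(5)[OF _ x(1)] by metis
    qed
    then show "fold push_cell Q G' x = 0"
      using fold_push_notin[OF Qeven ev(1)] G'[OF dm(1)] zero(1)[OF x(1)] by simp
    have "x + 2 \<notin> fst ` set Q"
    proof
      assume "x + 2 \<in> fst ` set Q"
      then obtain y where "(x + 2, y) \<in> set Q" by force
      then show False unfolding Q_iff using adj_items x dvd_32_offsets(1)[OF x(1)] by (metis add_right_cancel)
    qed
    then show "fold push_cell Q G' (x + 2) = 0"
      using fold_push_notin[OF Qeven ev(2)] G'[OF dm(2)] zero(1)[OF x(1)] by simp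
  qed
  moreover have "vert (fold push_cell Q G') c1' c2'"
  proof (rule vert_preserved[OF vert'])
    show "h mod 32 \<in> {0, 2, 4}" if "(h, x) \<in> set Q" for h x using Qmod[OF that] by auto
  qed simp
  moreover have "fits m (128 * H) Q"
    using dist Qeven H by (intro fits_distinct) auto
  ultimately show ?thesis by (simp add: L_def)
qed

section \<open>The vertex records after the first messages\<close>

definition nth0 :: "nat list \<Rightarrow> nat \<Rightarrow> nat" where "nth0 xs i = (if i < length xs then xs ! i else 0)"

text \<open>Cell 6 holds the child that reported last and cell 7 the one before, hence the reversed
  list and the induction from the right end. Cell 39 takes the old content of cell 38.\<close>

lemma setup_cells:
  assumes "distinct vs"
  defines "G \<equiv> fold push_cell (concat (map (\<lambda>v. init_msgs (v, par v)) vs)) (\<lambda>_. 0)"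
  shows "(\<forall>v. G (128 * v + 38) = (if v \<in> set vs then 128 * par v + 1 else 0) \<and>
      G (128 * v + 6) = 128 * nth0 (rev (filter (\<lambda>x. par x = v) vs)) 0 \<and>
      G (128 * v + 7) = 128 * nth0 (rev (filter (\<lambda>x. par x = v) vs)) 1) \<and>
    (\<forall>g. g mod 128 \<notin> {6, 7, 38, 39} \<longrightarrow> G g = 0)"
  unfolding G_def using assms(1)
proof (induction vs rule: rev_induct)
  case (snoc u vs)
  define G0 where "G0 = fold push_cell (concat (map (\<lambda>v. init_msgs (v, par v)) vs)) (\<lambda>_. 0)"
  define G1 where "G1 = fold push_cell (concat (map (\<lambda>v. init_msgs (v, par v)) (vs @ [u]))) (\<lambda>_. 0)"
  have IH: "G0 (128 * v + 38) = (if v \<in> set vs then 128 * par v + 1 else 0)"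
    "G0 (128 * v + 6) = 128 * nth0 (rev (filter (\<lambda>x. par x = v) vs)) 0"
    "G0 (128 * v + 7) = 128 * nth0 (rev (filter (\<lambda>x. par x = v) vs)) 1"
    "g mod 128 \<notin> {6, 7, 38, 39} \<Longrightarrow> G0 g = 0" for v g
    using snoc by (simp_all add: G0_def)
  have G1: "G1 = (G0(128 * u + 39 := G0 (128 * u + 38), 128 * u + 38 := 128 * par u + 1,
      128 * par u + 7 := G0 (128 * par u + 6), 128 * par u + 6 := 128 * u))"
  proof -
    have e: "128 * u + 38 + 1 = 128 * u + 39" "128 * par u + 6 + 1 = 128 * par u + 7" by simp_all
    have "G1 = push_cell (128 * par u + 6, 128 * u) (push_cell (128 * u + 38, 128 * par u + 1) G0)"
      by (simp add: G1_def G0_def del: push_cell.simps)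
    then show ?thesis unfolding push_cell.simps e by (simp add: offset_128)
  qed
  have off: "g \<noteq> 128 * w + i" if "g mod 128 \<noteq> i" "i < 128" for g w i :: nat
    using that by auto
  have "G1 (128 * v + 38) = (if v \<in> set (vs @ [u]) then 128 * par v + 1 else 0)" for v
    by (simp add: G1 IH offset_128)
  moreover have "G1 (128 * v + 6) = 128 * nth0 (rev (filter (\<lambda>x. par x = v) (vs @ [u]))) 0" for v
    by (simp add: G1 IH nth0_def offset_128)
  moreover have "G1 (128 * v + 7) = 128 * nth0 (rev (filter (\<lambda>x. par x = v) (vs @ [u]))) 1" for v
    by (simp add: G1 IH nth0_def offset_128)
  moreover have "G1 g = 0" if "g mod 128 \<notin> {6, 7, 38, 39}" for g
    using that IH(4)[OF that] off[of g] by (simp add: G1)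
  ultimately show ?case unfolding G1_def by blast
qed (simp add: nth0_def)

lemma setup_step:
  assumes vs: "distinct vs" "set vs = V"
    and bin: "\<And>u. u \<le> n \<Longrightarrow> card {v \<in> V. par v = u} \<le> 2"
  defines "Q \<equiv> concat (map (\<lambda>v. init_msgs (v, par v)) vs)"
  defines "G \<equiv> fold push_cell Q (\<lambda>_. 0)"
  shows "\<exists>c1 c2. vert G c1 c2 \<and> (\<forall>v\<in>V. {c1 v, c2 v} - {0} = {u \<in> V. par u = v} \<and> (c1 v = c2 v \<longrightarrow> c1 v = 0)) \<and>
    (\<forall>x. 32 dvd x \<longrightarrow> G x = 0 \<and> G (x + 2) = 0 \<and> G (x + 4) = 0 \<and> G (x + 5) = 0) \<and> fits m (128 * H) Q"
proof -
  note cells = setup_cells[OF vs(1), folded Q_def, folded G_def]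
  define ch where "ch v = rev (filter (\<lambda>x. par x = v) vs)" for v
  define c1 c2 where "c1 v = nth0 (ch v) 0" and "c2 v = nth0 (ch v) 1" for v
  have chs: "set (ch v) = {u \<in> V. par u = v}" "distinct (ch v)" for v
    using vs by (auto simp: ch_def)
  have V0: "x \<noteq> 0" if "x \<in> V" for x using that by (simp add: V_def)
  have children: "{c1 v, c2 v} - {0} = {u \<in> V. par u = v} \<and> (c1 v = c2 v \<longrightarrow> c1 v = 0)" if "v \<in> V" for v
  proof -
    have "length (ch v) = card {u \<in> V. par u = v}" using chs distinct_card by metis
    then have "length (ch v) \<le> 2" using bin[of v] that by (simp add: V_def)
    then consider "ch v = []" | a where "ch v = [a]" | a b where "ch v = [a, b]"
      by (metis (no_types, lifting) Suc_le_eq le_zero_eq length_0_conv length_Suc_conv less_Suc_eq less_Suc_eq_le numeral_2_eq_2 not_less_eq_eq le_Suc_eq)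
    then show ?thesis
    proof cases
      case 1
      then show ?thesis using chs(1)[of v] by (simp add: c1_def c2_def nth0_def)
    next
      case (2 a)
      then have "a \<noteq> 0" using chs(1)[of v] V0 by auto
      then show ?thesis using chs(1)[of v] 2 by (auto simp add: c1_def c2_def nth0_def)
    next
      case (3 a b)
      then have "a \<noteq> 0" "b \<noteq> 0" "a \<noteq> b" using chs[of v] V0 by auto
      then show ?thesis using chs(1)[of v] 3 by (auto simp add: c1_def c2_def nth0_def)
    qed
  qed
  have other: "G g = 0" if "g mod 128 \<notin> {6, 7, 38, 39}" for g using cells that by blast
  have m32: "g mod 128 \<notin> {6, 7, 38, 39}" if "g mod 32 \<noteq> 6" "g mod 32 \<noteq> 7" for g :: nat
  proof
    assume "g mod 128 \<in> {6, 7, 38, 39}"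
    then have "g mod 128 mod 32 = 6 \<or> g mod 128 mod 32 = 7" by auto
    moreover have "g mod 128 mod 32 = g mod 32" by (rule mod_mod_cancel) simp
    ultimately show False using that by auto
  qed
  have "vert G c1 c2"
    unfolding vert_def
  proof (intro conjI ballI allI impI)
    show "G (32 * k + f) = 0" if "f \<in> {8, 10, 12, 14, 16}" for k f
      by (rule other, rule m32) (use that in auto)
  qed (use cells vs(2) in \<open>simp_all add: c1_def c2_def ch_def\<close>)
  moreover have "G x = 0 \<and> G (x + 2) = 0 \<and> G (x + 4) = 0 \<and> G (x + 5) = 0" if "32 dvd x" for x
    by (intro conjI; rule other, rule m32; use that in presburger)
  \<comment> \<open>Two children write to the same cell, so \<open>fits_distinct\<close> does not
    apply. The load is counted instead: a machine has \<open>H\<close> records, each of which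
    receives its own message and at most two from children.\<close>
  moreover have "fits m (128 * H) Q"
    unfolding fits_def
  proof (intro conjI allI impI)
    show "\<forall>(g, x)\<in>set Q. even g" by (auto simp: Q_def)
    fix i
    have finV: "finite V" by (simp add: V_def)
    define A B U where "A = {v \<in> V. v div H = i}" and "B = {v \<in> V. par v div H = i}" and "U = {u. u \<le> n \<and> u div H = i}"
    have dd: "(128 * v + j) div (128 * H) = v div H" if "j < 128" for v j
      using that by (simp add: div_mult2_eq)
    have len: "length (local_q (128 * H) i (concat (map (\<lambda>v. init_msgs (v, par v)) ws))) =
       length (filter (\<lambda>v. v div H = i) ws) + length (filter (\<lambda>v. par v div H = i) ws)" for ws
      by (induction ws) (simp_all add: dd)
    have "length (filter (\<lambda>v. v div H = i) vs) = card A" "length (filter (\<lambda>v. par v div H = i) vs) = card B"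
      using vs distinct_card[of "filter (\<lambda>v. v div H = i) vs"] distinct_card[of "filter (\<lambda>v. par v div H = i) vs"]
      by (simp_all add: A_def B_def)
    then have l: "length (local_q (128 * H) i Q) = card A + card B" using len[of vs] by (simp add: Q_def)
    have sub: "{u. u div H = i} \<subseteq> {i * H..<i * H + H}"
    proof
      fix u assume "u \<in> {u. u div H = i}"
      then have "u = i * H + u mod H" "u mod H < H" using H by auto
      then show "u \<in> {i * H..<i * H + H}" by auto
    qed
    have "A \<subseteq> {i * H..<i * H + H}" "U \<subseteq> {i * H..<i * H + H}" using sub by (auto simp: A_def U_def)
    then have AU: "card A \<le> H" "card U \<le> H" using card_mono[of "{i * H..<i * H + H}"] by fastforce+
    have "B \<subseteq> (\<Union>u\<in>U. {v \<in> V. par v = u})" using par by (auto simp: B_def U_def V_def)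
    moreover have finU: "finite U" by (simp add: U_def)
    ultimately have "card B \<le> card (\<Union>u\<in>U. {v \<in> V. par v = u})" using finV by (intro card_mono) auto
    also have "\<dots> \<le> (\<Sum>u\<in>U. card {v \<in> V. par v = u})" by (rule card_UN_le[OF finU])
    also have "\<dots> \<le> (\<Sum>u\<in>U. 2)" by (rule sum_mono) (use bin in \<open>auto simp: U_def\<close>)
    finally have "card B \<le> 2 * card U" by simp
    then show "length (local_q (128 * H) i Q) \<le> 2 * (128 * H)" using l AU by linarith
  qed
  ultimately show ?thesis using children by blast
qed

section \<open>Intervals of the tour and the scatter round\<close>

definition chunk :: "nat tree \<Rightarrow> nat \<Rightarrow> nat" where "chunk T v = pos 0 T v div (4 * H)"

text \<open>A slot has 32 cells and a machine \<open>128 * H\<close>, so \<open>chunk\<close> is the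
  machine that holds the slot of a vertex. The vertices with \<open>breaks\<close> become the starts
  of components.\<close>

definition breaks :: "nat tree \<Rightarrow> nat \<Rightarrow> bool" where
  "breaks T v \<longleftrightarrow> par v = 0 \<or> chunk T (par v) \<noteq> chunk T v"

definition far :: "nat tree \<Rightarrow> nat \<Rightarrow> nat \<Rightarrow> nat" where
  "far T v c = (if c \<noteq> 0 \<and> chunk T c \<noteq> chunk T v then 128 * c else 0)"

lemma par_root:
  assumes "is_tour T" "v \<in> V"
  shows "par v = 0 \<longleftrightarrow> v = rt T" "v \<noteq> rt T \<Longrightarrow> par v \<in> V \<and> pos 0 T (par v) < pos 0 T v"
proof -
  show 1: "par v \<in> V \<and> pos 0 T (par v) < pos 0 T v" if "v \<noteq> rt T"
    using parent_in_tree[of par T v 0] assms that by (simp add: is_tour_def)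
  show "par v = 0 \<longleftrightarrow> v = rt T"
  proof (cases "v = rt T")
    case True
    then show ?thesis using assms(1) by (simp add: is_tour_def)
  next
    case False
    then show ?thesis using 1 by (auto simp: V_def)
  qed
qed

text \<open>A parent informs the slot of a child only if the child is on another machine; the mark
  in cell 12 is therefore present exactly when the parent edge leaves the interval or there is
  none.\<close>

lemma scatter_step:
  assumes T: "is_tour T" "child_ptrs c1 c2 T" and G: "vert G c1 c2"
    and rank: "\<And>i. i < 3 * n \<Longrightarrow> G (tour T ! i + 4) = 3 * n - i"
  defines "Q \<equiv> gmsgs 128 (scatter_msgs M (128 * H)) n G (m * H)"
  defines "G' \<equiv> fold push_cell Q (gnew 128 (\<lambda>r. r) G)"
  shows "fits m (128 * H) Q \<and> (\<forall>v\<in>V. let k = 32 * pos 0 T v in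
      G' (k + 8) = 128 * v \<and> G' (k + 10) = 128 * par v + 1 \<and>
      G' (k + 12) = (if breaks T v then 1 else 0) \<and> G' (k + 14) = far T v (c1 v) \<and> G' (k + 16) = far T v (c2 v)) \<and>
    (\<forall>k. k \<notin> pos 0 T ` V \<longrightarrow> (\<forall>f\<in>{8, 10, 12, 14, 16}. G' (32 * k + f) = 0))"
proof -
  note [simp del] = add_2_eq_Suc add_2_eq_Suc'
  define p where "p = pos 0 T"
  have tT: "set_tree T = V" "size T = n" "distinct (inorder T)" using T(1) by (auto simp: is_tour_def)
  have pb: "p v + 2 + 3 * left_size T v < 3 * n" if "v \<in> V" for v
    using left_right_size[of v T 0] that tT by (simp add: p_def)
  have pinj: "v = u" if "v \<in> V" "u \<in> V" "p v = p u" for u v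
    using pos_inj[of v T u] that tT by (simp add: p_def)
  have nM: "128 * n + 1000 < M"
  proof -
    have "128 * n \<le> m * (128 * H)" using room by simp
    then show ?thesis using M by linarith
  qed
  have R: "3 * n mod M - G (128 * v + 4) = p v" "3 * n mod M - G (128 * v + 36) = p v + 1 + 3 * left_size T v"
    if v: "v \<in> V" for v
  proof -
    have lt: "p v < 3 * n" "p v + 1 + 3 * left_size T v < 3 * n" using pb[OF v] by simp_all
    have vT: "v \<in> set_tree T" using v tT by simp
    have e: "128 * v + 32 + 4 = 128 * v + 36" by simp
    have "G (128 * v + 4) = 3 * n - p v"
      using rank[OF lt(1)] unfolding p_def tour_nth(1)[OF vT] .
    moreover have "G (128 * v + 36) = 3 * n - (p v + 1 + 3 * left_size T v)"
      using rank[OF lt(2)] unfolding p_def tour_nth(2)[OF vT] e .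
    moreover have "3 * n mod M = 3 * n" using nM by simp
    ultimately show "3 * n mod M - G (128 * v + 4) = p v" "3 * n mod M - G (128 * v + 36) = p v + 1 + 3 * left_size T v"
      using lt by simp_all
  qed
  have G38: "G (128 * v + 38) = (if v \<in> V then 128 * par v + 1 else 0)" for v
    using G by (simp add: vert_def)
  have Gc: "G (128 * v + 6) = 128 * c1 v" "G (128 * v + 7) = 128 * c2 v" if "v \<in> V" for v
    using G that by (simp_all add: vert_def)
  define cm where "cm v c d = (if c \<noteq> 0 \<and> chunk T c \<noteq> chunk T v then [(32 * p c + 12, 1 :: nat), (32 * p v + d, 128 * c)] else [])" for v c d
  define ms where "ms v = scatter_msgs M (128 * H) n (\<lambda>f. G (128 * v + f)) (128 * v)" for v
  have dd: "(32 * x) div (128 * H) = x div (4 * H)" for x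
  proof -
    have "(32 * x) div (128 * H) = (32 * x) div (32 * (4 * H))" by simp
    also have "\<dots> = x div (4 * H)" by (rule div_mult_mult1) simp
    finally show ?thesis .
  qed
  have small: "32 * k + d < M" if "k < 3 * n" "d < 128" for k d
    using that nM by linarith
  have scm: "scatter_child_msgs M (128 * H) (128 * c) (32 * q) (32 * p v) d = cm v c d"
    if "v \<in> V" "c \<noteq> 0 \<Longrightarrow> c \<in> V \<and> p c = q + 1" "d < 128" "q < 3 * n" for v c q d
  proof (cases "c = 0")
    case True
    then show ?thesis by (simp add: scatter_child_msgs_def cm_def)
  next
    case False
    then have c: "c \<in> V" "p c = q + 1" using that by auto
    have e: "32 * q + 32 = 32 * p c" using c by simp
    have lt: "p c < 3 * n" "p v < 3 * n" using pb[OF c(1)] pb[OF that(1)] by simp_all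
    have "(32 * p c) mod M = 32 * p c" "(32 * p c + 12) mod M = 32 * p c + 12" "(32 * p v + d) mod M = 32 * p v + d"
      using small[OF lt(1), of 0] small[OF lt(1), of 12] small[OF lt(2) that(3)] by simp_all
    then show ?thesis using False unfolding scatter_child_msgs_def cm_def e
      by (simp add: dd chunk_def p_def)
  qed
  have ms: "ms v = (if v \<in> V then [(32 * p v + 8, 128 * v), (32 * p v + 10, 128 * par v + 1)] @
      (if par v = 0 then [(32 * p v + 12, 1)] else []) @ cm v (c1 v) 14 @ cm v (c2 v) 16 else [])" for v
  proof (cases "v \<in> V")
    case True
    have lt: "p v < 3 * n" "p v + 1 + 3 * left_size T v < 3 * n" using pb[OF True] by simp_all
    have mm: "(32 * p v) mod M = 32 * p v" "32 * (p v + 1 + 3 * left_size T v) mod M = 32 * (p v + 1 + 3 * left_size T v)"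
      "(32 * p v + 8) mod M = 32 * p v + 8" "(32 * p v + 10) mod M = 32 * p v + 10" "(32 * p v + 12) mod M = 32 * p v + 12"
      using small[OF lt(1), of 0] small[OF lt(2), of 0] small[OF lt(1), of 8] small[OF lt(1), of 10] small[OF lt(1), of 12]
      by simp_all
    have s1: "scatter_child_msgs M (128 * H) (128 * c1 v) (32 * p v) (32 * p v) 14 = cm v (c1 v) 14"
      by (rule scm) (use True lt tour_children(1)[OF T True] in \<open>auto simp: p_def\<close>)
    have s2: "scatter_child_msgs M (128 * H) (128 * c2 v) (32 * (p v + 1 + 3 * left_size T v)) (32 * p v) 16 = cm v (c2 v) 16"
      by (rule scm) (use True lt tour_children(2)[OF T True] in \<open>auto simp: p_def\<close>)
    have "G (128 * v + 38) = 128 * par v + 1" using G38 True by simp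
    then show ?thesis
      using True unfolding ms_def scatter_msgs_def Let_def R[OF True] mm Gc[OF True] s1 s2 by simp
  qed (simp add: ms_def scatter_msgs_def G38)
  have Qset: "q \<in> set Q \<longleftrightarrow> (\<exists>v\<in>V. q \<in> set (ms v))" for q
  proof
    assume "q \<in> set Q"
    then obtain v where "q \<in> set (ms v)" unfolding Q_def in_gmsgs ms_def by blast
    moreover from this have "v \<in> V" using ms[of v] by (cases "v \<in> V") simp_all
    ultimately show "\<exists>v\<in>V. q \<in> set (ms v)" by blast
  next
    assume "\<exists>v\<in>V. q \<in> set (ms v)"
    then show "q \<in> set Q" unfolding Q_def in_gmsgs ms_def using V_room(1) by blast
  qed
  have keys: "(g, x) \<in> set (ms v) \<longleftrightarrow> v \<in> V \<and>
      (g = 32 * p v + 8 \<and> x = 128 * v \<or> g = 32 * p v + 10 \<and> x = 128 * par v + 1 \<or>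
       par v = 0 \<and> g = 32 * p v + 12 \<and> x = 1 \<or>
       (\<exists>c\<in>{c1 v, c2 v}. c \<noteq> 0 \<and> chunk T c \<noteq> chunk T v \<and> g = 32 * p c + 12 \<and> x = 1) \<or>
       c1 v \<noteq> 0 \<and> chunk T (c1 v) \<noteq> chunk T v \<and> g = 32 * p v + 14 \<and> x = 128 * c1 v \<or>
       c2 v \<noteq> 0 \<and> chunk T (c2 v) \<noteq> chunk T v \<and> g = 32 * p v + 16 \<and> x = 128 * c2 v)" for g x v
    by (cases "v \<in> V"; cases "par v = 0") (auto simp: ms cm_def)
  have Qeven: "\<forall>q\<in>set Q. even (fst q)"
  proof
    fix q assume "q \<in> set Q"
    then obtain v where "(fst q, snd q) \<in> set (ms v)" using Qset by auto
    then show "even (fst q)" unfolding keys by (elim disjE conjE bexE) simp_all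
  qed
  have root0: "c1 v \<noteq> 0 \<Longrightarrow> c1 v \<in> V \<and> par (c1 v) = v" "c2 v \<noteq> 0 \<Longrightarrow> c2 v \<in> V \<and> par (c2 v) = v" if "v \<in> V" for v
    using tour_children(1,2)[OF T that] by auto
  have dist: "distinct (map fst Q)"
    unfolding Q_def gmsgs_def ms_def[symmetric]
  proof (rule distinct_fst_concat)
    fix v assume "v \<in> set [0..<m * H]"
    show "distinct (map fst (ms v))"
    proof (cases "v \<in> V")
      case True
      have ne: "p v \<noteq> p (c1 v)" if "c1 v \<noteq> 0" using tour_children(1)[OF T True that] by (simp add: p_def)
      have ne2: "p v \<noteq> p (c2 v)" if "c2 v \<noteq> 0" using tour_children(2)[OF T True that] by (simp add: p_def)
      have ne3: "p (c1 v) \<noteq> p (c2 v)" if "c1 v \<noteq> 0" "c2 v \<noteq> 0"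
        using tour_children(1)[OF T True that(1)] tour_children(2)[OF T True that(2)] by (simp add: p_def)
      show ?thesis using True ne ne2 ne3 by (auto simp: ms cm_def offset_32)
    qed (simp add: ms)
  next
    \<comment> \<open>The vertex that writes cell \<open>g\<close> is the one whose slot it is,
      except that the mark in cell 12 comes from the parent unless the vertex is the root.\<close>
    define own where "own g = (let u = (THE u. u \<in> V \<and> p u = g div 32) in
        if g mod 32 = 12 \<and> par u \<noteq> 0 then par u else u)" for g :: nat
    have the: "(THE u. u \<in> V \<and> p u = p v) = v" if "v \<in> V" for v
      by (rule the_equality) (use that pinj in auto)
    have own: "own g = v" if "(g, x) \<in> set (ms v)" for g x v
    proof -
      from that have v: "v \<in> V" unfolding keys by blast
      from that consider i where "g = 32 * p v + i" "i < 32" "i \<noteq> 12" | "g = 32 * p v + 12" "par v = 0"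
        | c where "g = 32 * p c + 12" "c \<in> V" "par c = v"
        unfolding keys using root0[OF v] by fastforce
      then show ?thesis
      proof cases
        case 1
        then show ?thesis using the[OF v] by (simp add: own_def Let_def)
      next
        case 2
        then show ?thesis using the[OF v] by (simp add: own_def Let_def)
      next
        case 3
        then show ?thesis using the[OF 3(2)] V_room(3)[OF v] by (simp add: own_def Let_def)
      qed
    qed
    fix x y g a b assume "(g, a) \<in> set (ms x)" "(g, b) \<in> set (ms y)"
    then show "x = y" using own by metis
  qed simp
  have G1: "gnew 128 (\<lambda>r. r) G = G" by (simp add: gnew_def fun_eq_iff)
  have hit: "G' g = x" if "(g, x) \<in> set (ms v)" "v \<in> V" for g x v
  proof -
    have "(g, x) \<in> set Q" using Qset that by blast
    then show ?thesis unfolding G'_def using fold_push_in[OF dist Qeven] by blast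
  qed
  have zero: "G (32 * k + f) = 0" if "f \<in> {8, 10, 12, 14, 16}" for k f
    using G[unfolded vert_def, THEN conjunct2, THEN conjunct2, rule_format, OF that] .
  have miss: "G' (32 * k + f) = 0" if f: "f \<in> {8, 10, 12, 14, 16}" and no: "\<And>v x. (32 * k + f, x) \<notin> set (ms v)" for k f
  proof -
    have "32 * k + f \<notin> fst ` set Q"
    proof
      assume "32 * k + f \<in> fst ` set Q"
      then obtain x where "(32 * k + f, x) \<in> set Q" by force
      then show False using Qset no by blast
    qed
    moreover have "even (32 * k + f)" using f by auto
    ultimately have "G' (32 * k + f) = gnew 128 (\<lambda>r. r) G (32 * k + f)"
      unfolding G'_def using fold_push_notin[OF Qeven] by blast
    then show ?thesis using zero[OF f] by (simp add: G1)
  qed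
  have f32: "f < 32" if "f \<in> {8, 10, 12, 14, 16}" for f :: nat using that by auto
  have empty: "G' (32 * k + f) = 0" if "k \<notin> p ` V" "f \<in> {8, 10, 12, 14, 16}" for k f
  proof (rule miss[OF that(2)])
    fix v x
    show "(32 * k + f, x) \<notin> set (ms v)"
    proof
      assume a: "(32 * k + f, x) \<in> set (ms v)"
      then have v: "v \<in> V" unfolding keys by blast
      have "\<exists>u\<in>V. p u = k"
        using a root0[OF v] f32[OF that(2)] by (auto simp: keys offset_32)
      then show False using that(1) by blast
    qed
  qed
  have slots: "G' (32 * p v + 8) = 128 * v \<and> G' (32 * p v + 10) = 128 * par v + 1 \<and>
      G' (32 * p v + 12) = (if breaks T v then 1 else 0) \<and> G' (32 * p v + 14) = far T v (c1 v) \<and>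
      G' (32 * p v + 16) = far T v (c2 v)" if v: "v \<in> V" for v
  proof (intro conjI)
    show "G' (32 * p v + 8) = 128 * v" "G' (32 * p v + 10) = 128 * par v + 1"
      by (rule hit[OF _ v], simp add: keys v)+
    show "G' (32 * p v + 14) = far T v (c1 v)"
    proof (cases "c1 v \<noteq> 0 \<and> chunk T (c1 v) \<noteq> chunk T v")
      case True
      then show ?thesis unfolding far_def if_P[OF True] by (intro hit[OF _ v]) (simp add: keys v)
    next
      case False
      have "(32 * p v + 14, x) \<notin> set (ms u)" for u x
      proof
        assume a: "(32 * p v + 14, x) \<in> set (ms u)"
        then have u: "u \<in> V" unfolding keys by blast
        have "p v = p u \<and> c1 u \<noteq> 0 \<and> chunk T (c1 u) \<noteq> chunk T u"
          using a by (auto simp: keys offset_32)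
        then show False using pinj[OF v u] False by auto
      qed
      then show ?thesis using miss[of 14 "p v"] False by (simp add: far_def)
    qed
    show "G' (32 * p v + 16) = far T v (c2 v)"
    proof (cases "c2 v \<noteq> 0 \<and> chunk T (c2 v) \<noteq> chunk T v")
      case True
      then show ?thesis unfolding far_def if_P[OF True] by (intro hit[OF _ v]) (simp add: keys v)
    next
      case False
      have "(32 * p v + 16, x) \<notin> set (ms u)" for u x
      proof
        assume a: "(32 * p v + 16, x) \<in> set (ms u)"
        then have u: "u \<in> V" unfolding keys by blast
        have "p v = p u \<and> c2 u \<noteq> 0 \<and> chunk T (c2 u) \<noteq> chunk T u"
          using a by (auto simp: keys offset_32)
        then show False using pinj[OF v u] False by auto
      qed
      then show ?thesis using miss[of 16 "p v"] False by (simp add: far_def)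
    qed
    show "G' (32 * p v + 12) = (if breaks T v then 1 else 0)"
    proof (cases "par v = 0")
      case True
      then show ?thesis using hit[OF _ v, of "32 * p v + 12" 1] v by (simp add: keys breaks_def)
    next
      case nz: False
      then have nr: "v \<noteq> rt T" using par_root(1)[OF T(1) v] by simp
      define u where "u = par v"
      have u: "u \<in> V" using par_root(2)[OF T(1) v nr] by (simp add: u_def)
      have cu: "v = c1 u \<or> v = c2 u"
        using child_par[of c1 c2 T par v] T nr v by (auto simp: is_tour_def u_def)
      show ?thesis
      proof (cases "chunk T u = chunk T v")
        case True
        have "(32 * p v + 12, x) \<notin> set (ms w)" for w x
        proof
          assume a: "(32 * p v + 12, x) \<in> set (ms w)"
          then have w: "w \<in> V" unfolding keys by blast
          have "(par w = 0 \<and> p v = p w) \<or> (\<exists>c\<in>{c1 w, c2 w}. c \<noteq> 0 \<and> chunk T c \<noteq> chunk T w \<and> p v = p c)"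
            using a by (auto simp: keys offset_32)
          then show False
          proof
            assume "par w = 0 \<and> p v = p w"
            then show False using pinj[OF v w] nz by auto
          next
            assume "\<exists>c\<in>{c1 w, c2 w}. c \<noteq> 0 \<and> chunk T c \<noteq> chunk T w \<and> p v = p c"
            then obtain c where c: "c \<in> {c1 w, c2 w}" "c \<noteq> 0" "chunk T c \<noteq> chunk T w" "p v = p c" by blast
            then have "c \<in> V" "par c = w" using root0[OF w] by auto
            then have "v = c" using pinj[OF v] c by blast
            then show False using c(3) True \<open>par c = w\<close> by (simp add: u_def)
          qed
        qed
        then have "G' (32 * p v + 12) = 0" by (intro miss) auto
        then show ?thesis using True nz by (simp add: breaks_def u_def)
      next
        case False
        have "v \<noteq> 0" using V_room(3)[OF v] by simp
        then have "(32 * p v + 12, 1) \<in> set (ms u)" using u cu False by (auto simp: keys)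
        then have "G' (32 * p v + 12) = 1" by (rule hit[OF _ u])
        then show ?thesis using False by (simp add: breaks_def u_def)
      qed
    qed
  qed
  show ?thesis
  proof (intro conjI)
    show "fits m (128 * H) Q" using dist Qeven H by (intro fits_distinct) auto
    show "\<forall>v\<in>V. let k = 32 * pos 0 T v in
      G' (k + 8) = 128 * v \<and> G' (k + 10) = 128 * par v + 1 \<and>
      G' (k + 12) = (if breaks T v then 1 else 0) \<and> G' (k + 14) = far T v (c1 v) \<and> G' (k + 16) = far T v (c2 v)"
      unfolding Let_def p_def[symmetric] by (intro ballI slots)
    show "\<forall>k. k \<notin> pos 0 T ` V \<longrightarrow> (\<forall>f\<in>{8, 10, 12, 14, 16}. G' (32 * k + f) = 0)"
      unfolding p_def[symmetric] by (intro allI impI ballI empty)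
  qed
qed

end

section \<open>The components\<close>

lemma slots_components_in:
  "c \<in> set (slots_components m K j) \<Longrightarrow> \<exists>a. j \<le> a \<and> a < K \<and> m (32 * a + 12) \<noteq> 0 \<and> c = slots_component m a (next_break m K a)"
proof (induction m K j rule: slots_components.induct)
  case (1 m K j)
  show ?case
  proof (cases "K \<le> j")
    case True
    then show ?thesis using 1(3) by (simp add: slots_components.simps)
  next
    case False
    note gt = next_break_gt[of j m K]
    show ?thesis
    proof (cases "m (32 * j + 12) = 0")
      case True
      then have "c \<in> set (slots_components m K (Suc j))"
        using 1(3) False by (subst (asm) slots_components.simps) simp
      then obtain a where "Suc j \<le> a \<and> a < K \<and> m (32 * a + 12) \<noteq> 0 \<and> c = slots_component m a (next_break m K a)"
        using 1(2) False True by blast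
      then show ?thesis by (intro exI[of _ a]) simp
    next
      case nz: False
      then have "c = slots_component m j (next_break m K j) \<or> c \<in> set (slots_components m K (next_break m K j))"
        using 1(3) False by (subst (asm) slots_components.simps) simp
      then show ?thesis
      proof
        assume "c = slots_component m j (next_break m K j)"
        then show ?thesis using False nz by (intro exI[of _ j]) simp
      next
        assume "c \<in> set (slots_components m K (next_break m K j))"
        then obtain a where "next_break m K j \<le> a \<and> a < K \<and> m (32 * a + 12) \<noteq> 0 \<and> c = slots_component m a (next_break m K a)"
          using 1(1) False nz by blast
        then show ?thesis using gt by (intro exI[of _ a]) simp
      qed
    qed
  qed
qed

text \<open>Slots before the first mark are lost, so no vertex may be stored there. The hypothesis
  survives the recursion because a component ends at a mark or at the end of the memory.\<close>

lemma concat_verts_slots_components: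
  assumes "\<And>k. j \<le> k \<Longrightarrow> k < K \<Longrightarrow> m (32 * k + 8) \<noteq> 0 \<Longrightarrow> \<exists>k'. j \<le> k' \<and> k' \<le> k \<and> m (32 * k' + 12) \<noteq> 0"
  shows "concat (map verts (slots_components m K j)) = concat (map (slot_vert m) [j..<K])"
  using assms
proof (induction m K j rule: slots_components.induct)
  case (1 m K j)
  show ?case
  proof (cases "K \<le> j")
    case True
    then show ?thesis by (simp add: slots_components.simps)
  next
    case False
    show ?thesis
    proof (cases "m (32 * j + 12) = 0")
      case True
      have "m (32 * j + 8) = 0"
      proof (rule ccontr)
        assume "m (32 * j + 8) \<noteq> 0"
        then obtain k' where "j \<le> k'" "k' \<le> j" "m (32 * k' + 12) \<noteq> 0" using 1(3)[of j] False by auto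
        then show False using True by simp
      qed
      moreover have "concat (map verts (slots_components m K (Suc j))) = concat (map (slot_vert m) [Suc j..<K])"
      proof (rule 1(2))
        fix k assume k: "Suc j \<le> k" "k < K" "m (32 * k + 8) \<noteq> 0"
        then obtain k' where k': "j \<le> k'" "k' \<le> k" "m (32 * k' + 12) \<noteq> 0" using 1(3)[of k] by auto
        then have "k' \<noteq> j" using True by auto
        then show "\<exists>k'. Suc j \<le> k' \<and> k' \<le> k \<and> m (32 * k' + 12) \<noteq> 0" using k' by (intro exI[of _ k']) simp
      qed (use False True in auto)
      ultimately show ?thesis
        using False True by (subst slots_components.simps) (simp add: upt_conv_Cons slot_vert_def)
    next
      case nz: False
      let ?e = "next_break m K j"
      have e: "j < ?e" "?e \<le> K" using next_break_gt next_break_le False by simp_all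
      have "concat (map verts (slots_components m K ?e)) = concat (map (slot_vert m) [?e..<K])"
      proof (rule 1(1))
        fix k assume k: "?e \<le> k" "k < K" "m (32 * k + 8) \<noteq> 0"
        then have "m (32 * ?e + 12) \<noteq> 0" using next_break_stop[of K m j] by auto
        then show "\<exists>k'. ?e \<le> k' \<and> k' \<le> k \<and> m (32 * k' + 12) \<noteq> 0" using k by (intro exI[of _ ?e]) simp
      qed (use False nz in auto)
      moreover have "[j..<K] = [j..<?e] @ [?e..<K]" using e upt_add_eq_append[of j ?e "K - ?e"] by simp
      ultimately show ?thesis
        using False nz by (subst slots_components.simps) (simp add: slots_component_def)
    qed
  qed
qed

lemma length_slots_components:
  "length (slots_components m K j) \<le> card {k. j \<le> k \<and> k < K \<and> m (32 * k + 12) \<noteq> 0}"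
proof (induction m K j rule: slots_components.induct)
  case (1 m K j)
  have fin: "finite {k. i \<le> k \<and> k < K \<and> m (32 * k + 12) \<noteq> 0}" for i by simp
  show ?case
  proof (cases "K \<le> j")
    case True
    then show ?thesis by (simp add: slots_components.simps)
  next
    case False
    show ?thesis
    proof (cases "m (32 * j + 12) = 0")
      case True
      have "card {k. Suc j \<le> k \<and> k < K \<and> m (32 * k + 12) \<noteq> 0} \<le> card {k. j \<le> k \<and> k < K \<and> m (32 * k + 12) \<noteq> 0}"
        by (rule card_mono[OF fin]) auto
      then show ?thesis using 1(2) False True by (subst slots_components.simps) simp
    next
      case nz: False
      let ?e = "next_break m K j"
      have "insert j {k. ?e \<le> k \<and> k < K \<and> m (32 * k + 12) \<noteq> 0} \<subseteq> {k. j \<le> k \<and> k < K \<and> m (32 * k + 12) \<noteq> 0}"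
        using next_break_gt[of j m K] False nz by auto
      then have "card (insert j {k. ?e \<le> k \<and> k < K \<and> m (32 * k + 12) \<noteq> 0}) \<le> card {k. j \<le> k \<and> k < K \<and> m (32 * k + 12) \<noteq> 0}"
        by (rule card_mono[OF fin])
      moreover have "j \<notin> {k. ?e \<le> k \<and> k < K \<and> m (32 * k + 12) \<noteq> 0}" using next_break_gt[of j m K] by auto
      ultimately have "Suc (card {k. ?e \<le> k \<and> k < K \<and> m (32 * k + 12) \<noteq> 0}) \<le> card {k. j \<le> k \<and> k < K \<and> m (32 * k + 12) \<noteq> 0}"
        using fin by simp
      moreover have "length (slots_components m K ?e) \<le> card {k. ?e \<le> k \<and> k < K \<and> m (32 * k + 12) \<noteq> 0}"
        using 1(1) False nz by blast
      ultimately show ?thesis using False nz by (subst slots_components.simps) simp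
    qed
  qed
qed

text \<open>As for the encoding, but without the three lengths: 7 words per slot and 2 for the
  upward edge.\<close>

lemma component_size_slots: "component_size (slots_component m j e) \<le> 2 + 7 * (e - j)"
proof -
  have *: "length (concat (map f [j..<e])) \<le> c * (e - j)" if "\<And>k. length (f k) \<le> c"
    for f :: "nat \<Rightarrow> 'a list" and c
    using sum_list_mono[of "[j..<e]" "\<lambda>k. length (f k)" "\<lambda>_. c"] that
    by (simp add: length_concat_sum sum_list_triv mult.commute)
  have "length (concat (map (slot_vert m) [j..<e])) \<le> 1 * (e - j)"
    by (rule *) (simp add: slot_vert_def)
  moreover have "length (concat (map (slot_inner m) [j..<e])) \<le> 1 * (e - j)"
    by (rule *) (simp add: slot_inner_def)
  moreover have "length (concat (map (slot_outer m) [j..<e])) \<le> 2 * (e - j)"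
    by (rule *) (simp add: slot_outer_def)
  moreover have "length (slot_up m j) \<le> 1" by (simp add: slot_up_def)
  ultimately show ?thesis by (simp add: component_size_def slots_component_def)
qed

text \<open>The memory after the scatter round, for a tree whose smaller subtrees come first. From
  here on the argument is about this memory and the tree only.\<close>

locale decomposed = run_data +
  fixes T c1 c2 G
  assumes T: "is_tour T" "child_ptrs c1 c2 T" "light_first T"
    and slot: "\<And>v. v \<in> V \<Longrightarrow> G (32 * pos 0 T v + 8) = 128 * v \<and> G (32 * pos 0 T v + 10) = 128 * par v + 1 \<and>
      G (32 * pos 0 T v + 12) = (if breaks T v then 1 else 0) \<and>
      G (32 * pos 0 T v + 14) = far T v (c1 v) \<and> G (32 * pos 0 T v + 16) = far T v (c2 v)"
    and no_slot: "\<And>k f. k \<notin> pos 0 T ` V \<Longrightarrow> f \<in> {8, 10, 12, 14, 16} \<Longrightarrow> G (32 * k + f) = 0"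
begin

abbreviation "p \<equiv> pos 0 T"
abbreviation "K \<equiv> 4 * H"
abbreviation "E \<equiv> tree_edges n par"

definition mem_of :: "nat \<Rightarrow> nat \<Rightarrow> nat" where "mem_of i a = G (i * (128 * H) + a)"

lemma mem_of_slot: "mem_of i (32 * k + f) = G (32 * (i * K + k) + f)"
proof -
  have "i * (128 * H) + (32 * k + f) = 32 * (i * K + k) + f" by (simp add: algebra_simps)
  then show ?thesis by (simp only: mem_of_def)
qed

lemma tT: "set_tree T = V" "distinct (inorder T)" "parent_ptrs par T" "T \<noteq> Leaf" "size T = n"
  using T by (auto simp: is_tour_def)

lemma p_inj: "u \<in> V \<Longrightarrow> v \<in> V \<Longrightarrow> p u = p v \<Longrightarrow> u = v"
  using pos_inj[of u T v] tT by simp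

lemma p_less: "v \<in> V \<Longrightarrow> p v < 3 * n"
  using pos_bounds[of v T 0] tT by simp

lemma chunk_iff: "chunk T v = i \<longleftrightarrow> i * K \<le> p v \<and> p v < i * K + K"
proof
  assume "chunk T v = i"
  then have i: "p v div K = i" by (simp add: chunk_def)
  have "i * K + p v mod K = p v" using div_mult_mod_eq[of "p v" K] unfolding i .
  moreover have "p v mod K < K" by (rule mod_less_divisor) (use H in simp)
  ultimately show "i * K \<le> p v \<and> p v < i * K + K" by linarith
next
  assume a: "i * K \<le> p v \<and> p v < i * K + K"
  then have "p v div K = i" by (intro div_nat_eqI) (simp_all add: algebra_simps)
  then show "chunk T v = i" by (simp add: chunk_def)
qed

lemma edge_iff: "(u, w) \<in> E \<longleftrightarrow> u \<in> V \<and> u \<noteq> rt T \<and> w = par u"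
  using par_root(1)[OF T(1), of u] by (auto simp: tree_edges_def V_def)

lemma noncross:
  assumes "x \<in> V" "y \<in> V" "x \<noteq> rt T" "p (par x) < p y" "p y < p x"
  shows "y \<noteq> rt T \<and> p (par x) \<le> p (par y)"
  using edges_noncrossing[of par T x y 0] assms tT by blast

lemma not_breaks: "v \<in> V \<Longrightarrow> \<not> breaks T v \<Longrightarrow> v \<noteq> rt T \<and> par v \<in> V \<and> p (par v) < p v \<and> chunk T (par v) = chunk T v"
  using par_root[OF T(1), of v] by (auto simp: breaks_def)

lemma slot_vert_G: "slot_vert G k = (if k \<in> p ` V then [THE v. v \<in> V \<and> p v = k] else [])"
proof (cases "k \<in> p ` V")
  case True
  then obtain v where v: "v \<in> V" "k = p v" by blast
  have "(THE u. u \<in> V \<and> p u = k) = v" by (rule the_equality) (use v p_inj in auto)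
  then show ?thesis using True slot[OF v(1)] v V_room(3)[OF v(1)] by (simp add: slot_vert_def)
next
  case False
  then show ?thesis using no_slot[of k 8] by (simp add: slot_vert_def)
qed

lemma the_at: "v \<in> V \<Longrightarrow> (THE u. u \<in> V \<and> p u = p v) = v"
  by (rule the_equality) (use p_inj in auto)

lemma set_verts_G: "set (concat (map (slot_vert G) [a..<b])) = {v \<in> V. a \<le> p v \<and> p v < b}"
proof (intro equalityI subsetI)
  fix x assume "x \<in> set (concat (map (slot_vert G) [a..<b]))"
  then obtain k where k: "a \<le> k" "k < b" "x \<in> set (slot_vert G k)" by auto
  then obtain v where v: "v \<in> V" "k = p v" by (auto simp: slot_vert_G split: if_splits)
  then have "x = v" using k(3) the_at by (simp add: slot_vert_G)
  then show "x \<in> {v \<in> V. a \<le> p v \<and> p v < b}" using v k by simp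
next
  fix v assume v: "v \<in> {v \<in> V. a \<le> p v \<and> p v < b}"
  then have "v \<in> set (slot_vert G (p v))" using the_at by (simp add: slot_vert_G)
  then show "v \<in> set (concat (map (slot_vert G) [a..<b]))" using v by auto
qed

lemma distinct_verts_G: "distinct (concat (map (slot_vert G) [a..<b]))"
proof (induction b)
  case (Suc b)
  show ?case
  proof (cases "a \<le> b")
    case True
    have "distinct (slot_vert G b)" by (simp add: slot_vert_G)
    moreover have "set (slot_vert G b) \<inter> set (concat (map (slot_vert G) [a..<b])) = {}"
    proof (rule ccontr)
      assume "set (slot_vert G b) \<inter> set (concat (map (slot_vert G) [a..<b])) \<noteq> {}"
      then obtain x where x: "x \<in> set (slot_vert G b)" "x \<in> set (concat (map (slot_vert G) [a..<b]))" by blast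
      from x(2) have lt: "p x < b" unfolding set_verts_G by simp
      from x(1) obtain v where v: "v \<in> V" "b = p v" by (auto simp: slot_vert_G split: if_splits)
      then have "x = v" using x(1) the_at by (simp add: slot_vert_G)
      then show False using lt v by simp
    qed
    ultimately show ?thesis using Suc True by auto
  qed simp
qed simp

lemma concat_slots_mem_of:
  "concat (map (slot_vert (mem_of i)) [a..<b]) = concat (map (slot_vert G) [i * K + a..<i * K + b])"
proof -
  have "map (slot_vert (mem_of i)) [a..<b] = map (slot_vert G) [i * K + a..<i * K + b]"
    by (rule nth_equalityI) (simp_all add: slot_vert_def mem_of_slot add.assoc)
  then show ?thesis by simp
qed

definition comps :: "nat \<Rightarrow> component list" where "comps i = slots_components (mem_of i) K 0"

lemma concat_verts_comps: "concat (map verts (comps i)) = concat (map (slot_vert G) [i * K..<i * K + K])"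
proof -
  have "concat (map verts (comps i)) = concat (map (slot_vert (mem_of i)) [0..<K])"
    unfolding comps_def
  proof (rule concat_verts_slots_components)
    fix k assume k: "k < K" "mem_of i (32 * k + 8) \<noteq> 0"
    then have "i * K + k \<in> p ` V" using no_slot[of "i * K + k" 8] unfolding mem_of_slot by auto
    then obtain v where v: "v \<in> V" "p v = i * K + k" by auto
    \<comment> \<open>Climb from \<open>v\<close> to its parents: as long as there is no mark, the
      parent has a smaller position in the same interval, so the climb ends at a mark.\<close>
    have "\<exists>u\<in>V. chunk T u = i \<and> p u \<le> p v \<and> breaks T u" if "v \<in> V" "chunk T v = i" for v
      using that
    proof (induction "p v" arbitrary: v rule: less_induct)
      case less
      show ?case
      proof (cases "breaks T v")
        case False
        then have "par v \<in> V" "p (par v) < p v" "chunk T (par v) = i"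
          using not_breaks[OF less.prems(1)] less.prems by auto
        then obtain u where "u \<in> V" "chunk T u = i" "p u \<le> p (par v)" "breaks T u" using less.hyps by blast
        then show ?thesis using \<open>p (par v) < p v\<close> by (intro bexI[of _ u]) auto
      qed (use less.prems in blast)
    qed
    moreover have "chunk T v = i" using v k unfolding chunk_iff by simp
    ultimately obtain u where u: "u \<in> V" "chunk T u = i" "p u \<le> p v" "breaks T u" using v(1) by blast
    define k' where "k' = p u - i * K"
    have "i * K \<le> p u" using u(2) unfolding chunk_iff by simp
    then have pu: "p u = i * K + k'" by (simp add: k'_def)
    have "mem_of i (32 * k' + 12) \<noteq> 0" unfolding mem_of_slot pu[symmetric] using slot[OF u(1)] u(4) by simp
    moreover have "k' \<le> k" using u(3) v(2) pu by simp
    ultimately show "\<exists>k'\<ge>0. k' \<le> k \<and> mem_of i (32 * k' + 12) \<noteq> 0" by blast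
  qed
  then show ?thesis using concat_slots_mem_of[of i 0 K] by simp
qed

lemma concat_all_verts: "concat (map verts (concat (map comps [0..<m]))) = concat (map (slot_vert G) [0..<m * K])"
proof -
  have "concat (map verts (concat (map comps xs))) = concat (map (\<lambda>i. concat (map verts (comps i))) xs)" for xs
    by (induction xs) simp_all
  moreover have "concat (map (slot_vert G) [i * K..<i * K + K]) = concat (map (\<lambda>k. slot_vert G (i * K + k)) [0..<K])" for i
  proof -
    have "map (slot_vert G) [i * K..<i * K + K] = map (\<lambda>k. slot_vert G (i * K + k)) [0..<K]"
      by (intro nth_equalityI) simp_all
    then show ?thesis by simp
  qed
  ultimately show ?thesis using concat_map_blocks[of "slot_vert G" K m] by (simp add: concat_verts_comps)
qed

lemma slots_room: "3 * n \<le> m * K"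
proof -
  have "128 * n \<le> 32 * (m * (4 * H))" using room by simp
  then show ?thesis by linarith
qed

text \<open>A marked vertex other than the root has its parent before it but not in the interval, so
  its edge crosses the left end of the interval. By \<open>card_crossing\<close> there are at most
  \<open>J\<close> such edges; the root accounts for the additional 1.\<close>

lemma length_comps: "length (comps i) \<le> (if i * K < 3 * n then J + 1 else 0)"
proof -
  let ?B = "{v \<in> V. breaks T v \<and> chunk T v = i}"
  have finV: "finite V" by (simp add: V_def)
  have "length (comps i) \<le> card {k. k < K \<and> mem_of i (32 * k + 12) \<noteq> 0}"
    using length_slots_components[of "mem_of i" K 0] by (simp add: comps_def)
  also have "\<dots> \<le> card ?B"
  proof (rule card_inj_on_le)
    define f where "f k = (THE v. v \<in> V \<and> p v = i * K + k)" for k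
    have f: "f k \<in> ?B \<and> p (f k) = i * K + k" if k: "k < K" "mem_of i (32 * k + 12) \<noteq> 0" for k
    proof -
      have "i * K + k \<in> p ` V" using no_slot[of "i * K + k" 12] k(2) unfolding mem_of_slot by auto
      then obtain v where v: "v \<in> V" "p v = i * K + k" by auto
      have "f k = v" unfolding f_def v(2)[symmetric] by (rule the_at[OF v(1)])
      moreover have "chunk T v = i" using v k unfolding chunk_iff by simp
      moreover have "breaks T v"
      proof (rule ccontr)
        assume "\<not> breaks T v"
        then have "G (32 * p v + 12) = 0" using slot[OF v(1)] by simp
        then show False using k(2) unfolding mem_of_slot v(2) by simp
      qed
      ultimately show ?thesis using v by simp
    qed
    show "inj_on f {k. k < K \<and> mem_of i (32 * k + 12) \<noteq> 0}"
    proof (rule inj_onI)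
      fix x y assume a: "x \<in> {k. k < K \<and> mem_of i (32 * k + 12) \<noteq> 0}" "y \<in> {k. k < K \<and> mem_of i (32 * k + 12) \<noteq> 0}" "f x = f y"
      have x: "p (f x) = i * K + x" by (rule f[THEN conjunct2]) (use a(1) in simp_all)
      have y: "p (f y) = i * K + y" by (rule f[THEN conjunct2]) (use a(2) in simp_all)
      have "i * K + x = i * K + y" by (rule trans[OF x[symmetric, unfolded a(3)] y])
      then show "x = y" by simp
    qed
    show "f ` {k. k < K \<and> mem_of i (32 * k + 12) \<noteq> 0} \<subseteq> ?B"
    proof
      fix v assume "v \<in> f ` {k. k < K \<and> mem_of i (32 * k + 12) \<noteq> 0}"
      then obtain k where "k < K" "mem_of i (32 * k + 12) \<noteq> 0" "v = f k" by blast
      then show "v \<in> ?B" using f[of k] by simp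
    qed
    show "finite ?B" using finV by simp
  qed
  also have "\<dots> \<le> (if i * K < 3 * n then J + 1 else 0)"
  proof (cases "i * K < 3 * n")
    case True
    have fin: "finite (crossing par 0 T (i * K))"
      by (rule finite_subset[of _ "set_tree T"]) (auto simp: crossing_def)
    have "?B \<subseteq> insert (rt T) (crossing par 0 T (i * K))"
    proof
      fix v assume v: "v \<in> ?B"
      show "v \<in> insert (rt T) (crossing par 0 T (i * K))"
      proof (cases "v = rt T")
        case False
        have pv: "par v \<in> V" "p (par v) < p v" "par v \<noteq> 0" using par_root[OF T(1), of v] v False by auto
        have c: "i * K \<le> p v" "p v < i * K + K" using v chunk_iff by auto
        have "chunk T (par v) \<noteq> i" using v pv by (auto simp: breaks_def)
        then have "p (par v) < i * K" using pv(2) c unfolding chunk_iff by linarith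
        then show ?thesis using v False c tT by (simp add: crossing_def)
      qed simp
    qed
    then have "card ?B \<le> card (insert (rt T) (crossing par 0 T (i * K)))" by (rule card_mono[rotated]) (simp add: fin)
    also have "\<dots> \<le> Suc (card (crossing par 0 T (i * K)))" by (simp add: card_insert_if fin)
    also have "card (crossing par 0 T (i * K)) \<le> J"
    proof (rule ccontr)
      assume "\<not> card (crossing par 0 T (i * K)) \<le> J"
      then have "(2::nat) ^ J < 2 ^ card (crossing par 0 T (i * K))" by simp
      also have "\<dots> \<le> 2 * n" using card_crossing[OF tT(3,2) T(3) tT(4), of 0 "i * K"] tT by simp
      finally show False using J n by simp
    qed
    finally show ?thesis using True by simp
  next
    case False
    have "?B = {}"
    proof (rule ccontr)
      assume "?B \<noteq> {}"
      then obtain v where v: "v \<in> V" "chunk T v = i" by blast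
      then show False using p_less[OF v(1)] v(2) False unfolding chunk_iff by simp
    qed
    then show ?thesis using False by (simp only: card.empty if_False)
  qed
  finally show ?thesis .
qed

text \<open>The last machines may own only slots beyond the tour and then contribute nothing, which
  is why the number of intervals is bounded by \<open>3 * n div K + 1\<close> and not by
  \<open>m\<close>.\<close>

lemma length_all_comps: "length (concat (map comps [0..<m])) \<le> (3 * n div K + 1) * (J + 1)"
proof -
  have "length (concat (map comps [0..<m])) = (\<Sum>i<m. length (comps i))"
    by (simp add: length_concat_sum sum_list_distinct_conv_sum_set atLeast0LessThan)
  also have "\<dots> \<le> (\<Sum>i<m. if i * K < 3 * n then J + 1 else 0)" by (rule sum_mono) (rule length_comps)
  also have "\<dots> = (\<Sum>i\<in>{i. i < m \<and> i * K < 3 * n}. J + 1)"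
    by (rule sum.mono_neutral_cong_right) auto
  also have "\<dots> \<le> (\<Sum>i\<in>{..3 * n div K}. J + 1)"
  proof (rule sum_mono2)
    show "{i. i < m \<and> i * K < 3 * n} \<subseteq> {..3 * n div K}"
    proof
      fix i assume "i \<in> {i. i < m \<and> i * K < 3 * n}"
      then have "i * K div K \<le> 3 * n div K" by (intro div_le_mono) simp
      then show "i \<in> {..3 * n div K}" using H by simp
    qed
  qed auto
  finally show ?thesis by simp
qed

text \<open>The run of slots from a mark to the next one is connected, since every vertex but the
  first has its parent in the run, and its outer edges are complete, since an edge that leaves it
  downwards also leaves the interval. Both rest on parent edges not crossing.\<close>

lemma comps_component:
  assumes i: "i < m" and c: "c \<in> set (comps i)"
  shows "is_component n par c \<and> component_size c \<le> 9 * K"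
proof -
  obtain a where a: "a < K" "mem_of i (32 * a + 12) \<noteq> 0" "c = slots_component (mem_of i) a (next_break (mem_of i) K a)"
    using slots_components_in[of c "mem_of i" K 0] c by (auto simp: comps_def)
  define e where "e = next_break (mem_of i) K a"
  have e: "a < e" "e \<le> K" using next_break_gt next_break_le[OF a(1)] by (simp_all add: e_def)
  define lo hi where "lo = i * K + a" and "hi = i * K + e"
  have c': "c = slots_component (mem_of i) a e" using a by (simp add: e_def)
  define vs where "vs = concat (map (slot_vert G) [lo..<hi])"
  define C where "C = {v \<in> V. lo \<le> p v \<and> p v < hi}"
  have vs: "verts c = vs" "set vs = C" "distinct vs"
    by (simp_all add: c' slots_component_def vs_def lo_def hi_def concat_slots_mem_of C_def set_verts_G distinct_verts_G
      del: set_concat)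
  have "lo \<in> p ` V" using no_slot[of lo 12] a(2) unfolding mem_of_slot lo_def by auto
  then obtain y where y: "y \<in> V" "p y = lo" by auto
  have yb: "breaks T y" using a(2) slot[OF y(1)] unfolding mem_of_slot lo_def[symmetric] y(2)[symmetric] by (auto split: if_splits)
  have yC: "y \<in> C" using y e by (simp add: C_def lo_def hi_def)
  have chC: "chunk T v = i" if "v \<in> C" for v
    using that e unfolding chunk_iff by (simp add: C_def lo_def hi_def)
  have nb: "\<not> breaks T v" if v: "v \<in> C" "v \<noteq> y" for v
  proof -
    have "lo < p v" using v y p_inj[of v y] by (force simp: C_def)
    define k where "k = p v - i * K"
    have pv: "p v = i * K + k" using \<open>lo < p v\<close> by (simp add: k_def lo_def)
    have "a < k" "k < e" using pv \<open>lo < p v\<close> v(1) by (simp_all add: lo_def hi_def C_def)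
    then have "mem_of i (32 * k + 12) = 0" using next_break_between[of a k "mem_of i" K] by (simp add: e_def)
    then have "G (32 * p v + 12) = 0" unfolding mem_of_slot pv[symmetric] .
    then show ?thesis using slot[of v] v(1) by (auto simp: C_def)
  qed
  have parC: "v \<noteq> rt T \<and> par v \<in> C \<and> p (par v) < p v" if v: "v \<in> C" "v \<noteq> y" for v
  proof -
    have vV: "v \<in> V" using v by (simp add: C_def)
    note b = not_breaks[OF vV nb[OF v]]
    have ci: "chunk T (par v) = i" using b chC[OF v(1)] by simp
    \<comment> \<open>Otherwise the marked vertex \<open>y\<close> lies between \<open>par v\<close>
      and \<open>v\<close>. Then \<open>par y\<close> is no earlier than \<open>par v\<close>, so it
      is in the interval, against the mark of \<open>y\<close>.\<close>
    have "lo \<le> p (par v)"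
    proof (rule ccontr)
      assume lt: "\<not> lo \<le> p (par v)"
      have "p y \<noteq> p v" using p_inj[OF y(1) vV] v(2) by auto
      then have "y \<noteq> rt T \<and> p (par v) \<le> p (par y)"
        using noncross[of v y] vV y b lt v(1) by (auto simp: C_def)
      moreover have "p (par y) < p y" "par y \<noteq> 0" if "y \<noteq> rt T" using par_root[OF T(1) y(1)] that by auto
      moreover have "chunk T (par y) \<noteq> i" if "par y \<noteq> 0" using yb chC[OF yC] that by (simp add: breaks_def)
      moreover have "i * K \<le> p (par v)" using ci unfolding chunk_iff by simp
      moreover have "p y < i * K + K" using chC[OF yC] unfolding chunk_iff by simp
      ultimately show False unfolding chunk_iff by linarith
    qed
    then show ?thesis using b v(1) by (simp add: C_def)
  qed
  have par_y: "par y \<notin> C" using par_root[OF T(1) y(1)] y by (cases "y = rt T") (auto simp: C_def V_def)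
  \<comment> \<open>Parents have smaller positions, so following them inside \<open>C\<close> ends
    at \<open>y\<close>.\<close>
  have to_y: "(v, y) \<in> ((E \<union> E\<inverse>) \<inter> C \<times> C)\<^sup>* \<and> (y, v) \<in> ((E \<union> E\<inverse>) \<inter> C \<times> C)\<^sup>*" if "v \<in> C" for v
    using that
  proof (induction "p v" arbitrary: v rule: less_induct)
    case less
    show ?case
    proof (cases "v = y")
      case False
      note q = parC[OF less.prems False]
      have "(v, par v) \<in> E" using edge_iff less.prems q by (simp add: C_def)
      then have "(v, par v) \<in> (E \<union> E\<inverse>) \<inter> C \<times> C" "(par v, v) \<in> (E \<union> E\<inverse>) \<inter> C \<times> C" using q less.prems by auto
      moreover have "(par v, y) \<in> ((E \<union> E\<inverse>) \<inter> C \<times> C)\<^sup>* \<and> (y, par v) \<in> ((E \<union> E\<inverse>) \<inter> C \<times> C)\<^sup>*"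
        using less.hyps[of "par v"] q by blast
      ultimately show ?thesis
        by (meson converse_rtrancl_into_rtrancl rtrancl_into_rtrancl)
    qed simp
  qed
  have conn: "connected_subset E C"
    unfolding connected_subset_def using to_y by (blast intro: rtrancl_trans)
  have inner: "inner c = map (\<lambda>v. (v, par v)) (filter (\<lambda>v. \<not> breaks T v) vs)"
  proof -
    have "slot_inner (mem_of i) k = map (\<lambda>v. (v, par v)) (filter (\<lambda>v. \<not> breaks T v) (slot_vert G (i * K + k)))" for k
    proof (cases "i * K + k \<in> p ` V")
      case True
      then obtain v where v: "v \<in> V" "p v = i * K + k" by auto
      have "(128 * par v + 1) div 128 = par v" by simp
      then show ?thesis
        using slot[OF v(1)] V_room(3)[OF v(1)] unfolding slot_inner_def mem_of_slot slot_vert_def v(2)[symmetric] by simp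
    next
      case False
      then show ?thesis using no_slot[OF False, of 8] unfolding slot_inner_def mem_of_slot slot_vert_def by simp
    qed
    then have "map (slot_inner (mem_of i)) [a..<e] = map (\<lambda>k. map (\<lambda>v. (v, par v)) (filter (\<lambda>v. \<not> breaks T v) (slot_vert G k))) [lo..<hi]"
      by (intro nth_equalityI) (simp_all add: lo_def hi_def add.assoc)
    moreover have "concat (map (\<lambda>k. map f (filter P (g k))) xs) = map f (filter P (concat (map g xs)))"
      for f :: "nat \<Rightarrow> nat \<times> nat" and P g and xs :: "nat list" by (induction xs) simp_all
    ultimately show ?thesis by (simp add: c' slots_component_def vs_def)
  qed
  define ol where "ol v = map (\<lambda>u. (u, v)) (filter (\<lambda>u. u \<noteq> 0 \<and> chunk T u \<noteq> chunk T v) [c1 v, c2 v])" for v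
  have outer: "outer c = (if par y \<noteq> 0 then [(y, par y)] else []) @ concat (map ol vs)"
  proof -
    have "slot_outer (mem_of i) k = concat (map ol (slot_vert G (i * K + k)))" for k
    proof (cases "i * K + k \<in> p ` V")
      case True
      then obtain v where v: "v \<in> V" "p v = i * K + k" by auto
      then show ?thesis
        using slot[OF v(1)] V_room(3)[OF v(1)] unfolding slot_outer_def mem_of_slot slot_vert_def v(2)[symmetric]
        by (simp add: ol_def far_def)
    next
      case False
      then show ?thesis using no_slot[OF False] unfolding slot_outer_def mem_of_slot slot_vert_def by simp
    qed
    then have "map (slot_outer (mem_of i)) [a..<e] = map (\<lambda>k. concat (map ol (slot_vert G k))) [lo..<hi]"
      by (intro nth_equalityI) (simp_all add: lo_def hi_def add.assoc)
    moreover have "concat (map (\<lambda>k. concat (map f (g k))) xs) = concat (map f (concat (map g xs)))"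
      for f :: "nat \<Rightarrow> (nat \<times> nat) list" and g and xs :: "nat list" by (induction xs) simp_all
    ultimately have "concat (map (slot_outer (mem_of i)) [a..<e]) = concat (map ol vs)" by (simp add: vs_def)
    moreover have "slot_up (mem_of i) a = (if par y \<noteq> 0 then [(y, par y)] else [])"
    proof -
      have "(128 * par y + 1) div 128 = par y" by simp
      then show ?thesis using slot[OF y(1)] unfolding slot_up_def mem_of_slot lo_def[symmetric] y(2)[symmetric] by simp
    qed
    ultimately show ?thesis by (simp add: c' slots_component_def)
  qed
  have kids: "u \<in> V \<and> par u = v \<and> u \<noteq> rt T" if "v \<in> V" "u \<in> {c1 v, c2 v}" "u \<noteq> 0" for u v
  proof -
    have u: "u \<in> V" "par u = v" using tour_children(1,2)[OF T(1,2) that(1)] that(2,3) by auto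
    moreover have "par u \<noteq> 0" using V_room(3)[OF that(1)] u(2) by simp
    ultimately show ?thesis using par_root(1)[OF T(1) u(1)] by simp
  qed
  have ol: "(u, w) \<in> set (ol v) \<longleftrightarrow> w = v \<and> u \<in> {c1 v, c2 v} \<and> u \<noteq> 0 \<and> chunk T u \<noteq> chunk T v" for u w v
    by (auto simp: ol_def)
  have "is_component n par c"
    unfolding is_component_def Let_def vs
  proof (intro conjI)
    show "C \<noteq> {}" using yC by blast
    show "C \<subseteq> {1..n}" by (auto simp: C_def V_def)
    show "connected_subset E C" by (rule conn)
    show "distinct (inner c)"
      unfolding inner using vs(3) by (simp add: distinct_map inj_on_def)
    show "set (inner c) = {(u, v) \<in> E. u \<in> C \<and> v \<in> C}"
    proof (intro equalityI subsetI)
      fix q assume "q \<in> set (inner c)"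
      then obtain v where v: "q = (v, par v)" "v \<in> C" "\<not> breaks T v" unfolding inner using vs(2) by auto
      then have "v \<noteq> y" using yb by auto
      then show "q \<in> {(u, v) \<in> E. u \<in> C \<and> v \<in> C}" using parC v edge_iff by (auto simp: C_def)
    next
      fix q assume "q \<in> {(u, v) \<in> E. u \<in> C \<and> v \<in> C}"
      then obtain u where u: "q = (u, par u)" "u \<in> C" "par u \<in> C" using edge_iff by auto
      then have "u \<noteq> y" using par_y by auto
      then show "q \<in> set (inner c)" unfolding inner using u nb vs(2) by auto
    qed
    show "distinct (outer c)"
    proof -
      have "distinct (ol v)" if "v \<in> C" for v
        using tour_children(3)[OF T(1,2), of v] that by (auto simp: ol_def C_def)
      moreover have "distinct (concat (map ol ws))" if "distinct ws" "\<And>v. v \<in> set ws \<Longrightarrow> distinct (ol v)" for ws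
        using that
      proof (induction ws)
        case (Cons w ws)
        have "set (ol w) \<inter> set (concat (map ol ws)) = {}"
        proof (rule ccontr)
          assume "set (ol w) \<inter> set (concat (map ol ws)) \<noteq> {}"
          then obtain q v where "q \<in> set (ol w)" "v \<in> set ws" "q \<in> set (ol v)" by auto
          then have "w = v" using ol[of "fst q" "snd q"] by simp
          then show False using Cons.prems \<open>v \<in> set ws\<close> by simp
        qed
        then show ?case using Cons by simp
      qed simp
      ultimately have "distinct (concat (map ol vs))" using vs by blast
      moreover have "(y, par y) \<notin> set (concat (map ol vs))"
        using ol par_y vs(2) by auto
      ultimately show ?thesis unfolding outer by simp
    qed
    show "set (outer c) = {(u, v) \<in> E. (u \<in> C) \<noteq> (v \<in> C)}"
    proof (intro equalityI subsetI)
      fix q assume "q \<in> set (outer c)"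
      then consider "par y \<noteq> 0" "q = (y, par y)" | v where "v \<in> C" "q \<in> set (ol v)"
        unfolding outer using vs(2) by (auto split: if_splits)
      then show "q \<in> {(u, v) \<in> E. (u \<in> C) \<noteq> (v \<in> C)}"
      proof cases
        case 1
        then show ?thesis using y yC par_y par_root(1)[OF T(1) y(1)] edge_iff by auto
      next
        case (2 v)
        then obtain u where u: "q = (u, v)" "u \<in> {c1 v, c2 v}" "u \<noteq> 0" "chunk T u \<noteq> chunk T v"
          using ol by (cases q) auto
        have "v \<in> V" using 2 by (simp add: C_def)
        note k = kids[OF this u(2,3)]
        have "u \<notin> C" using u(4) chC[of u] chC[OF 2(1)] by auto
        then show ?thesis using u(1) k 2(1) edge_iff by auto
      qed
    next
      fix q assume "q \<in> {(u, v) \<in> E. (u \<in> C) \<noteq> (v \<in> C)}"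
      then obtain u where u: "q = (u, par u)" "u \<in> V" "u \<noteq> rt T" "(u \<in> C) \<noteq> (par u \<in> C)" using edge_iff by auto
      show "q \<in> set (outer c)"
      proof (cases "u \<in> C")
        case True
        then have "u = y" using parC u by blast
        then show ?thesis using u par_root(1)[OF T(1) u(2)] unfolding outer by simp
      next
        case False
        then have w: "par u \<in> C" using u by blast
        have "u \<in> {c1 (par u), c2 (par u)}" using child_par[OF T(2) tT(3), of u] u tT by auto
        moreover have "u \<noteq> 0" using V_room(3)[OF u(2)] by simp
        moreover have "chunk T u \<noteq> chunk T (par u)"
        proof
          assume e1: "chunk T u = chunk T (par u)"
          then have ui: "chunk T u = i" using chC[OF w] by simp
          have pu: "p (par u) < p u" using par_root(2)[OF T(1) u(2,3)] by simp
          have "hi \<le> p u" using False u(2) w pu by (auto simp: C_def)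
          then have eK: "e < K" using ui unfolding chunk_iff by (simp add: hi_def)
          then have "mem_of i (32 * e + 12) \<noteq> 0" using next_break_stop[of K "mem_of i" a] by (simp add: e_def)
          then have G0: "G (32 * hi + 12) \<noteq> 0" unfolding mem_of_slot hi_def .
          then have "hi \<in> p ` V" using no_slot[of hi 12] by auto
          then obtain z where z: "z \<in> V" "p z = hi" by auto
          have zb: "breaks T z" using G0 slot[OF z(1)] unfolding z(2)[symmetric] by (auto split: if_splits)
          have zi: "chunk T z = i" unfolding chunk_iff z(2) hi_def using eK by simp
          have "z \<noteq> u" using zb e1 par_root(1)[OF T(1) u(2)] u(3) by (auto simp: breaks_def)
          then have "p z < p u" using \<open>hi \<le> p u\<close> z p_inj[OF z(1) u(2)] by linarith
          moreover have "p (par u) < p z" using w z by (simp add: C_def)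
          ultimately have nz: "z \<noteq> rt T" "p (par u) \<le> p (par z)" using noncross[OF u(2) z(1) u(3)] by blast+
          have pz: "p (par z) < p z" "par z \<noteq> 0" using par_root[OF T(1) z(1)] nz(1) by auto
          have "i * K \<le> p (par u)" using chC[OF w] unfolding chunk_iff by simp
          then have "chunk T (par z) = i" using nz(2) pz(1) zi unfolding chunk_iff by linarith
          then show False using zb zi pz(2) by (simp add: breaks_def)
        qed
        ultimately have "q \<in> set (ol (par u))" using ol u(1) by blast
        then show ?thesis unfolding outer using w vs(2) by auto
      qed
    qed
  qed
  moreover have "component_size c \<le> 9 * K"
  proof -
    have "component_size c \<le> 2 + 7 * (e - a)" unfolding c' by (rule component_size_slots)
    also have "\<dots> \<le> 2 + 7 * K" using e by simp
    also have "\<dots> \<le> 9 * K" using H by simp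
    finally show ?thesis .
  qed
  ultimately show ?thesis by blast
qed

lemma decomposition:
  assumes "real ((3 * n div K + 1) * (J + 1)) \<le> A" "real (9 * K) \<le> S"
  shows "is_decomposition n par A S (concat (map comps [0..<m]))"
  unfolding is_decomposition_def
proof (intro conjI ballI)
  show "real (length (concat (map comps [0..<m]))) \<le> A"
    using length_all_comps assms(1) by linarith
  fix c assume "c \<in> set (concat (map comps [0..<m]))"
  then obtain i where i: "i < m" "c \<in> set (comps i)" by auto
  note cc = comps_component[OF i]
  show "is_component n par c" using cc by blast
  have "real (component_size c) \<le> real (9 * K)" using cc by (simp only: of_nat_le_iff)
  then show "real (component_size c) \<le> S" using assms(2) by linarith
next
  show "distinct (concat (map verts (concat (map comps [0..<m]))))"
    unfolding concat_all_verts by (rule distinct_verts_G)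
  show "set (concat (map verts (concat (map comps [0..<m])))) = {1..n}"
    unfolding concat_all_verts set_verts_G using p_less slots_room by (fastforce simp: V_def)
qed

end

section \<open>The complete run\<close>

context run_data
begin

text \<open>The memory at the start of round \<open>t\<close> with the writes in transit applied.
  Rounds 1 and \<open>J + 3\<close> are about to link, the rounds \<open>k + 2\<close> and
  \<open>J + 4 + k\<close> follow \<open>k\<close> doublings, and at \<open>J + 3\<close> and
  \<open>2 * J + 5\<close> the ranks are complete. The tree changes at the second link round, so
  \<open>stage\<close> quantifies over it.\<close>

definition stage_for :: "nat tree \<Rightarrow> (nat \<Rightarrow> nat) \<Rightarrow> (nat \<Rightarrow> nat) \<Rightarrow> nat \<Rightarrow> (nat \<Rightarrow> nat) \<Rightarrow> bool" where
  "stage_for T c1 c2 t G \<longleftrightarrow> (is_tour T \<and> child_ptrs c1 c2 T \<and> (J + 4 \<le> t \<longrightarrow> light_first T) \<and>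
     (t \<le> 2 * J + 5 \<longrightarrow> vert G c1 c2) \<and>
     (t = 1 \<longrightarrow> (\<forall>x. 32 dvd x \<longrightarrow> G x = 0 \<and> G (x + 2) = 0 \<and> G (x + 4) = 0 \<and> G (x + 5) = 0)) \<and>
     (\<forall>k\<le>J. t = k + 2 \<or> t = J + 4 + k \<longrightarrow> tours k G (tour T)) \<and>
     (t = J + 3 \<or> t = 2 * J + 5 \<longrightarrow> (\<forall>x. 32 dvd x \<longrightarrow> G x = 0 \<and> G (x + 2) = 0) \<and>
        (\<forall>i<3 * n. G (tour T ! i + 4) = 3 * n - i \<and> G (tour T ! i + 5) = 0)) \<and>
     (t = 2 * J + 6 \<longrightarrow> decomposed n m H J M par T c1 c2 G))"

definition stage :: "nat \<Rightarrow> (nat \<Rightarrow> nat) \<Rightarrow> bool" where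
  "stage t G \<longleftrightarrow> (\<exists>T c1 c2. stage_for T c1 c2 t G)"

lemma J_pos: "0 < J"
  using J n by (cases J) auto

lemma six_n_less: "6 * n < M"
proof -
  have "128 * (n + 1) + 1000 < M" using room M by (rule order.strict_trans1[OF add_right_mono])
  then show ?thesis by simp
qed

lemma tour_item: "is_tour T \<Longrightarrow> x \<in> set (tour T) \<Longrightarrow> \<exists>i<3 * n. x = tour T ! i"
  using tour_facts(1) by (metis in_set_conv_nth)

lemma is_tour_lighten: "is_tour T \<Longrightarrow> is_tour (lighten T)"
  by (simp add: is_tour_def distinct_lighten parent_ptrs_lighten)

lemma tours_finished:
  assumes "is_tour T" "tours (Suc J) G (tour T)" "32 dvd x"
  shows "G x = 0 \<and> G (x + 2) = 0"
proof (cases "x \<in> set (tour T)")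
  case True
  then obtain i where i: "i < 3 * n" "x = tour T ! i" using tour_item[OF assms(1)] by blast
  have "3 * n \<le> 2 ^ Suc J" using J by simp
  then have "\<not> i + 2 ^ Suc J < 3 * n" "\<not> 2 ^ Suc J \<le> i" using i(1) by linarith+
  then show ?thesis
    using assms(2)[unfolded tours_def tour_facts(1)[OF assms(1)], THEN conjunct1, rule_format, OF i(1)] i(2)
    by (simp only: if_False simp_thms)
qed (use assms in \<open>auto simp: tours_def\<close>)

text \<open>With ranks \<open>3 * n - i\<close> the test of \<open>swaps\<close> compares
  \<open>1 + 3 * l\<close> with \<open>1 + 3 * r\<close>; \<open>six_n_less\<close> keeps the sums
  of two ranks from wrapping around.\<close>

lemma swaps_iff:
  assumes T: "is_tour T" and v: "v \<in> V"
    and rank: "\<And>i. i < 3 * n \<Longrightarrow> G (tour T ! i + 4) = 3 * n - i"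
  shows "swaps M (\<lambda>f. G (128 * v + f)) \<longleftrightarrow> right_size T v < left_size T v"
proof -
  have vT: "v \<in> set_tree T" "size T = n" using T v by (auto simp: is_tour_def)
  define p l r where "p = pos 0 T v" and "l = left_size T v" and "r = right_size T v"
  have b: "p + 2 + 3 * l + 3 * r < 3 * n"
    using left_right_size[OF vT(1), of 0] vT(2) by (simp add: p_def l_def r_def)
  note nth = tour_nth[OF vT(1), folded p_def l_def r_def]
  have "G (128 * v + 4) = 3 * n - p" using rank[of p] b nth(1) by simp
  moreover have "G (128 * v + 36) = 3 * n - (p + 1 + 3 * l)"
  proof -
    have e: "128 * v + 36 = tour T ! (p + 1 + 3 * l) + 4" unfolding nth(2) by simp
    show ?thesis unfolding e by (rule rank) (use b in linarith)
  qed
  moreover have "G (128 * v + 68) = 3 * n - (p + 2 + 3 * l + 3 * r)"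
  proof -
    have e: "128 * v + 68 = tour T ! (p + 2 + 3 * l + 3 * r) + 4" unfolding nth(3) by simp
    show ?thesis unfolding e by (rule rank[OF b])
  qed
  moreover have "(a + b) mod M = a + b" if "a \<le> 3 * n" "b \<le> 3 * n" for a b
    using that six_n_less by simp
  ultimately have "swaps M (\<lambda>f. G (128 * v + f)) \<longleftrightarrow>
      3 * n - (p + 1 + 3 * l) + (3 * n - (p + 1 + 3 * l)) < 3 * n - p + (3 * n - (p + 2 + 3 * l + 3 * r))"
    unfolding swaps_def by simp
  also have "\<dots> \<longleftrightarrow> r < l" using b by linarith
  finally show ?thesis by (simp add: l_def r_def)
qed

text \<open>In round 1 all counters are 0, nothing is swapped and the tree stays. In round
  \<open>J + 3\<close> the counters are ranks, and swapping by subtree size turns the tree into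
  \<open>lighten T\<close>.\<close>

lemma stage_link:
  assumes S: "stage t G" and t: "t = 1 \<or> t = J + 3"
  defines "Q \<equiv> gmsgs 128 (link_msgs M) n G (m * H)" and "G' \<equiv> gnew 128 (link_new M) G"
  shows "stage (Suc t) (fold push_cell Q G') \<and> fits m (128 * H) Q"
proof -
  obtain T c1 c2 where S: "stage_for T c1 c2 t G" using S by (auto simp: stage_def)
  have "t \<le> 2 * J + 5" using t by auto
  then have T: "is_tour T" "child_ptrs c1 c2 T" and G: "vert G c1 c2"
    using S unfolding stage_for_def by blast+
  have one: "G x = 0 \<and> G (x + 2) = 0 \<and> G (x + 4) = 0 \<and> G (x + 5) = 0" if "t = 1" "32 dvd x" for x
    using S that unfolding stage_for_def by blast
  have two: "(\<forall>x. 32 dvd x \<longrightarrow> G x = 0 \<and> G (x + 2) = 0) \<and>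
        (\<forall>i<3 * n. G (tour T ! i + 4) = 3 * n - i \<and> G (tour T ! i + 5) = 0)" if "t = J + 3"
    using S that unfolding stage_for_def by blast
  have "\<exists>T' c1' c2'. is_tour T' \<and> child_ptrs c1' c2' T' \<and> (t = J + 3 \<longrightarrow> light_first T') \<and>
      tours 0 (fold push_cell Q G') (tour T') \<and> vert (fold push_cell Q G') c1' c2' \<and> fits m (128 * H) Q"
  proof (cases "t = 1")
    case True
    have "\<not> swaps M (\<lambda>f. G (128 * v + f))" for v
    proof -
      have "32 dvd 128 * v" "32 dvd 128 * v + 32" "32 dvd 128 * v + 64" by presburger+
      then have "G (128 * v + 4) = 0" "G (128 * v + 32 + 4) = 0" "G (128 * v + 64 + 4) = 0"
        using one[OF True] by blast+
      then have "G (128 * v + 4) = 0" "G (128 * v + 36) = 0" "G (128 * v + 68) = 0"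
        by (simp_all add: add.assoc)
      then show ?thesis by (simp add: swaps_def)
    qed
    moreover have "32 dvd x" if "x \<in> set (tour T)" for x using tour_facts(4)[OF T(1) that] by blast
    ultimately have "tours 0 (fold push_cell Q G') (tour T) \<and> vert (fold push_cell Q G') c1 c2 \<and> fits m (128 * H) Q"
      unfolding Q_def G'_def by (intro link_step[OF T G]) (use one[OF True] in simp_all)
    then show ?thesis using T True by (intro exI[of _ T] exI[of _ c1] exI[of _ c2]) simp
  next
    case False
    then have tJ: "t = J + 3" using t by blast
    note two = two[OF tJ]
    define c1' where "c1' v = (if right_size T v < left_size T v then c2 v else c1 v)" for v
    define c2' where "c2' v = (if right_size T v < left_size T v then c1 v else c2 v)" for v
    have T': "is_tour (lighten T)" by (rule is_tour_lighten[OF T(1)])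
    have d: "distinct (inorder T)" using T(1) by (simp add: is_tour_def)
    have ch: "child_ptrs c1' c2' (lighten T)"
      by (rule child_ptrs_lighten[OF T(2) d]) (simp_all add: c1'_def c2'_def)
    have sw: "swaps M (\<lambda>f. G (128 * v + f)) \<longleftrightarrow> right_size T v < left_size T v" if "v \<in> V" for v
      using swaps_iff[OF T(1) that] two by blast
    have "tours 0 (fold push_cell Q G') (tour (lighten T)) \<and> vert (fold push_cell Q G') c1' c2' \<and> fits m (128 * H) Q"
      unfolding Q_def G'_def
    proof (rule link_step[OF T' ch G])
      fix x assume "x \<in> set (tour (lighten T))"
      then have "x \<in> set (tour T)" by (simp add: set_tour)
      then obtain i where "i < 3 * n" "x = tour T ! i" using tour_item[OF T(1)] by blast
      then show "G (x + 5) = 0" using two[THEN conjunct2, rule_format, of i] by simp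
    next
      fix x :: nat assume "32 dvd x"
      then show "G x = 0 \<and> G (x + 2) = 0" using two by blast
    next
      fix v assume v: "v \<in> V"
      show "c1' v = (if swaps M (\<lambda>f. G (128 * v + f)) then c2 v else c1 v)"
        "c2' v = (if swaps M (\<lambda>f. G (128 * v + f)) then c1 v else c2 v)"
        by (simp_all add: sw[OF v] c1'_def c2'_def)
    qed
    then show ?thesis using T' ch light_first_lighten by blast
  qed
  then obtain T' c1' c2' where R: "is_tour T'" "child_ptrs c1' c2' T'" "t = J + 3 \<longrightarrow> light_first T'"
      "tours 0 (fold push_cell Q G') (tour T')" "vert (fold push_cell Q G') c1' c2'" "fits m (128 * H) Q"
    by blast
  have "stage (Suc t) (fold push_cell Q G')"
    unfolding stage_def stage_for_def
  proof (rule exI[of _ T'], rule exI[of _ c1'], rule exI[of _ c2'], intro conjI allI impI)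
    fix k assume "k \<le> J" "Suc t = k + 2 \<or> Suc t = J + 4 + k"
    then have "k = 0" using t by auto
    then show "tours k (fold push_cell Q G') (tour T')" using R(4) by simp
  qed (use R t J_pos in auto)
  then show ?thesis using R(6) by blast
qed

lemma stage_jump:
  assumes S: "stage t G" and t: "1 < t" "t \<noteq> J + 3" "t < 2 * J + 5"
  defines "Q \<equiv> gmsgs 32 (jump_msgs M) n G (m * (4 * H))" and "G' \<equiv> gnew 32 (jump_new M) G"
  shows "stage (Suc t) (fold push_cell Q G') \<and> fits m (128 * H) Q"
proof -
  obtain T c1 c2 where S: "stage_for T c1 c2 t G" using S by (auto simp: stage_def)
  have "t \<le> 2 * J + 5" using t by simp
  then have T: "is_tour T" "child_ptrs c1 c2 T" "J + 4 \<le> t \<longrightarrow> light_first T" and G: "vert G c1 c2"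
    using S unfolding stage_for_def by blast+
  have tk: "tours k G (tour T)" if "k \<le> J" "t = k + 2 \<or> t = J + 4 + k" for k
    using S that unfolding stage_for_def by blast
  \<comment> \<open>The number of doublings completed in the current phase.\<close>
  define k where "k = (if t < J + 3 then t - 2 else t - (J + 4))"
  have k: "k \<le> J" "t = k + 2 \<or> t = J + 4 + k" using t by (auto simp: k_def)
  note st = jump_step[OF T(1) tk[OF k] G, folded Q_def G'_def]
  have "stage (Suc t) (fold push_cell Q G')"
    unfolding stage_def stage_for_def
  proof (rule exI[of _ T], rule exI[of _ c1], rule exI[of _ c2], intro conjI)
    show "\<forall>k\<le>J. Suc t = k + 2 \<or> Suc t = J + 4 + k \<longrightarrow> tours k (fold push_cell Q G') (tour T)"
    proof (intro allI impI)
      fix k' assume "k' \<le> J" "Suc t = k' + 2 \<or> Suc t = J + 4 + k'"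
      then have "k' = Suc k" using k t by auto
      then show "tours k' (fold push_cell Q G') (tour T)" using st by simp
    qed
    show "Suc t = J + 3 \<or> Suc t = 2 * J + 5 \<longrightarrow>
       (\<forall>x. 32 dvd x \<longrightarrow> fold push_cell Q G' x = 0 \<and> fold push_cell Q G' (x + 2) = 0) \<and>
       (\<forall>i<3 * n. fold push_cell Q G' (tour T ! i + 4) = 3 * n - i \<and> fold push_cell Q G' (tour T ! i + 5) = 0)"
    proof (intro impI)
      assume "Suc t = J + 3 \<or> Suc t = 2 * J + 5"
      \<comment> \<open>This is the last jump of a phase: nothing is in transit, so the merged
        counters in \<open>G'\<close> are final.\<close>
      then have kJ: "k = J" using k by auto
      then have "Q = []" and r: "\<forall>i<3 * n. G' (tour T ! i + 4) = 3 * n - i \<and> G' (tour T ! i + 5) = 0"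
        using st by simp_all
      moreover have "tours (Suc J) (fold push_cell Q G') (tour T)" by (rule st[unfolded kJ, THEN conjunct1])
      then have "\<forall>x. 32 dvd x \<longrightarrow> fold push_cell Q G' x = 0 \<and> fold push_cell Q G' (x + 2) = 0"
        using tours_finished[OF T(1)] by blast
      ultimately show "(\<forall>x. 32 dvd x \<longrightarrow> fold push_cell Q G' x = 0 \<and> fold push_cell Q G' (x + 2) = 0) \<and>
       (\<forall>i<3 * n. fold push_cell Q G' (tour T ! i + 4) = 3 * n - i \<and> fold push_cell Q G' (tour T ! i + 5) = 0)"
        by simp
    qed
  qed (use T t st in auto)
  then show ?thesis using st by blast
qed

lemma stage_scatter:
  assumes S: "stage (2 * J + 5) G"
  defines "Q \<equiv> gmsgs 128 (scatter_msgs M (128 * H)) n G (m * H)"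
  shows "stage (2 * J + 6) (fold push_cell Q (gnew 128 (\<lambda>r. r) G)) \<and> fits m (128 * H) Q"
proof -
  define G' where "G' = fold push_cell Q (gnew 128 (\<lambda>r. r) G)"
  obtain T c1 c2 where S: "stage_for T c1 c2 (2 * J + 5) G" using S by (auto simp: stage_def)
  have "J + 4 \<le> 2 * J + 5" using J_pos by simp
  then have T: "is_tour T" "child_ptrs c1 c2 T" "light_first T" and G: "vert G c1 c2"
    using S unfolding stage_for_def by blast+
  have r: "G (tour T ! i + 4) = 3 * n - i" if "i < 3 * n" for i
    using S that unfolding stage_for_def by blast
  note st = scatter_step[OF T(1,2) G, folded Q_def, folded G'_def]
  have "decomposed n m H J M par T c1 c2 G'"
  proof (intro decomposed.intro decomposed_axioms.intro)
    show "run_data n m H J M par" by (rule run_data_axioms)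
  qed (use T st r in \<open>auto simp: Let_def\<close>)
  then have "stage (2 * J + 6) G'"
    unfolding stage_def stage_for_def using T J_pos by (intro exI[of _ T] exI[of _ c1] exI[of _ c2]) auto
  then show ?thesis using st r unfolding G'_def by blast
qed

lemma stage_round:
  assumes S: "stage t G" "1 \<le> t" "t \<le> 2 * J + 5"
  obtains c k new msgs where "round_kind M (128 * H) J t c new msgs" "128 * H = c * k" "0 < k"
    "stage (Suc t) (fold push_cell (gmsgs c msgs n G (m * k)) (gnew c new G))"
    "fits m (128 * H) (gmsgs c msgs n G (m * k))"
proof -
  consider "t = 1 \<or> t = J + 3" | "1 < t" "t \<noteq> J + 3" "t < 2 * J + 5" | "t = 2 * J + 5"
    using S by linarith
  then show thesis
  proof cases
    case 1
    then show thesis using H stage_link[OF S(1) 1] by (intro that[OF round_kind.link, of H]) auto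
  next
    case 2
    then show thesis using H stage_jump[OF S(1) 2] by (intro that[OF round_kind.jump, of "4 * H"]) auto
  next
    case 3
    then show thesis using H stage_scatter[OF S(1)[unfolded 3]]
      by (intro that[OF round_kind.scatter, of H]) (auto simp: eval_nat_numeral)
  qed
qed

text \<open>The cells read in the output round are words, so the divisions by 128 on the machine
  give the true indices.\<close>

lemma final_cells:
  assumes "decomposed n m H J M par T c1 c2 G" "f \<in> {8, 10, 14, 16}"
  shows "G (32 * k + f) < M"
proof (cases "k \<in> pos 0 T ` V")
  case True
  then obtain v where v: "v \<in> V" "k = pos 0 T v" by blast
  interpret decomposed n m H J M par T c1 c2 G by (rule assms(1))
  have c: "c1 v = 0 \<or> c1 v \<in> V" "c2 v = 0 \<or> c2 v \<in> V" using tour_children(1,2)[OF T(1,2) v(1)] by blast+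
  have less: "128 * u + 1 < M" if "u = 0 \<or> u \<in> V" for u using that V_room(2)[of u] M by auto
  have "par v \<le> n" using par[of v] v(1) by (simp add: V_def)
  then have "par v = 0 \<or> par v \<in> V" by (auto simp: V_def)
  then have l: "128 * v + 1 < M" "128 * par v + 1 < M" "128 * c1 v + 1 < M" "128 * c2 v + 1 < M"
    using less c v(1) by blast+
  have "far T v u < M" if "128 * u + 1 < M" for u using that by (simp add: far_def)
  then have "far T v (c1 v) < M" "far T v (c2 v) < M" using l by blast+
  then show ?thesis using slot[OF v(1)] assms(2) l v(2) by auto
next
  case False
  interpret decomposed n m H J M par T c1 c2 G by (rule assms(1))
  have "f \<in> {8, 10, 12, 14, 16}" using assms(2) by blast
  then show ?thesis using no_slot[OF False] M by simp
qed

end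
lemma binary_tree_par:
  assumes "binary_tree n par"
  shows "v \<in> {1..n} \<Longrightarrow> par v \<le> n" and "u \<le> n \<Longrightarrow> card {v \<in> {1..n}. par v = u} \<le> 2"
proof -
  from assms obtain r where r: "r \<in> {1..n}" "par r = 0" "\<forall>v\<in>{1..n}. v \<noteq> r \<longrightarrow> par v \<in> {1..n}"
    unfolding binary_tree_def by blast
  show "par v \<le> n" if "v \<in> {1..n}" using r that by (cases "v = r") auto
  show "card {v \<in> {1..n}. par v = u} \<le> 2" if "u \<le> n"
  proof (cases "u = 0")
    case True
    then have "{v \<in> {1..n}. par v = u} \<subseteq> {r}" using r(3) by fastforce
    then have "card {v \<in> {1..n}. par v = u} \<le> card {r}" by (rule card_mono[rotated]) simp
    then show ?thesis by simp
  next
    case False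
    then show ?thesis using assms that unfolding binary_tree_def by simp
  qed
qed

lemma deterministic_run:
  fixes n m w X :: nat and vss :: "nat list list" and A S :: real
  defines "J \<equiv> doublings n"
  defines "H \<equiv> J * (n div m + 1)"
  assumes bt: "binary_tree n par" and nm: "0 < n" "0 < m"
    and vss: "length vss = m" "distinct (concat vss)" "set (concat vss) = {1..n}"
      "\<forall>vs\<in>set vss. length vs \<le> X"
    and w: "m * (128 * H) + 4 * (128 * H) + 1000 < 2 ^ w" "2 * X + 2 < 2 ^ w" "2 * J + 10 < 2 ^ w"
    and A: "real ((3 * n div (4 * H) + 1) * (J + 1)) \<le> A" and S: "real (9 * (4 * H)) \<le> S"
  shows "\<exists>tr. length tr = 2 * J + 7 \<and> terminated tr \<and> outputs_decomposition n par A S (last tr) \<and>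
     (\<forall>cfg\<in>set tr. resources (1000 * (128 * H + X)) cfg) \<and>
     (\<forall>k. mpc_run w prog k (initial_config n m par vss) = return_spmf (take k tr)) \<and>
     (\<forall>k\<le>2 * J + 6. \<not> terminated (take k tr))"
proof -
  have J: "4 * n \<le> 2 ^ J" by (simp add: J_def doublings_ge)
  then have "0 < J" using nm by (cases J) auto
  then have H: "0 < H" by (simp add: H_def)
  \<comment> \<open>\<open>m * (n div m + 1)\<close> exceeds \<open>n\<close>, which leaves room for
    the records 0 to \<open>n\<close>.\<close>
  have "m * (n div m) + n mod m = n" by simp
  moreover have "m * (n div m + 1) = m * (n div m) + m" by (simp add: distrib_left)
  ultimately have "n + 1 \<le> m * (n div m + 1)" using mod_less_divisor[OF nm(2), of n] by linarith
  also have "\<dots> \<le> m * H"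
  proof (unfold H_def, rule mult_le_mono2)
    have "1 * (n div m + 1) \<le> J * (n div m + 1)" by (rule mult_le_mono1) (use \<open>0 < J\<close> in simp)
    then show "n div m + 1 \<le> J * (n div m + 1)" by (simp only: mult_1)
  qed
  finally have room: "n + 1 \<le> m * H" .
  then have room': "128 * (n + 1) \<le> m * (128 * H)" by simp
  interpret run_data n m H J "2 ^ w" par
    by unfold_locales (use nm H J room' w binary_tree_par(1)[OF bt] in auto)
  define SZ where "SZ = 128 * H"
  \<comment> \<open>Round 0 is special: the inboxes hold vertex objects, and the registers 3 to 6
    have not been set up. Afterwards a round begins by receiving, so \<open>stage\<close> refers to
    the memory with the pending writes applied.\<close>
  define Inv where "Inv t cfg \<longleftrightarrow> (if t = 0 then cfg = initial_config n m par vss else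
     \<exists>G Q. sim n m J SZ t G Q cfg \<and> fits m SZ Q \<and> stage t (fold push_cell Q G))" for t cfg
  have mono: "resources (1000 * (SZ + X)) cfg" if "resources (1000 * SZ) cfg" for cfg
    using that unfolding resources_def by fastforce
  have step: "\<exists>cfg'. sequence_spmf (map (local_round w prog) cfg) = return_spmf cfg' \<and>
      resources (1000 * (SZ + X)) cfg' \<and>
      (if t = 2 * J + 6 then all_halted cfg' \<and> outputs_decomposition n par A S cfg'
       else \<not> all_halted cfg' \<and> Inv (Suc t) (deliver cfg'))"
    if t: "t \<le> 2 * J + 6" and I: "Inv t cfg" for t cfg
  proof -
    consider "t = 0" | "1 \<le> t" "t \<le> 2 * J + 5" | "t = 2 * J + 6" using t by linarith
    then show ?thesis
    proof cases
      case 1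
      then have cfg: "cfg = initial_config n m par vss" using I by (simp add: Inv_def)
      define Q where "Q = concat (map (\<lambda>v. init_msgs (v, par v)) (concat vss))"
      have "\<exists>cfg'. sequence_spmf (map (local_round w prog) cfg) = return_spmf cfg' \<and>
        resources (1000 * (SZ + X)) cfg' \<and> \<not> all_halted cfg' \<and> sim n m J SZ 1 (\<lambda>_. 0) Q (deliver cfg')"
        unfolding cfg Q_def SZ_def H_def J_def
      proof (rule sim_setup[OF nm(1,2) vss(1,3) binary_tree_par(1)[OF bt] bspec[OF vss(4)]])
        show "m * (128 * (doublings n * (n div m + 1))) + 128 * (doublings n * (n div m + 1)) + 256 < 2 ^ w"
          using w(1) unfolding H_def J_def by linarith
        have "128 * n + 128 \<le> 128 * (m * H)" using room by simp
        moreover have "m * (128 * H) = 128 * (m * H)" by simp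
        ultimately show "128 * n + 256 < 2 ^ w" using w(1) by linarith
      qed (use w in auto)
      then obtain cfg' where cfg': "sequence_spmf (map (local_round w prog) cfg) = return_spmf cfg'"
        "resources (1000 * (SZ + X)) cfg'" "\<not> all_halted cfg'" "sim n m J SZ 1 (\<lambda>_. 0) Q (deliver cfg')" by blast
      define G where "G = fold push_cell Q (\<lambda>_. 0)"
      have "\<exists>c1 c2. vert G c1 c2 \<and> (\<forall>v\<in>V. {c1 v, c2 v} - {0} = {u \<in> V. par u = v} \<and> (c1 v = c2 v \<longrightarrow> c1 v = 0)) \<and>
        (\<forall>x. 32 dvd x \<longrightarrow> G x = 0 \<and> G (x + 2) = 0 \<and> G (x + 4) = 0 \<and> G (x + 5) = 0) \<and> fits m (128 * H) Q" (is "\<exists>c1 c2. ?P c1 c2")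
        unfolding G_def Q_def
        by (rule setup_step) (use vss(2,3) binary_tree_par(2)[OF bt] in \<open>simp_all add: V_def\<close>)
      then obtain c1 where "\<exists>c2. ?P c1 c2" ..
      then obtain c2 where P: "?P c1 c2" ..
      note G1 = P[THEN conjunct1] P[THEN conjunct2, THEN conjunct1] P[THEN conjunct2, THEN conjunct2, THEN conjunct1]
        P[THEN conjunct2, THEN conjunct2, THEN conjunct2, folded SZ_def]
      have ch: "{c1 v, c2 v} - {0} = {u \<in> V. par u = v}" "c1 v = c2 v \<Longrightarrow> c1 v = 0" if "v \<in> V" for v
        using bspec[OF G1(2) that] by simp_all
      obtain T where "T \<noteq> Leaf" "set_tree T = V" "size T = n" "distinct (inorder T)" "child_ptrs c1 c2 T"
          "parent_ptrs par T" "par (rt T) = 0"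
        using binary_tree_imp_tree[OF bt ch[unfolded V_def]] unfolding V_def by blast
      then have "stage_for T c1 c2 1 G"
        using G1(1,3) \<open>0 < J\<close> by (auto simp: stage_for_def is_tour_def)
      then have "stage 1 (fold push_cell Q (\<lambda>_. 0))" unfolding stage_def G_def by blast
      then have "sim n m J SZ 1 (\<lambda>_. 0) Q (deliver cfg') \<and> fits m SZ Q \<and> stage 1 (fold push_cell Q (\<lambda>_. 0))"
        using cfg'(4) G1(4) by blast
      then have "Inv (Suc t) (deliver cfg')" unfolding Inv_def 1 by auto
      then show ?thesis using cfg' 1 by auto
    next
      case 2
      then obtain G Q where GQ: "sim n m J SZ t G Q cfg" "fits m SZ Q" "stage t (fold push_cell Q G)"
        using I by (auto simp: Inv_def)
      define G1 where "G1 = fold push_cell Q G"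
      obtain c k new msgs where r: "round_kind (2 ^ w) SZ J t c new msgs" "SZ = c * k" "0 < k"
          "stage (Suc t) (fold push_cell (gmsgs c msgs n G1 (m * k)) (gnew c new G1))"
          "fits m SZ (gmsgs c msgs n G1 (m * k))"
        using stage_round[OF GQ(3) 2] unfolding G1_def SZ_def by metis
      have "\<exists>cfg'. sequence_spmf (map (local_round w prog) cfg) = return_spmf cfg' \<and>
        resources (1000 * SZ) cfg' \<and> \<not> all_halted cfg' \<and>
        sim n m J SZ (Suc t) (gnew c new G1) (gmsgs c msgs n G1 (m * k)) (deliver cfg')"
        unfolding G1_def
        by (rule sim_round[OF GQ(1) r(1,2,3) _ nm(2) GQ(2)]) (use w in \<open>auto simp: SZ_def\<close>)
      then obtain cfg' where cfg': "sequence_spmf (map (local_round w prog) cfg) = return_spmf cfg'"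
        "resources (1000 * SZ) cfg'" "\<not> all_halted cfg'"
        "sim n m J SZ (Suc t) (gnew c new G1) (gmsgs c msgs n G1 (m * k)) (deliver cfg')" by blast
      have "Inv (Suc t) (deliver cfg')" unfolding Inv_def using cfg'(4) r(4,5) by auto
      then show ?thesis using cfg'(1,3) mono[OF cfg'(2)] 2 by auto
    next
      case 3
      then obtain G Q where GQ: "sim n m J SZ (2 * J + 6) G Q cfg" "fits m SZ Q" "stage t (fold push_cell Q G)"
        using I by (auto simp: Inv_def)
      define G1 where "G1 = fold push_cell Q G"
      obtain T c1 c2 where "stage_for T c1 c2 (2 * J + 6) G1"
        using GQ(3) 3 by (auto simp: stage_def G1_def)
      then have D: "decomposed n m H J (2 ^ w) par T c1 c2 G1" unfolding stage_for_def by blast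
      interpret D: decomposed n m H J "2 ^ w" par T c1 c2 G1 by (rule D)
      have "\<exists>cfg'. sequence_spmf (map (local_round w prog) cfg) = return_spmf cfg' \<and>
        resources (1000 * SZ) cfg' \<and> all_halted cfg' \<and> map outp cfg' = map (\<lambda>cs. concat (map encode_component cs))
          (map (\<lambda>i. slots_components (\<lambda>a. G1 (i * SZ + a)) (4 * H) 0) [0..<m])"
        unfolding G1_def
      proof (rule sim_output[OF GQ(1) _ _ GQ(2)])
        show "fold push_cell Q G (32 * k + f) < 2 ^ w" if "f \<in> {8, 10, 14, 16}" for k f
          using final_cells[OF D that] unfolding G1_def .
      qed (use w H in \<open>auto simp: SZ_def\<close>)
      moreover have "(\<lambda>i. slots_components (\<lambda>a. G1 (i * SZ + a)) (4 * H) 0) = D.comps"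
        by (simp add: fun_eq_iff D.comps_def D.mem_of_def[abs_def] SZ_def)
      ultimately obtain cfg' where cfg': "sequence_spmf (map (local_round w prog) cfg) = return_spmf cfg'"
        "resources (1000 * SZ) cfg'" "all_halted cfg'"
        "map outp cfg' = map (\<lambda>cs. concat (map encode_component cs)) (map D.comps [0..<m])" by auto
      have "outputs_decomposition n par A S cfg'"
        unfolding outputs_decomposition_def using cfg'(4) D.decomposition[OF A S] by blast
      then show ?thesis using cfg'(1,3) mono[OF cfg'(2)] 3 by auto
    qed
  qed
  have "Inv 0 (initial_config n m par vss)" by (simp add: Inv_def)
  then obtain tr where tr: "length tr = Suc (2 * J + 6 - 0)" "terminated tr" "outputs_decomposition n par A S (last tr)"
     "\<forall>c\<in>set tr. resources (1000 * (SZ + X)) c"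
     "\<forall>k. mpc_run w prog k (initial_config n m par vss) = return_spmf (take k tr)"
     "\<forall>k\<le>2 * J + 6 - 0. \<not> terminated (take k tr)"
    using mpc_run_deterministic[of "2 * J + 6" Inv w prog "resources (1000 * (SZ + X))" "outputs_decomposition n par A S" 0
      "initial_config n m par vss", OF step] by blast
  then show ?thesis unfolding SZ_def by (intro exI[of _ tr]) simp
qed

section \<open>Parameters\<close>

text \<open>Minimality gives \<open>2 ^ (J - 1) < 4 * n\<close>, hence
  \<open>J < 3 + log 2 n\<close>, and \<open>log 2 n \<ge> 1\<close> absorbs the constant.\<close>

lemma doublings_log:
  assumes "2 \<le> n"
  shows "real (doublings n) \<le> 4 * log 2 (real n)"
proof -
  have l: "1 \<le> log 2 (real n)" using assms by (simp add: le_log_iff)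
  obtain j where j: "doublings n = Suc j"
    using doublings_ge[of n] assms by (cases "doublings n") auto
  then have "(2::nat) ^ j < 4 * n" using doublings_less[of j n] by simp
  then have "2 ^ j < 4 * real n" by (metis of_nat_less_iff of_nat_mult of_nat_numeral of_nat_power)
  then have "2 powr real j < 4 * real n" by (simp add: powr_realpow)
  then have "real j < log 2 (4 * real n)" using assms by (subst less_log_iff) simp_all
  also have "\<dots> = 2 + log 2 (real n)"
  proof -
    have "log 2 4 = (2::real)" using log_pow_cancel[of 2 2] by simp
    then show ?thesis using assms by (simp add: log_mult)
  qed
  finally show ?thesis using l j by simp
qed

text \<open>Exponential growth beats linear growth:
  \<open>n powr \<delta> = exp (\<delta> * ln n)\<close> is at least
  \<open>1 + \<delta> * ln n\<close>. Thus one batch of O(log n) components is affordable.\<close>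

lemma log_le_machines:
  assumes "0 < \<delta>" "2 \<le> n" "real n powr \<delta> \<le> real m"
  shows "log 2 (real n) \<le> real m / (\<delta> * ln 2)"
proof -
  have "1 + \<delta> * ln (real n) \<le> exp (\<delta> * ln (real n))" by (rule exp_ge_add_one_self)
  also have "\<dots> = real n powr \<delta>" using assms by (simp add: powr_def)
  finally have "\<delta> * ln (real n) \<le> real m" using assms(3) by linarith
  then have "ln (real n) \<le> real m / \<delta>" using assms(1) by (simp add: field_simps)
  then have "ln (real n) / ln 2 \<le> real m / \<delta> / ln 2" by (rule divide_right_mono) simp
  then show ?thesis by (simp add: log_def)
qed

lemma mpc_input_run:
  fixes n m k0 q :: nat and \<delta> K0 :: real
  defines "l \<equiv> log 2 (real n)"
  assumes pos: "0 < \<delta>" "0 < K0" and inp: "mpc_input \<delta> K0 k0 n m par vss"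
    and q: "3560 + 2560 * K0 \<le> 2 ^ q"
  obtains J N tr where "real (2 * J + 7) \<le> 15 * l" "length tr = 2 * J + 7" "terminated tr"
    "outputs_decomposition n par ((5 / 2 + 4 / (\<delta> * ln 2)) * real m) (polylog_share (144 * (1 + K0)) (k0 + 1) n m) (last tr)"
    "\<forall>cfg\<in>set tr. resources N cfg" "real N \<le> polylog_share (1000 * (512 * (1 + K0) + K0)) (k0 + 1) n m"
    "\<And>k. mpc_exec (q + k0 + 2) prog n m par vss k = return_spmf (take k tr)"
    "\<And>k. k \<le> 2 * J + 6 \<Longrightarrow> \<not> terminated (take k tr)"
proof -
  have n: "2 \<le> n" and m\<delta>: "real n powr \<delta> \<le> real m" and share: "real m \<le> polylog_share K0 k0 n m"
    and bt: "binary_tree n par" and vss: "length vss = m" "distinct (concat vss)" "set (concat vss) = {1..n}"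
    and load: "\<forall>vs\<in>set vss. real (length vs) \<le> polylog_share K0 k0 n m"
    using inp by (auto simp: mpc_input_def)
  have "0 < real n powr \<delta>" using n by simp
  then have m: "0 < m" using m\<delta> by (cases m) auto
  have l: "1 \<le> l" using n by (simp add: l_def le_log_iff)
  define J where "J = doublings n"
  define H where "H = J * (n div m + 1)"
  \<comment> \<open>A machine holds at most \<open>n\<close> vertices anyway; the minimum makes
    \<open>X\<close> fit into a word without a further estimate.\<close>
  define X where "X = min n (nat \<lfloor>polylog_share K0 k0 n m\<rfloor>)"
  define r where "r = real n / real m"
  have r: "0 < r" using n m by (simp add: r_def)
  have Jl: "real J \<le> 4 * l" using doublings_log[OF n] by (simp add: J_def l_def)
  have "0 < J" using doublings_ge[of n] n by (cases "doublings n") (auto simp: J_def)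
  then have J: "1 \<le> real J" by simp
  have ln: "l \<le> real n"
  proof -
    have "real n \<le> 2 powr real n" using less_exp[of n] by (simp add: powr_realpow less_imp_le)
    then show ?thesis using n by (simp add: l_def log_le_iff)
  qed
  have share': "polylog_share K0 k0 n m = K0 * r * l ^ k0" by (simp add: polylog_share_def r_def l_def)
  have rl: "r \<le> r * l ^ k0" using r l by simp
  \<comment> \<open>At least one machine exists and the share is at least \<open>m\<close>; so 1 is
    at most the share, which absorbs the rounding up in \<open>n div m + 1\<close>.\<close>
  have one: "1 \<le> K0 * (r * l ^ k0)" using share m unfolding share' by (simp add: mult.assoc)
  have divr: "real (n div m) \<le> r" unfolding r_def by (rule of_nat_div_le_of_nat)
  have "real H \<le> 4 * l * (r + 1)"
    unfolding H_def of_nat_mult by (rule mult_mono) (use Jl divr l in auto)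
  also have "\<dots> \<le> 4 * l * (r * l ^ k0 + K0 * (r * l ^ k0))"
    by (rule mult_left_mono) (use rl one l in auto)
  also have "\<dots> = 4 * (1 + K0) * r * l ^ (k0 + 1)" by (simp add: algebra_simps)
  finally have H: "real H \<le> 4 * (1 + K0) * r * l ^ (k0 + 1)" .
  have X: "real X \<le> K0 * r * l ^ (k0 + 1)"
  proof -
    have "real X \<le> real (nat \<lfloor>K0 * r * l ^ k0\<rfloor>)" by (simp add: X_def share')
    also have "\<dots> \<le> K0 * r * l ^ k0" using one by (intro of_nat_floor) (simp add: mult.assoc)
    also have "\<dots> \<le> K0 * r * l ^ (k0 + 1)"
      using pos r l by (intro mult_left_mono power_increasing) simp_all
    finally show ?thesis .
  qed
  have len: "\<forall>vs\<in>set vss. length vs \<le> X"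
  proof
    fix vs assume vs: "vs \<in> set vss"
    have "distinct vs" "set vs \<subseteq> {1..n}" using vss(2,3) vs by (auto simp: distinct_concat_iff)
    then have "length vs \<le> n" using card_mono[of "{1..n}" "set vs"] distinct_card[of vs] by simp
    moreover have "length vs \<le> nat \<lfloor>polylog_share K0 k0 n m\<rfloor>" using load vs by (simp add: le_nat_floor)
    ultimately show "length vs \<le> X" by (simp add: X_def)
  qed
  have nr: "2 \<le> real n" using n by simp
  define w where "w = (q + k0 + 2) * floorlog 2 n"
  \<comment> \<open>As \<open>n \<ge> 2\<close>, the constant factor is at most
    \<open>n ^ q\<close>, and \<open>n ^ (q + k0 + 2)\<close> has at most as many bits as a
    word.\<close>
  have word: "x < 2 ^ w" if "real x \<le> (3560 + 2560 * K0) * real n ^ (k0 + 2)" for x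
  proof -
    have "real x \<le> 2 ^ q * real n ^ (k0 + 2)" using that mult_right_mono[OF q, of "real n ^ (k0 + 2)"] by simp
    also have "\<dots> \<le> real n ^ q * real n ^ (k0 + 2)" by (rule mult_right_mono) (use nr in \<open>auto intro: power_mono\<close>)
    also have "\<dots> = real n ^ (q + k0 + 2)" by (simp add: power_add)
    finally have "x \<le> n ^ (q + k0 + 2)" by (metis of_nat_le_iff of_nat_power)
    also have "n < 2 ^ floorlog 2 n" using floorlog_bounds[of n 2] n by simp
    then have "n ^ (q + k0 + 2) < (2 ^ floorlog 2 n) ^ (q + k0 + 2)" by (rule power_strict_mono) simp_all
    also have "\<dots> = 2 ^ w" by (simp only: w_def power_mult[symmetric] mult.commute[of "floorlog 2 n"])
    finally show ?thesis .
  qed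
  have np: "real n ^ j \<le> real n ^ (k0 + 2)" if "j \<le> k0 + 2" for j
    using that nr by (intro power_increasing) simp_all
  have mb: "real m \<le> K0 * real n ^ (k0 + 1)"
  proof -
    have "real n * 1 \<le> real n * real m" by (rule mult_left_mono) (use m in auto)
    then have "r \<le> real n" using m by (simp add: r_def pos_divide_le_eq)
    have "real m \<le> K0 * r * l ^ k0" using share share' by simp
    also have "\<dots> \<le> K0 * real n * real n ^ k0"
      using pos r l ln \<open>r \<le> real n\<close> by (intro mult_mono power_mono) auto
    finally show ?thesis by simp
  qed
  have "real (m * H) = real J * (real m * real (n div m) + real m)" by (simp add: H_def algebra_simps)
  also have "\<dots> \<le> 4 * real n * (real n + K0 * real n ^ (k0 + 1))"
  proof (rule mult_mono)
    have "real m * real (n div m) \<le> real n" by (metis of_nat_le_iff of_nat_mult times_div_less_eq_dividend)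
    then show "real m * real (n div m) + real m \<le> real n + K0 * real n ^ (k0 + 1)" using mb by simp
  qed (use Jl ln in auto)
  also have "\<dots> = 4 * (real n ^ 2 + K0 * real n ^ (k0 + 2))" by (simp add: algebra_simps power2_eq_square)
  also have "\<dots> \<le> 4 * (real n ^ (k0 + 2) + K0 * real n ^ (k0 + 2))" using np[of 2] by simp
  finally have mH: "real (m * H) \<le> (4 + 4 * K0) * real n ^ (k0 + 2)" by (simp add: algebra_simps)
  have n1: "1 \<le> real n ^ (k0 + 2)" using np[of 0] by simp
  have n2: "real n \<le> real n ^ (k0 + 2)" using np[of 1] by simp
  have K0n: "0 \<le> K0 * real n ^ (k0 + 2)" using pos by simp
  \<comment> \<open>The largest quantity, which fixes the constant of the word length:
    \<open>640 * (4 + 4 * K0) + 1000 = 3560 + 2560 * K0\<close>.\<close>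
  have w1: "m * (128 * H) + 4 * (128 * H) + 1000 < 2 ^ w"
  proof (rule word)
    have "m * (128 * H) + 4 * (128 * H) + 1000 = 128 * (m * H) + 512 * H + 1000" by simp
    also have "\<dots> \<le> 640 * (m * H) + 1000" using m by (cases m) simp_all
    finally have "real (m * (128 * H) + 4 * (128 * H) + 1000) \<le> real (640 * (m * H) + 1000)"
      by (simp only: of_nat_le_iff)
    also have "\<dots> = 640 * real (m * H) + 1000" by simp
    also have "\<dots> \<le> 640 * ((4 + 4 * K0) * real n ^ (k0 + 2)) + 1000 * real n ^ (k0 + 2)" using mH n1 by linarith
    also have "\<dots> = (3560 + 2560 * K0) * real n ^ (k0 + 2)" by (simp add: algebra_simps)
    finally show "real (m * (128 * H) + 4 * (128 * H) + 1000) \<le> \<dots>" .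
  qed
  have split: "(3560 + 2560 * K0) * real n ^ (k0 + 2) = 3560 * real n ^ (k0 + 2) + 2560 * (K0 * real n ^ (k0 + 2))"
    by (simp add: algebra_simps)
  have w2: "2 * X + 2 < 2 ^ w"
  proof (rule word)
    have "real X \<le> real n" by (simp add: X_def)
    then have "real (2 * X + 2) \<le> 2 * real n + 2" by simp
    then show "real (2 * X + 2) \<le> (3560 + 2560 * K0) * real n ^ (k0 + 2)"
      using n1 n2 K0n unfolding split by linarith
  qed
  have w3: "2 * J + 10 < 2 ^ w"
  proof (rule word)
    have "real (2 * J + 10) \<le> 8 * real n + 10" using Jl ln by simp
    then show "real (2 * J + 10) \<le> (3560 + 2560 * K0) * real n ^ (k0 + 2)"
      using n1 n2 K0n unfolding split by linarith
  qed
  \<comment> \<open>With \<open>x = 3 * n div (4 * H)\<close> the product is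
    \<open>x * J + x + J + 1\<close>. As \<open>n * J \<le> m * H\<close>, the first two terms are
    at most \<open>3 / 4 * m\<close> each; 1 is at most \<open>m\<close>, and \<open>J\<close> is
    bounded by \<open>log_le_machines\<close>.\<close>
  have A: "real ((3 * n div (4 * H) + 1) * (J + 1)) \<le> (5 / 2 + 4 / (\<delta> * ln 2)) * real m"
  proof -
    have "n \<le> m * (n div m + 1)" using m by (metis Suc_eq_plus1 dividend_less_times_div less_imp_le mult_Suc_right add.commute)
    then have "n * J \<le> m * (n div m + 1) * J" by (rule mult_le_mono1)
    then have "n * J \<le> m * H" by (simp only: H_def mult_ac)
    then have nJ: "real n * real J \<le> real m * real H" by (metis of_nat_le_iff of_nat_mult)
    have "0 < H" using \<open>0 < J\<close> by (simp add: H_def)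
    have "real (3 * n div (4 * H)) \<le> real (3 * n) / real (4 * H)" by (rule of_nat_div_le_of_nat)
    then have "real (3 * n div (4 * H)) * real J \<le> real (3 * n) / real (4 * H) * real J"
      by (rule mult_right_mono) simp
    also have "\<dots> \<le> 3 / 4 * real m" using nJ \<open>0 < H\<close> by (simp add: field_simps)
    finally have a: "real (3 * n div (4 * H)) * real J \<le> 3 / 4 * real m" .
    have "real (3 * n div (4 * H)) * 1 \<le> real (3 * n div (4 * H)) * real J" by (rule mult_left_mono) (use J in auto)
    then have "real ((3 * n div (4 * H) + 1) * (J + 1)) \<le> 3 / 2 * real m + 1 + real J"
      using a by (simp add: algebra_simps)
    also have "\<dots> \<le> 3 / 2 * real m + real m + 4 * (real m / (\<delta> * ln 2))"
    proof -
      have "real J \<le> 4 * (real m / (\<delta> * ln 2))" using Jl log_le_machines[OF pos(1) n m\<delta>] unfolding l_def by linarith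
      moreover have "1 \<le> real m" using m by simp
      ultimately show ?thesis by linarith
    qed
    also have "\<dots> = (5 / 2 + 4 / (\<delta> * ln 2)) * real m" by (simp add: field_simps)
    finally show ?thesis .
  qed
  \<comment> \<open>\<open>H\<close> carries the factor \<open>4 * (1 + K0)\<close>, and 36 times 4
    is 144.\<close>
  have S: "real (9 * (4 * H)) \<le> polylog_share (144 * (1 + K0)) (k0 + 1) n m"
    using H by (simp add: polylog_share_def r_def[symmetric] l_def[symmetric] algebra_simps)
  obtain tr where tr: "length tr = 2 * J + 7" "terminated tr"
    "outputs_decomposition n par ((5 / 2 + 4 / (\<delta> * ln 2)) * real m) (polylog_share (144 * (1 + K0)) (k0 + 1) n m) (last tr)"
    "\<forall>cfg\<in>set tr. resources (1000 * (128 * H + X)) cfg"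
    "\<forall>k. mpc_run w prog k (initial_config n m par vss) = return_spmf (take k tr)"
    "\<forall>k\<le>2 * J + 6. \<not> terminated (take k tr)"
  proof -
    have "0 < n" using n by simp
    from deterministic_run[OF bt this m vss len, of w, folded J_def, folded H_def, OF w1 w2 w3 A S]
    show thesis using that by blast
  qed
  show thesis
  proof (rule that[OF _ tr(1-4)])
    \<comment> \<open>\<open>J \<le> 4 * l\<close> contributes 8 and the constant 7 is at most
      \<open>7 * l\<close>.\<close>
    show "real (2 * J + 7) \<le> 15 * l" using Jl l by simp
    show "real (1000 * (128 * H + X)) \<le> polylog_share (1000 * (512 * (1 + K0) + K0)) (k0 + 1) n m"
      using H X by (simp add: polylog_share_def r_def[symmetric] l_def[symmetric] algebra_simps)
    show "mpc_exec (q + k0 + 2) prog n m par vss k = return_spmf (take k tr)" for k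
      using tr(5) by (simp add: mpc_exec_def w_def)
    show "\<not> terminated (take k tr)" if "k \<le> 2 * J + 6" for k using tr(6) that by blast
  qed
qed

theorem theorem3:
  fixes \<delta> K\<^sub>0 :: real and k\<^sub>0 :: nat
  assumes "0 < \<delta>" and "\<delta> < 1" and "K\<^sub>0 > 0"
  shows "\<exists>(P :: com) (\<kappa> :: nat) (A :: real) (B :: real) (b :: nat).
    (\<forall>n m par vss. mpc_input \<delta> K\<^sub>0 k\<^sub>0 n m par vss \<longrightarrow>
       (\<forall>t. \<forall>tr\<in>set_spmf (mpc_exec \<kappa> P n m par vss t). terminated tr \<longrightarrow>
          outputs_decomposition n par (A * real m) (polylog_share B b n m) (last tr))) \<and>
    (\<forall>c > 0. \<exists>(C :: real) (K :: real) (k :: nat) (L :: real) (n\<^sub>0 :: nat).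
       \<forall>n m par vss. n \<ge> n\<^sub>0 \<longrightarrow> mpc_input \<delta> K\<^sub>0 k\<^sub>0 n m par vss \<longrightarrow>
         measure (measure_spmf (mpc_exec \<kappa> P n m par vss (nat \<lfloor>C * log 2 (real n)\<rfloor>)))
           {tr. terminated tr \<and> within_resources (polylog_share K k n m) L tr}
         \<ge> 1 - real n powr (- c))"
proof -
  \<comment> \<open>\<open>q\<close> depends on the load constant only, so program and word length
    are fixed before the input.\<close>
  obtain q where "3560 + 2560 * K\<^sub>0 < 2 ^ q" using real_arch_pow[of 2 "3560 + 2560 * K\<^sub>0"] by auto
  then have q: "3560 + 2560 * K\<^sub>0 \<le> 2 ^ q" by simp
  let ?\<kappa> = "q + k\<^sub>0 + 2" and ?A = "5 / 2 + 4 / (\<delta> * ln 2)" and ?B = "144 * (1 + K\<^sub>0)" and ?b = "k\<^sub>0 + 1"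
  let ?K = "1000 * (512 * (1 + K\<^sub>0) + K\<^sub>0)"
  have correct: "outputs_decomposition n par (?A * real m) (polylog_share ?B ?b n m) (last tr)"
    if inp: "mpc_input \<delta> K\<^sub>0 k\<^sub>0 n m par vss" and tr: "tr \<in> set_spmf (mpc_exec ?\<kappa> prog n m par vss t)" "terminated tr"
    for n m par vss t tr
  proof -
    obtain J N tr' where run: "length tr' = 2 * J + 7" "outputs_decomposition n par (?A * real m) (polylog_share ?B ?b n m) (last tr')"
      "\<And>k. mpc_exec ?\<kappa> prog n m par vss k = return_spmf (take k tr')"
      "\<And>k. k \<le> 2 * J + 6 \<Longrightarrow> \<not> terminated (take k tr')"
      by (rule mpc_input_run[OF assms(1,3) inp q]) blast
    have "tr = take t tr'" using tr(1) unfolding run(3) by simp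
    \<comment> \<open>An execution that was cut off earlier is not terminated, so a terminated one
      is the full trace.\<close>
    moreover from this have "2 * J + 6 < t" using run(4)[of t] tr(2) by (cases "t \<le> 2 * J + 6") auto
    ultimately have "tr = tr'" using run(1) by simp
    then show ?thesis using run(2) by simp
  qed
  \<comment> \<open>The full trace within its bounds has probability 1, so one choice of constants
    serves every \<open>c\<close>.\<close>
  have fast: "1 - real n powr - c \<le> measure (measure_spmf (mpc_exec ?\<kappa> prog n m par vss (nat \<lfloor>15 * log 2 (real n)\<rfloor>)))
      {tr. terminated tr \<and> within_resources (polylog_share ?K ?b n m) 1 tr}"
    if inp: "mpc_input \<delta> K\<^sub>0 k\<^sub>0 n m par vss" for n m par vss c
  proof -
    obtain J N tr where run: "real (2 * J + 7) \<le> 15 * log 2 (real n)" "length tr = 2 * J + 7" "terminated tr"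
      "\<forall>cfg\<in>set tr. resources N cfg" "real N \<le> polylog_share ?K ?b n m"
      "\<And>k. mpc_exec ?\<kappa> prog n m par vss k = return_spmf (take k tr)"
      by (rule mpc_input_run[OF assms(1,3) inp q]) blast
    have "2 * J + 7 \<le> nat \<lfloor>15 * log 2 (real n)\<rfloor>" by (rule le_nat_floor[OF run(1)])
    then have "mpc_exec ?\<kappa> prog n m par vss (nat \<lfloor>15 * log 2 (real n)\<rfloor>) = return_spmf tr"
      unfolding run(6) using run(2) by simp
    moreover have "within_resources (polylog_share ?K ?b n m) 1 tr"
      unfolding within_resources_def
    proof (intro ballI)
      fix cfg s assume "cfg \<in> set tr" "s \<in> set cfg"
      then have "space s \<le> N" "length (outbox s) \<le> N" "length (inbox s) \<le> N" "steps s \<le> N"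
        using run(4) by (auto simp: resources_def)
      then have "real (space s) \<le> real N" "real (length (outbox s)) \<le> real N" "real (length (inbox s)) \<le> real N"
        "real (steps s) \<le> real N" by simp_all
      then show "real (space s) \<le> polylog_share ?K ?b n m \<and> real (length (outbox s)) \<le> polylog_share ?K ?b n m \<and>
         real (length (inbox s)) \<le> polylog_share ?K ?b n m \<and> real (steps s) \<le> 1 * polylog_share ?K ?b n m"
        using run(5) by simp
    qed
    ultimately show ?thesis using run(3) by (simp add: measure_spmf_return_spmf measure_return)
  qed
  show ?thesis
    by (rule exI[of _ prog], rule exI[of _ ?\<kappa>], rule exI[of _ ?A], rule exI[of _ ?B], rule exI[of _ ?b],
        rule conjI, (intro allI impI ballI, rule correct, assumption+),
        intro allI impI, rule exI[of _ 15], rule exI[of _ ?K], rule exI[of _ ?b], rule exI[of _ 1], rule exI[of _ 0],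
        intro allI impI, rule fast)
qed

end
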